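(* Let $f=f(x,y)$ be an element of $F_2^{nil}=\prod_{l}F_2^{(l)}$ ($l$ running over all primes) satisfying $$f(x_{12},x_{23}x_{24})\,f(x_{13}x_{23},x_{34})=f(x_{23},x_{34})\,f(x_{12}x_{13},x_{24}x_{34})\,f(x_{12},x_{23})$$ in $K_4^{nil}=\prod_lK_4^{(l)}$. Then there exists $\lambda=(\lambda_l)_l\in\prod_l\overline{\mathbf Q}_l$ such that the pair $(\lambda,f)$ satisfies $$f(z,x)z^mf(y,z)y^mf(x,y)x^m=1\quad\text{with } xyz=1\text{ and } m=\frac{\lambda-1}{2},$$ $$f(x,y)f(y,x)=1.$$ Moreover, this $\lambda$ is equal to $\pm(24c_2(f)+1)^{1/2}$ (square root taken componentwise).
   Context: $F_2^{nil}$ is the pro-nilpotent completion of the free group on $x,y$, i.e. $\prod_lF_2^{(l)}$ with $F_2^{(l)}$ the pro-$l$ completion. It embeds in $\prod_lF_2(\mathbf Q_l)$, where $F_2(\mathbf Q_l)$ denotes the $\mathbf Q_l$-points of the free pro-unipotent group on $x,y$, identified via $x\mapsto e^X$, $y\mapsto e^Y$ with the group-like elements of $\mathbf Q_l\langle\langle X,Y\rangle\rangle$ (constant term $1$ and $\Delta(\varphi)=\varphi\otimes\varphi$, with $X,Y$ primitive). Writing $f=(f_l)_l$, $c_2(f)=(c_2(f_l))_l$ where $c_2(f_l)$ is the coefficient of $XY$ in $f_l(e^X,e^Y)\in\mathbf Q_l\langle\langle X,Y\rangle\rangle$. Since the components of $\lambda$ may lie in quadratic extensions, the first displayed relation of the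 conclusion is understood componentwise in $\prod_lF_2(\overline{\mathbf Q}_l)$, where $a^m=\exp(m\log a)$. $f(a,b)$ denotes the image of $f$ under the continuous homomorphism with $x\mapsto a$, $y\mapsto b$. $K_4^{(l)}$ is the pro-$l$ completion of the pure braid group $K_4=\ker(B_4\to\mathfrak S_4)$ on $4$ strings ($B_4$ the Artin braid group with generators $\sigma_1,\sigma_2,\sigma_3$), with standard generators $x_{ij}=(\sigma_{j-1}\cdots\sigma_{i+1})\,\sigma_i^2\,(\sigma_{j-1}\cdots\sigma_{i+1})^{-1}$ for $1\le i<j\le4$. *)

theory Defs
  imports "HOL-Analysis.Analysis" "HOL-Algebra.Algebra"
begin

section \<open>Groups given by generators and relations\<close>

text \<open>A pair \<open>(s, True)\<close> stands for the generator \<open>s\<close> and \<open>(s, False)\<close> for its inverse.\<close>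

type_synonym 'a gword = "('a \<times> bool) list"

inductive pres_eq :: "'a set \<Rightarrow> ('a gword \<times> 'a gword) set \<Rightarrow> 'a gword \<Rightarrow> 'a gword \<Rightarrow> bool"
  for S R where
  pres_refl: "w \<in> lists (S \<times> UNIV) \<Longrightarrow> pres_eq S R w w"
| pres_sym: "pres_eq S R u v \<Longrightarrow> pres_eq S R v u"
| pres_trans: "pres_eq S R u v \<Longrightarrow> pres_eq S R v w \<Longrightarrow> pres_eq S R u w"
| pres_append: "pres_eq S R u v \<Longrightarrow> pres_eq S R u' v' \<Longrightarrow> pres_eq S R (u @ u') (v @ v')"
| pres_cancel: "s \<in> S \<Longrightarrow> pres_eq S R [(s, b), (s, \<not> b)] []"
| pres_rel: "(u, v) \<in> R \<Longrightarrow> u \<in> lists (S \<times> UNIV) \<Longrightarrow> v \<in> lists (S \<times> UNIV) \<Longrightarrow> pres_eq S R u v"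

definition presented_group :: "'a set \<Rightarrow> ('a gword \<times> 'a gword) set \<Rightarrow> 'a gword set monoid" where
  "presented_group S R =
     \<lparr> carrier = lists (S \<times> UNIV) // {(u, v). pres_eq S R u v},
       monoid.mult = (\<lambda>A B. {w. \<exists>u\<in>A. \<exists>v\<in>B. pres_eq S R (u @ v) w}),
       one = {w. pres_eq S R [] w} \<rparr>"

definition pres_gen :: "'a set \<Rightarrow> ('a gword \<times> 'a gword) set \<Rightarrow> 'a \<Rightarrow> 'a gword set" where
  "pres_gen S R s = {w. pres_eq S R [(s, True)] w}"

datatype letter = LX | LY

definition F2 :: "letter gword set monoid" where
  "F2 = presented_group UNIV {}"

definition F2_x :: "letter gword set" where "F2_x = pres_gen UNIV {} LX"
definition F2_y :: "letter gword set" where "F2_y = pres_gen UNIV {} LY"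


section \<open>Braid groups\<close>

definition braid_rels :: "nat \<Rightarrow> (nat gword \<times> nat gword) set" where
  "braid_rels n =
     {([(i, True), (j, True)], [(j, True), (i, True)]) | i j. 1 \<le> i \<and> i + 2 \<le> j \<and> j < n} \<union>
     {([(i, True), (i + 1, True), (i, True)], [(i + 1, True), (i, True), (i + 1, True)])
        | i. 1 \<le> i \<and> i + 1 < n}"

definition braid_group :: "nat \<Rightarrow> nat gword set monoid" where
  "braid_group n = presented_group {1..<n} (braid_rels n)"

definition braid_sigma :: "nat \<Rightarrow> nat \<Rightarrow> nat gword set" where
  "braid_sigma n i = pres_gen {1..<n} (braid_rels n) i"

text \<open>The homomorphism from the braid group to the symmetric group sends both \<open>\<sigma>\<^sub>i\<close> and its
  inverse to the transposition of \<open>i\<close> and \<open>i + 1\<close>; it is constant on each class of words, so its image of a class is a singleton.\<close>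

definition gword_perm :: "nat gword \<Rightarrow> nat \<Rightarrow> nat" where
  "gword_perm w = foldr (\<lambda>(i, b) p. Transposition.transpose i (i + 1) \<circ> p) w id"

definition braid_perm :: "nat gword set \<Rightarrow> nat \<Rightarrow> nat" where
  "braid_perm A = the_elem (gword_perm ` A)"

definition pure_braid_group :: "nat \<Rightarrow> nat gword set monoid" where
  "pure_braid_group n =
     (braid_group n) \<lparr> carrier := kernel (braid_group n) (sym_group n) braid_perm \<rparr>"

definition pure_braid_gen :: "nat \<Rightarrow> nat \<Rightarrow> nat \<Rightarrow> nat gword set" where
  "pure_braid_gen n i j =
     (let B = braid_group n;
          c = foldr (\<lambda>k g. braid_sigma n k \<otimes>\<^bsub>B\<^esub> g) (rev [i + 1..<j]) \<one>\<^bsub>B\<^esub>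
      in c \<otimes>\<^bsub>B\<^esub> (braid_sigma n i [^]\<^bsub>B\<^esub> (2::nat)) \<otimes>\<^bsub>B\<^esub> inv\<^bsub>B\<^esub> c)"

abbreviation K4 :: "nat gword set monoid" where "K4 \<equiv> pure_braid_group 4"


section \<open>Pro-$l$ and pro-nilpotent completions\<close>

abbreviation primes :: "nat set" where "primes \<equiv> {l. Factorial_Ring.prime l}"

definition pro_index :: "nat \<Rightarrow> 'g monoid \<Rightarrow> 'g set set" where
  "pro_index l G = {N. N \<lhd> G \<and> (\<exists>k. order (G Mod N) = l ^ k)}"

text \<open>The inverse limit of the quotients by the normal subgroups of \<open>l\<close>-power index. For
  \<open>M \<subseteq> N\<close> the transition map sends a coset of \<open>M\<close> to the unique coset of \<open>N\<close>
  containing it.\<close>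

definition pro_completion :: "nat \<Rightarrow> 'g monoid \<Rightarrow> ('g set \<Rightarrow> 'g set) monoid" where
  "pro_completion l G =
     (product_group (pro_index l G) (\<lambda>N. G Mod N))
       \<lparr> carrier := {c \<in> carrier (product_group (pro_index l G) (\<lambda>N. G Mod N)).
            \<forall>M\<in>pro_index l G. \<forall>N\<in>pro_index l G. M \<subseteq> N \<longrightarrow> c M \<subseteq> c N} \<rparr>"

definition pro_topology :: "nat \<Rightarrow> 'g monoid \<Rightarrow> ('g set \<Rightarrow> 'g set) topology" where
  "pro_topology l G =
     subtopology
       (product_topology (\<lambda>N. discrete_topology (carrier (G Mod N))) (pro_index l G))
       (carrier (pro_completion l G))"

definition pro_incl :: "nat \<Rightarrow> 'g monoid \<Rightarrow> 'g \<Rightarrow> 'g set \<Rightarrow> 'g set" where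
  "pro_incl l G g = (\<lambda>N\<in>pro_index l G. N #>\<^bsub>G\<^esub> g)"

definition nil_completion :: "'g monoid \<Rightarrow> (nat \<Rightarrow> 'g set \<Rightarrow> 'g set) monoid" where
  "nil_completion G = product_group primes (\<lambda>l. pro_completion l G)"

definition nil_topology :: "'g monoid \<Rightarrow> (nat \<Rightarrow> 'g set \<Rightarrow> 'g set) topology" where
  "nil_topology G = product_topology (\<lambda>l. pro_topology l G) primes"

definition nil_incl :: "'g monoid \<Rightarrow> 'g \<Rightarrow> nat \<Rightarrow> 'g set \<Rightarrow> 'g set" where
  "nil_incl G g = (\<lambda>l\<in>primes. pro_incl l G g)"

text \<open>The continuous homomorphism from the topological group \<open>(G, TG)\<close> to \<open>(H, TH)\<close> that
  sends \<open>x\<close> to \<open>a\<close> and \<open>y\<close> to \<open>b\<close>. It is unique when \<open>x\<close>, \<open>y\<close> generate a dense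
  subgroup of \<open>G\<close> and \<open>H\<close> is Hausdorff, once its values off the carrier are fixed by
  extensionality.\<close>

definition cont_hom ::
  "'g monoid \<Rightarrow> 'g topology \<Rightarrow> 'g \<Rightarrow> 'g \<Rightarrow> 'h monoid \<Rightarrow> 'h topology \<Rightarrow> 'h \<Rightarrow> 'h \<Rightarrow> 'g \<Rightarrow> 'h" where
  "cont_hom G TG x y H TH a b =
     (THE h. h \<in> hom G H \<and> h \<in> extensional (carrier G) \<and> continuous_map TG TH h \<and>
             h x = a \<and> h y = b)"

abbreviation F2nil :: "(nat \<Rightarrow> letter gword set set \<Rightarrow> letter gword set set) monoid" where
  "F2nil \<equiv> nil_completion F2"

abbreviation K4nil :: "(nat \<Rightarrow> nat gword set set \<Rightarrow> nat gword set set) monoid" where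
  "K4nil \<equiv> nil_completion K4"

definition nx :: "nat \<Rightarrow> letter gword set set \<Rightarrow> letter gword set set" where
  "nx = nil_incl F2 F2_x"
definition ny :: "nat \<Rightarrow> letter gword set set \<Rightarrow> letter gword set set" where
  "ny = nil_incl F2 F2_y"
definition nz :: "nat \<Rightarrow> letter gword set set \<Rightarrow> letter gword set set" where
  "nz = inv\<^bsub>F2nil\<^esub> (nx \<otimes>\<^bsub>F2nil\<^esub> ny)"

definition braid_x :: "nat \<Rightarrow> nat \<Rightarrow> nat \<Rightarrow> nat gword set set \<Rightarrow> nat gword set set" where
  "braid_x i j = nil_incl K4 (pure_braid_gen 4 i j)"

text \<open>\<open>f(a, b)\<close> with \<open>a\<close>, \<open>b\<close> in the pro-nilpotent completion of \<open>G\<close>.\<close>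

definition nil_subst ::
  "'g monoid \<Rightarrow> (nat \<Rightarrow> letter gword set set \<Rightarrow> letter gword set set) \<Rightarrow>
   (nat \<Rightarrow> 'g set \<Rightarrow> 'g set) \<Rightarrow> (nat \<Rightarrow> 'g set \<Rightarrow> 'g set) \<Rightarrow> (nat \<Rightarrow> 'g set \<Rightarrow> 'g set)" where
  "nil_subst G f a b =
     cont_hom F2nil (nil_topology F2) nx ny (nil_completion G) (nil_topology G) a b f"


section \<open>The field of $l$-adic numbers and its algebraic closure\<close>

definition padic_abs :: "nat \<Rightarrow> rat \<Rightarrow> real" where
  "padic_abs l q =
     (if q = 0 then 0
      else real l powi (int (multiplicity (int l) (snd (quotient_of q)))
                        - int (multiplicity (int l) (fst (quotient_of q)))))"

definition padic_cauchy :: "nat \<Rightarrow> (nat \<Rightarrow> rat) ring" where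
  "padic_cauchy l =
     \<lparr> carrier = {a. \<forall>e>0. \<exists>N. \<forall>m\<ge>N. \<forall>n\<ge>N. padic_abs l (a m - a n) < e},
       monoid.mult = (\<lambda>a b n. a n * b n),
       one = (\<lambda>n. 1),
       ring.zero = (\<lambda>n. 0),
       ring.add = (\<lambda>a b n. a n + b n) \<rparr>"

definition padic_null :: "nat \<Rightarrow> (nat \<Rightarrow> rat) set" where
  "padic_null l = {a. (\<lambda>n. padic_abs l (a n)) \<longlonglongrightarrow> 0}"

definition Ql :: "nat \<Rightarrow> (nat \<Rightarrow> rat) set ring" where
  "Ql l = padic_cauchy l Quot padic_null l"

definition Ql_abs :: "nat \<Rightarrow> (nat \<Rightarrow> rat) set \<Rightarrow> real" where
  "Ql_abs l A = (THE r. \<forall>a\<in>A. (\<lambda>n. padic_abs l (a n)) \<longlonglongrightarrow> r)"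

text \<open>The distance is set to 0 off the carrier because the locale \<open>Metric_space\<close> requires
  nonnegativity and symmetry on the whole type.\<close>

definition Ql_dist :: "nat \<Rightarrow> (nat \<Rightarrow> rat) set \<Rightarrow> (nat \<Rightarrow> rat) set \<Rightarrow> real" where
  "Ql_dist l A B =
     (if A \<in> carrier (Ql l) \<and> B \<in> carrier (Ql l) then Ql_abs l (A \<ominus>\<^bsub>Ql l\<^esub> B) else 0)"

definition Ql_topology :: "nat \<Rightarrow> (nat \<Rightarrow> rat) set topology" where
  "Ql_topology l = Metric_space.mtopology (carrier (Ql l)) (Ql_dist l)"

type_synonym ql = "(nat \<Rightarrow> rat) set"
type_synonym qlbar = "(ql list \<times> nat) multiset \<Rightarrow> ql"

definition Qlbar :: "nat \<Rightarrow> qlbar ring" where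
  "Qlbar l = field.alg_closure (Ql l)"

definition Ql_embed :: "nat \<Rightarrow> ql \<Rightarrow> qlbar" where
  "Ql_embed l = ring.indexed_const (Ql l)"


section \<open>Noncommutative power series and the free pro-unipotent group\<close>

text \<open>A power series in two noncommuting variables is its family of coefficients, indexed by
  the words in these variables.\<close>

definition ncps :: "('a, 'm) ring_scheme \<Rightarrow> (letter list \<Rightarrow> 'a) ring" where
  "ncps R =
     \<lparr> carrier = {\<phi>. \<forall>w. \<phi> w \<in> carrier R},
       monoid.mult =
         (\<lambda>\<phi> \<psi> w. finsum R (\<lambda>i. \<phi> (take i w) \<otimes>\<^bsub>R\<^esub> \<psi> (drop i w)) {..length w}),
       one = (\<lambda>w. if w = [] then \<one>\<^bsub>R\<^esub> else \<zero>\<^bsub>R\<^esub>),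
       ring.zero = (\<lambda>w. \<zero>\<^bsub>R\<^esub>),
       ring.add = (\<lambda>\<phi> \<psi> w. \<phi> w \<oplus>\<^bsub>R\<^esub> \<psi> w) \<rparr>"

definition nc_var :: "('a, 'm) ring_scheme \<Rightarrow> letter \<Rightarrow> letter list \<Rightarrow> 'a" where
  "nc_var R s = (\<lambda>w. if w = [s] then \<one>\<^bsub>R\<^esub> else \<zero>\<^bsub>R\<^esub>)"

text \<open>If \<open>\<phi>\<close> has constant term 0, then \<open>\<phi>\<^sup>n\<close> has no terms of degree below \<open>n\<close>, so the
  coefficient at \<open>w\<close> of the exponential series only involves \<open>n \<le> length w\<close>. The same applies
  to the logarithm of a series with constant term 1.\<close>

definition nc_exp :: "('a, 'm) ring_scheme \<Rightarrow> (letter list \<Rightarrow> 'a) \<Rightarrow> letter list \<Rightarrow> 'a" where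
  "nc_exp R \<phi> = (\<lambda>w. finsum R
     (\<lambda>n. inv\<^bsub>R\<^esub> ([(fact n :: nat)] \<cdot>\<^bsub>R\<^esub> \<one>\<^bsub>R\<^esub>) \<otimes>\<^bsub>R\<^esub> (\<phi> [^]\<^bsub>ncps R\<^esub> (n::nat)) w)
     {..length w})"

definition nc_log :: "('a, 'm) ring_scheme \<Rightarrow> (letter list \<Rightarrow> 'a) \<Rightarrow> letter list \<Rightarrow> 'a" where
  "nc_log R \<phi> = (\<lambda>w. finsum R
     (\<lambda>n. (\<ominus>\<^bsub>R\<^esub> \<one>\<^bsub>R\<^esub>) [^]\<^bsub>R\<^esub> (n + 1) \<otimes>\<^bsub>R\<^esub> inv\<^bsub>R\<^esub> ([n] \<cdot>\<^bsub>R\<^esub> \<one>\<^bsub>R\<^esub>) \<otimes>\<^bsub>R\<^esub>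
          ((\<phi> \<ominus>\<^bsub>ncps R\<^esub> \<one>\<^bsub>ncps R\<^esub>) [^]\<^bsub>ncps R\<^esub> (n::nat)) w)
     {1..length w})"

definition nc_powr ::
  "('a, 'm) ring_scheme \<Rightarrow> (letter list \<Rightarrow> 'a) \<Rightarrow> 'a \<Rightarrow> letter list \<Rightarrow> 'a" where
  "nc_powr R \<phi> m = nc_exp R (\<lambda>w. m \<otimes>\<^bsub>R\<^esub> nc_log R \<phi> w)"

text \<open>The coproduct \<open>\<Delta>\<close> for which the variables are primitive: \<open>\<Delta>(w)\<close> is the product over the
  letters \<open>s\<close> of \<open>w\<close> of \<open>s \<otimes> 1 + 1 \<otimes> s\<close>. Expanding, each set \<open>I\<close> of positions of \<open>w\<close>
  contributes the subword of \<open>w\<close> on \<open>I\<close> tensor the subword on the complement of \<open>I\<close>. The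
  value below is the coefficient of \<open>u \<otimes> v\<close> in \<open>\<Delta>(\<phi>)\<close>, a finite sum.\<close>

definition nc_coproduct ::
  "('a, 'm) ring_scheme \<Rightarrow> (letter list \<Rightarrow> 'a) \<Rightarrow> letter list \<Rightarrow> letter list \<Rightarrow> 'a" where
  "nc_coproduct R \<phi> u v = finsum R (\<lambda>(w, I). \<phi> w)
     {(w, I). I \<subseteq> {..<length w} \<and> nths w I = u \<and> nths w (- I) = v}"

definition F2_points :: "('a, 'm) ring_scheme \<Rightarrow> (letter list \<Rightarrow> 'a) monoid" where
  "F2_points R =
     \<lparr> carrier = {\<phi> \<in> carrier (ncps R). \<phi> [] = \<one>\<^bsub>R\<^esub> \<and>
                    (\<forall>u v. nc_coproduct R \<phi> u v = \<phi> u \<otimes>\<^bsub>R\<^esub> \<phi> v)},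
       monoid.mult = monoid.mult (ncps R),
       one = \<one>\<^bsub>ncps R\<^esub> \<rparr>"

definition F2_Ql_topology :: "nat \<Rightarrow> (letter list \<Rightarrow> ql) topology" where
  "F2_Ql_topology l =
     subtopology (product_topology (\<lambda>w. Ql_topology l) UNIV) (carrier (F2_points (Ql l)))"

text \<open>\<open>F2_to_Ql l g\<close> is \<open>g(e\<^sup>X, e\<^sup>Y)\<close> for \<open>g\<close> in the pro-\<open>l\<close> completion of the free group.\<close>

definition F2_to_Ql ::
  "nat \<Rightarrow> (letter gword set set \<Rightarrow> letter gword set set) \<Rightarrow> letter list \<Rightarrow> ql" where
  "F2_to_Ql l =
     cont_hom (pro_completion l F2) (pro_topology l F2) (pro_incl l F2 F2_x) (pro_incl l F2 F2_y)
       (F2_points (Ql l)) (F2_Ql_topology l)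
       (nc_exp (Ql l) (nc_var (Ql l) LX)) (nc_exp (Ql l) (nc_var (Ql l) LY))"

definition F2_to_Qlbar ::
  "nat \<Rightarrow> (letter gword set set \<Rightarrow> letter gword set set) \<Rightarrow> letter list \<Rightarrow> qlbar" where
  "F2_to_Qlbar l g = (\<lambda>w. Ql_embed l (F2_to_Ql l g w))"

definition c2 :: "nat \<Rightarrow> (letter gword set set \<Rightarrow> letter gword set set) \<Rightarrow> ql" where
  "c2 l g = F2_to_Ql l g [LX, LY]"


section \<open>The two relations\<close>

definition hexagon_at ::
  "nat \<Rightarrow> qlbar \<Rightarrow> (nat \<Rightarrow> letter gword set set \<Rightarrow> letter gword set set) \<Rightarrow> bool" where
  "hexagon_at l lam f \<longleftrightarrow>
     (let K = Qlbar l; P = F2_points K;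
          m = (lam \<ominus>\<^bsub>K\<^esub> \<one>\<^bsub>K\<^esub>) \<otimes>\<^bsub>K\<^esub> inv\<^bsub>K\<^esub> ([(2::nat)] \<cdot>\<^bsub>K\<^esub> \<one>\<^bsub>K\<^esub>);
          \<iota> = (\<lambda>g. F2_to_Qlbar l (g l))
      in \<iota> (nil_subst F2 f nz nx) \<otimes>\<^bsub>P\<^esub> nc_powr K (\<iota> nz) m \<otimes>\<^bsub>P\<^esub>
         \<iota> (nil_subst F2 f ny nz) \<otimes>\<^bsub>P\<^esub> nc_powr K (\<iota> ny) m \<otimes>\<^bsub>P\<^esub>
         \<iota> (nil_subst F2 f nx ny) \<otimes>\<^bsub>P\<^esub> nc_powr K (\<iota> nx) m = \<one>\<^bsub>P\<^esub>)"

definition gt_pair ::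
  "(nat \<Rightarrow> qlbar) \<Rightarrow> (nat \<Rightarrow> letter gword set set \<Rightarrow> letter gword set set) \<Rightarrow> bool" where
  "gt_pair lam f \<longleftrightarrow>
     (\<forall>l\<in>primes. hexagon_at l (lam l) f) \<and>
     nil_subst F2 f nx ny \<otimes>\<^bsub>F2nil\<^esub> nil_subst F2 f ny nx = \<one>\<^bsub>F2nil\<^esub>"

text \<open>The elements denoted by \<open>\<plusminus>a\<^bsup>1/2\<^esup>\<close>.\<close>

definition square_roots :: "('a, 'm) ring_scheme \<Rightarrow> 'a \<Rightarrow> 'a set" where
  "square_roots K a = {s \<in> carrier K. s [^]\<^bsub>K\<^esub> (2::nat) = a}"

end

theory Submission
  imports Defs "HOL-Computational_Algebra.Formal_Power_Series"
begin

text \<open>The braid group on four strings acts on the power series in four noncommuting variables (Artin).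
  This turns the pentagon into an identity between infinite lower triangular matrices indexed by words,
  in which \<open>f\<close> is the evaluation at logarithms of the series \<open>\<Phi> = f(e\<^sup>X, e\<^sup>Y)\<close>. Its
  terms of degree one show that \<open>\<Phi>\<close> has no linear part, so that central factors in the arguments of
  \<open>f\<close> do not matter. A strand can be moved past three others in two ways; comparing them with the help
  of the pentagon gives a relation between four conjugates of the left hand side
  \<open>L(z, y) = f(z, x) z\<^sup>m f(y, z) y\<^sup>m f(x, y) x\<^sup>m\<close>, \<open>x = (yz)\<^sup>-\<^sup>1\<close>, of the
  hexagon relation, at different arguments. Hence the leading term of \<open>L - 1\<close> satisfies a two-cocycle
  equation in a free algebra. Together with \<open>L(z, z) = 1\<close> this forces the leading term to vanish in every
  degree other than two, where it is a multiple of \<open>[X, Y]\<close> by \<open>(m\<^sup>2 + m) / 2 - 3 c\<^sub>2(f)\<close>.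
  So the hexagon holds if and only if \<open>\<lambda>\<^sup>2 = 24 c\<^sub>2(f) + 1\<close>. The relation
  \<open>f(x, y) f(y, x) = 1\<close> is the image of the pentagon under a homomorphism \<open>K\<^sub>4 \<rightarrow> F\<^sub>2\<close>, up to a
  power of \<open>y\<close> that is trivial because \<open>\<Phi>\<close> has no linear part.\<close>

text \<open>The pentagon holds in a pro-l group, while the hexagon is an equation between power
  series over \<open>Qlbar l\<close>. The discrete groups join the two: a pure braid acts by a
  unipotent integral matrix, and congruence subgroups of such representations have l-power index, so
  that matrix entries are l-adically uniformly continuous on \<open>K4\<close> and on
  \<open>F2\<close>. Hence an identity for f_l is the limit of congruences for words g close to f_l.

  The limit is axiomatised with values in a commutative Q-algebra rather than a field, because the
  product of all the fields \<open>Qlbar l\<close> then serves as one coefficient ring for all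
  primes at once. A function \<open>qi\<close> from the rationals carries the algebra structure; it
  also supplies the division by integers that a field would give.

  The constant 24 comes from m = (\<lambda> - 1) / 2: then (m^2 + m) / 2 = (\<lambda>^2 - 1) / 8,
  and this equals 3 c_2 exactly when \<lambda>^2 = 24 c_2 + 1.\<close>

class qalg = comm_ring_1 +
  fixes qi :: "rat \<Rightarrow> 'a"
  assumes qi_add: "qi (a + b) = qi a + qi b"
    and qi_mult: "qi (a * b) = qi a * qi b"
    and qi_1 [simp]: "qi 1 = 1"
begin

lemma qi_0 [simp]: "qi 0 = 0"
  using qi_add[of 0 0] by simp

lemma qi_minus: "qi (- a) = - qi a"
  using qi_add[of a "- a"] by (simp add: eq_neg_iff_add_eq_0 add.commute)

lemma qi_diff: "qi (a - b) = qi a - qi b"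
  using qi_add[of a "- b"] by (simp add: qi_minus)

lemma qi_of_nat: "qi (of_nat n) = of_nat n"
  by (induction n) (auto simp: qi_add)

lemma qi_numeral [simp]: "qi (numeral n) = numeral n"
  using qi_of_nat[of "numeral n"] by simp

lemma qi_sum: "qi (sum f S) = (\<Sum>x\<in>S. qi (f x))"
  by (induction S rule: infinite_finite_induct) (auto simp: qi_add)

lemma qi_power: "qi (a ^ n) = qi a ^ n"
  by (induction n) (auto simp: qi_mult)

lemma of_nat_cancel:
  assumes "of_nat n * x = of_nat n * y" "n > 0"
  shows "x = y"
proof -
  have "qi (1 / of_nat n) * of_nat n = (1 :: 'a)"
    using assms(2) by (simp add: qi_of_nat[symmetric] qi_mult[symmetric] flip: of_nat_0_less_iff)
  then show ?thesis
    using arg_cong[OF assms(1), of "\<lambda>z. qi (1 / of_nat n) * z"] by (simp flip: mult.assoc)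
qed

end

instantiation rat :: qalg
begin
definition qi_rat :: "rat \<Rightarrow> rat" where [simp]: "qi_rat x = x"
instance by standard auto
end

section \<open>Operators on noncommutative power series as matrices indexed by words\<close>

definition lw :: "nat \<Rightarrow> 'i list set" where "lw n = {w. length w \<le> n}"

lemma finite_lw [simp, intro]: "finite (lw n :: 'i::finite list set)"
  using finite_lists_length_le[of "UNIV :: 'i set" n] by (simp add: lw_def)

lemma lw_iff [simp]: "w \<in> lw n \<longleftrightarrow> length w \<le> n"
  by (simp add: lw_def)

text \<open>\<open>M u v\<close> is the coefficient of the word \<open>u\<close> in the image of the
  word \<open>v\<close>, so these are operators on power series that do not lower the degree. Over a
  finite alphabet each row has finitely many nonzero entries, which makes products finite sums
  although the index set is infinite.\<close>

typedef (overloaded) ('i, 'k::zero) tmat =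
    "{M :: 'i list \<Rightarrow> 'i list \<Rightarrow> 'k. \<forall>u v. length u < length v \<longrightarrow> M u v = 0}"
  morphisms ent Tmat
  by (rule exI[of _ "\<lambda>_ _. 0"]) simp

setup_lifting type_definition_tmat

lemma ent_lower [simp]: "length u < length v \<Longrightarrow> ent M u v = 0"
  using ent[of M] by simp

lemma tmat_eqI: "(\<And>u v. length v \<le> length u \<Longrightarrow> ent M u v = ent N u v) \<Longrightarrow> M = N"
  by (subst ent_inject[symmetric], intro ext) (metis ent_lower not_le)

instantiation tmat :: (finite, comm_ring_1) ring_1
begin
lift_definition zero_tmat :: "('a, 'b) tmat" is "\<lambda>_ _. 0" by simp
lift_definition one_tmat :: "('a, 'b) tmat" is "\<lambda>u v. if u = v then 1 else 0" by auto
lift_definition plus_tmat :: "('a, 'b) tmat \<Rightarrow> ('a, 'b) tmat \<Rightarrow> ('a, 'b) tmat"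
  is "\<lambda>M N u v. M u v + N u v" by simp
lift_definition minus_tmat :: "('a, 'b) tmat \<Rightarrow> ('a, 'b) tmat \<Rightarrow> ('a, 'b) tmat"
  is "\<lambda>M N u v. M u v - N u v" by simp
lift_definition uminus_tmat :: "('a, 'b) tmat \<Rightarrow> ('a, 'b) tmat"
  is "\<lambda>M u v. - M u v" by simp
lift_definition times_tmat :: "('a, 'b) tmat \<Rightarrow> ('a, 'b) tmat \<Rightarrow> ('a, 'b) tmat"
  is "\<lambda>M N u v. \<Sum>w\<in>lw (length u). M u w * N w v"
  by (auto intro!: sum.neutral)
instance
proof
  fix A B C :: "('a, 'b) tmat"
  show "A * B * C = A * (B * C)"
  proof (transfer, intro ext)
    fix A B C :: "'a list \<Rightarrow> 'a list \<Rightarrow> 'b" and u v :: "'a list"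
    assume *: "\<forall>u v. length u < length v \<longrightarrow> A u v = 0"
      "\<forall>u v. length u < length v \<longrightarrow> B u v = 0" "\<forall>u v. length u < length v \<longrightarrow> C u v = 0"
    \<comment> \<open>Enlarging the inner range from \<open>length w\<close> to
      \<open>length u\<close> adds only vanishing entries of \<open>B\<close>; both sums then run
      over one fixed set and can be exchanged.\<close>
    have "(\<Sum>x\<in>lw (length w). B w x * C x v) = (\<Sum>x\<in>lw (length u). B w x * C x v)"
      if "w \<in> lw (length u)" for w
      by (rule sum.mono_neutral_left) (use that * in auto)
    then have "(\<Sum>w\<in>lw (length u). A u w * (\<Sum>x\<in>lw (length w). B w x * C x v)) =
          (\<Sum>w\<in>lw (length u). A u w * (\<Sum>x\<in>lw (length u). B w x * C x v))"
      by simp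
    also have "\<dots> = (\<Sum>x\<in>lw (length u). (\<Sum>w\<in>lw (length u). A u w * B w x) * C x v)"
      by (simp add: sum_distrib_left sum_distrib_right mult.assoc) (rule sum.swap)
    finally show "(\<Sum>w\<in>lw (length u). (\<Sum>x\<in>lw (length u). A u x * B x w) * C w v) =
        (\<Sum>w\<in>lw (length u). A u w * (\<Sum>x\<in>lw (length w). B w x * C x v))" by simp
  qed
  show "(A + B) * C = A * C + B * C"
    by transfer (auto simp: sum.distrib distrib_right intro!: ext)
  show "A * (B + C) = A * B + A * C"
    by transfer (auto simp: sum.distrib distrib_left intro!: ext)
  show "1 * A = A"
  proof (transfer, intro ext)
    fix A :: "'a list \<Rightarrow> 'a list \<Rightarrow> 'b" and u v :: "'a list"
    have "(\<Sum>w\<in>lw (length u). (if u = w then 1 else 0) * A w v) =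
      (\<Sum>w\<in>lw (length u). if w = u then A w v else 0)"
      by (intro sum.cong) auto
    then show "(\<Sum>w\<in>lw (length u). (if u = w then 1 else 0) * A w v) = A u v"
      by (auto simp: sum.delta')
  qed
  show "A * 1 = A"
  proof (transfer, intro ext)
    fix A :: "'a list \<Rightarrow> 'a list \<Rightarrow> 'b" and u v :: "'a list"
    assume *: "\<forall>u v. length u < length v \<longrightarrow> A u v = 0"
    have "(\<Sum>w\<in>lw (length u). A u w * (if w = v then 1 else 0)) =
      (\<Sum>w\<in>lw (length u). if w = v then A u w else 0)"
      by (intro sum.cong) auto
    then show "(\<Sum>w\<in>lw (length u). A u w * (if w = v then 1 else 0)) = A u v"
      using * by (auto simp: sum.delta')
  qed
  show "(0::('a, 'b) tmat) \<noteq> 1"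
    by transfer (auto simp: fun_eq_iff)
  show "A + B + C = A + (B + C)" "A + B = B + A" "0 + A = A" "- A + A = 0" "A - B = A + - B"
    by (transfer; auto simp: algebra_simps fun_eq_iff)+
qed
end

lemma ent_0 [simp]: "ent 0 u v = 0" by transfer simp
lemma ent_1: "ent 1 u v = (if u = v then 1 else 0)" by transfer simp
lemma ent_add [simp]: "ent (A + B) u v = ent A u v + ent B u v" by transfer simp
lemma ent_diff [simp]: "ent (A - B) u v = ent A u v - ent B u v" by transfer simp
lemma ent_minus [simp]: "ent (- A) u v = - ent A u v" by transfer simp
lemma ent_mult_self: "ent (A * B) u v = (\<Sum>w\<in>lw (length u). ent A u w * ent B w v)"
  by transfer simp
lemma ent_mult: "length u \<le> n \<Longrightarrow> ent (A * B) u v = (\<Sum>w\<in>lw n. ent A u w * ent B w v)"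
  unfolding ent_mult_self by (intro sum.mono_neutral_left) auto
lift_definition scm :: "'k::comm_ring_1 \<Rightarrow> ('i::finite, 'k) tmat \<Rightarrow> ('i, 'k) tmat"
  is "\<lambda>c M u v. c * M u v" by simp

lemma ent_scm [simp]: "ent (scm c M) u v = c * ent M u v" by transfer simp

text \<open>The filtration by the amount by which the degree is raised. It is multiplicative
  (\<open>Fil_mult\<close>), so an element of \<open>Fil 1\<close> can be substituted into any power
  series, and "leading term" means the lowest step of this filtration that is not zero.\<close>

definition Fil :: "nat \<Rightarrow> ('i::finite, 'k::comm_ring_1) tmat set" where
  "Fil n = {M. \<forall>u v. length u < length v + n \<longrightarrow> ent M u v = 0}"

lemma FilI: "(\<And>u v. length u < length v + n \<Longrightarrow> ent M u v = 0) \<Longrightarrow> M \<in> Fil n"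
  by (simp add: Fil_def)
lemma FilD: "M \<in> Fil n \<Longrightarrow> length u < length v + n \<Longrightarrow> ent M u v = 0"
  by (simp add: Fil_def)
lemma Fil_0 [simp]: "M \<in> Fil 0" by (simp add: Fil_def)
lemma Fil_zero [simp]: "0 \<in> Fil n" by (simp add: Fil_def)
lemma Fil_add: "A \<in> Fil n \<Longrightarrow> B \<in> Fil n \<Longrightarrow> A + B \<in> Fil n" by (simp add: Fil_def)
lemma Fil_diff: "A \<in> Fil n \<Longrightarrow> B \<in> Fil n \<Longrightarrow> A - B \<in> Fil n" by (simp add: Fil_def)
lemma Fil_minus: "A \<in> Fil n \<Longrightarrow> - A \<in> Fil n" by (simp add: Fil_def)
lemma Fil_scm: "A \<in> Fil n \<Longrightarrow> scm c A \<in> Fil n" by (simp add: Fil_def)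
lemma Fil_mult: "A \<in> Fil m \<Longrightarrow> B \<in> Fil n \<Longrightarrow> A * B \<in> Fil (m + n)"
proof (rule FilI)
  fix u v :: "'a list"
  assume *: "A \<in> Fil m" "B \<in> Fil n" "length u < length v + (m + n)"
  have "ent A u w * ent B w v = 0" for w
  proof (cases "length u < length w + m")
    case True
    then show ?thesis using * by (simp add: FilD)
  next
    case False
    then have "length w < length v + n" using * by simp
    then show ?thesis using * by (simp add: FilD)
  qed
  then show "ent (A * B) u v = 0" by (simp add: ent_mult_self)
qed
lemma Fil_multL: "A \<in> Fil n \<Longrightarrow> B * A \<in> Fil n" using Fil_mult[of B 0 A n] by simp
lemma Fil_multR: "A \<in> Fil n \<Longrightarrow> A * B \<in> Fil n" using Fil_mult[of A n B 0] by simp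
lemma Fil_power: "A \<in> Fil 1 \<Longrightarrow> A ^ n \<in> Fil n"
  by (induction n) (auto dest: Fil_mult)

lemma scm_mult_left: "scm c A * B = scm c (A * B)"
  by (rule tmat_eqI) (simp add: ent_mult_self sum_distrib_left mult.assoc)
lemma scm_mult_right: "A * scm c B = scm c (A * B)"
  by (rule tmat_eqI) (simp add: ent_mult_self sum_distrib_left mult.left_commute)
lemma scm_scm: "scm c (scm d A) = scm (c * d) A"
  by (rule tmat_eqI) (simp add: mult.assoc)
lemma scm_1 [simp]: "scm 1 A = A" by (rule tmat_eqI) simp
lemma scm_0 [simp]: "scm 0 A = 0" by (rule tmat_eqI) simp
section \<open>Evaluation of power series\<close>

abbreviation unip :: "('i::finite, 'k::comm_ring_1) tmat \<Rightarrow> bool" where "unip a \<equiv> a - 1 \<in> Fil 1"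

definition wd :: "('j \<Rightarrow> ('i::finite, 'k::comm_ring_1) tmat) \<Rightarrow> 'j list \<Rightarrow> ('i, 'k) tmat" where
  "wd A w = prod_list (map A w)"

lemma wd_simps [simp]: "wd A [] = 1" "wd A (j # w) = A j * wd A w" "wd A (v @ w) = wd A v * wd A w"
  by (auto simp: wd_def)

lemma wd_Fil: "(\<And>j. A j \<in> Fil 1) \<Longrightarrow> wd A w \<in> Fil (length w)"
  by (induction w) (use Fil_mult[of _ 1] in auto)

text \<open>For arguments in \<open>Fil 1\<close> the cut at \<open>length u\<close> loses nothing,
  since a word of length n is then sent to \<open>Fil n\<close>; \<open>ent_ev\<close> permits any
  cut at or above the difference of the degrees. The finite sum makes evaluation total, without a
  convergence predicate.\<close>

lift_definition ev ::
  "('j::finite list \<Rightarrow> 'k::comm_ring_1) \<Rightarrow> ('j \<Rightarrow> ('i::finite, 'k) tmat) \<Rightarrow> ('i, 'k) tmat"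
  is "\<lambda>\<phi> A u v. \<Sum>w\<in>lw (length u). \<phi> w * ent (wd A w) u v"
  by simp

lemma ent_ev:
  assumes "\<And>j. A j \<in> Fil 1" "length u \<le> length v + n"
  shows "ent (ev \<phi> A) u v = (\<Sum>w\<in>lw n. \<phi> w * ent (wd A w) u v)"
proof -
  have *: "ent (wd A w) u v = 0" if "length w > n" for w
    using FilD[OF wd_Fil[of A w], of u v] assms that by simp
  have **: "ent (wd A w) u v = 0" if "length w > length u" for w
    using FilD[OF wd_Fil[of A w], of u v] assms that by simp
  have "(\<Sum>w\<in>lw n. \<phi> w * ent (wd A w) u v) = (\<Sum>w\<in>lw (max n (length u)). \<phi> w * ent (wd A w) u v)"
    by (rule sum.mono_neutral_left) (use * in auto)
  also have "\<dots> = (\<Sum>w\<in>lw (length u). \<phi> w * ent (wd A w) u v)"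
    by (rule sum.mono_neutral_right) (use ** in auto)
  finally show ?thesis by (simp add: ev.rep_eq)
qed

definition conv :: "('j list \<Rightarrow> 'k::comm_ring_1) \<Rightarrow> ('j list \<Rightarrow> 'k) \<Rightarrow> 'j list \<Rightarrow> 'k" where
  "conv \<phi> \<psi> w = (\<Sum>i\<le>length w. \<phi> (take i w) * \<psi> (drop i w))"

lemma sum_splits:
  fixes f :: "'j::finite list \<Rightarrow> 'j list \<Rightarrow> 'a::comm_monoid_add"
  shows "(\<Sum>y\<in>lw n. \<Sum>i\<le>length y. f (take i y) (drop i y)) =
         (\<Sum>(w, x)\<in>{(w, x). length w + length x \<le> n}. f w x)"
proof -
  have "(\<Sum>y\<in>lw n. \<Sum>i\<le>length y. f (take i y) (drop i y)) =
     (\<Sum>(y, i)\<in>Sigma (lw n) (\<lambda>y. {..length y}). f (take i y) (drop i y))"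
    by (subst sum.Sigma) auto
  also have "\<dots> = (\<Sum>(w, x)\<in>{(w, x). length w + length x \<le> n}. f w x)"
    by (rule sum.reindex_bij_witness[where i = "\<lambda>(w, x). (w @ x, length w)"
          and j = "\<lambda>(y, i). (take i y, drop i y)"]) auto
  finally show ?thesis .
qed

lemma ev_mult:
  fixes A :: "'j::finite \<Rightarrow> ('i::finite, 'k::comm_ring_1) tmat"
  assumes A: "\<And>j. A j \<in> Fil 1"
  shows "ev \<phi> A * ev \<psi> A = ev (conv \<phi> \<psi>) A"
proof (rule tmat_eqI)
  fix u v :: "'i list"
  let ?n = "length u"
  have "ent (ev \<phi> A * ev \<psi> A) u v =
    (\<Sum>y\<in>lw ?n. (\<Sum>w\<in>lw ?n. \<phi> w * ent (wd A w) u y) * (\<Sum>x\<in>lw ?n. \<psi> x * ent (wd A x) y v))"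
    by (simp add: ent_mult_self ent_ev[OF A, of _ _ ?n])
  also have "\<dots> = (\<Sum>y\<in>lw ?n. \<Sum>w\<in>lw ?n. \<Sum>x\<in>lw ?n. \<phi> w * \<psi> x * (ent (wd A w) u y * ent (wd A x) y v))"
    by (simp add: sum_product mult_ac)
  also have "\<dots> = (\<Sum>w\<in>lw ?n. \<Sum>x\<in>lw ?n. \<Sum>y\<in>lw ?n. \<phi> w * \<psi> x * (ent (wd A w) u y * ent (wd A x) y v))"
    by (subst sum.swap, intro sum.cong refl, subst sum.swap, rule refl)
  also have "\<dots> = (\<Sum>w\<in>lw ?n. \<Sum>x\<in>lw ?n. \<phi> w * \<psi> x * ent (wd A (w @ x)) u v)"
    by (simp add: ent_mult_self sum_distrib_left)
  also have "\<dots> = (\<Sum>(w, x)\<in>lw ?n \<times> lw ?n. \<phi> w * \<psi> x * ent (wd A (w @ x)) u v)"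
    by (simp add: sum.cartesian_product)
  \<comment> \<open>Two words of total length above \<open>?n\<close> have a product in a step of
    the filtration where this entry vanishes, so the square of pairs shrinks to the triangle that
    the convolution runs over.\<close>
  also have "\<dots> = (\<Sum>(w, x)\<in>{(w, x). length w + length x \<le> ?n}. \<phi> w * \<psi> x * ent (wd A (w @ x)) u v)"
  proof (rule sum.mono_neutral_right)
    have "ent (wd A (w @ x)) u v = 0" if "\<not> length w + length x \<le> ?n" for w x
      using FilD[OF wd_Fil[of A "w @ x", OF A], of u v] that by simp
    then show "\<forall>i\<in>lw ?n \<times> lw ?n - {(w, x). length w + length x \<le> ?n}.
       (case i of (w, x) \<Rightarrow> \<phi> w * \<psi> x * ent (wd A (w @ x)) u v) = 0"
      by (fastforce simp del: wd_simps)
  qed auto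
  also have "\<dots> = (\<Sum>y\<in>lw ?n. \<Sum>i\<le>length y. \<phi> (take i y) * \<psi> (drop i y) * ent (wd A (take i y @ drop i y)) u v)"
    by (rule sum_splits[symmetric])
  also have "\<dots> = ent (ev (conv \<phi> \<psi>) A) u v"
    by (simp add: ent_ev[OF A, of _ _ ?n] conv_def sum_distrib_right del: wd_simps)
  finally show "ent (ev \<phi> A * ev \<psi> A) u v = ent (ev (conv \<phi> \<psi>) A) u v" .
qed

definition delta :: "'j list \<Rightarrow> 'k::comm_ring_1" where "delta w = (if w = [] then 1 else 0)"

lemma ev_delta [simp]: "(\<And>j. A j \<in> Fil 1) \<Longrightarrow> ev delta A = 1"
  by (rule tmat_eqI) (simp add: ev.rep_eq delta_def if_distrib[of "\<lambda>x. x * _"] ent_1 cong: if_cong)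

lemma ev_add: "ev (\<lambda>w. \<phi> w + \<psi> w) A = ev \<phi> A + ev \<psi> A"
  by (rule tmat_eqI) (simp add: ev.rep_eq distrib_right sum.distrib)

lemma ev_cmult: "ev (\<lambda>w. c * \<phi> w) A = scm c (ev \<phi> A)"
  by (rule tmat_eqI) (simp add: ev.rep_eq mult.assoc sum_distrib_left)

lemma ev_Fil:
  fixes A :: "'j::finite \<Rightarrow> ('i::finite, 'k::comm_ring_1) tmat"
  assumes A: "\<And>j. A j \<in> Fil 1" and "\<And>w. length w < n \<Longrightarrow> \<phi> w = 0"
  shows "ev \<phi> A \<in> Fil n"
proof (rule FilI)
  fix u v :: "'i list" assume *: "length u < length v + n"
  have "\<phi> w * ent (wd A w) u v = 0" for w
    using assms(2)[of w] FilD[OF wd_Fil[of A w, OF A], of u v] * by (cases "length w < n") auto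
  then show "ent (ev \<phi> A) u v = 0" by (simp add: ev.rep_eq)
qed

text \<open>Left multiplication by the letter \<open>i\<close>. Thus \<open>ev \<phi> Toep\<close>
  is left multiplication by the series \<phi>, whose value at the empty word, extracted by
  \<open>col\<close>, is \<phi> again: the series form a subalgebra of the matrices through the
  regular representation.\<close>

lift_definition Toep :: "'i::finite \<Rightarrow> ('i, 'k::comm_ring_1) tmat"
  is "\<lambda>i u v. if u = i # v then 1 else 0" by auto

lemma ent_Toep: "ent (Toep i) u v = (if u = i # v then 1 else 0)" by transfer simp
lemma Toep_Fil [simp]: "Toep i \<in> Fil 1" by (rule FilI) (auto simp: ent_Toep)

lemma ent_Toep_mult: "ent (Toep i * M) u v = (case u of [] \<Rightarrow> 0 | j # w \<Rightarrow> if i = j then ent M w v else 0)"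
proof (cases u)
  case (Cons j w)
  have "ent (Toep i * M) u v = (\<Sum>x\<in>lw (length u). if x = w then (if i = j then ent M x v else 0) else 0)"
    unfolding ent_mult_self by (intro sum.cong) (auto simp: Cons ent_Toep)
  then show ?thesis by (simp add: Cons sum.delta')
qed (simp add: ent_mult_self ent_Toep)

lemma ent_mult_Toep: "ent (M * Toep i) u v = ent M u (i # v)"
proof (cases "length u < length (i # v)")
  case True
  have "ent (M * Toep i) u v = 0"
    by (rule FilD[OF Fil_multL[OF Toep_Fil]]) (use True in auto)
  then show ?thesis using True by simp
next
  case False
  have "ent (M * Toep i) u v = (\<Sum>x\<in>lw (length u). if x = i # v then ent M u x else 0)"
    unfolding ent_mult_self by (intro sum.cong) (auto simp: ent_Toep)
  then show ?thesis using False by (simp add: sum.delta')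
qed

lemma ent_wd_Toep: "ent (wd Toep w) u v = (if u = w @ v then 1 else 0)"
proof (induction w arbitrary: u)
  case (Cons a w)
  then show ?case by (auto simp: ent_Toep_mult split: list.splits)
qed (auto simp: ent_1)

definition col :: "('i::finite, 'k::comm_ring_1) tmat \<Rightarrow> 'i list \<Rightarrow> 'k" where "col M w = ent M w []"

lemma col_ev_Toep [simp]: "col (ev \<phi> Toep) = \<phi>"
proof
  fix w
  show "col (ev \<phi> Toep) w = \<phi> w"
    by (simp add: col_def ev.rep_eq ent_wd_Toep if_distrib[of "\<lambda>x. _ * x"] sum.delta cong: if_cong)
qed

fun convw :: "('l \<Rightarrow> 'j list \<Rightarrow> 'k::comm_ring_1) \<Rightarrow> 'l list \<Rightarrow> 'j list \<Rightarrow> 'k" where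
  "convw \<psi> [] = delta"
| "convw \<psi> (j # w) = conv (\<psi> j) (convw \<psi> w)"

lemma wd_ev: "(\<And>j. A j \<in> Fil 1) \<Longrightarrow> wd (\<lambda>j. ev (\<psi> j) A) w = ev (convw \<psi> w) A"
  by (induction w) (auto simp: ev_mult)

lemma convw_low: "(\<And>j. \<psi> j [] = 0) \<Longrightarrow> length v < length w \<Longrightarrow> convw \<psi> w v = 0"
proof (induction w arbitrary: v)
  case (Cons a w)
  have "\<psi> a (take i v) * convw \<psi> w (drop i v) = 0" if "i \<le> length v" for i
    using Cons that by (cases i) auto
  then show ?case by (simp add: conv_def)
qed auto

definition psubst :: "('l::finite list \<Rightarrow> 'k::comm_ring_1) \<Rightarrow> ('l \<Rightarrow> 'j list \<Rightarrow> 'k) \<Rightarrow> 'j list \<Rightarrow> 'k" where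
  "psubst \<phi> \<psi> x = (\<Sum>w\<in>lw (length x). \<phi> w * convw \<psi> w x)"

lemma ev_ev:
  fixes A :: "'j::finite \<Rightarrow> ('i::finite, 'k::comm_ring_1) tmat"
  assumes A: "\<And>j. A j \<in> Fil 1" and z: "\<And>j. \<psi> j [] = 0"
  shows "ev \<phi> (\<lambda>j. ev (\<psi> j) A) = ev (psubst \<phi> \<psi>) A"
proof (rule tmat_eqI)
  fix u v :: "'i list"
  let ?n = "length u"
  have F: "ev (\<psi> j) A \<in> Fil 1" for j
    by (rule ev_Fil[OF A]) (use z in auto)
  have "ent (ev \<phi> (\<lambda>j. ev (\<psi> j) A)) u v = (\<Sum>w\<in>lw ?n. \<phi> w * (\<Sum>x\<in>lw ?n. convw \<psi> w x * ent (wd A x) u v))"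
    by (simp add: ent_ev[OF F, of _ _ ?n] wd_ev[OF A] ent_ev[OF A, of _ _ ?n])
  also have "\<dots> = (\<Sum>x\<in>lw ?n. (\<Sum>w\<in>lw ?n. \<phi> w * convw \<psi> w x) * ent (wd A x) u v)"
    by (simp add: sum_distrib_left sum_distrib_right mult.assoc) (rule sum.swap)
  also have "\<dots> = (\<Sum>x\<in>lw ?n. psubst \<phi> \<psi> x * ent (wd A x) u v)"
  proof (intro sum.cong refl arg_cong2[where f = "(*)"])
    fix x :: "'j list" assume x: "x \<in> lw ?n"
    show "(\<Sum>w\<in>lw ?n. \<phi> w * convw \<psi> w x) = psubst \<phi> \<psi> x"
      unfolding psubst_def by (rule sum.mono_neutral_right) (use x z in \<open>auto simp: convw_low\<close>)
  qed
  also have "\<dots> = ent (ev (psubst \<phi> \<psi>) A) u v"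
    by (simp add: ent_ev[OF A, of _ _ ?n])
  finally show "ent (ev \<phi> (\<lambda>j. ev (\<psi> j) A)) u v = ent (ev (psubst \<phi> \<psi>) A) u v" .
qed

declare One_nat_def [simp del]

lift_definition ev1 :: "'k::comm_ring_1 fps \<Rightarrow> ('i::finite, 'k) tmat \<Rightarrow> ('i, 'k) tmat"
  is "\<lambda>F N u v. \<Sum>n\<le>length u. fps_nth F n * ent (N ^ n) u v"
  by simp

lemma ent_ev1:
  assumes "N \<in> Fil 1" "length u \<le> length v + n"
  shows "ent (ev1 F N) u v = (\<Sum>k\<le>n. fps_nth F k * ent (N ^ k) u v)"
proof -
  have *: "ent (N ^ k) u v = 0" if "k > n" for k
    by (rule FilD[OF Fil_power[OF assms(1)]]) (use assms that in simp)
  have **: "ent (N ^ k) u v = 0" if "k > length u" for k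
    by (rule FilD[OF Fil_power[OF assms(1)]]) (use assms that in simp)
  have "(\<Sum>k\<le>n. fps_nth F k * ent (N ^ k) u v) = (\<Sum>k\<le>max n (length u). fps_nth F k * ent (N ^ k) u v)"
    by (rule sum.mono_neutral_left) (use * in auto)
  also have "\<dots> = (\<Sum>k\<le>length u. fps_nth F k * ent (N ^ k) u v)"
    by (rule sum.mono_neutral_right) (use ** in auto)
  finally show ?thesis by (simp add: ev1.rep_eq)
qed

lemma ev1_mult:
  fixes N :: "('i::finite, 'k::comm_ring_1) tmat"
  assumes N: "N \<in> Fil 1"
  shows "ev1 F N * ev1 G N = ev1 (F * G) N"
proof (rule tmat_eqI)
  fix u v :: "'i list"
  let ?n = "length u"
  let ?t = "\<lambda>(i, j). fps_nth F i * fps_nth G j * ent (N ^ (i + j)) u v"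
  have "ent (ev1 F N * ev1 G N) u v =
    (\<Sum>y\<in>lw ?n. (\<Sum>i\<le>?n. fps_nth F i * ent (N ^ i) u y) * (\<Sum>j\<le>?n. fps_nth G j * ent (N ^ j) y v))"
    by (simp add: ent_mult_self ent_ev1[OF N, of _ _ ?n])
  also have "\<dots> = (\<Sum>y\<in>lw ?n. \<Sum>i\<le>?n. \<Sum>j\<le>?n. fps_nth F i * fps_nth G j * (ent (N ^ i) u y * ent (N ^ j) y v))"
    by (simp add: sum_product mult_ac)
  also have "\<dots> = (\<Sum>i\<le>?n. \<Sum>j\<le>?n. \<Sum>y\<in>lw ?n. fps_nth F i * fps_nth G j * (ent (N ^ i) u y * ent (N ^ j) y v))"
    by (subst sum.swap, intro sum.cong refl, subst sum.swap, rule refl)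
  also have "\<dots> = (\<Sum>p\<in>{..?n} \<times> {..?n}. ?t p)"
    unfolding sum.cartesian_product[symmetric] by (simp add: ent_mult_self sum_distrib_left power_add)
  also have "\<dots> = (\<Sum>p\<in>{(i, j). i + j \<le> ?n}. ?t p)"
  proof (rule sum.mono_neutral_right)
    have "ent (N ^ k) u v = 0" if "\<not> k \<le> ?n" for k
      by (rule FilD[OF Fil_power[OF N]]) (use that in simp)
    then show "\<forall>p\<in>{..?n} \<times> {..?n} - {(i, j). i + j \<le> ?n}. ?t p = 0" by fastforce
  qed auto
  also have "\<dots> = (\<Sum>(i, j)\<in>Sigma {..?n} (\<lambda>k. {..k}). ?t (j, i - j))"
    by (rule sum.reindex_bij_witness[where i = "\<lambda>(k, i). (i, k - i)" and j = "\<lambda>(i, j). (i + j, i)"]) auto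
  also have "\<dots> = (\<Sum>k\<le>?n. \<Sum>i\<le>k. ?t (i, k - i))"
    by (subst sum.Sigma) auto
  also have "\<dots> = ent (ev1 (F * G) N) u v"
    by (simp add: ent_ev1[OF N, of _ _ ?n] fps_mult_nth sum_distrib_right atMost_atLeast0)
  finally show "ent (ev1 F N * ev1 G N) u v = ent (ev1 (F * G) N) u v" .
qed

lemma ev1_1 [simp]: "ev1 1 N = 1"
  by (rule tmat_eqI) (simp add: ev1.rep_eq if_distrib[of "\<lambda>x. x * _"] cong: if_cong)

lemma ev1_power: "N \<in> Fil 1 \<Longrightarrow> ev1 F N ^ n = ev1 (F ^ n) N"
  by (induction n) (auto simp: ev1_mult)

lemma ev1_add: "ev1 (F + G) N = ev1 F N + ev1 G N"
  by (rule tmat_eqI) (simp add: ev1.rep_eq distrib_right sum.distrib)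

lemma ev1_diff: "ev1 (F - G) N = ev1 F N - ev1 G N"
  by (rule tmat_eqI) (simp add: ev1.rep_eq left_diff_distrib sum_subtractf)

lemma ev1_X [simp]: "N \<in> Fil 1 \<Longrightarrow> ev1 fps_X N = N"
proof (rule tmat_eqI)
  fix u v :: "'a list" assume "N \<in> Fil 1" "length v \<le> length u"
  then show "ent (ev1 fps_X N) u v = ent N u v"
    by (simp add: Suc_le_eq One_nat_def ent_ev1[of N u v "Suc (length u)"] fps_X_def if_distrib[of "\<lambda>x. x * _"] sum.delta' cong: if_cong)
qed

lemma ev1_Fil:
  fixes N :: "('i::finite, 'k::comm_ring_1) tmat"
  assumes N: "N \<in> Fil 1" and "\<And>k. k < n \<Longrightarrow> fps_nth F k = 0"
  shows "ev1 F N \<in> Fil n"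
proof (rule FilI)
  fix u v :: "'i list" assume *: "length u < length v + n"
  have "fps_nth F k * ent (N ^ k) u v = 0" for k
    using assms(2)[of k] FilD[OF Fil_power[OF N], of u v] * by (cases "k < n") auto
  then show "ent (ev1 F N) u v = 0" by (simp add: ev1.rep_eq)
qed

lemma ev1_compose:
  fixes N :: "('i::finite, 'k::comm_ring_1) tmat"
  assumes N: "N \<in> Fil 1" and G: "fps_nth G 0 = 0"
  shows "ev1 F (ev1 G N) = ev1 (F oo G) N"
proof (rule tmat_eqI)
  fix u v :: "'i list"
  let ?n = "length u"
  have GF: "ev1 G N \<in> Fil 1" by (rule ev1_Fil[OF N]) (use G in simp)
  have "ent (ev1 F (ev1 G N)) u v = (\<Sum>k\<le>?n. fps_nth F k * (\<Sum>j\<le>?n. fps_nth (G ^ k) j * ent (N ^ j) u v))"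
    by (simp add: ent_ev1[OF GF, of _ _ ?n] ent_ev1[OF N, of _ _ ?n] ev1_power[OF N])
  also have "\<dots> = (\<Sum>j\<le>?n. (\<Sum>k\<le>?n. fps_nth F k * fps_nth (G ^ k) j) * ent (N ^ j) u v)"
    by (simp add: sum_distrib_left sum_distrib_right mult.assoc) (rule sum.swap)
  also have "\<dots> = (\<Sum>j\<le>?n. fps_nth (F oo G) j * ent (N ^ j) u v)"
  proof (intro sum.cong refl arg_cong2[where f = "(*)"])
    fix j assume j: "j \<in> {..?n}"
    show "(\<Sum>k\<le>?n. fps_nth F k * fps_nth (G ^ k) j) = fps_nth (F oo G) j"
      unfolding fps_compose_nth
      by (rule sum.mono_neutral_right) (use j startsby_zero_power_prefix[OF G] in auto)
  qed
  also have "\<dots> = ent (ev1 (F oo G) N) u v" by (simp add: ent_ev1[OF N, of _ _ ?n])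
  finally show "ent (ev1 F (ev1 G N)) u v = ent (ev1 (F oo G) N) u v" .
qed

lemma intertwine_power: "B * A = A' * (B :: 'a::ring_1) \<Longrightarrow> B * A ^ n = A' ^ n * B"
proof (induction n)
  case (Suc n)
  have "B * A ^ Suc n = (B * A ^ n) * A" by (simp only: power_Suc2 mult.assoc)
  also have "\<dots> = A' ^ Suc n * B" using Suc by (simp only: power_Suc2 mult.assoc)
  finally show ?case .
qed simp

text \<open>An intertwiner passes through every power of \<open>A\<close>, hence through every
  series. The form \<open>B * A = A' * B\<close> replaces conjugation throughout, so that inverses
  of matrices need not be carried along.\<close>

lemma ev1_intertwine:
  fixes B :: "('i::finite, 'k::comm_ring_1) tmat"
  assumes "A \<in> Fil 1" "A' \<in> Fil 1" "B * A = A' * B"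
  shows "B * ev1 F A = ev1 F A' * B"
proof (rule tmat_eqI)
  fix u v :: "'i list"
  let ?n = "length u"
  have "ent (B * ev1 F A) u v = (\<Sum>y\<in>lw ?n. ent B u y * (\<Sum>k\<le>?n. fps_nth F k * ent (A ^ k) y v))"
    by (simp add: ent_mult_self ent_ev1[OF assms(1), of _ _ ?n])
  also have "\<dots> = (\<Sum>k\<le>?n. fps_nth F k * ent (B * A ^ k) u v)"
    by (simp add: ent_mult_self sum_distrib_left mult.left_commute) (rule sum.swap)
  also have "\<dots> = (\<Sum>k\<le>?n. fps_nth F k * ent (A' ^ k * B) u v)"
    by (simp add: intertwine_power[OF assms(3)])
  also have "\<dots> = (\<Sum>y\<in>lw ?n. (\<Sum>k\<le>?n. fps_nth F k * ent (A' ^ k) u y) * ent B y v)"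
    by (simp add: ent_mult_self sum_distrib_left sum_distrib_right mult.assoc) (rule sum.swap)
  also have "\<dots> = ent (ev1 F A' * B) u v"
    by (simp add: ent_mult_self ent_ev1[OF assms(2), of _ _ ?n])
  finally show "ent (B * ev1 F A) u v = ent (ev1 F A' * B) u v" .
qed

lemma wd_intertwine: "(\<And>j. B * A j = A' j * B) \<Longrightarrow> B * wd A w = wd A' w * B"
proof (induction w)
  case (Cons a w)
  then show ?case by simp (metis mult.assoc)
qed simp

lemma ev_intertwine:
  fixes B :: "('i::finite, 'k::comm_ring_1) tmat"
  assumes "\<And>j. A j \<in> Fil 1" "\<And>j. A' j \<in> Fil 1" "\<And>j. B * A j = A' j * B"
  shows "B * ev \<phi> A = ev \<phi> A' * B"
proof (rule tmat_eqI)
  fix u v :: "'i list"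
  let ?n = "length u"
  have "ent (B * ev \<phi> A) u v = (\<Sum>y\<in>lw ?n. ent B u y * (\<Sum>w\<in>lw ?n. \<phi> w * ent (wd A w) y v))"
    by (simp add: ent_mult_self ent_ev[OF assms(1), of _ _ ?n])
  also have "\<dots> = (\<Sum>w\<in>lw ?n. \<phi> w * ent (B * wd A w) u v)"
    by (simp add: ent_mult_self sum_distrib_left mult.left_commute) (rule sum.swap)
  also have "\<dots> = (\<Sum>w\<in>lw ?n. \<phi> w * ent (wd A' w * B) u v)"
    by (simp add: wd_intertwine[OF assms(3)])
  also have "\<dots> = (\<Sum>y\<in>lw ?n. (\<Sum>w\<in>lw ?n. \<phi> w * ent (wd A' w) u y) * ent B y v)"
    by (simp add: ent_mult_self sum_distrib_left sum_distrib_right mult.assoc) (rule sum.swap)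
  also have "\<dots> = ent (ev \<phi> A' * B) u v"
    by (simp add: ent_mult_self ent_ev[OF assms(2), of _ _ ?n])
  finally show "ent (B * ev \<phi> A) u v = ent (ev \<phi> A' * B) u v" .
qed

section \<open>Exponential and logarithm\<close>

definition qfps :: "rat fps \<Rightarrow> 'k::qalg fps" where "qfps F = Abs_fps (\<lambda>n. qi (fps_nth F n))"

lemma qfps_nth [simp]: "fps_nth (qfps F) n = qi (fps_nth F n)" by (simp add: qfps_def)
lemma qfps_mult: "qfps (F * G) = qfps F * qfps G"
  by (rule fps_ext) (simp add: fps_mult_nth qi_sum qi_mult)
lemma qfps_1 [simp]: "qfps 1 = 1" by (rule fps_ext) simp
lemma qfps_power: "qfps (F ^ n) = qfps F ^ n" by (induction n) (auto simp: qfps_mult)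
lemma qfps_add: "qfps (F + G) = qfps F + qfps G" by (rule fps_ext) (simp add: qi_add)
lemma qfps_diff: "qfps (F - G) = qfps F - qfps G" by (rule fps_ext) (simp add: qi_diff)
lemma qfps_X [simp]: "qfps fps_X = fps_X" by (rule fps_ext) (simp add: fps_X_def)
lemma qfps_compose: "qfps (F oo G) = qfps F oo qfps G"
  by (rule fps_ext) (simp add: fps_compose_nth qi_sum qi_mult qfps_power[symmetric])
lemma qfps_rat [simp]: "(qfps F :: rat fps) = F" by (rule fps_ext) simp

definition expf :: "'k::qalg \<Rightarrow> 'k fps" where "expf m = Abs_fps (\<lambda>n. m ^ n * qi (1 / fact n))"

lemma expf_nth [simp]: "fps_nth (expf m) n = m ^ n * qi (1 / fact n)" by (simp add: expf_def)

lemma expf_1: "expf 1 = qfps (fps_exp 1)"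
  by (rule fps_ext) simp

lemma expf_mult: "expf a * expf b = expf (a + b)"
proof (rule fps_ext)
  fix n
  have "a ^ i * qi (1 / fact i) * (b ^ (n - i) * qi (1 / fact (n - i))) =
        of_nat (n choose i) * a ^ i * b ^ (n - i) * qi (1 / fact n)" if "i \<le> n" for i
  proof -
    have "(1 / fact i) * (1 / fact (n - i)) = of_nat (n choose i) * (1 / fact n :: rat)"
      using binomial_fact[OF that, where 'a = rat] by simp
    then have "qi (1 / fact i) * qi (1 / fact (n - i)) = of_nat (n choose i) * (qi (1 / fact n) :: 'a)"
      by (metis qi_mult qi_of_nat)
    then have "a ^ i * b ^ (n - i) * (qi (1 / fact i) * qi (1 / fact (n - i))) =
        a ^ i * b ^ (n - i) * (of_nat (n choose i) * qi (1 / fact n))" by simp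
    then show ?thesis by (simp add: mult_ac)
  qed
  then have "(\<Sum>i = 0..n. a ^ i * qi (1 / fact i) * (b ^ (n - i) * qi (1 / fact (n - i)))) =
     (\<Sum>i\<le>n. of_nat (n choose i) * a ^ i * b ^ (n - i)) * qi (1 / fact n)"
    by (simp add: sum_distrib_right atMost_atLeast0)
  then show "fps_nth (expf a * expf b) n = fps_nth (expf (a + b)) n"
    by (simp add: fps_mult_nth binomial_ring)
qed

definition lnf :: "'k::qalg fps" where "lnf = qfps (fps_ln 1)"

lemma fps_exp_ln: "fps_exp 1 oo fps_ln 1 = (1 + fps_X :: rat fps)"
proof -
  have "(fps_exp 1 - 1) oo fps_ln 1 = (fps_X :: rat fps)"
    unfolding fps_ln_fps_exp_inv[OF one_neq_zero] by (rule fps_inv_right) auto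
  then show ?thesis
    by (simp add: fps_compose_sub_distrib algebra_simps)
qed

lemma fps_ln_exp: "fps_ln 1 oo (fps_exp 1 - 1) = (fps_X :: rat fps)"
  unfolding fps_ln_fps_exp_inv[OF one_neq_zero] by (rule fps_inv) auto

lemma expf_lnf: "expf 1 oo lnf = 1 + fps_X"
  unfolding expf_1 lnf_def qfps_compose[symmetric] fps_exp_ln by (simp add: qfps_add)

lemma lnf_expf: "lnf oo (expf 1 - 1) = fps_X"
  using arg_cong[OF fps_ln_exp, of qfps] unfolding expf_1 lnf_def
  by (simp add: qfps_compose qfps_diff)

definition ex :: "'k::qalg \<Rightarrow> ('i::finite, 'k) tmat \<Rightarrow> ('i, 'k) tmat" where "ex m A = ev1 (expf m) A"
definition lg :: "('i::finite, 'k::qalg) tmat \<Rightarrow> ('i, 'k) tmat" where "lg a = ev1 lnf (a - 1)"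
definition pw :: "'k::qalg \<Rightarrow> ('i::finite, 'k) tmat \<Rightarrow> ('i, 'k) tmat" where "pw m a = ex m (lg a)"

lemma lnf_0 [simp]: "fps_nth lnf 0 = 0" by (simp add: lnf_def)

lemma lg_Fil [simp]: "unip a \<Longrightarrow> lg a \<in> Fil 1"
  unfolding lg_def by (rule ev1_Fil) auto
lemma ex_Fil [simp]: "A \<in> Fil 1 \<Longrightarrow> unip (ex m A)"
  unfolding ex_def by (subst ev1_1[symmetric], subst ev1_diff[symmetric], rule ev1_Fil) auto
lemma pw_Fil [simp]: "unip a \<Longrightarrow> unip (pw m a)" by (simp add: pw_def)

lemma ex_lg [simp]: "unip a \<Longrightarrow> ex 1 (lg a) = a"
  unfolding ex_def lg_def by (simp add: ev1_compose expf_lnf ev1_add)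
lemma lg_ex [simp]: "A \<in> Fil 1 \<Longrightarrow> lg (ex 1 A) = A"
proof -
  assume A: "A \<in> Fil 1"
  have "ex 1 A - 1 = ev1 (expf 1 - 1) A" by (simp add: ex_def ev1_diff)
  then show ?thesis unfolding lg_def using A by (simp add: ev1_compose lnf_expf)
qed
lemma ex_add: "A \<in> Fil 1 \<Longrightarrow> ex (a + b) A = ex a A * ex b A"
  unfolding ex_def by (simp add: ev1_mult expf_mult)
lemma expf_0 [simp]: "expf 0 = 1" by (rule fps_ext) (auto simp: power_0_left)
lemma ex_0 [simp]: "ex 0 A = 1" by (simp add: ex_def)

lemma scm_power: "scm c A ^ n = scm (c ^ n) (A ^ n)"
  by (induction n) (auto simp: scm_mult_left scm_mult_right scm_scm mult_ac)

lemma ex_scm: "ex m (scm c A) = ex (m * c) A"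
  by (rule tmat_eqI) (simp add: ex_def ev1.rep_eq scm_power power_mult_distrib mult_ac)
lemma scm_minus_1: "scm (- 1) A = - A" by (rule tmat_eqI) simp
lemma ex_minus: "ex m (- A) = ex (- m) A"
  using ex_scm[of m "- 1" A] by (simp add: scm_minus_1)
lemma ex_inv: "A \<in> Fil 1 \<Longrightarrow> ex m A * ex (- m) A = 1" "A \<in> Fil 1 \<Longrightarrow> ex (- m) A * ex m A = 1"
  using ex_add[of A m "- m"] ex_add[of A "- m" m] by auto
lemma pw_inv: "unip a \<Longrightarrow> pw m a * pw (- m) a = 1" "unip a \<Longrightarrow> pw (- m) a * pw m a = 1"
  by (auto simp: pw_def ex_inv)

lemma lg_inverse:
  assumes "unip a" "a * b = 1"
  shows "lg b = - lg a" "unip b"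
proof -
  have "ex (- 1) (lg a) * a = 1" using ex_inv(2)[of "lg a" 1] assms by simp
  then have "b = ex (- 1) (lg a) * (a * b)" by (simp flip: mult.assoc)
  then have b: "b = ex (- 1) (lg a)" by (simp add: assms(2))
  then show "unip b" using assms by simp
  show "lg b = - lg a" unfolding b using assms by (simp add: ex_minus[symmetric] Fil_minus)
qed

lemma lg_intertwine:
  assumes "unip a" "unip a'" "B * a = a' * B"
  shows "B * lg a = lg a' * B"
  unfolding lg_def by (rule ev1_intertwine) (use assms in \<open>auto simp: algebra_simps\<close>)

lemma pw_intertwine:
  assumes "unip a" "unip a'" "B * a = a' * B"
  shows "B * pw m a = pw m a' * B"
  unfolding pw_def ex_def by (rule ev1_intertwine) (use assms lg_intertwine in auto)

text \<open>The matrices of braids and of words are rational, whereas the coefficients of f and the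
  exponent m lie in the algebra; this extension of scalars brings both together. It commutes with
  exponential and logarithm because their coefficients are rational.\<close>

lift_definition qm :: "('i::finite, rat) tmat \<Rightarrow> ('i, 'k::qalg) tmat" is "\<lambda>M u v. qi (M u v)" by simp

lemma ent_qm [simp]: "ent (qm M) u v = qi (ent M u v)" by transfer simp
lemma qm_1 [simp]: "qm 1 = 1" by (rule tmat_eqI) (simp add: ent_1)
lemma qm_diff: "qm (A - B) = qm A - qm B" by (rule tmat_eqI) (simp add: qi_diff)
lemma qm_mult: "qm (A * B) = qm A * qm B"
  by (rule tmat_eqI) (simp add: ent_mult_self qi_sum qi_mult)
lemma qm_power: "qm (A ^ n) = qm A ^ n" by (induction n) (auto simp: qm_mult)
lemma qm_Fil [simp]: "A \<in> Fil n \<Longrightarrow> qm A \<in> Fil n" by (simp add: Fil_def)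
lemma qm_Fil1 [simp]: "unip a \<Longrightarrow> unip (qm a)"
  using qm_Fil[of "a - 1" 1] by (simp add: qm_diff)
lemma qm_ev1: "qm (ev1 F A) = ev1 (qfps F) (qm A)"
  by (rule tmat_eqI) (simp add: ev1.rep_eq qi_sum qi_mult qm_power[symmetric])
lemma qm_lg: "qm (lg a) = lg (qm a)"
  by (simp add: lg_def qm_ev1 lnf_def qm_diff)
lemma qm_ex1: "qm (ex 1 a) = ex 1 (qm a)"
  by (simp add: ex_def qm_ev1 expf_1)
lemma qm_wd: "qm (wd A w) = wd (\<lambda>j. qm (A j)) w"
  by (induction w) (auto simp: qm_mult)
lemma qm_Toep [simp]: "qm (Toep i) = Toep i" by (rule tmat_eqI) (simp add: ent_Toep)

declare in_lists_conv_set [simp del] in_listsD [rule del] in_listsI [rule del]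

section \<open>Homomorphisms from presented groups\<close>

definition gev :: "('g, 'm) monoid_scheme \<Rightarrow> ('a \<Rightarrow> 'g) \<Rightarrow> 'a gword \<Rightarrow> 'g" where
  "gev H m w = foldr (\<lambda>(s, b) g. (if b then m s else inv\<^bsub>H\<^esub> (m s)) \<otimes>\<^bsub>H\<^esub> g) w \<one>\<^bsub>H\<^esub>"

lemma gev_simps [simp]:
  "gev H m [] = \<one>\<^bsub>H\<^esub>"
  "gev H m ((s, b) # w) = (if b then m s else inv\<^bsub>H\<^esub> (m s)) \<otimes>\<^bsub>H\<^esub> gev H m w"
  by (auto simp: gev_def)

lemma (in group) gev_closed:
  "m \<in> S \<rightarrow> carrier G \<Longrightarrow> w \<in> lists (S \<times> UNIV) \<Longrightarrow> gev G m w \<in> carrier G"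
  by (induction w) (auto intro!: m_closed inv_closed)

lemma (in group) gev_append:
  "m \<in> S \<rightarrow> carrier G \<Longrightarrow> u \<in> lists (S \<times> UNIV) \<Longrightarrow> v \<in> lists (S \<times> UNIV) \<Longrightarrow>
   gev G m (u @ v) = gev G m u \<otimes> gev G m v"
proof (induction u)
  case (Cons a u)
  obtain s b where a: "a = (s, b)" by force
  then have "m s \<in> carrier G" using Cons by auto
  then show ?case using Cons gev_closed[OF Cons.prems(1)] by (simp add: a m_assoc)
qed (auto simp: gev_closed)

lemma pres_eq_lists:
  "pres_eq S R u v \<Longrightarrow> u \<in> lists (S \<times> UNIV) \<and> v \<in> lists (S \<times> UNIV)"
  by (induction rule: pres_eq.induct) auto

lemma (in group) gev_pres_eq:
  assumes m: "m \<in> S \<rightarrow> carrier G"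
    and R: "\<And>u v. (u, v) \<in> R \<Longrightarrow> gev G m u = gev G m v"
  shows "pres_eq S R u v \<Longrightarrow> gev G m u = gev G m v"
proof (induction rule: pres_eq.induct)
  case (pres_append u v u' v')
  then show ?case using pres_eq_lists[OF pres_append(1)] pres_eq_lists[OF pres_append(2)]
    by (simp add: gev_append[OF m])
next
  case (pres_cancel s b)
  then have "m s \<in> carrier G" using m by auto
  then show ?case by auto
qed (use R in auto)

definition cls :: "'a set \<Rightarrow> ('a gword \<times> 'a gword) set \<Rightarrow> 'a gword \<Rightarrow> 'a gword set" where
  "cls S R w = {v. pres_eq S R w v}"

lemma cls_eq: "pres_eq S R u v \<Longrightarrow> cls S R u = cls S R v"
  by (auto simp: cls_def intro: pres_trans pres_sym)

lemma cls_self: "w \<in> lists (S \<times> UNIV) \<Longrightarrow> w \<in> cls S R w"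
  by (auto simp: cls_def intro: pres_refl)

lemma carrier_presented: "carrier (presented_group S R) = cls S R ` lists (S \<times> UNIV)"
  by (auto simp: presented_group_def quotient_def cls_def)

lemma one_presented: "\<one>\<^bsub>presented_group S R\<^esub> = cls S R []"
  by (simp add: presented_group_def cls_def)

lemma mult_cls:
  assumes "u \<in> lists (S \<times> UNIV)" "v \<in> lists (S \<times> UNIV)"
  shows "cls S R u \<otimes>\<^bsub>presented_group S R\<^esub> cls S R v = cls S R (u @ v)"
proof (intro equalityI subsetI)
  fix w assume "w \<in> cls S R u \<otimes>\<^bsub>presented_group S R\<^esub> cls S R v"
  then show "w \<in> cls S R (u @ v)"
    by (auto simp: presented_group_def cls_def intro: pres_trans pres_append)
next
  fix w assume "w \<in> cls S R (u @ v)"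
  then show "w \<in> cls S R u \<otimes>\<^bsub>presented_group S R\<^esub> cls S R v"
    using cls_self[OF assms(1), of R] cls_self[OF assms(2), of R]
    by (auto simp: presented_group_def cls_def)
qed

lemma pres_gen_cls: "pres_gen S R s = cls S R [(s, True)]"
  by (simp add: pres_gen_def cls_def)

definition winv :: "'a gword \<Rightarrow> 'a gword" where "winv w = rev (map (\<lambda>(s, b). (s, \<not> b)) w)"

lemma winv_lists: "w \<in> lists (S \<times> UNIV) \<Longrightarrow> winv w \<in> lists (S \<times> UNIV)"
  by (induction w) (auto simp: winv_def)

lemma winv_cancel: "w \<in> lists (S \<times> UNIV) \<Longrightarrow> pres_eq S R (winv w @ w) []"
proof (induction w)
  case (Cons a w)
  obtain s b where a: "a = (s, b)" by force
  have s: "s \<in> S" and w: "w \<in> lists (S \<times> UNIV)" using Cons a by auto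
  have c: "pres_eq S R [(s, \<not> b), (s, b)] []"
    using pres_cancel[OF s, of R "\<not> b"] by simp
  have "pres_eq S R ([(s, \<not> b), (s, b)] @ w) ([] @ w)"
    by (rule pres_append[OF c pres_refl[OF w]])
  then have "pres_eq S R (winv w @ ([(s, \<not> b), (s, b)] @ w)) (winv w @ ([] @ w))"
    by (rule pres_append[OF pres_refl[OF winv_lists[OF w]]])
  then show ?case using Cons.IH[OF w] by (auto simp: winv_def a intro: pres_trans)
qed (simp add: winv_def pres_refl)

lemma group_presented: "group (presented_group S R)"
proof (rule groupI)
  fix x y z assume *: "x \<in> carrier (presented_group S R)" "y \<in> carrier (presented_group S R)"
    "z \<in> carrier (presented_group S R)"
  then obtain u v w where "x = cls S R u" "y = cls S R v" "z = cls S R w"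
    "u \<in> lists (S \<times> UNIV)" "v \<in> lists (S \<times> UNIV)" "w \<in> lists (S \<times> UNIV)"
    by (auto simp: carrier_presented)
  then show "x \<otimes>\<^bsub>presented_group S R\<^esub> y \<otimes>\<^bsub>presented_group S R\<^esub> z =
     x \<otimes>\<^bsub>presented_group S R\<^esub> (y \<otimes>\<^bsub>presented_group S R\<^esub> z)"
    by (simp add: mult_cls)
next
  fix x assume "x \<in> carrier (presented_group S R)"
  then obtain u where u: "x = cls S R u" "u \<in> lists (S \<times> UNIV)" by (auto simp: carrier_presented)
  then show "\<exists>y\<in>carrier (presented_group S R). y \<otimes>\<^bsub>presented_group S R\<^esub> x = \<one>\<^bsub>presented_group S R\<^esub>"
    by (intro bexI[of _ "cls S R (winv u)"])
       (auto simp: mult_cls winv_lists one_presented carrier_presented intro!: cls_eq winv_cancel)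
qed (auto simp: carrier_presented one_presented mult_cls intro!: imageI)

lemma cls_in_carrier: "w \<in> lists (S \<times> UNIV) \<Longrightarrow> cls S R w \<in> carrier (presented_group S R)"
  by (auto simp: carrier_presented)

lemma pres_gen_carrier: "s \<in> S \<Longrightarrow> pres_gen S R s \<in> carrier (presented_group S R)"
  by (auto simp: pres_gen_cls intro: cls_in_carrier)

lemma inv_cls:
  assumes "w \<in> lists (S \<times> UNIV)"
  shows "inv\<^bsub>presented_group S R\<^esub> (cls S R w) = cls S R (winv w)"
proof -
  interpret group "presented_group S R" by (rule group_presented)
  show ?thesis
    by (rule inv_equality)
       (auto simp: mult_cls winv_lists one_presented carrier_presented assms intro!: cls_eq winv_cancel)
qed

lemma cls_gev:
  assumes "w \<in> lists (S \<times> UNIV)"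
  shows "cls S R w = gev (presented_group S R) (pres_gen S R) w"
  using assms
proof (induction w)
  case (Cons a w)
  obtain s b where a: "a = (s, b)" by force
  have s: "s \<in> S" and w: "w \<in> lists (S \<times> UNIV)" using Cons a by auto
  have "cls S R [(s, b)] = (if b then pres_gen S R s else inv\<^bsub>presented_group S R\<^esub> (pres_gen S R s))"
    using s by (simp add: pres_gen_cls inv_cls winv_def)
  moreover have "cls S R (a # w) = cls S R [(s, b)] \<otimes>\<^bsub>presented_group S R\<^esub> cls S R w"
    using s w by (subst mult_cls) (auto simp: a)
  ultimately show ?case using Cons.IH w by (simp add: a)
qed (simp add: one_presented)

text \<open>The class is evaluated at an arbitrarily chosen representative. In
  \<open>pres_hom\<close> the relations hold in the target, which makes the value independent of the
  choice and yields the universal property of the presentation.\<close>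

definition plift :: "('g, 'm) monoid_scheme \<Rightarrow> ('a \<Rightarrow> 'g) \<Rightarrow> 'a gword set \<Rightarrow> 'g" where
  "plift H m A = gev H m (SOME w. w \<in> A)"

locale pres_hom = group H for S R and H (structure) and m +
  assumes m: "m \<in> S \<rightarrow> carrier H"
    and R: "\<And>u v. (u, v) \<in> R \<Longrightarrow> gev H m u = gev H m v"
begin

lemma plift_cls: "w \<in> lists (S \<times> UNIV) \<Longrightarrow> plift H m (cls S R w) = gev H m w"
proof -
  assume w: "w \<in> lists (S \<times> UNIV)"
  have "(SOME v. v \<in> cls S R w) \<in> cls S R w" by (rule someI[of _ w]) (rule cls_self[OF w])
  then show ?thesis
    unfolding plift_def by (intro gev_pres_eq[OF m R, symmetric]) (auto simp: cls_def)
qed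

lemma plift_hom: "plift H m \<in> hom (presented_group S R) H"
  by (rule homI) (auto simp: carrier_presented plift_cls gev_closed[OF m] mult_cls gev_append[OF m])

lemma plift_gen: "s \<in> S \<Longrightarrow> plift H m (pres_gen S R s) = m s"
  unfolding pres_gen_cls using m by (subst plift_cls) (auto simp: Pi_iff)

end

lemma hom_gev:
  assumes "group G" "group H" "h \<in> hom G H" "m \<in> S \<rightarrow> carrier G" "w \<in> lists (S \<times> UNIV)"
  shows "h (gev G m w) = gev H (\<lambda>s. h (m s)) w"
proof -
  interpret group_hom G H h using assms by (simp add: group_hom_def group_hom_axioms_def)
  show ?thesis using assms(5)
  proof (induction w)
    case (Cons a w)
    obtain s b where a: "a = (s, b)" by force
    then have "m s \<in> carrier G" using Cons assms(4) by auto
    then show ?case using Cons G.gev_closed[OF assms(4)] by (auto simp: a)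
  qed simp
qed

lemma pres_hom_unique:
  assumes "group H" "h \<in> hom (presented_group S R) H" "h' \<in> hom (presented_group S R) H"
    "\<And>s. s \<in> S \<Longrightarrow> h (pres_gen S R s) = h' (pres_gen S R s)" "x \<in> carrier (presented_group S R)"
  shows "h x = h' x"
proof -
  obtain w where w: "x = cls S R w" "w \<in> lists (S \<times> UNIV)" using assms(5) by (auto simp: carrier_presented)
  have "gev H (\<lambda>s. h (pres_gen S R s)) w = gev H (\<lambda>s. h' (pres_gen S R s)) w"
    using w(2) assms(4) by (induction w) auto
  moreover have "pres_gen S R \<in> S \<rightarrow> carrier (presented_group S R)" by (auto simp: pres_gen_carrier)
  ultimately show ?thesis
    unfolding w(1) cls_gev[OF w(2)]
    using hom_gev[OF group_presented assms(1) assms(2) _ w(2)] hom_gev[OF group_presented assms(1) assms(3) _ w(2)]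
    by metis
qed

section \<open>The free group on two generators and the evaluation g(a, b) of its elements\<close>

abbreviation F2_mult (infixl "\<star>" 70) where "g \<star> h \<equiv> g \<otimes>\<^bsub>F2\<^esub> h"
abbreviation F2_inv ("iv _" [81] 80) where "iv g \<equiv> inv\<^bsub>F2\<^esub> g"

lemma group_F2: "group F2" by (simp add: F2_def group_presented)

definition F2hom :: "('g, 'm) monoid_scheme \<Rightarrow> 'g \<Rightarrow> 'g \<Rightarrow> letter gword set \<Rightarrow> 'g" where
  "F2hom H a b = plift H (case_letter a b)"

lemma F2_pres_hom: "group H \<Longrightarrow> a \<in> carrier H \<Longrightarrow> b \<in> carrier H \<Longrightarrow> pres_hom UNIV {} H (case_letter a b)"
  by (auto simp: pres_hom_def pres_hom_axioms_def split: letter.splits)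

lemma F2_x_carrier [simp]: "F2_x \<in> carrier F2" and F2_y_carrier [simp]: "F2_y \<in> carrier F2"
  by (auto simp: F2_def F2_x_def F2_y_def intro: pres_gen_carrier)

lemma F2hom:
  assumes "group H" "a \<in> carrier H" "b \<in> carrier H"
  shows "F2hom H a b \<in> hom F2 H" "F2hom H a b F2_x = a" "F2hom H a b F2_y = b"
proof -
  interpret pres_hom UNIV "{}" H "case_letter a b" by (rule F2_pres_hom[OF assms])
  show "F2hom H a b \<in> hom F2 H" "F2hom H a b F2_x = a" "F2hom H a b F2_y = b"
    using plift_hom plift_gen by (auto simp: F2hom_def F2_def F2_x_def F2_y_def)
qed

lemma F2hom_closed: "group H \<Longrightarrow> a \<in> carrier H \<Longrightarrow> b \<in> carrier H \<Longrightarrow> g \<in> carrier F2 \<Longrightarrow> F2hom H a b g \<in> carrier H"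
  using F2hom(1)[of H a b] by (auto simp: hom_def)

lemma F2_hom_eq:
  assumes "group H" "h \<in> hom F2 H" "h' \<in> hom F2 H" "h F2_x = h' F2_x" "h F2_y = h' F2_y" "g \<in> carrier F2"
  shows "h g = h' g"
  unfolding F2_def
proof (rule pres_hom_unique[OF assms(1)])
  show "h (pres_gen UNIV {} s) = h' (pres_gen UNIV {} s)" for s
    using assms(4,5) by (cases s) (auto simp: F2_x_def F2_y_def)
qed (use assms in \<open>auto simp: F2_def\<close>)

lemma F2_induct [consumes 1, case_names one x y xi yi]:
  assumes g: "g \<in> carrier F2" and "P \<one>\<^bsub>F2\<^esub>"
    and "\<And>g. g \<in> carrier F2 \<Longrightarrow> P g \<Longrightarrow> P (F2_x \<star> g)" "\<And>g. g \<in> carrier F2 \<Longrightarrow> P g \<Longrightarrow> P (F2_y \<star> g)"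
    "\<And>g. g \<in> carrier F2 \<Longrightarrow> P g \<Longrightarrow> P (iv F2_x \<star> g)"
    "\<And>g. g \<in> carrier F2 \<Longrightarrow> P g \<Longrightarrow> P (iv F2_y \<star> g)"
  shows "P g"
proof -
  have "gev F2 (pres_gen UNIV {}) w \<in> carrier F2 \<and> P (gev F2 (pres_gen UNIV {}) w)" for w
  proof (induction w)
    case Nil
    then show ?case using assms(2) group.is_monoid[OF group_F2] by (simp add: monoid.one_closed)
  next
    case (Cons a w)
    obtain s b where a: "a = (s, b)" by force
    interpret group F2 by (rule group_F2)
    show ?case using Cons assms(3-6) F2_x_carrier F2_y_carrier unfolding a
      by (cases s) (auto simp: F2_x_def F2_y_def)
  qed
  moreover obtain w where "g = cls UNIV {} w" using g by (auto simp: F2_def carrier_presented)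
  then have "g = gev F2 (pres_gen UNIV {}) w" by (simp add: cls_gev F2_def)
  ultimately show ?thesis by simp
qed

lemma F2hom_comp:
  assumes "group G" "group H" "h \<in> hom G H" "a \<in> carrier G" "b \<in> carrier G" "g \<in> carrier F2"
  shows "h (F2hom G a b g) = F2hom H (h a) (h b) g"
proof -
  have *: "h a \<in> carrier H" "h b \<in> carrier H" using assms by (auto simp: hom_def)
  have "(h \<circ> F2hom G a b) g = F2hom H (h a) (h b) g"
    by (rule F2_hom_eq[OF assms(2)])
       (use assms(3,6) F2hom[OF assms(1,4,5)] F2hom[OF assms(2) *] in \<open>auto simp: hom_def o_def Pi_iff\<close>)
  then show ?thesis by simp
qed

text \<open>Words of the free group and of the braid group are evaluated at matrices. As the target
  of a homomorphism of carrier-based groups the ring has to appear through its group of units;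
  \<open>ui\<close> is the inverse in it, written as an operation of the ring.\<close>

definition Ugr :: "'a::ring_1 monoid" where
  "Ugr = \<lparr>carrier = {a. \<exists>b. a * b = 1 \<and> b * a = 1}, monoid.mult = (*), one = 1\<rparr>"

lemma Ugr_simps [simp]: "\<one>\<^bsub>Ugr\<^esub> = 1" "a \<otimes>\<^bsub>Ugr\<^esub> b = a * b"
  "a \<in> carrier Ugr \<longleftrightarrow> (\<exists>b. a * b = 1 \<and> b * a = 1)"
  by (auto simp: Ugr_def)

lemma group_Ugr: "group (Ugr :: 'a::ring_1 monoid)"
proof (rule groupI)
  fix x y :: 'a assume "x \<in> carrier Ugr" "y \<in> carrier Ugr"
  then obtain x' y' where *: "x * x' = 1" "x' * x = 1" "y * y' = 1" "y' * y = 1" by auto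
  have "x * y * (y' * x') = x * (y * y') * x'" "y' * x' * (x * y) = y' * (x' * x) * y"
    by (simp_all only: mult.assoc)
  then show "x \<otimes>\<^bsub>Ugr\<^esub> y \<in> carrier Ugr" using * by auto
next
  fix x :: 'a assume "x \<in> carrier Ugr"
  then obtain b where "x * b = 1" "b * x = 1" by auto
  then show "\<exists>y\<in>carrier Ugr. y \<otimes>\<^bsub>Ugr\<^esub> x = \<one>\<^bsub>Ugr\<^esub>"
    by (intro bexI[of _ b]) auto
qed (auto simp: mult.assoc)

lemma Ugr_inv: "a * b = 1 \<Longrightarrow> b * a = 1 \<Longrightarrow> inv\<^bsub>Ugr\<^esub> a = (b :: 'a::ring_1)"
  by (rule group.inv_equality[OF group_Ugr]) auto

definition ui :: "'a::ring_1 \<Rightarrow> 'a" where "ui a = inv\<^bsub>Ugr\<^esub> a"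

lemma ui: "a \<in> carrier Ugr \<Longrightarrow> a * ui a = 1" "a \<in> carrier Ugr \<Longrightarrow> ui a * a = 1"
  using group.r_inv[OF group_Ugr, of a] group.l_inv[OF group_Ugr, of a] by (auto simp: ui_def)

lemma Fil1_unit: "unip a \<Longrightarrow> (a :: ('i::finite, 'k::qalg) tmat) \<in> carrier Ugr"
  using ex_inv[of "lg a" 1] by auto

section \<open>The Artin representation\<close>

text \<open>The column of a word i_1 ... i_k is S i_1 ... S i_k applied to the empty word. If the
  \<open>S i\<close> are left multiplications by series, this is the matrix of the algebra
  endomorphism that substitutes these series for the letters, and \<open>Msub_Toep\<close> expresses
  its multiplicativity.\<close>

fun msub :: "('i \<Rightarrow> ('i::finite, 'k::comm_ring_1) tmat) \<Rightarrow> 'i list \<Rightarrow> 'i list \<Rightarrow> 'k" where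
  "msub S [] u = (if u = [] then 1 else 0)"
| "msub S (i # v) u = (\<Sum>w\<in>lw (length u). ent (S i) u w * msub S v w)"

lift_definition Msub :: "('i \<Rightarrow> ('i::finite, 'k::comm_ring_1) tmat) \<Rightarrow> ('i, 'k) tmat"
  is "\<lambda>S u v. if length u < length v then 0 else msub S v u"
  by simp

lemma msub_low:
  assumes S: "\<And>i. S i \<in> Fil 1" shows "length u < length v \<Longrightarrow> msub S v u = 0"
proof (induction v arbitrary: u)
  case (Cons i v)
  have "ent (S i) u w * msub S v w = 0" for w
    using FilD[OF S, of u w i] Cons by (cases "length w < length v") auto
  then show ?case by simp
qed simp

lemma ent_Msub: "(\<And>i. S i \<in> Fil 1) \<Longrightarrow> ent (Msub S) u v = msub S v u"
  by (auto simp: Msub.rep_eq msub_low)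

lemma Msub_Toep: "(\<And>i. S i \<in> Fil 1) \<Longrightarrow> Msub S * Toep i = S i * Msub S"
  by (rule tmat_eqI, unfold ent_mult_Toep) (simp add: ent_mult_self ent_Msub)

text \<open>A unital endomorphism fixes the empty word, and the empty word generates all words under
  the operators \<open>Toep i\<close>. An intertwiner normalised in this way is therefore unique,
  and identities between substitutions need only be compared on letters.\<close>

definition vac :: "('i::finite, 'k::comm_ring_1) tmat \<Rightarrow> bool" where
  "vac M \<longleftrightarrow> (\<forall>u. ent M u [] = (if u = [] then 1 else 0))"

lemma vac_Msub: "(\<And>i. S i \<in> Fil 1) \<Longrightarrow> vac (Msub S)"
  by (simp add: vac_def ent_Msub)

lemma vac_1: "vac 1" by (simp add: vac_def ent_1)

lemma vac_mult: "vac M \<Longrightarrow> vac N \<Longrightarrow> vac (M * N)"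
  by (simp add: vac_def ent_mult_self if_distrib[of "\<lambda>x. _ * x"] cong: if_cong)

lemma intertwiner_unique:
  assumes "vac M" "vac N" "\<And>i. M * Toep i = S i * M" "\<And>i. N * Toep i = S i * N"
  shows "M = N"
proof (rule tmat_eqI)
  have "ent M u v = ent N u v" for u v
  proof (induction v arbitrary: u)
    case Nil
    then show ?case using assms(1,2) by (simp add: vac_def)
  next
    case (Cons i v)
    have "ent M u (i # v) = ent (S i * M) u v" using assms(3) by (simp flip: ent_mult_Toep)
    also have "\<dots> = ent (S i * N) u v" by (simp add: ent_mult_self Cons)
    also have "\<dots> = ent N u (i # v)" using assms(4) by (simp flip: ent_mult_Toep)
    finally show ?case .
  qed
  then show "ent M u v = ent N u v" for u v .
qed

definition itw :: "'a::ring_1 \<Rightarrow> 'a \<Rightarrow> 'a \<Rightarrow> bool" where "itw M a b \<longleftrightarrow> M * a = b * M"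

lemma itw_mult: "itw M a b \<Longrightarrow> itw M a' b' \<Longrightarrow> itw M (a * a') (b * b')"
  unfolding itw_def by (metis mult.assoc)
lemma itw_comp: "itw M b c \<Longrightarrow> itw N a b \<Longrightarrow> itw (M * N) a c"
  unfolding itw_def by (metis mult.assoc)
lemma itw_inverse:
  assumes "itw M a b" "a * a' = 1" "b' * b = 1"
  shows "itw M a' b'"
proof -
  have "b' * (M * a) * a' = b' * (b * M) * a'" using assms(1) by (simp add: itw_def)
  moreover have "b' * (M * a) * a' = b' * M * (a * a')" "b' * (b * M) * a' = (b' * b) * (M * a')"
    by (simp_all only: mult.assoc)
  ultimately show ?thesis using assms(2,3) by (simp add: itw_def)
qed
lemma itw_diff1: "itw M a b \<longleftrightarrow> itw M (a - 1) (b - 1)"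
  by (simp add: itw_def algebra_simps)

text \<open>The Magnus embedding of the free group, 1 + letter instead of the exponential of the
  letter. It keeps the matrices of braids integral, on which the l-adic continuity of their entries
  will rest.\<close>

definition Yt :: "'i \<Rightarrow> ('i::finite, rat) tmat" where "Yt i = 1 + Toep i"

lemma Yt_Fil [simp]: "unip (Yt i)" by (simp add: Yt_def)
lemma Yt_unit [simp]: "Yt i \<in> carrier Ugr" by (rule Fil1_unit) simp
lemma Yt_inv [simp]: "Yt i * ui (Yt i) = 1" "ui (Yt i) * Yt i = 1"
  by (rule ui, rule Yt_unit)+
lemma Yt_inv_assoc [simp]: "Yt i * (ui (Yt i) * b) = b" "ui (Yt i) * (Yt i * b) = b"
  by (simp_all flip: mult.assoc)

lemma Fil1_mult: "unip a \<Longrightarrow> unip b \<Longrightarrow> unip (a * b)"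
proof -
  assume *: "unip a" "unip b"
  have "(a - 1) * b + (b - 1) \<in> Fil 1" using * by (intro Fil_add Fil_multR)
  then show ?thesis by (simp add: algebra_simps)
qed

lemma Fil1_ui: "unip a \<Longrightarrow> unip (ui (a :: ('i::finite, 'k::qalg) tmat))"
  using lg_inverse(2)[of a "ui a"] ui(1)[OF Fil1_unit] by blast

text \<open>Artin's automorphism y_a -> y_a y_b y_a^-1, y_b -> y_a of the free group, and next to it
  its inverse y_a -> y_b, y_b -> y_b^-1 y_a y_b. The strands are arbitrary distinct letters, so that
  one computation serves all generators.\<close>

definition Ssub :: "'i \<Rightarrow> 'i \<Rightarrow> 'i \<Rightarrow> ('i::finite, rat) tmat" where
  "Ssub a b i = (if i = a then Yt a * Yt b * ui (Yt a) else if i = b then Yt a else Yt i)"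
definition Ssub' :: "'i \<Rightarrow> 'i \<Rightarrow> 'i \<Rightarrow> ('i::finite, rat) tmat" where
  "Ssub' a b i = (if i = a then Yt b else if i = b then ui (Yt b) * Yt a * Yt b else Yt i)"
definition Ms :: "'i \<Rightarrow> 'i \<Rightarrow> ('i::finite, rat) tmat" where "Ms a b = Msub (\<lambda>i. Ssub a b i - 1)"
definition Ms' :: "'i \<Rightarrow> 'i \<Rightarrow> ('i::finite, rat) tmat" where "Ms' a b = Msub (\<lambda>i. Ssub' a b i - 1)"

lemma Ssub_Fil: "unip (Ssub a b i)" "unip (Ssub' a b i)"
  by (auto simp: Ssub_def Ssub'_def intro!: Fil1_mult Fil1_ui)

lemma vac_Ms [simp]: "vac (Ms a b)" "vac (Ms' a b)"
  by (simp_all add: Ms_def Ms'_def vac_Msub Ssub_Fil)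

lemma itw_Yt: "itw M (Yt i) s \<longleftrightarrow> M * Toep i = (s - 1) * M"
  by (subst itw_diff1) (simp add: itw_def Yt_def)

lemma itw_Ms: "itw (Ms a b) (Yt i) (Ssub a b i)" "itw (Ms' a b) (Yt i) (Ssub' a b i)"
  by (auto simp: itw_Yt Ms_def Ms'_def Msub_Toep Ssub_Fil)

lemma itw_Ms_inv: "itw (Ms a b) (ui (Yt i)) (ui (Ssub a b i))" (is ?P) "itw (Ms' a b) (ui (Yt i)) (ui (Ssub' a b i))" (is ?Q)
proof -
  show ?P
    by (rule itw_inverse[OF itw_Ms(1) Yt_inv(1) ui(2)[OF Fil1_unit[OF Ssub_Fil(1)]]])
  show ?Q
    by (rule itw_inverse[OF itw_Ms(2) Yt_inv(1) ui(2)[OF Fil1_unit[OF Ssub_Fil(2)]]])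
qed

lemma Ms_cases:
  assumes "a \<noteq> b"
  shows "itw (Ms a b) (Yt a) (Yt a * Yt b * ui (Yt a))" "itw (Ms a b) (Yt b) (Yt a)"
    "itw (Ms a b) (ui (Yt b)) (ui (Yt a))"
    "itw (Ms' a b) (Yt a) (Yt b)" "itw (Ms' a b) (Yt b) (ui (Yt b) * Yt a * Yt b)"
    "itw (Ms' a b) (ui (Yt a)) (ui (Yt b))"
    "i \<noteq> a \<Longrightarrow> i \<noteq> b \<Longrightarrow> itw (Ms a b) (Yt i) (Yt i)"
    "i \<noteq> a \<Longrightarrow> i \<noteq> b \<Longrightarrow> itw (Ms' a b) (Yt i) (Yt i)"
    "i \<noteq> a \<Longrightarrow> i \<noteq> b \<Longrightarrow> itw (Ms a b) (ui (Yt i)) (ui (Yt i))"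
  using itw_Ms(1)[of a b a] itw_Ms(1)[of a b b] itw_Ms(2)[of a b a] itw_Ms(2)[of a b b]
    itw_Ms(1)[of a b i] itw_Ms(2)[of a b i] itw_Ms_inv(1)[of a b b] itw_Ms_inv(1)[of a b i]
    itw_Ms_inv(2)[of a b a] assms
  by (simp_all add: Ssub_def Ssub'_def)

lemma Ms_unique:
  assumes "vac M" "vac N" "\<And>i. itw M (Yt i) (s i)" "\<And>i. itw N (Yt i) (s i)"
  shows "M = N"
  by (rule intertwiner_unique[of M N "\<lambda>i. s i - 1"]) (use assms in \<open>auto simp: itw_Yt\<close>)

lemma Ms_Ms' [simp]: assumes "a \<noteq> b" shows "Ms a b * Ms' a b = 1" "Ms' a b * Ms a b = 1"
proof -
  note c = Ms_cases[OF assms]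
  have 1: "itw 1 (Yt i) (Yt i)" for i :: 'a by (simp add: itw_def)
  have "itw (Ms a b * Ms' a b) (Yt i) (Yt i)" for i
  proof -
    consider "i = a" | "i = b" | "i \<noteq> a" "i \<noteq> b" by blast
    then show ?thesis
    proof cases
      case 1
      then show ?thesis using itw_comp[OF c(2) c(4)] by simp
    next
      case 2
      then show ?thesis
        using itw_comp[OF itw_mult[OF itw_mult[OF c(3) c(1)] c(2)] c(5)] by (simp add: mult.assoc)
    qed (use itw_comp[OF c(7) c(8)] in auto)
  qed
  then show "Ms a b * Ms' a b = 1"
    by (intro Ms_unique[of _ 1 Yt] vac_mult vac_1 1 vac_Ms)
  have "itw (Ms' a b * Ms a b) (Yt i) (Yt i)" for i
  proof -
    consider "i = a" | "i = b" | "i \<noteq> a" "i \<noteq> b" by blast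
    then show ?thesis
    proof cases
      case 1
      then show ?thesis
        using itw_comp[OF itw_mult[OF itw_mult[OF c(4) c(5)] c(6)] c(1)] by (simp add: mult.assoc)
    next
      case 2
      then show ?thesis using itw_comp[OF c(4) c(2)] by simp
    qed (use itw_comp[OF c(8) c(7)] in auto)
  qed
  then show "Ms' a b * Ms a b = 1"
    by (intro Ms_unique[of _ 1 Yt] vac_mult vac_1 1 vac_Ms)
qed

text \<open>By uniqueness of intertwiners it suffices to compare images of generators. Both sides
  send y_a to y_a y_b y_c y_b^-1 y_a^-1, y_b to y_a y_b y_a^-1 and y_c to y_a; this common value is
  \<open>?s\<close>.\<close>

lemma Ms_braid:
  assumes "distinct [a, b, c]"
  shows "Ms a b * Ms b c * Ms a b = Ms b c * Ms a b * Ms b c"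
proof -
  have ab: "a \<noteq> b" and bc: "b \<noteq> c" and ac: "a \<noteq> c" using assms by auto
  note p = Ms_cases[OF ab] and q = Ms_cases[OF bc]
  let ?s = "\<lambda>i. if i = a then Yt a * Yt b * Yt c * ui (Yt b) * ui (Yt a)
     else if i = b then Yt a * Yt b * ui (Yt a) else if i = c then Yt a else Yt i"
  have qa: "itw (Ms b c) (Yt a) (Yt a)" "itw (Ms b c) (ui (Yt a)) (ui (Yt a))"
    and pc: "itw (Ms a b) (Yt c) (Yt c)"
    using p(7)[of c] q(7)[of a] q(9)[of a] ab bc ac by auto
  have pai: "itw (Ms a b) (ui (Yt a)) (Yt a * ui (Yt b) * ui (Yt a))"
    by (rule itw_inverse[OF p(1)]) (simp_all add: mult.assoc)
  have "itw (Ms a b * Ms b c * Ms a b) (Yt i) (?s i)" for i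
  proof -
    consider "i = a" | "i = b" | "i = c" | "i \<noteq> a" "i \<noteq> b" "i \<noteq> c" by blast
    then show ?thesis
    proof cases
      case 1
      have "itw (Ms b c * Ms a b) (Yt a) (Yt a * (Yt b * Yt c * ui (Yt b)) * ui (Yt a))"
        by (rule itw_comp[OF itw_mult[OF itw_mult[OF qa(1) q(1)] qa(2)] p(1)])
      moreover have "itw (Ms a b) (Yt a * (Yt b * Yt c * ui (Yt b)) * ui (Yt a))
        ((Yt a * Yt b * ui (Yt a)) * (Yt a * Yt c * ui (Yt a)) * (Yt a * ui (Yt b) * ui (Yt a)))"
        by (intro itw_mult p(1) p(2) p(3) pc pai)
      ultimately show ?thesis using itw_comp[of "Ms a b" _ _ "Ms b c * Ms a b"] 1
        by (simp add: mult.assoc)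
    next
      case 2
      have "itw (Ms b c * Ms a b) (Yt b) (Yt a)" by (rule itw_comp[OF qa(1) p(2)])
      from itw_comp[OF p(1) this] show ?thesis using 2 ab by (simp add: mult.assoc)
    next
      case 3
      have "itw (Ms b c * Ms a b) (Yt c) (Yt b)" by (rule itw_comp[OF q(2) pc])
      from itw_comp[OF p(2) this] show ?thesis using 3 ac bc by (simp add: mult.assoc)
    next
      case 4
      then show ?thesis using itw_comp[OF itw_comp[OF p(7) q(7)] p(7)] by auto
    qed
  qed
  moreover have "itw (Ms b c * Ms a b * Ms b c) (Yt i) (?s i)" for i
  proof -
    consider "i = a" | "i = b" | "i = c" | "i \<noteq> a" "i \<noteq> b" "i \<noteq> c" by blast
    then show ?thesis
    proof cases
      case 1
      have "itw (Ms a b * Ms b c) (Yt a) (Yt a * Yt b * ui (Yt a))" by (rule itw_comp[OF p(1) qa(1)])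
      from itw_comp[OF itw_mult[OF itw_mult[OF qa(1) q(1)] qa(2)] this]
      show ?thesis using 1 by (simp add: mult.assoc)
    next
      case 2
      have "itw (Ms a b * Ms b c) (Yt b) (Yt a * Yt c * ui (Yt a))"
        by (rule itw_comp[OF itw_mult[OF itw_mult[OF p(2) pc] p(3)] q(1)])
      from itw_comp[OF itw_mult[OF itw_mult[OF qa(1) q(2)] qa(2)] this]
      show ?thesis using 2 ab by (simp add: mult.assoc)
    next
      case 3
      from itw_comp[OF qa(1) itw_comp[OF p(2) q(2)]]
      show ?thesis using 3 ac bc by (simp add: mult.assoc)
    next
      case 4
      then show ?thesis using itw_comp[OF itw_comp[OF q(7) p(7)] q(7)] by auto
    qed
  qed
  ultimately show ?thesis by (intro Ms_unique[of _ _ ?s] vac_mult vac_Ms)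
qed

lemma Ms_commute:
  assumes "distinct [a, b, c, d]"
  shows "Ms a b * Ms c d = Ms c d * Ms a b"
proof -
  have ab: "a \<noteq> b" and cd: "c \<noteq> d" using assms by auto
  note p = Ms_cases[OF ab] and q = Ms_cases[OF cd]
  let ?s = "\<lambda>i. if i = a then Yt a * Yt b * ui (Yt a) else if i = b then Yt a
     else if i = c then Yt c * Yt d * ui (Yt c) else if i = d then Yt c else Yt i"
  have P: "i = a \<or> i = b \<Longrightarrow> itw (Ms c d) (Yt i) (Yt i) \<and> itw (Ms c d) (ui (Yt i)) (ui (Yt i))"
   and Q: "i = c \<or> i = d \<Longrightarrow> itw (Ms a b) (Yt i) (Yt i) \<and> itw (Ms a b) (ui (Yt i)) (ui (Yt i))" for i
    using p(7,9)[of i] q(7,9)[of i] assms by auto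
  have "itw (Ms a b * Ms c d) (Yt i) (?s i) \<and> itw (Ms c d * Ms a b) (Yt i) (?s i)" for i
  proof -
    consider "i = a" | "i = b" | "i = c" | "i = d" | "i \<notin> {a, b, c, d}" by blast
    then show ?thesis
    proof cases
      case 1
      then show ?thesis using itw_comp[OF p(1) P[of a, THEN conjunct1]]
          itw_comp[OF itw_mult[OF itw_mult[OF P[of a, THEN conjunct1] P[of b, THEN conjunct1]] P[of a, THEN conjunct2]] p(1)]
        by simp
    next
      case 2
      then show ?thesis using itw_comp[OF p(2) P[of b, THEN conjunct1]]
          itw_comp[OF P[of a, THEN conjunct1] p(2)] ab by simp
    next
      case 3
      then show ?thesis using itw_comp[OF q(1) Q[of c, THEN conjunct1]]
          itw_comp[OF itw_mult[OF itw_mult[OF Q[of c, THEN conjunct1] Q[of d, THEN conjunct1]] Q[of c, THEN conjunct2]] q(1)]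
          assms by auto
    next
      case 4
      then show ?thesis using itw_comp[OF q(2) Q[of d, THEN conjunct1]]
          itw_comp[OF Q[of c, THEN conjunct1] q(2)] assms by auto
    next
      case 5
      then show ?thesis using itw_comp[OF q(7) p(7)] itw_comp[OF p(7) q(7)] by auto
    qed
  qed
  then show ?thesis by (intro Ms_unique[of _ _ ?s] vac_mult vac_Ms) auto
qed

section \<open>Leading terms\<close>

lemma lead_mult:
  assumes "A \<in> Fil p" "B \<in> Fil q" "length u = length v + p + q"
  shows "ent (A * B) u v = (\<Sum>w | length w = length v + q. ent A u w * ent B w v)"
  unfolding ent_mult_self
proof (rule sum.mono_neutral_right)
  have "ent A u w * ent B w v = 0" if "length w \<noteq> length v + q" for w
    using that assms FilD[OF assms(1), of u w] FilD[OF assms(2), of w v]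
    by (cases "length w < length v + q") auto
  then show "\<forall>w\<in>lw (length u) - {w. length w = length v + q}. ent A u w * ent B w v = 0" by auto
qed (use assms in auto)

lemma finite_len [simp]: "finite {w :: 'i::finite list. length w = n}"
  by (rule finite_subset[OF _ finite_lw[of n]]) auto

text \<open>The degree-preserving part of the matrix of a braid is its permutation of the strands.
  By \<open>deg0_id\<close> a matrix is unipotent exactly if this part is the identity, which is how
  pure braids are recognised.\<close>

definition deg0 :: "('i::finite, 'k::comm_ring_1) tmat \<Rightarrow> ('i \<Rightarrow> 'i) \<Rightarrow> bool" where
  "deg0 M \<pi> \<longleftrightarrow> (\<forall>u v. length u = length v \<longrightarrow> ent M u v = (if u = map \<pi> v then 1 else 0))"

lemma deg0_1: "deg0 1 id" by (auto simp: deg0_def ent_1)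

lemma deg0_id: "deg0 a id \<longleftrightarrow> unip a"
proof
  assume "deg0 a id"
  then show "unip a"
    by (intro FilI) (auto simp: deg0_def ent_1 less_Suc_eq One_nat_def)
next
  assume "unip a"
  then show "deg0 a id"
    using FilD[of "a - 1" 1] by (force simp: deg0_def ent_1)
qed

lemma deg0_mult: "deg0 M \<pi> \<Longrightarrow> deg0 N \<rho> \<Longrightarrow> deg0 (M * N) (\<pi> \<circ> \<rho>)"
  unfolding deg0_def
proof (intro allI impI)
  fix u v :: "'a list"
  assume M: "\<forall>u v. length u = length v \<longrightarrow> ent M u v = (if u = map \<pi> v then 1 else 0)"
    and N: "\<forall>u v. length u = length v \<longrightarrow> ent N u v = (if u = map \<rho> v then 1 else 0)"
    and l: "length u = length v"
  have "ent (M * N) u v = (\<Sum>w | length w = length v. ent M u w * ent N w v)"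
    using lead_mult[of M 0 N 0 u v] l by simp
  also have "\<dots> = (\<Sum>w | length w = length v. if w = map \<rho> v then ent M u w else 0)"
    using N by (intro sum.cong) auto
  also have "\<dots> = ent M u (map \<rho> v)" by (simp add: sum.delta')
  finally show "ent (M * N) u v = (if u = map (\<pi> \<circ> \<rho>) v then 1 else 0)"
    using M l by simp
qed

lemma deg0_itw:
  assumes M: "vac M" "\<And>i. M * Toep i = S i * M" and S: "\<And>i. S i - Toep (\<pi> i) \<in> Fil 2"
  shows "deg0 M \<pi>"
proof -
  have "length u = length v \<Longrightarrow> ent M u v = (if u = map \<pi> v then 1 else 0)" for u v
  proof (induction v arbitrary: u)
    case (Cons i v)
    obtain c u' where u: "u = c # u'" using Cons by (cases u) auto
    have "ent M u (i # v) = ent (Toep (\<pi> i) * M) u v + ent ((S i - Toep (\<pi> i)) * M) u v"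
      unfolding ent_add[symmetric] distrib_right[symmetric] using M(2) by (simp flip: ent_mult_Toep)
    also have "ent ((S i - Toep (\<pi> i)) * M) u v = 0"
      by (rule FilD[OF Fil_multR[OF S]]) (use Cons in auto)
    finally show ?case using Cons by (auto simp: u ent_Toep_mult)
  qed (use M in \<open>simp add: vac_def\<close>)
  then show ?thesis by (simp add: deg0_def)
qed

text \<open>The Leibniz rule for the degree-one part of a unipotent substitution: on
  \<open>i # v\<close> it either keeps the letter \<open>i\<close> and acts on \<open>v\<close>, or
  changes \<open>i\<close> by the quadratic part \<open>d i\<close> and keeps \<open>v\<close>. Rows
  are longer than \<open>v\<close> by 2 because the column \<open>i # v\<close> is longer by
  1.\<close>

lemma lead_itw:
  assumes M: "unip M" "\<And>i. M * Toep i = S i * M"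
    and S: "\<And>i. S i - Toep i - d i \<in> Fil 3" "\<And>i. d i \<in> Fil 2"
    and l: "length u = length v + 2"
  shows "ent M u (i # v) =
    (case u of [] \<Rightarrow> 0 | c # u' \<Rightarrow> if c = i then ent M u' v else 0) + ent (d i) u v"
proof -
  have "S i * M = Toep i * M + d i + d i * (M - 1) + (S i - Toep i - d i) * M"
    by (simp add: algebra_simps)
  moreover have "ent (d i * (M - 1)) u v = 0"
    by (rule FilD[OF Fil_mult[OF S(2) M(1)]]) (use l in auto)
  moreover have "ent ((S i - Toep i - d i) * M) u v = 0"
    by (rule FilD[OF Fil_multR[OF S(1)]]) (use l in auto)
  ultimately have "ent M u (i # v) = ent (Toep i * M) u v + ent (d i) u v"
    using M(2)[of i] by (simp flip: ent_mult_Toep)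
  then show ?thesis by (auto simp: ent_Toep_mult split: list.split)
qed

lemma Yt_swap: "Yt a * Yt b = Yt b * Yt a + (Toep a * Toep b - Toep b * Toep a)"
  by (simp add: Yt_def algebra_simps)

lemma Yt_comm: "Yt a * Yt b * ui (Yt a) - Yt b = (Toep a * Toep b - Toep b * Toep a) * ui (Yt a)"
  unfolding Yt_swap[of a b] distrib_right by (simp add: mult.assoc)

lemma Fil_Toep2: "Toep a * Toep b - Toep b * Toep a \<in> Fil 2"
  using Fil_mult[OF Toep_Fil Toep_Fil, of a b] Fil_mult[OF Toep_Fil Toep_Fil, of b a]
  by (intro Fil_diff) (simp_all)

lemma Yt_ui_comm: "ui (Yt b) * Yt a * Yt b - Yt a = ui (Yt b) * (Toep a * Toep b - Toep b * Toep a)"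
  unfolding mult.assoc Yt_swap[of a b] distrib_left by simp

lemma Toep_Yt: "Toep i = Yt i - 1" by (simp add: Yt_def)

abbreviation "tsp \<equiv> Transposition.transpose"

lemma deg0_Ms:
  assumes ab: "a \<noteq> b"
  shows "deg0 (Ms a b) (tsp a b)" "deg0 (Ms' a b) (tsp a b)"
proof -
  have "Ssub a b i - 1 - Toep (tsp a b i) \<in> Fil 2" for i
    using Fil_multR[OF Fil_Toep2, of a b "ui (Yt a)"] ab unfolding Yt_comm[symmetric]
    by (auto simp: Ssub_def Transposition.transpose_def Toep_Yt)
  then show "deg0 (Ms a b) (tsp a b)"
    by (intro deg0_itw[of _ "\<lambda>i. Ssub a b i - 1"]) (use itw_Ms(1)[of a b] in \<open>auto simp: itw_Yt\<close>)
  have "Ssub' a b i - 1 - Toep (tsp a b i) \<in> Fil 2" for i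
    using Fil_multL[OF Fil_Toep2, of "ui (Yt b)" a b] ab unfolding Yt_ui_comm[symmetric]
    by (auto simp: Ssub'_def Transposition.transpose_def Toep_Yt)
  then show "deg0 (Ms' a b) (tsp a b)"
    by (intro deg0_itw[of _ "\<lambda>i. Ssub' a b i - 1"]) (use itw_Ms(2)[of a b] in \<open>auto simp: itw_Yt\<close>)
qed

text \<open>The derivation of the free associative algebra with a -> [b, a], b -> [a, b] that kills
  all other letters, written as a matrix. It represents the infinitesimal pure braid t_ab. The
  recursion follows the column word, hence the order of arguments that \<open>Der\<close> exchanges
  afterwards.\<close>

primrec Derv :: "'i \<Rightarrow> 'i \<Rightarrow> 'i list \<Rightarrow> 'i list \<Rightarrow> rat" where
  "Derv a b [] = (\<lambda>u. 0)"
| "Derv a b (k # v) = (\<lambda>u. (case u of [] \<Rightarrow> 0 | c # u' \<Rightarrow> if c = k then Derv a b v u' else 0)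
     + (if k = a then (if u = b # a # v then 1 else 0) - (if u = a # b # v then 1 else 0)
        else if k = b then (if u = a # b # v then 1 else 0) - (if u = b # a # v then 1 else 0)
        else 0))"

definition Der :: "'i \<Rightarrow> 'i \<Rightarrow> 'i list \<Rightarrow> 'i list \<Rightarrow> rat" where "Der a b u v = Derv a b v u"

lemma Der_simps [simp]:
  "Der a b u [] = 0"
  "Der a b u (k # v) = (case u of [] \<Rightarrow> 0 | c # u' \<Rightarrow> if c = k then Der a b u' v else 0)
     + (if k = a then (if u = b # a # v then 1 else 0) - (if u = a # b # v then 1 else 0)
        else if k = b then (if u = a # b # v then 1 else 0) - (if u = b # a # v then 1 else 0)
        else 0)"
  by (auto simp: Der_def split: list.split)

definition ld1 :: "('i::finite, 'k::qalg) tmat \<Rightarrow> ('i list \<Rightarrow> 'i list \<Rightarrow> 'k) \<Rightarrow> bool" where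
  "ld1 M D \<longleftrightarrow> unip M \<and> (\<forall>u v. length u = length v + 1 \<longrightarrow> ent M u v = D u v)"

text \<open>The square of Artin's automorphism conjugates y_a by y_a y_b and y_b by y_a. Modulo
  degree three this adds [b, a] to the letter a and [a, b] to the letter b, the values of
  \<open>?d\<close>, and the Leibniz rule \<open>lead_itw\<close> extends this to all words.\<close>

lemma ld1_Ms_sq:
  assumes ab: "a \<noteq> b"
  shows "ld1 (Ms a b * Ms a b) (Der a b)"
proof -
  let ?M = "Ms a b * Ms a b"
  let ?K = "Toep b * Toep a - Toep a * Toep b :: ('a, rat) tmat"
  let ?s = "\<lambda>i. if i = a then Yt a * Yt b * Yt a * ui (Yt b) * ui (Yt a)
    else if i = b then Yt a * Yt b * ui (Yt a) else Yt i"
  let ?d = "\<lambda>i. if i = a then ?K else if i = b then - ?K else 0"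
  note p = Ms_cases[OF ab]
  have d2: "?d i \<in> Fil 2" for i
    using Fil_Toep2[of b a] Fil_minus[OF Fil_Toep2, of b a] by auto
  have "deg0 ?M id"
    using deg0_mult[OF deg0_Ms(1)[OF ab] deg0_Ms(1)[OF ab]] by simp
  then have M1: "unip ?M" by (simp add: deg0_id)
  have pai: "itw (Ms a b) (ui (Yt a)) (Yt a * ui (Yt b) * ui (Yt a))"
    by (rule itw_inverse[OF p(1)]) (simp_all add: mult.assoc)
  have it: "itw ?M (Yt i) (?s i)" for i
  proof -
    consider "i = a" | "i = b" | "i \<noteq> a" "i \<noteq> b" by blast
    then show ?thesis
    proof cases
      case 1
      show ?thesis
        using itw_comp[OF itw_mult[OF itw_mult[OF p(1) p(2)] pai] p(1)] 1 by (simp add: mult.assoc)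
    next
      case 2
      then show ?thesis using itw_comp[OF p(1) p(2)] ab by simp
    qed (use itw_comp[OF p(7) p(7)] in auto)
  qed
  have Fy: "unip (ui (Yt i))" for i :: 'a by (rule Fil1_ui) simp
  have k3: "?K * (ui (Yt i) - 1) \<in> Fil 3" for i
    using Fil_mult[OF Fil_Toep2 Fy, of b a i] by (simp add: eval_nat_numeral One_nat_def)
  have S: "?s i - 1 - Toep i - ?d i \<in> Fil 3" for i
  proof -
    consider "i = a" | "i = b" | "i \<noteq> a" "i \<noteq> b" by blast
    then show ?thesis
    proof cases
      case 1
      let ?X = "Yt b * Yt a * ui (Yt b)"
      have X: "?X - Yt a = ?K * ui (Yt b)" by (rule Yt_comm)
      have X2: "?X - Yt a \<in> Fil 2" unfolding X by (intro Fil_multR Fil_Toep2)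
      have X3: "?X - Yt a - ?K \<in> Fil 3" unfolding X using k3[of b] by (simp add: algebra_simps)
      have c3: "Toep a * (?X - Yt a) - (?X - Yt a) * Toep a \<in> Fil 3"
        using Fil_mult[OF Toep_Fil X2, of a] Fil_mult[OF X2 Toep_Fil, of a]
        by (intro Fil_diff) (simp_all add: eval_nat_numeral One_nat_def)
      have "Yt a * ?X = ?X * Yt a + (Toep a * (?X - Yt a) - (?X - Yt a) * Toep a)"
        by (simp add: Yt_def algebra_simps)
      then have "Yt a * ?X * ui (Yt a) = (?X * Yt a + (Toep a * (?X - Yt a) - (?X - Yt a) * Toep a)) * ui (Yt a)"
        by simp
      also have "\<dots> = ?X + (Toep a * (?X - Yt a) - (?X - Yt a) * Toep a) * ui (Yt a)"
        unfolding distrib_right by (simp add: mult.assoc)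
      finally have F: "?s a - 1 - Toep a - ?K = (?X - Yt a - ?K) + (Toep a * (?X - Yt a) - (?X - Yt a) * Toep a) * ui (Yt a)"
        by (simp add: mult.assoc Yt_def)
      show ?thesis
        using Fil_add[OF X3 Fil_multR[OF c3, of "ui (Yt a)"]] unfolding F[symmetric]
        by (simp only: 1 simp_thms if_True)
    next
      case 2
      have "?s b - 1 - Toep b - - ?K = Yt a * Yt b * ui (Yt a) - Yt b + ?K" using ab by (simp add: Yt_def)
      also have "\<dots> = - (?K * (ui (Yt a) - 1))" unfolding Yt_comm by (simp add: algebra_simps)
      finally show ?thesis using 2 ab Fil_minus[OF k3] by simp
    qed (simp add: Yt_def)
  qed
  have "length u = length v + 1 \<Longrightarrow> ent ?M u v = Der a b u v" for u v
  proof (induction v arbitrary: u)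
    case Nil
    then have "u \<noteq> []" by auto
    then show ?case using vac_mult[OF vac_Ms(1) vac_Ms(1), of a b a b] by (simp add: vac_def)
  next
    case (Cons i v)
    have "ent ?M u (i # v) = (case u of [] \<Rightarrow> 0 | c # u' \<Rightarrow> if c = i then ent ?M u' v else 0) + ent (?d i) u v"
      by (rule lead_itw[OF M1 _ S d2]) (use it Cons in \<open>auto simp: itw_Yt\<close>)
    also have "\<dots> = Der a b u (i # v)"
      using Cons ab by (auto simp: ent_mult_Toep ent_Toep split: list.split)
    finally show ?case .
  qed
  then show ?thesis using M1 by (simp add: ld1_def)
qed

lemma ld1_mult: "ld1 x D \<Longrightarrow> ld1 y E \<Longrightarrow> ld1 (x * y) (\<lambda>u v. D u v + E u v)"
  unfolding ld1_def
proof (intro conjI allI impI)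
  assume *: "unip x \<and> (\<forall>u v. length u = length v + 1 \<longrightarrow> ent x u v = D u v)"
    "unip y \<and> (\<forall>u v. length u = length v + 1 \<longrightarrow> ent y u v = E u v)"
  then show "unip (x * y)" by (simp add: Fil1_mult)
  fix u v :: "'a list" assume l: "length u = length v + 1"
  have "x * y = (x - 1) * (y - 1) + x + y - 1" by (simp add: algebra_simps)
  moreover have "ent ((x - 1) * (y - 1)) u v = 0"
    by (rule FilD[OF Fil_mult[of _ 1 _ 1]]) (use * l in auto)
  ultimately show "ent (x * y) u v = D u v + E u v" using * l by (auto simp: ent_1)
qed

text \<open>Only the degree-preserving parts of \<open>M\<close> and \<open>M'\<close> meet the
  leading term, so conjugation relabels letters. As \<pi> is an involution, rows and columns are
  relabelled by \<pi> itself.\<close>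

lemma ld1_conj:
  assumes x: "ld1 x D" and M: "deg0 M \<pi>" "deg0 M' \<pi>" "M * M' = 1" and \<pi>: "\<pi> \<circ> \<pi> = id"
  shows "ld1 (M * x * M') (\<lambda>u v. D (map \<pi> u) (map \<pi> v))"
  unfolding ld1_def
proof (intro conjI allI impI)
  have e: "M * x * M' - 1 = M * ((x - 1) * M')" using M(3) by (simp add: algebra_simps)
  have F: "(x - 1) * M' \<in> Fil 1" using x by (simp add: ld1_def Fil_multR)
  then show "unip (M * x * M')" unfolding e by (rule Fil_multL)
  fix u v :: "'a list" assume l: "length u = length v + 1"
  have pp: "map \<pi> (map \<pi> w) = w" for w using \<pi> by simp
  have inv: "u = map \<pi> w \<longleftrightarrow> w = map \<pi> u" for w using pp by metis
  have "ent (M * x * M') u v = ent (M * x * M' - 1) u v" using l by (auto simp: ent_1)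
  also have "\<dots> = (\<Sum>w | length w = length v + 1. ent M u w * ent ((x - 1) * M') w v)"
    unfolding e using lead_mult[OF Fil_0 F, of u v M] l by simp
  also have "\<dots> = (\<Sum>w | length w = length v + 1. if w = map \<pi> u then ent ((x - 1) * M') w v else 0)"
    using M(1) l inv by (intro sum.cong) (auto simp: deg0_def)
  also have "\<dots> = ent ((x - 1) * M') (map \<pi> u) v" using l by (simp add: sum.delta')
  also have "\<dots> = (\<Sum>w | length w = length v. ent (x - 1) (map \<pi> u) w * ent M' w v)"
    using lead_mult[of "x - 1" 1 M' 0 "map \<pi> u" v] x l by (simp add: ld1_def)
  also have "\<dots> = (\<Sum>w | length w = length v. if w = map \<pi> v then ent (x - 1) (map \<pi> u) w else 0)"
    using M(2) by (intro sum.cong) (auto simp: deg0_def)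
  also have "\<dots> = ent (x - 1) (map \<pi> u) (map \<pi> v)" by (simp add: sum.delta')
  also have "\<dots> = D (map \<pi> u) (map \<pi> v)" using x l
    by (auto simp: ld1_def ent_1) (metis length_map n_not_Suc_n Suc_eq_plus1)
  finally show "ent (M * x * M') u v = D (map \<pi> u) (map \<pi> v)" .
qed

lemma Der_map:
  assumes \<pi>: "\<pi> \<circ> \<pi> = id"
  shows "Der a b (map \<pi> u) (map \<pi> v) = Der (\<pi> a) (\<pi> b) u v"
proof (induction v arbitrary: u)
  case (Cons k v)
  have pp: "\<pi> (\<pi> x) = x" for x using \<pi> by (metis comp_apply id_apply)
  have inv: "\<pi> x = y \<longleftrightarrow> x = \<pi> y" for x y using pp by metis
  have inj: "map \<pi> w = map \<pi> w' \<longleftrightarrow> w = w'" for w w'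
    by (rule inj_eq, rule inj_mapI, rule injI) (metis pp)
  have e: "map \<pi> u = x # y # map \<pi> v \<longleftrightarrow> u = \<pi> x # \<pi> y # v" for x y
    using inj[of u "\<pi> x # \<pi> y # v"] by (simp add: pp)
  have i2: "\<pi> x = \<pi> y \<longleftrightarrow> x = y" for x y using pp by metis
  have l: "(case map \<pi> u of [] \<Rightarrow> 0 | c # u' \<Rightarrow> if c = \<pi> k then Der a b u' (map \<pi> v) else 0) =
    (case u of [] \<Rightarrow> 0 | c # u' \<Rightarrow> if c = k then Der (\<pi> a) (\<pi> b) u' v else 0)"
    by (cases u) (simp_all add: Cons i2)
  show ?case unfolding list.map Der_simps l e inv[of k a] inv[of k b] by simp
qed simp

text \<open>Every term of [i, z] contains z, so z never disappears. Together with
  \<open>Der_butlast\<close> and \<open>Der_last\<close> this describes \<open>Der i z\<close> on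
  words that end in their only z, modulo words with an earlier z: it inserts \<open>i\<close>
  directly before the last letter.\<close>

lemma Der_drop:
  assumes "z \<in> set v" "z \<notin> set u" "i \<noteq> z"
  shows "Der i z u v = 0"
  using assms
proof (induction v arbitrary: u)
  case (Cons k v)
  then show ?case by (auto split: list.split)
qed simp

lemma Der_butlast:
  assumes "z \<in> set (butlast v)" "z \<notin> set u" "i \<noteq> z"
  shows "Der i z (u @ [z]) v = 0"
  using assms
proof (induction v arbitrary: u)
  case (Cons k v)
  then have v: "v \<noteq> []" by auto
  have no: "u @ [z] \<noteq> x # z # v" "u @ [z] \<noteq> z # x # v" if "x \<noteq> z" for x
  proof -
    show "u @ [z] \<noteq> z # x # v" using Cons(3) that by (cases u) auto
    show "u @ [z] \<noteq> x # z # v"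
    proof
      assume "u @ [z] = x # z # v"
      then have "butlast (u @ [z]) = x # z # butlast v" using v by simp
      then show False using Cons(3) by simp
    qed
  qed
  show ?case
  proof (cases u)
    case Nil
    have "Der i z [] v = 0" using Cons(4) by (cases v) auto
    then show ?thesis using no[OF Cons(4)] Cons(4) by (auto simp: Nil)
  next
    case (Cons c u')
    have "z \<in> set (butlast v)" if "c = k"
      using Cons.prems(1,2) that v by (auto simp: Cons)
    then have "c = k \<Longrightarrow> Der i z (u' @ [z]) v = 0" using Cons.IH[of u'] Cons.prems Cons by auto
    moreover have "Der i z (u @ [z]) (k # v) = (if c = k then Der i z (u' @ [z]) v else 0)"
      using no[OF Cons.prems(3)] Cons.prems(3) unfolding Cons by auto
    ultimately show ?thesis by auto
  qed
qed simp

lemma Der_last: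
  assumes "z \<notin> set w" "z \<notin> set u" "i \<noteq> z"
  shows "Der i z (u @ [z]) (w @ [z]) = (if u = w @ [i] then 1 else 0)"
  using assms
proof (induction w arbitrary: u)
  case Nil
  then show ?case by (cases u) (auto simp: Cons_eq_append_conv)
next
  case (Cons k w)
  show ?case
  proof (cases u)
    case Nil
    then show ?thesis using Cons.prems by auto
  next
    case (Cons c u')
    have no: "u @ [z] \<noteq> x # z # w @ [z]" "u @ [z] \<noteq> z # x # w @ [z]" for x
    proof -
      show "u @ [z] \<noteq> z # x # w @ [z]" using Cons.prems Cons by auto
      show "u @ [z] \<noteq> x # z # w @ [z]"
      proof
        assume "u @ [z] = x # z # w @ [z]"
        then have "u = x # z # w" by simp
        then show False using Cons.prems(2) by simp
      qed
    qed
    then have d1: "Der i z (u @ [z]) ((k # w) @ [z]) = (if c = k then Der i z (u' @ [z]) (w @ [z]) else 0)"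
      using no Cons.prems(3) unfolding Cons by auto
    have d2: "Der i z (u' @ [z]) (w @ [z]) = (if u' = w @ [i] then 1 else 0)"
      using Cons.prems Cons by (intro Cons.IH) auto
    show ?thesis unfolding d1 d2 by (simp add: Cons)
  qed
qed

section \<open>The power series of an element of the free group\<close>

instance letter :: finite
proof
  have "(UNIV :: letter set) = {LX, LY}" by (auto intro: letter.exhaust)
  then show "finite (UNIV :: letter set)" by (metis finite.emptyI finite.insertI)
qed

lemma wd_replicate: "wd A (replicate k j) = A j ^ k"
  by (induction k) auto

definition fser :: "'k::qalg fps \<Rightarrow> 'j \<Rightarrow> 'j list \<Rightarrow> 'k" where
  "fser F j w = (if w = replicate (length w) j then fps_nth F (length w) else 0)"

lemma ev_fser:
  fixes A :: "'j::finite \<Rightarrow> ('i::finite, 'k::qalg) tmat"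
  assumes A: "\<And>j. A j \<in> Fil 1"
  shows "ev (fser F j) A = ev1 F (A j)"
proof (rule tmat_eqI)
  fix u v :: "'i list"
  let ?n = "length u"
  have "ent (ev (fser F j) A) u v = (\<Sum>w\<in>lw ?n. fser F j w * ent (wd A w) u v)"
    by (rule ent_ev[OF A]) simp
  also have "\<dots> = (\<Sum>w\<in>(\<lambda>k. replicate k j) ` {..?n}. fser F j w * ent (wd A w) u v)"
    by (rule sum.mono_neutral_right) (auto simp: fser_def)
  also have "\<dots> = (\<Sum>k\<le>?n. fps_nth F k * ent (A j ^ k) u v)"
    by (subst sum.reindex) (auto simp: inj_on_def fser_def wd_replicate dest: arg_cong[of _ _ length])
  also have "\<dots> = ent (ev1 F (A j)) u v"
    by (simp add: ent_ev1[OF A, of _ _ ?n])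
  finally show "ent (ev (fser F j) A) u v = ent (ev1 F (A j)) u v" .
qed

abbreviation esr :: "'k::qalg \<Rightarrow> 'j \<Rightarrow> 'j list \<Rightarrow> 'k" where "esr m \<equiv> fser (expf m)"

lemma esr_def: "esr m j w = (if w = replicate (length w) j then m ^ length w * qi (1 / fact (length w)) else 0)"
  by (simp add: fser_def)

lemma ex_ev: "(\<And>j. A j \<in> Fil 1) \<Longrightarrow> ev (esr m j) A = ex m (A j)"
  by (simp add: ev_fser ex_def)

abbreviation eLX :: "(letter, rat) tmat" where "eLX \<equiv> ex 1 (Toep LX)"
abbreviation eLY :: "(letter, rat) tmat" where "eLY \<equiv> ex 1 (Toep LY)"

lemma unip_eL: "unip eLX" "unip eLY" by simp_all

abbreviation pr :: "'a \<Rightarrow> 'a \<Rightarrow> letter \<Rightarrow> 'a" where "pr A B \<equiv> case_letter A B"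

lemma pr_Fil [intro]: "A \<in> Fil n \<Longrightarrow> B \<in> Fil n \<Longrightarrow> pr A B j \<in> Fil n"
  by (cases j) auto

text \<open>The coefficients of g(e^X, e^Y): the word is evaluated at operators of left
  multiplication, and the result is applied to the empty word.\<close>

definition ser :: "letter gword set \<Rightarrow> letter list \<Rightarrow> rat" where
  "ser g = col (F2hom Ugr eLX eLY g)"

lemma F2_one [simp]: "\<one>\<^bsub>F2\<^esub> \<in> carrier F2"
  by (rule monoid.one_closed[OF group.is_monoid[OF group_F2]])

lemma F2hom_rec:
  assumes "group H" "a \<in> carrier H" "b \<in> carrier H" "g \<in> carrier F2"
  shows "F2hom H a b (F2_x \<star> g) = a \<otimes>\<^bsub>H\<^esub> F2hom H a b g" (is ?P)
    "F2hom H a b (F2_y \<star> g) = b \<otimes>\<^bsub>H\<^esub> F2hom H a b g" (is ?Q)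
    "F2hom H a b (iv F2_x \<star> g) = inv\<^bsub>H\<^esub> a \<otimes>\<^bsub>H\<^esub> F2hom H a b g" (is ?R)
    "F2hom H a b (iv F2_y \<star> g) = inv\<^bsub>H\<^esub> b \<otimes>\<^bsub>H\<^esub> F2hom H a b g" (is ?S)
    "F2hom H a b \<one>\<^bsub>F2\<^esub> = \<one>\<^bsub>H\<^esub>" (is ?T)
proof -
  note h = F2hom[OF assms(1-3)]
  interpret group_hom F2 H "F2hom H a b"
    using h(1) assms(1) group_F2 by (simp add: group_hom_def group_hom_axioms_def)
  show ?P
    ?Q
    ?R
    ?S
    ?T
    using assms(4) h by auto
qed

lemma ui_unip: "unip a \<Longrightarrow> ui (a :: ('i::finite, 'k::qalg) tmat) = ex (- 1) (lg a)"
  unfolding ui_def by (rule Ugr_inv) (use ex_inv[of "lg a" 1] in auto)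

lemma ex1_unit: "A \<in> Fil 1 \<Longrightarrow> ex m (A :: ('i::finite, 'k::qalg) tmat) \<in> carrier Ugr"
  by (rule Fil1_unit) simp

text \<open>Both evaluations obey the same recursion along the word, each letter contributing a
  factor exp of plus or minus X or Y. Therefore g(a, b) is the universal series of g at log a and
  log b. The two claims are proved together because the recursion for \<open>ser\<close> is
  extracted from the first.\<close>

lemma ser_main:
  fixes a b :: "('i::finite, rat) tmat"
  assumes "g \<in> carrier F2" and ab: "unip a" "unip b"
  shows "F2hom Ugr eLX eLY g = ev (ser g) Toep \<and>
         F2hom Ugr a b g = ev (ser g) (pr (lg a) (lg b))"
  using assms(1)
proof (induction rule: F2_induct)
  let ?X = eLX and ?Y = eLY and ?A = "pr (lg a) (lg b)"
  have T: "Toep j \<in> Fil 1" for j :: letter by simp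
  have A: "?A j \<in> Fil 1" for j using ab by auto
  note rX = F2hom_rec[OF group_Ugr ex1_unit[OF T[of LX], of 1] ex1_unit[OF T[of LY], of 1], unfolded Ugr_simps(1,2)]
  note ra = F2hom_rec[OF group_Ugr Fil1_unit[OF ab(1)] Fil1_unit[OF ab(2)], unfolded Ugr_simps(1,2)]
  have iX: "inv\<^bsub>Ugr\<^esub> ?X = ev (esr (- 1) LX) Toep" "inv\<^bsub>Ugr\<^esub> ?Y = ev (esr (- 1) LY) Toep"
    using ui_unip[of ?X] ui_unip[of ?Y] by (simp_all add: ui_def ex_ev)
  have ia: "inv\<^bsub>Ugr\<^esub> a = ev (esr (- 1) LX) ?A" "inv\<^bsub>Ugr\<^esub> b = ev (esr (- 1) LY) ?A"
    using ui_unip[OF ab(1)] ui_unip[OF ab(2)] by (simp_all add: ui_def ex_ev[OF A])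
  have eX: "?X = ev (esr 1 LX) Toep" "?Y = ev (esr 1 LY) Toep" by (simp_all add: ex_ev)
  have ea: "a = ev (esr 1 LX) ?A" "b = ev (esr 1 LY) ?A"
    using ab by (simp_all add: ex_ev[OF A])
  have step: "F2hom Ugr ?X ?Y g' = ev (ser g') Toep \<and> F2hom Ugr a b g' = ev (ser g') ?A"
    if "F2hom Ugr ?X ?Y g' = s * F2hom Ugr ?X ?Y g" "s = ev (esr c j) Toep"
      "F2hom Ugr a b g' = t * F2hom Ugr a b g" "t = ev (esr c j) ?A"
      "F2hom Ugr ?X ?Y g = ev (ser g) Toep \<and> F2hom Ugr a b g = ev (ser g) ?A" for g g' c j s t
  proof -
    have e: "F2hom Ugr ?X ?Y g' = ev (conv (esr c j) (ser g)) Toep" using that ev_mult[OF T] by simp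
    then have "ser g' = conv (esr c j) (ser g)" by (simp add: ser_def)
    then show ?thesis using e that ev_mult[OF A] by simp
  qed
  {
    case one
    have e: "F2hom Ugr ?X ?Y \<one>\<^bsub>F2\<^esub> = ev delta Toep" using rX(5)[OF F2_one] by simp
    then have "ser \<one>\<^bsub>F2\<^esub> = delta" by (simp add: ser_def del: ev_delta)
    then show ?case using e ra(5)[OF F2_one] A by simp
  next
    case (x g)
    show ?case by (rule step[OF rX(1)[OF x(1)] eX(1) ra(1)[OF x(1)] ea(1) x(2)])
  next
    case (y g)
    show ?case by (rule step[OF rX(2)[OF y(1)] eX(2) ra(2)[OF y(1)] ea(2) y(2)])
  next
    case (xi g)
    show ?case by (rule step[OF rX(3)[OF xi(1)] iX(1) ra(3)[OF xi(1)] ia(1) xi(2)])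
  next
    case (yi g)
    show ?case by (rule step[OF rX(4)[OF yi(1)] iX(2) ra(4)[OF yi(1)] ia(2) yi(2)])
  }
qed

lemma ev_ser:
  fixes a b :: "('i::finite, rat) tmat"
  assumes "g \<in> carrier F2" "unip a" "unip b"
  shows "F2hom Ugr a b g = ev (ser g) (pr (lg a) (lg b))"
  using ser_main[OF assms] by blast

lemma F2hom_unip:
  fixes a b :: "('i::finite, 'k::qalg) tmat"
  assumes "g \<in> carrier F2" and ab: "unip a" "unip b"
  shows "unip (F2hom Ugr a b g)"
  using assms(1)
proof (induction rule: F2_induct)
  note r = F2hom_rec[OF group_Ugr Fil1_unit[OF ab(1)] Fil1_unit[OF ab(2)]]
  {
    case one
    then show ?case using r(5)[OF F2_one] by simp
  next
    case (x g)
    then show ?case using r(1)[of g] ab by (simp add: Fil1_mult)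
  next
    case (y g)
    then show ?case using r(2)[of g] ab by (simp add: Fil1_mult)
  next
    case (xi g)
    then show ?case using r(3)[of g] ab Fil1_ui[of a] by (simp add: Fil1_mult flip: ui_def)
  next
    case (yi g)
    then show ?case using r(4)[of g] ab Fil1_ui[of b] by (simp add: Fil1_mult flip: ui_def)
  }
qed

lemma ent_unip: "unip a \<Longrightarrow> length u \<le> length v \<Longrightarrow> ent a u v = (if u = v then 1 else 0)"
  using FilD[of "a - 1" 1 u v] by (auto simp: ent_1 split: if_splits)

lemma ser_Nil: "g \<in> carrier F2 \<Longrightarrow> ser g [] = 1"
  using ent_unip[OF F2hom_unip[of g eLX eLY], of "[]" "[]"]
  by (simp add: ser_def col_def)

lemma ser_mult:
  assumes "g \<in> carrier F2" "h \<in> carrier F2"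
  shows "ser (g \<star> h) = conv (ser g) (ser h)"
proof -
  note a = ex1_unit[OF Toep_Fil, of "1::rat" LX] ex1_unit[OF Toep_Fil, of "1::rat" LY]
  have "F2hom Ugr eLX eLY (g \<star> h) =
     ev (ser g) Toep * ev (ser h) (Toep :: letter \<Rightarrow> (letter, rat) tmat)"
    using F2hom(1)[OF group_Ugr a] ser_main[OF assms(1), of "1 :: (letter, rat) tmat" 1]
      ser_main[OF assms(2), of "1 :: (letter, rat) tmat" 1] assms by (simp add: hom_def)
  then show ?thesis by (simp add: ser_def ev_mult)
qed

lemma ser_gen: "ser F2_x = esr 1 LX" "ser F2_y = esr 1 LY"
proof -
  note a = ex1_unit[OF Toep_Fil, of "1::rat" LX] ex1_unit[OF Toep_Fil, of "1::rat" LY]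
  show "ser F2_x = esr 1 LX" "ser F2_y = esr 1 LY"
    using F2hom[OF group_Ugr a] by (simp_all add: ser_def ex_ev[of Toep "1::rat", OF Toep_Fil, symmetric])
qed

lemma ser_inv:
  assumes g: "g \<in> carrier F2"
  shows "ser (iv F2_x \<star> g) = conv (esr (- 1) LX) (ser g)" (is ?P)
    "ser (iv F2_y \<star> g) = conv (esr (- 1) LY) (ser g)" (is ?Q)
proof -
  note a = ex1_unit[OF Toep_Fil, of "1::rat" LX] ex1_unit[OF Toep_Fil, of "1::rat" LY]
  have i: "inv\<^bsub>Ugr\<^esub> (ex 1 (Toep j)) = ev (esr (- 1) j) (Toep :: letter \<Rightarrow> (letter, rat) tmat)" for j
    using ui_unip[of "ex 1 (Toep j) :: (letter, rat) tmat"] by (simp add: ui_def ex_ev)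
  note r = F2hom_rec(3,4)[OF group_Ugr a g, unfolded Ugr_simps(1,2) i]
    conjunct1[OF ser_main[OF g, of "1 :: (letter, rat) tmat" 1]]
  show ?P
    ?Q
    by (subst ser_def, simp add: r ev_mult)+
qed

lemma ser_one: "ser \<one>\<^bsub>F2\<^esub> = delta"
  using F2hom_rec(5)[OF group_Ugr ex1_unit[OF Toep_Fil] ex1_unit[OF Toep_Fil] F2_one, of "1::rat" LX "1::rat" LY]
  by (auto simp: ser_def col_def fun_eq_iff ent_1 delta_def)

lemma ser_linear_rec:
  assumes "g \<in> carrier F2"
  shows "ser (F2_x \<star> g) [k] = (if k = LX then 1 else 0) + ser g [k]" (is ?P)
    "ser (F2_y \<star> g) [k] = (if k = LY then 1 else 0) + ser g [k]" (is ?Q)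
    "ser (iv F2_x \<star> g) [k] = (if k = LX then - 1 else 0) + ser g [k]" (is ?R)
    "ser (iv F2_y \<star> g) [k] = (if k = LY then - 1 else 0) + ser g [k]" (is ?S)
    "ser \<one>\<^bsub>F2\<^esub> [k] = 0"
proof -
  have "conv (esr c j) (ser g) [k] = (if k = j then c else 0) + ser g [k]" for c j k
    using ser_Nil[OF assms] by (simp add: conv_def atMost_Suc esr_def)
  then show ?P
    ?Q
    ?R
    ?S
    using assms by (simp_all add: ser_inv, simp_all add: ser_mult ser_gen)
qed (simp add: ser_one delta_def)

text \<open>If one argument is trivial, only the exponent sum of the other letter survives, and the
  linear coefficients of \<open>ser g\<close> are these exponent sums.\<close>

lemma F2hom_1:
  fixes c :: "('i::finite, rat) tmat"
  assumes c: "unip c" and g: "g \<in> carrier F2"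
  shows "F2hom Ugr c 1 g = ex (ser g [LX]) (lg c) \<and> F2hom Ugr 1 c g = ex (ser g [LY]) (lg c)"
  using g
proof (induction rule: F2_induct)
  have 1: "(1::('i, rat) tmat) \<in> carrier Ugr" by auto
  note r = F2hom_rec[OF group_Ugr Fil1_unit[OF c] 1] and r' = F2hom_rec[OF group_Ugr 1 Fil1_unit[OF c]]
  note add = ex_add[OF lg_Fil[OF c], symmetric]
  have u1: "ui (1 :: ('i, rat) tmat) = 1" unfolding ui_def by (rule Ugr_inv) auto
  {
    case one
    show ?case using r(5)[OF F2_one] r'(5)[OF F2_one] by (simp add: ser_linear_rec(5)[OF F2_one])
  next
    case (x g)
    then show ?case using r(1)[of g] r'(1)[of g] add[of 1] c
      by (simp add: ser_linear_rec)
  next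
    case (y g)
    then show ?case using r(2)[of g] r'(2)[of g] add[of 1] c
      by (simp add: ser_linear_rec)
  next
    case (xi g)
    then show ?case using r(3)[of g] r'(3)[of g] add[of "- 1"] ui_unip[OF c]
      by (simp add: ser_linear_rec u1 flip: ui_def)
  next
    case (yi g)
    then show ?case using r(4)[of g] r'(4)[of g] add[of "- 1"] ui_unip[OF c]
      by (simp add: ser_linear_rec u1 flip: ui_def)
  }
qed

lemma ui_commute:
  assumes "p * q = q * p" "p \<in> carrier Ugr"
  shows "ui p * q = q * ui (p :: 'r::ring_1)"
proof -
  have "ui p * q = ui p * q * (p * ui p)" using ui(1)[OF assms(2)] by simp
  also have "\<dots> = ui p * (p * q) * ui p" unfolding assms(1) by (simp only: mult.assoc)
  also have "\<dots> = q * ui p" using ui(2)[OF assms(2)] by (simp flip: mult.assoc)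
  finally show ?thesis .
qed

lemma F2hom_commute:
  fixes a b p :: "'r::ring_1"
  assumes H: "a \<in> carrier Ugr" "b \<in> carrier Ugr" and p: "p * a = a * p" "p * b = b * p" and g: "g \<in> carrier F2"
  shows "p * F2hom Ugr a b g = F2hom Ugr a b g * p"
  using g
proof (induction rule: F2_induct)
  note r = F2hom_rec[OF group_Ugr H, unfolded Ugr_simps(1,2), folded ui_def]
  have e: "p * (q * x) = q * x * p" if "p * q = q * p" "p * x = x * p" for q x
    using that by (metis mult.assoc)
  { case one then show ?case using r(5)[OF F2_one] by simp
  next case (x g) then show ?case using r(1)[of g] e[OF p(1)] by simp
  next case (y g) then show ?case using r(2)[of g] e[OF p(2)] by simp
  next case (xi g) then show ?case using r(3)[of g] e[OF ui_commute[OF p(1)[symmetric] H(1), symmetric]] by simp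
  next case (yi g) then show ?case using r(4)[of g] e[OF ui_commute[OF p(2)[symmetric] H(2), symmetric]] by simp
  }
qed

text \<open>By \<open>F2hom_commute\<close>, applied in each variable, all values at (a, b) commute
  with all values at (c, d). The pointwise product is then a homomorphism on \<open>F2\<close> and
  is determined by its values on the generators.\<close>

lemma F2hom_central:
  fixes a b c d :: "'r::ring_1"
  assumes H: "a \<in> carrier Ugr" "b \<in> carrier Ugr" "c \<in> carrier Ugr" "d \<in> carrier Ugr"
    and com: "a * c = c * a" "a * d = d * a" "b * c = c * b" "b * d = d * b" and g: "g \<in> carrier F2"
  shows "F2hom Ugr (a * c) (b * d) g = F2hom Ugr a b g * F2hom Ugr c d g"
proof -
  interpret U: group "Ugr :: 'r monoid" by (rule group_Ugr)
  have ac: "a * c \<in> carrier Ugr" "b * d \<in> carrier Ugr"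
    using U.m_closed[OF H(1,3)] U.m_closed[OF H(2,4)] by auto
  have c2: "F2hom Ugr c d g * F2hom Ugr a b h = F2hom Ugr a b h * F2hom Ugr c d g"
    if "g \<in> carrier F2" "h \<in> carrier F2" for g h
    by (rule F2hom_commute[OF H(1,2) F2hom_commute[OF H(3,4) com(1,2) that(1), symmetric]
      F2hom_commute[OF H(3,4) com(3,4) that(1), symmetric] that(2)])
  show ?thesis
  proof (rule F2_hom_eq[OF group_Ugr _ _ _ _ g])
    show "F2hom Ugr (a * c) (b * d) \<in> hom F2 Ugr" by (rule F2hom(1)[OF group_Ugr ac])
    note h1 = F2hom(1)[OF group_Ugr H(1,2)] and h2 = F2hom(1)[OF group_Ugr H(3,4)]
    show "(\<lambda>g. F2hom Ugr a b g * F2hom Ugr c d g) \<in> hom F2 Ugr"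
    proof (rule homI)
      fix x assume "x \<in> carrier F2"
      then have "F2hom Ugr a b x \<in> carrier Ugr" "F2hom Ugr c d x \<in> carrier Ugr"
        using h1 h2 by (auto simp: hom_def)
      then show "F2hom Ugr a b x * F2hom Ugr c d x \<in> carrier Ugr" using U.m_closed by fastforce
    next
      fix x y assume xy: "x \<in> carrier F2" "y \<in> carrier F2"
      then show "F2hom Ugr a b (x \<star> y) * F2hom Ugr c d (x \<star> y) =
        F2hom Ugr a b x * F2hom Ugr c d x \<otimes>\<^bsub>Ugr\<^esub> (F2hom Ugr a b y * F2hom Ugr c d y)"
        using h1 h2 c2[of x y] by (simp add: hom_def) (metis mult.assoc)
    qed
  qed (simp_all add: F2hom[OF group_Ugr ac] F2hom[OF group_Ugr H(1,2)] F2hom[OF group_Ugr H(3,4)])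
qed

section \<open>Limits of rational functions on the free group\<close>

text \<open>\<open>lim \<phi> a\<close> stands for: the rational function \<phi> on the free group
  tends to a when its argument tends to f. The function \<open>\<Phi>\<close> collects the limits of
  the coefficients, that is, the series f(e^X, e^Y). Sums and products suffice, since matrix entries
  of g(a, b) are polynomial in finitely many coefficients of g.\<close>

locale ratlim =
  fixes lim :: "(letter gword set \<Rightarrow> rat) \<Rightarrow> 'k::qalg \<Rightarrow> bool"
    and \<Phi> :: "letter list \<Rightarrow> 'k"
  assumes lim_const: "lim (\<lambda>_. q) (qi q)"
    and lim_add: "lim \<phi> a \<Longrightarrow> lim \<psi> b \<Longrightarrow> lim (\<lambda>g. \<phi> g + \<psi> g) (a + b)"
    and lim_mult: "lim \<phi> a \<Longrightarrow> lim \<psi> b \<Longrightarrow> lim (\<lambda>g. \<phi> g * \<psi> g) (a * b)"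
    and lim_unique: "lim \<phi> a \<Longrightarrow> lim \<phi> b \<Longrightarrow> a = b"
    and lim_cong: "(\<And>g. g \<in> carrier F2 \<Longrightarrow> \<phi> g = \<psi> g) \<Longrightarrow> lim \<phi> a \<Longrightarrow> lim \<psi> a"
    and lim_ser: "lim (\<lambda>g. ser g w) (\<Phi> w)"
begin

lemma lim_sum: "finite S \<Longrightarrow> (\<And>x. x \<in> S \<Longrightarrow> lim (\<phi> x) (a x)) \<Longrightarrow> lim (\<lambda>g. \<Sum>x\<in>S. \<phi> x g) (\<Sum>x\<in>S. a x)"
proof (induction S rule: finite_induct)
  case empty
  then show ?case using lim_const[of 0] by simp
next
  case (insert x S)
  then show ?case by (simp add: lim_add)
qed

lemma lim_cmult: "lim \<phi> a \<Longrightarrow> lim (\<lambda>g. c * \<phi> g) (qi c * a)"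
  by (rule lim_mult[OF lim_const])

lemma lim_power: "lim \<phi> a \<Longrightarrow> lim (\<lambda>g. \<phi> g ^ n) (a ^ n)"
  by (induction n) (use lim_const[of 1] lim_mult in auto)

definition tl :: "(letter gword set \<Rightarrow> ('i::finite, rat) tmat) \<Rightarrow> ('i, 'k) tmat \<Rightarrow> bool" where
  "tl \<Psi> M \<longleftrightarrow> (\<forall>u v. lim (\<lambda>g. ent (\<Psi> g) u v) (ent M u v))"

lemma tl_mult: "tl \<Psi> M \<Longrightarrow> tl \<Psi>' M' \<Longrightarrow> tl (\<lambda>g. \<Psi> g * \<Psi>' g) (M * M')"
  unfolding tl_def ent_mult_self by (intro allI lim_sum lim_mult) auto

lemma tl_unique: "tl \<Psi> M \<Longrightarrow> tl \<Psi> N \<Longrightarrow> M = N"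
  unfolding tl_def by (intro tmat_eqI) (blast intro: lim_unique)

lemma tl_cong: "(\<And>g. g \<in> carrier F2 \<Longrightarrow> \<Psi> g = \<Psi>' g) \<Longrightarrow> tl \<Psi> M \<Longrightarrow> tl \<Psi>' M"
  unfolding tl_def
proof (intro allI)
  fix u v assume e: "\<And>g. g \<in> carrier F2 \<Longrightarrow> \<Psi> g = \<Psi>' g" and l: "\<forall>u v. lim (\<lambda>g. ent (\<Psi> g) u v) (ent M u v)"
  show "lim (\<lambda>g. ent (\<Psi>' g) u v) (ent M u v)"
    by (rule lim_cong[OF _ l[rule_format]]) (simp add: e)
qed

lemma tl_ev:
  assumes A: "\<And>j. A j \<in> Fil 1" and l: "\<And>w. lim (\<lambda>g. \<phi> g w) (\<psi> w)"
  shows "tl (\<lambda>g. ev (\<phi> g) A) (ev \<psi> (\<lambda>j. qm (A j)))"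
  unfolding tl_def ev.rep_eq qm_wd[symmetric] ent_qm
proof (intro allI lim_sum finite_lw)
  fix u v :: "'b list" and w :: "'a list"
  show "lim (\<lambda>g. \<phi> g w * ent (wd A w) u v) (\<psi> w * qi (ent (wd A w) u v))"
    by (intro lim_mult l lim_const)
qed

text \<open>The value f(a, b) at unipotent rational matrices. As a series in log a and log b it
  respects intertwiners (\<open>fh_intertwine\<close>); as the limit of g(a, b)
  (\<open>tl_fh\<close>) it inherits identities that hold for all words g.\<close>

definition fh :: "('i::finite, rat) tmat \<Rightarrow> ('i, rat) tmat \<Rightarrow> ('i, 'k) tmat" where
  "fh a b = ev \<Phi> (pr (lg (qm a)) (lg (qm b)))"

lemma pr_qm: "pr (qm A) (qm B) = (\<lambda>j. qm (pr A B j))"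
  by (rule ext) (simp split: letter.split)

lemma tl_ser:
  assumes ab: "unip a" "unip b"
    and h: "\<And>g. g \<in> carrier F2 \<Longrightarrow> h g \<in> carrier F2" and l: "\<And>w. lim (\<lambda>g. ser (h g) w) (\<psi> w)"
  shows "tl (\<lambda>g. F2hom Ugr a b (h g)) (ev \<psi> (pr (lg (qm a)) (lg (qm b))))"
proof (rule tl_cong)
  show "tl (\<lambda>g. ev (ser (h g)) (pr (lg a) (lg b))) (ev \<psi> (pr (lg (qm a)) (lg (qm b))))"
    unfolding qm_lg[symmetric] pr_qm by (rule tl_ev) (use ab l in auto)
qed (use ab h in \<open>simp add: ev_ser\<close>)

lemma tl_fh: "unip a \<Longrightarrow> unip b \<Longrightarrow> tl (F2hom Ugr a b) (fh a b)"
  unfolding fh_def by (rule tl_ser[where h = "\<lambda>g. g"]) (auto simp: lim_ser)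

lemma Phi_Nil: "\<Phi> [] = 1"
  using lim_unique[OF lim_ser[of "[]"] lim_cong[OF _ lim_const[of 1]]] by (simp add: ser_Nil)

lemma fh_Fil: "unip a \<Longrightarrow> unip b \<Longrightarrow> unip (fh a b)"
proof -
  assume ab: "unip a" "unip b"
  have A: "pr (lg (qm a)) (lg (qm b)) j \<in> Fil 1" for j using ab by auto
  have "ev (\<lambda>w. \<Phi> w + - 1 * delta w) (pr (lg (qm a)) (lg (qm b))) \<in> Fil 1"
    by (rule ev_Fil[OF A]) (auto simp: Phi_Nil delta_def)
  moreover have "ev (\<lambda>w. \<Phi> w + - 1 * delta w) (pr (lg (qm a)) (lg (qm b))) = fh a b - 1"
    unfolding fh_def ev_add ev_cmult ev_delta[OF A] by (simp add: scm_minus_1)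
  ultimately show ?thesis by simp
qed

lemma fh_intertwine:
  assumes ab: "unip a" "unip b" "unip a'" "unip b'"
    and c: "c * a = a' * c" "c * b = b' * c"
  shows "qm c * fh a b = fh a' b' * qm c"
proof -
  have 1: "qm c * lg (qm a) = lg (qm a') * (qm c :: ('a, 'k) tmat)"
    by (intro lg_intertwine qm_Fil1 ab) (simp add: c flip: qm_mult)
  have 2: "qm c * lg (qm b) = lg (qm b') * (qm c :: ('a, 'k) tmat)"
    by (intro lg_intertwine qm_Fil1 ab) (simp add: c flip: qm_mult)
  have "qm c * pr (lg (qm a)) (lg (qm b)) j = pr (lg (qm a')) (lg (qm b')) j * (qm c :: ('a, 'k) tmat)" for j
    using 1 2 by (cases j) simp_all
  then show ?thesis unfolding fh_def by (intro ev_intertwine pr_Fil lg_Fil qm_Fil1 ab) auto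
qed

text \<open>Each entry is a polynomial in the exponent, and every term except the constant one tends
  to zero with it.\<close>

lemma tl_ex:
  assumes "lim \<alpha> 0" "A \<in> Fil 1"
  shows "tl (\<lambda>g. ex (\<alpha> g) A) (1 :: ('i::finite, 'k) tmat)"
proof -
  have l: "lim (\<lambda>g. \<Sum>n\<le>length u. \<alpha> g ^ n * qi (1 / fact n) * ent (A ^ n) u v)
        (\<Sum>n\<le>length u. 0 ^ n * qi (qi (1 / fact n)) * qi (ent (A ^ n) u v))" for u v
    by (intro lim_sum lim_mult lim_power assms lim_const) auto
  have e: "(\<Sum>n\<le>length u. 0 ^ n * qi (qi (1 / fact n)) * qi (ent (A ^ n) u v)) = ent 1 u v" for u v
    by (simp add: power_0_left if_distrib[of "\<lambda>x. x * _"] ent_1 cong: if_cong)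
  show ?thesis using l unfolding tl_def ex_def ev1.rep_eq e expf_nth by blast
qed

text \<open>If the linear coefficients of \<open>\<Phi>\<close> vanish, then \<open>f\<close> is a limit of elements of the commutator
  subgroup, so that central factors of its arguments do not matter.\<close>

lemma fh_central:
  assumes lin: "\<Phi> [LX] = 0" "\<Phi> [LY] = 0"
    and F: "unip a" "unip b" "unip c" and com: "a * c = c * a" "b * c = c * b"
  shows "fh (a * c) b = fh a b" "fh a (b * c) = fh a b"
proof -
  note u = Fil1_unit[OF F(1)] Fil1_unit[OF F(2)] Fil1_unit[OF F(3)]
  have 1: "1 \<in> carrier (Ugr :: ('a, rat) tmat monoid)" by auto
  have l: "lim (\<lambda>g. ser g [LX]) 0" "lim (\<lambda>g. ser g [LY]) 0"
    using lim_ser[of "[LX]"] lim_ser[of "[LY]"] lin by auto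
  have t: "tl (F2hom Ugr c 1) 1" "tl (F2hom Ugr 1 c) 1"
    by (rule tl_cong[OF _ tl_ex[OF l(1) lg_Fil[OF F(3)]]], simp add: F2hom_1 F(3),
        rule tl_cong[OF _ tl_ex[OF l(2) lg_Fil[OF F(3)]]], simp add: F2hom_1 F(3))
  have "tl (F2hom Ugr (a * c) (b * 1)) (fh a b * 1)"
    by (rule tl_cong[OF _ tl_mult[OF tl_fh[OF F(1,2)] t(1)]])
       (rule F2hom_central[symmetric, OF u(1,2,3) 1], use com in auto)
  then show "fh (a * c) b = fh a b"
    using tl_unique[OF tl_fh[OF Fil1_mult[OF F(1,3)] F(2)]] by simp
  have "tl (F2hom Ugr (a * 1) (b * c)) (fh a b * 1)"
    by (rule tl_cong[OF _ tl_mult[OF tl_fh[OF F(1,2)] t(2)]])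
       (rule F2hom_central[symmetric, OF u(1,2) 1 u(3)], use com in auto)
  then show "fh a (b * c) = fh a b"
    using tl_unique[OF tl_fh[OF F(1) Fil1_mult[OF F(2,3)]]] by simp
qed

lemma fh_1: "fh 1 1 = 1"
proof -
  have l1: "lg 1 = (0 :: ('a, 'k) tmat)"
    by (rule tmat_eqI) (simp add: lg_def ev1.rep_eq power_0_left if_distrib[of "\<lambda>x. ent x _ _"] if_distrib[of "\<lambda>x. _ * x"] cong: if_cong)
  have w0: "wd (pr 0 0) w = (if w = [] then 1 else (0 :: ('a, 'k) tmat))" for w
    by (cases w) (auto split: letter.split)
  show ?thesis unfolding fh_def qm_1 l1
    by (rule tmat_eqI) (simp add: ev.rep_eq w0 if_distrib[of "\<lambda>x. ent x _ _"] if_distrib[of "\<lambda>x. _ * x"] Phi_Nil cong: if_cong)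
qed

text \<open>Each argument is a central factor with respect to the other and can be removed: f(a, b)
  = f(1, b) = f(1, 1) = 1.\<close>

lemma fh_commuting:
  assumes lin: "\<Phi> [LX] = 0" "\<Phi> [LY] = 0"
    and F: "unip a" "unip b" "a * b = b * a"
  shows "fh a b = 1"
  using fh_central(1)[OF lin, of 1 b a] fh_central(2)[OF lin, of 1 1 b] F fh_1 by simp

end

section \<open>Relations in the braid group\<close>

text \<open>Two neighbouring generators in an arbitrary ring, so that both pairs \<open>g1\<close>,
  \<open>g2\<close> and \<open>g2\<close>, \<open>g3\<close> are instances. Products are kept nested
  to the right, and the rules that end in a variable allow rewriting inside such a product.\<close>

locale braid3 =
  fixes a b a' b' :: "'r::ring_1"
  assumes inv [simp]: "a * a' = 1" "a' * a = 1" "b * b' = 1" "b' * b = 1"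
    and braid: "a * b * a = b * a * b"
begin

lemma cancel [simp]: "a * (a' * x) = x" "a' * (a * x) = x" "b * (b' * x) = x" "b' * (b * x) = x"
  by (simp_all flip: mult.assoc)

lemma br: "b * (a * b) = a * (b * a)" "b * (a * (b * x)) = a * (b * (a * x))"
  using braid by (simp_all add: mult.assoc) (metis mult.assoc)

lemma aba: "a * (b * a) = b * (a * b)" "a * (b * (a * x)) = b * (a * (b * x))"
  by (simp_all add: br)

lemma full_a: "a * (b * (a * (a * b))) = b * (a * (a * (b * a)))"
  by (subst aba(2)) (subst br(1), rule refl)

lemma full_b: "b * (a * (b * (b * a))) = a * (b * (b * (a * b)))"
  by (subst br(2)) (subst aba(1), rule refl)

lemma full_a': "a * (b * (a * (a * (b * x)))) = b * (a * (a * (b * (a * x))))"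
  by (subst aba(2)) (subst br(2), rule refl)

lemma x13: "a * a * (b * (a * a) * b') = a * b * b * a"
proof -
  have "a * (b * (a * (a * b'))) = b * (b * a)"
  proof -
    have "a * (b * (a * (a * b'))) = b * (a * (b * (a * b')))" by (simp add: aba(2))
    also have "\<dots> = b * (b * (a * (b * b')))" by (subst aba(2)) (rule refl)
    finally show ?thesis by simp
  qed
  then show ?thesis by (simp add: mult.assoc)
qed

end

text \<open>The two ways of moving a strand past three others differ by two hexagons each. Every factor of
  either side is a conjugate of the loop around one of these hexagons.\<close>

lemma hexagon_relation:
  fixes p q r t u s1 s2 s3 T S S' p' q' r' t' u' s3' T' Si Si' :: "'r::ring_1"
  assumes inv: "p * p' = 1" "p' * p = 1" "q * q' = 1" "q' * q = 1" "r * r' = 1" "r' * r = 1"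
    "t * t' = 1" "t' * t = 1" "u * u' = 1" "u' * u = 1" "s3 * s3' = 1" "s3' * s3 = 1"
    "T * T' = 1" "T' * T = 1" "S * Si = 1" "Si * S = 1" "S' * Si' = 1" "Si' * S' = 1"
    and pent: "p * q = r * t * u" and T: "r * T = T * u" and qs: "q * s1 = s1 * q"
    and ps: "p * s3 = s3 * p" and ts: "t * s2 = s2 * t"
  shows "(T' * t * S * q' * s3 * q) * ((q' * s3' * q) * (Si * u * s1 * u' * s2 * u) * (q' * s3 * q)) =
    (u' * (T' * p * s1 * p' * S' * t) * u) * ((u' * t') * (Si' * r * s2 * r' * s3 * r) * (t * u))"
proof -
  have inv': "p * (p' * x) = x" "p' * (p * x) = x" "q * (q' * x) = x" "q' * (q * x) = x"
    "r * (r' * x) = x" "r' * (r * x) = x" "t * (t' * x) = x" "t' * (t * x) = x"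
    "u * (u' * x) = x" "u' * (u * x) = x" "s3 * (s3' * x) = x" "s3' * (s3 * x) = x"
    "T * (T' * x) = x" "T' * (T * x) = x" "S * (Si * x) = x" "Si * (S * x) = x"
    "S' * (Si' * x) = x" "Si' * (S' * x) = x" for x
    by (simp_all add: inv flip: mult.assoc)
  have L: "(T' * t * S * q' * s3 * q) * ((q' * s3' * q) * (Si * u * s1 * u' * s2 * u) * (q' * s3 * q)) =
    T' * (t * u) * s1 * u' * s2 * u * q' * s3 * q"
    by (simp add: mult.assoc inv')
  have R: "(u' * (T' * p * s1 * p' * S' * t) * u) * ((u' * t') * (Si' * r * s2 * r' * s3 * r) * (t * u)) =
    u' * T' * p * s1 * p' * r * s2 * r' * s3 * (r * t * u)"
    by (simp add: mult.assoc inv')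
  have uT: "u' * T' = T' * r'"
  proof -
    have "u' * T' * (r * T) * (T' * r') = u' * T' * (T * u) * (T' * r')" by (simp only: T)
    then show ?thesis by (simp add: mult.assoc inv inv')
  qed
  have tu: "t * u = r' * p * q"
  proof -
    have "r' * (r * t * u) = r' * (p * q)" by (simp only: pent)
    then show ?thesis by (simp add: mult.assoc inv inv')
  qed
  have pr: "p' * r = q * u' * t'"
  proof -
    have "p' * (p * q) * (u' * t') = p' * (r * t * u) * (u' * t')" by (simp only: pent)
    then show ?thesis by (simp add: mult.assoc inv inv')
  qed
  have rp: "r' * p = t * u * q'"
  proof -
    have "r' * (p * q) * q' = r' * (r * t * u) * q'" by (simp only: pent)
    then show ?thesis by (simp add: mult.assoc inv inv')
  qed
  have ts': "t' * s2 * t = s2"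
  proof -
    have "t' * (t * s2) = t' * (s2 * t)" by (simp only: ts)
    then show ?thesis by (simp add: mult.assoc inv inv')
  qed
  \<comment> \<open>The pentagon enters in the forms p^-1 r = q u^-1 t^-1 and r^-1 p = t u q^-1.
    They bring s1 next to q, s3 next to p and s2 next to t, where the commutation relations exchange
    them into the order of the left side.\<close>
  have "u' * T' * p * s1 * p' * r * s2 * r' * s3 * (r * t * u) =
     (u' * T') * p * s1 * (p' * r) * s2 * r' * s3 * (p * q)" by (simp add: pent mult.assoc)
  also have "\<dots> = T' * r' * p * s1 * (q * u' * t') * s2 * r' * (s3 * p) * q"
    by (simp only: uT pr mult.assoc)
  also have "\<dots> = T' * r' * p * (s1 * q) * u' * t' * s2 * (r' * p) * s3 * q"
    by (simp only: ps[symmetric] mult.assoc)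
  also have "\<dots> = T' * r' * p * (q * s1) * u' * t' * s2 * (t * u * q') * s3 * q"
    by (simp only: rp qs)
  also have "\<dots> = T' * (r' * p * q) * s1 * u' * (t' * s2 * t) * u * q' * s3 * q"
    by (simp only: mult.assoc)
  also have "\<dots> = T' * (t * u) * s1 * u' * s2 * u * q' * s3 * q"
    by (simp only: ts' tu)
  finally show ?thesis using L R by simp
qed

section \<open>The braid group on four strings as matrices over words in four letters\<close>

datatype strand = S1 | S2 | S3 | S4

instance strand :: finite
proof
  have "(UNIV :: strand set) = {S1, S2, S3, S4}" by (auto intro: strand.exhaust)
  then show "finite (UNIV :: strand set)" by (metis finite.emptyI finite.insertI)
qed

type_synonym bmat = "(strand, rat) tmat"

definition g1 :: bmat where "g1 = Ms S1 S2"
definition g2 :: bmat where "g2 = Ms S2 S3"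
definition g3 :: bmat where "g3 = Ms S3 S4"
definition g1' :: bmat where "g1' = Ms' S1 S2"
definition g2' :: bmat where "g2' = Ms' S2 S3"
definition g3' :: bmat where "g3' = Ms' S3 S4"

interpretation b12: braid3 g1 g2 g1' g2'
  unfolding g1_def g2_def g1'_def g2'_def by unfold_locales (simp_all add: Ms_braid[of S1 S2 S3])
interpretation b23: braid3 g2 g3 g2' g3'
  unfolding g3_def g2_def g3'_def g2'_def by unfold_locales (simp_all add: Ms_braid[of S2 S3 S4])

lemma g13: "g3 * g1 = g1 * g3" "g3 * (g1 * x) = g1 * (g3 * x)"
proof -
  show "g3 * g1 = g1 * g3" unfolding g1_def g3_def by (rule Ms_commute) simp
  then show "g3 * (g1 * x) = g1 * (g3 * x)" by (simp flip: mult.assoc)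
qed

definition "x12 = g1 * g1"
definition "x23 = g2 * g2"
definition "x34 = g3 * g3"
definition "x13 = g2 * x12 * g2'"
definition "x24 = g3 * x23 * g3'"
definition "x14 = g3 * (g2 * x12 * g2') * g3'"

lemma x_cabled:
  "x13 * x23 = g2 * g1 * g1 * g2" "x24 * x34 = g3 * g2 * g2 * g3"
  "x12 * x13 = g1 * g2 * g2 * g1" "x23 * x24 = g2 * g3 * g3 * g2"
  "x14 * (x24 * x34) = g3 * g2 * g1 * g1 * g2 * g3"
  using b12.x13 b23.x13
  by (simp_all add: x13_def x23_def x24_def x34_def x12_def x14_def mult.assoc)

text \<open>The first four are the composite arguments x13 x23, x24 x34, x12 x13, x23 x24 of the
  pentagon, and D4 = x14 x24 x34 takes strand 4 around all others. As palindromes in the generators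
  they are accessible to the braid relations.\<close>

definition "a13 = g2 * g1 * g1 * g2"
definition "b24 = g3 * g2 * g2 * g3"
definition "c12 = g1 * g2 * g2 * g1"
definition "d23 = g2 * g3 * g3 * g2"
definition "D4 = g3 * g2 * g1 * g1 * g2 * g3"

lemma ld1_x:
  "ld1 x12 (Der S1 S2)" "ld1 x23 (Der S2 S3)" "ld1 x34 (Der S3 S4)" "ld1 x13 (Der S1 S3)"
  "ld1 x24 (Der S2 S4)" "ld1 x14 (Der S1 S4)" "ld1 (g3' * x23 * g3) (Der S2 S4)" (is ?P)
  "ld1 (g3' * (g2' * x12 * g2) * g3) (Der S1 S4)" (is ?Q)
proof -
  let ?t2 = "tsp S2 S3" and ?t3 = "tsp S3 S4"
  have tt: "?t2 \<circ> ?t2 = id" "?t3 \<circ> ?t3 = id" by simp_all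
  have d: "deg0 g2 ?t2" "deg0 g2' ?t2" "deg0 g3 ?t3" "deg0 g3' ?t3"
    by (simp_all add: g2_def g2'_def g3_def g3'_def deg0_Ms)
  have c2: "ld1 x (Der i j) \<Longrightarrow> ld1 (g2 * x * g2') (Der (?t2 i) (?t2 j)) \<and> ld1 (g2' * x * g2) (Der (?t2 i) (?t2 j))" for x i j
    using ld1_conj[OF _ d(1,2) _ tt(1), of x "Der i j"] ld1_conj[OF _ d(2,1) _ tt(1), of x "Der i j"]
    by (simp add: Der_map[OF tt(1)])
  have c3: "ld1 x (Der i j) \<Longrightarrow> ld1 (g3 * x * g3') (Der (?t3 i) (?t3 j)) \<and> ld1 (g3' * x * g3) (Der (?t3 i) (?t3 j))" for x i j
    using ld1_conj[OF _ d(3,4) _ tt(2), of x "Der i j"] ld1_conj[OF _ d(4,3) _ tt(2), of x "Der i j"]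
    by (simp add: Der_map[OF tt(2)])
  show 12: "ld1 x12 (Der S1 S2)" and 23: "ld1 x23 (Der S2 S3)" and "ld1 x34 (Der S3 S4)"
    unfolding x12_def x23_def x34_def g1_def g2_def g3_def by (rule ld1_Ms_sq, simp)+
  show 13: "ld1 x13 (Der S1 S3)" using c2[OF 12] by (simp add: x13_def Transposition.transpose_def)
  show "ld1 x24 (Der S2 S4)" using c3[OF 23] by (simp add: x24_def Transposition.transpose_def)
  show "ld1 x14 (Der S1 S4)" using c3[OF 13] by (simp add: x14_def x13_def Transposition.transpose_def)
  show ?P using c3[OF 23] by (simp add: Transposition.transpose_def)
  show ?Q
    using c3[OF c2[OF 12, THEN conjunct2]] by (simp add: Transposition.transpose_def)
qed

lemma ld1_cabled:
  "ld1 a13 (\<lambda>u v. Der S1 S3 u v + Der S2 S3 u v)"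
  "ld1 b24 (\<lambda>u v. Der S2 S4 u v + Der S3 S4 u v)"
  "ld1 c12 (\<lambda>u v. Der S1 S2 u v + Der S1 S3 u v)"
  "ld1 d23 (\<lambda>u v. Der S2 S3 u v + Der S2 S4 u v)"
  "ld1 D4 (\<lambda>u v. Der S1 S4 u v + (Der S2 S4 u v + Der S3 S4 u v))"
  unfolding a13_def b24_def c12_def d23_def D4_def x_cabled[symmetric]
  by (intro ld1_mult ld1_x)+

lemma unip_x: "unip x12" "unip x23" "unip x34" "unip a13"
  "unip b24" "unip c12" "unip d23" "unip D4"
  using ld1_x ld1_cabled by (auto simp: ld1_def)

lemma shift_mult: "a * \<beta> = \<beta> * b \<Longrightarrow> c * \<beta> = \<beta> * d \<Longrightarrow> a * c * \<beta> = \<beta> * (b * d)"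
  for a b c d \<beta> :: "'r::ring_1"
  by (metis mult.assoc)

text \<open>The braid \<open>g1 * g2 * g3\<close>, which moves one strand past three, conjugates
  \<open>g1\<close> to \<open>g2\<close> and \<open>g2\<close> to \<open>g3\<close>; it therefore
  raises every index by one.\<close>

lemma shift: "x23 * (g1 * g2 * g3) = (g1 * g2 * g3) * x12" "x34 * (g1 * g2 * g3) = (g1 * g2 * g3) * x23"
  "b24 * (g1 * g2 * g3) = (g1 * g2 * g3) * a13" "d23 * (g1 * g2 * g3) = (g1 * g2 * g3) * c12"
proof -
  let ?\<beta> = "g1 * g2 * g3"
  have 1: "g2 * ?\<beta> = ?\<beta> * g1" and 2: "g3 * ?\<beta> = ?\<beta> * g2"
    using b12.aba b23.aba by (simp_all add: mult.assoc g13)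
  show "x23 * ?\<beta> = ?\<beta> * x12" "x34 * ?\<beta> = ?\<beta> * x23" "b24 * ?\<beta> = ?\<beta> * a13" "d23 * ?\<beta> = ?\<beta> * c12"
    unfolding x23_def x12_def x34_def b24_def a13_def d23_def c12_def by (intro shift_mult 1 2)+
qed

text \<open>The generator acts on strands away from the loop, on strands that run parallel inside
  it, or inside a full twist. The full twists are \<open>a13 * x12\<close> on strands 1, 2, 3,
  \<open>b24 * x23\<close> on strands 2, 3, 4, and \<open>a13 * D4\<close> on the cable of 1 and 2
  together with 3 and 4.\<close>

lemma commutes:
  "g1 * a13 = a13 * g1" "g1 * x34 = x34 * g1" "g3 * x12 = x12 * g3" "g3 * d23 = d23 * g3"
  "g2 * c12 = c12 * g2" "g2 * b24 = b24 * g2" "g1 * D4 = D4 * g1" "g2 * D4 = D4 * g2"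
  "g2 * (a13 * x12) = a13 * x12 * g2" (is ?P) "g3 * (a13 * D4) = a13 * D4 * g3" (is ?Q)
  "g3 * (b24 * x23) = b24 * x23 * g3" (is ?R)
proof -
  show a: "g1 * a13 = a13 * g1" by (simp add: a13_def mult.assoc b12.full_a)
  show "g1 * x34 = x34 * g1" "g3 * x12 = x12 * g3" by (simp_all add: x34_def x12_def mult.assoc g13)
  show "g3 * d23 = d23 * g3" by (simp add: d23_def mult.assoc b23.full_b)
  show "g2 * c12 = c12 * g2" by (simp add: c12_def mult.assoc b12.full_b)
  show b: "g2 * b24 = b24 * g2" by (simp add: b24_def mult.assoc b23.full_a)
  show "g1 * D4 = D4 * g1"
  proof -
    have "g1 * D4 = g3 * (g1 * (g2 * (g1 * (g1 * (g2 * g3)))))" by (simp add: D4_def mult.assoc g13)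
    also have "\<dots> = D4 * g1" by (simp add: b12.full_a' D4_def mult.assoc g13)
    finally show ?thesis .
  qed
  show "g2 * D4 = D4 * g2"
  proof -
    have "g2 * D4 = g3 * (g2 * (g3 * (g1 * (g1 * (g2 * g3)))))"
      using b23.aba(2) by (simp add: D4_def mult.assoc)
    also have "\<dots> = g3 * (g2 * (g1 * (g1 * (g3 * (g2 * g3)))))" by (simp add: g13)
    also have "\<dots> = D4 * g2" using b23.br(1) by (simp add: D4_def mult.assoc)
    finally show ?thesis .
  qed
  have ae: "a13 * x12 = x12 * a13" unfolding x12_def by (metis a mult.assoc)
  show ?P
  proof -
    have "a13 * x12 * g2 = x12 * a13 * g2" by (simp only: ae)
    also have "\<dots> = g2 * (a13 * x12)"
    proof -
      have "g2 * (a13 * x12) = g2 * (x12 * a13)" by (simp only: ae)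
      also have "\<dots> = (g2 * x12 * g2) * x12 * g2" by (simp add: x12_def a13_def mult.assoc)
      also have "\<dots> = a13 * x12 * g2" by (simp add: x12_def a13_def mult.assoc)
      finally show ?thesis by (simp only: ae)
    qed
    finally show ?thesis by simp
  qed
  have be: "b24 * x23 = x23 * b24" unfolding x23_def by (metis b mult.assoc)
  show ?R
  proof -
    have "g3 * (b24 * x23) = g3 * (x23 * b24)" by (simp only: be)
    also have "\<dots> = b24 * x23 * g3" by (simp add: x23_def b24_def mult.assoc)
    finally show ?thesis .
  qed
  show ?Q
  proof -
    have 1: "a13 * D4 = g2 * (g3 * (x12 * (g2 * (x12 * (g2 * (g3 * g2))))))"
    proof -
      have "a13 * D4 = g2 * (g1 * (g1 * (g2 * (g3 * (g2 * (g1 * (g1 * (g2 * g3))))))))"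
        by (simp add: a13_def D4_def mult.assoc)
      also have "\<dots> = g2 * (g1 * (g1 * (g3 * (g2 * (g3 * (g1 * (g1 * (g2 * g3))))))))"
        by (simp add: b23.aba(2))
      also have "\<dots> = g2 * (g3 * (g1 * (g1 * (g2 * (g1 * (g1 * (g3 * (g2 * g3))))))))"
        by (simp add: g13)
      also have "\<dots> = g2 * (g3 * (x12 * (g2 * (x12 * (g2 * (g3 * g2))))))"
        by (simp add: b23.br(1) x12_def mult.assoc)
      finally show ?thesis .
    qed
    have e: "g2 * (x12 * (g2 * (x12 * x))) = x12 * (g2 * (x12 * (g2 * x)))" for x
    proof -
      have "g2 * (x12 * (g2 * (x12 * x))) = (a13 * x12) * x" by (simp add: a13_def x12_def mult.assoc)
      also have "\<dots> = x12 * (g2 * (x12 * (g2 * x)))" unfolding ae by (simp add: a13_def x12_def mult.assoc)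
      finally show ?thesis .
    qed
    have "g3 * (a13 * D4) = g2 * (g3 * (g2 * (x12 * (g2 * (x12 * (g2 * (g3 * g2)))))))"
      unfolding 1 by (simp add: b23.aba(2))
    also have "\<dots> = g2 * (g3 * (x12 * (g2 * (x12 * (g2 * (g2 * (g3 * g2)))))))" by (simp only: e)
    also have "\<dots> = a13 * D4 * g3" unfolding 1 by (simp add: mult.assoc b23.br(1))
    finally show ?thesis .
  qed
qed

lemma qm_ui: "unip a \<Longrightarrow> qm (ui a) = ui (qm a :: ('i::finite, 'k::qalg) tmat)"
proof -
  assume a: "unip a"
  have "qm a * qm (ui a) = (1 :: ('i, 'k) tmat)" "qm (ui a) * qm a = (1 :: ('i, 'k) tmat)"
    unfolding qm_mult[symmetric] using ui[OF Fil1_unit[OF a]] by simp_all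
  then show ?thesis unfolding ui_def[of "qm a"] by (intro Ugr_inv[symmetric])
qed

lemma pw_ui:
  assumes a: "unip a"
  shows "pw m (qm (ui a)) = pw (- m) (qm a :: ('i::finite, 'k::qalg) tmat)"
proof -
  have "lg (qm (ui a)) = - lg (qm a :: ('i, 'k) tmat)"
    using lg_inverse(1)[OF qm_Fil1[OF a], of "qm (ui a)"] ui(1)[OF Fil1_unit[OF a]]
    by (simp flip: qm_mult)
  then show ?thesis by (simp add: pw_def ex_minus)
qed

lemma qm_intertwine: "c * a = b * c \<Longrightarrow> qm c * qm a = qm b * qm c"
  by (simp flip: qm_mult)

section \<open>The pentagon for f as a matrix identity, and its linear terms\<close>

locale pentagon_limit = ratlim lim \<Phi>
  for lim :: "(letter gword set \<Rightarrow> rat) \<Rightarrow> 'k::qalg \<Rightarrow> bool" and \<Phi> +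
  assumes pent: "lim (\<lambda>g. ent (F2hom Ugr x12 (x23 * x24) g * F2hom Ugr (x13 * x23) x34 g -
      F2hom Ugr x23 x34 g * F2hom Ugr (x12 * x13) (x24 * x34) g * F2hom Ugr x12 x23 g) u v) 0"
begin

lemma pentagon_fh: "fh x12 d23 * fh a13 x34 = fh x23 x34 * fh c12 b24 * fh x12 x23"
proof (rule tmat_eqI)
  fix u v
  let ?L = "\<lambda>g. F2hom Ugr x12 (x23 * x24) g * F2hom Ugr (x13 * x23) x34 g"
  let ?R = "\<lambda>g. F2hom Ugr x23 x34 g * F2hom Ugr (x12 * x13) (x24 * x34) g * F2hom Ugr x12 x23 g"
  have L: "tl ?L (fh x12 d23 * fh a13 x34)" and R: "tl ?R (fh x23 x34 * fh c12 b24 * fh x12 x23)"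
    unfolding x_cabled a13_def[symmetric] b24_def[symmetric] c12_def[symmetric] d23_def[symmetric]
    by (intro tl_mult tl_fh unip_x)+
  have "lim (\<lambda>g. ent (?L g) u v + - 1 * ent (?R g) u v)
     (ent (fh x12 d23 * fh a13 x34) u v + qi (- 1) * ent (fh x23 x34 * fh c12 b24 * fh x12 x23) u v)"
    using L R unfolding tl_def by (intro lim_add lim_cmult) auto
  then have "lim (\<lambda>g. ent (?L g - ?R g) u v)
     (ent (fh x12 d23 * fh a13 x34) u v + qi (- 1) * ent (fh x23 x34 * fh c12 b24 * fh x12 x23) u v)"
    by simp
  from lim_unique[OF this pent] show "ent (fh x12 d23 * fh a13 x34) u v = ent (fh x23 x34 * fh c12 b24 * fh x12 x23) u v"
    by (simp add: qi_minus eq_neg_iff_add_eq_0)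
qed

text \<open>In degree one only words of length at most one contribute, and log c agrees with c - 1
  modulo \<open>Fil 2\<close>.\<close>

lemma ld1_fh:
  assumes "ld1 a D" "ld1 b E"
  shows "ld1 (fh a b) (\<lambda>u v. \<Phi> [LX] * qi (D u v) + \<Phi> [LY] * qi (E u v))"
  unfolding ld1_def
proof (intro conjI allI impI)
  have F: "unip a" "unip b" using assms by (auto simp: ld1_def)
  then show "unip (fh a b)" by (rule fh_Fil)
  fix u v :: "'a list" assume l: "length u = length v + 1"
  have lw1: "lw 1 = {[], [LX], [LY]}"
    by (auto simp: One_nat_def le_Suc_eq length_Suc_conv) (metis letter.exhaust)
  have lge: "ent (lg c) u v = ent c u v" if "unip c" for c :: "('a, 'k) tmat"
  proof -
    have "lg c - (c - 1) = ev1 (lnf - fps_X) (c - 1)" using that by (simp add: lg_def ev1_diff)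
    also have "\<dots> \<in> Fil 2"
      by (rule ev1_Fil[OF that]) (auto simp: lnf_def fps_ln_nth fps_X_def less_2_cases_iff One_nat_def)
    finally have "ent (lg c - (c - 1)) u v = 0" by (rule FilD) (use l in simp)
    then show ?thesis using l by (auto simp: ent_1)
  qed
  have "ent (fh a b) u v = (\<Sum>w\<in>lw 1. \<Phi> w * ent (wd (pr (lg (qm a)) (lg (qm b))) w) u v)"
    unfolding fh_def by (rule ent_ev) (use F l in auto)
  also have "\<dots> = \<Phi> [LX] * ent (qm a) u v + \<Phi> [LY] * ent (qm b) u v"
    unfolding lw1 using l F by (auto simp: ent_1 lge)
  finally show "ent (fh a b) u v = \<Phi> [LX] * qi (D u v) + \<Phi> [LY] * qi (E u v)"
    using assms l by (simp add: ld1_def)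
qed

lemma Phi_linear: "\<Phi> [LX] = 0" "\<Phi> [LY] = 0"
proof -
  note f1 = ld1_fh[OF ld1_x(1) ld1_cabled(4)] and f2 = ld1_fh[OF ld1_cabled(1) ld1_x(3)]
  note f3 = ld1_fh[OF ld1_x(2) ld1_x(3)] and f4 = ld1_fh[OF ld1_cabled(3) ld1_cabled(2)]
  note f5 = ld1_fh[OF ld1_x(1) ld1_x(2)]
  note L = ld1_mult[OF f1 f2, unfolded pentagon_fh] and R = ld1_mult[OF ld1_mult[OF f3 f4] f5]
  have e: "\<Phi> [LX] * qi (Der S1 S2 u v) + \<Phi> [LY] * qi (Der S2 S3 u v + Der S2 S4 u v) +
     (\<Phi> [LX] * qi (Der S1 S3 u v + Der S2 S3 u v) + \<Phi> [LY] * qi (Der S3 S4 u v)) =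
     \<Phi> [LX] * qi (Der S2 S3 u v) + \<Phi> [LY] * qi (Der S3 S4 u v) +
     (\<Phi> [LX] * qi (Der S1 S2 u v + Der S1 S3 u v) + \<Phi> [LY] * qi (Der S2 S4 u v + Der S3 S4 u v)) +
     (\<Phi> [LX] * qi (Der S1 S2 u v) + \<Phi> [LY] * qi (Der S2 S3 u v))"
    if "length u = length v + 1" for u v
    using L R that unfolding ld1_def by metis
  \<comment> \<open>At this entry only \<open>Der S1 S2\<close> is nonzero. The infinitesimal braid
    t_12 occurs once on the left of the pentagon and twice on the right, so the coefficient equals
    its double. The next line does the same with t_34.\<close>
  show "\<Phi> [LX] = 0" using e[of "[S2, S1]" "[S1]"] by simp
  show "\<Phi> [LY] = 0" using e[of "[S4, S3]" "[S3]"] by simp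
qed

end

section \<open>The loop around a hexagon and the relation between four such loops\<close>

locale pentlim = pentagon_limit lim \<Phi>
  for lim :: "(letter gword set \<Rightarrow> rat) \<Rightarrow> 'k::qalg \<Rightarrow> bool" and \<Phi> +
  assumes two: "lim (\<lambda>g. ser (g \<star> F2hom F2 F2_y F2_x g) w) (delta w)"
begin

lemma fh_swap: "unip a \<Longrightarrow> unip b \<Longrightarrow> fh a b * fh b a = 1"
proof -
  assume ab: "unip a" "unip b"
  note u = Fil1_unit[OF ab(1)] Fil1_unit[OF ab(2)]
  interpret F: group F2 by (rule group_F2)
  note h = F2hom[OF group_Ugr u]
  have sw: "F2hom F2 F2_y F2_x g \<in> carrier F2" if "g \<in> carrier F2" for g
    using that by (intro F2hom_closed group_F2) auto
  have "tl (\<lambda>g. F2hom Ugr a b (g \<star> F2hom F2 F2_y F2_x g)) (ev delta (pr (lg (qm a)) (lg (qm b))))"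
    by (rule tl_ser[OF ab]) (use two sw in auto)
  moreover have "F2hom Ugr a b (g \<star> F2hom F2 F2_y F2_x g) = F2hom Ugr a b g * F2hom Ugr b a g"
    if "g \<in> carrier F2" for g
    using that sw[OF that] h F2hom_comp[OF group_F2 group_Ugr h(1), of F2_y F2_x g] by (simp add: hom_def)
  ultimately have "tl (\<lambda>g. F2hom Ugr a b g * F2hom Ugr b a g) (ev delta (pr (lg (qm a)) (lg (qm b))))"
    by (rule tl_cong[rotated]) auto
  moreover have "tl (\<lambda>g. F2hom Ugr a b g * F2hom Ugr b a g) (fh a b * fh b a)"
    by (intro tl_mult tl_fh ab)
  ultimately have "fh a b * fh b a = ev delta (pr (lg (qm a)) (lg (qm b)))" by (rule tl_unique[rotated])
  also have "\<dots> = 1" by (rule ev_delta) (use ab in auto)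
  finally show ?thesis .
qed

definition hexa :: "'k \<Rightarrow> ('i::finite, rat) tmat \<Rightarrow> ('i, rat) tmat \<Rightarrow> ('i, 'k) tmat" where
  "hexa m z y = fh z (ui (y * z)) * pw m (qm z) * fh y z * pw m (qm y) * fh (ui (y * z)) y * pw m (qm (ui (y * z)))"

lemma hexagon_factor:
  fixes z y C \<beta> \<beta>' S0 s0 e1 e2 \<xi> \<upsilon> :: "('i::finite, rat) tmat"
  assumes F: "unip z" "unip y" "unip C" "unip e1" "unip e2"
    "unip (\<xi>)" "unip (\<upsilon>)"
    and C': "C * D = D * C" "C * y = y * C"
    and D: "D = y * z" and x': "x' = ui D * C"
    and b: "\<beta>' * \<beta> = 1" "S0 * s0 = \<beta>"
    and e: "e1 * \<beta> = \<beta> * z" "e2 * \<beta> = \<beta> * x'"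
    and s: "\<xi> * s0 = s0 * z" "\<upsilon> * s0 = s0 * y"
  shows "pw (- m) (qm D) * qm \<beta>' * fh e1 e2 * (qm S0 * pw m (qm \<xi>)) * fh \<upsilon> \<xi> * (qm s0 * pw m (qm y)) * fh x' y =
    pw (- m) (qm D) * hexa m z y * pw m (qm D)"
proof -
  have DF: "unip D" unfolding D by (intro Fil1_mult F)
  then have uF: "unip (ui D)" by (rule Fil1_ui)
  have xF: "unip x'" unfolding x' by (intro Fil1_mult F uF)
  note CD = C'(1)
  have C: "C * z = z * C" "C * y = y * C"
  proof -
    have "ui y * (C * D) = ui y * (D * C)" by (simp only: CD)
    moreover have "ui y * (C * D) = ui y * (C * y) * z" "ui y * (D * C) = (ui y * y) * z * C"
      by (simp_all only: D mult.assoc)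
    moreover have "ui y * (C * y) * z = (ui y * y) * C * z" by (simp only: C'(2) mult.assoc)
    ultimately show "C * z = z * C" by (simp add: ui[OF Fil1_unit[OF F(2)]])
  qed (rule C')
  have Cu: "ui D * C = C * ui D"
  proof -
    have "ui D * (C * D) * ui D = ui D * (D * C) * ui D" by (simp only: CD)
    moreover have "ui D * (C * D) * ui D = ui D * C * (D * ui D)" "ui D * (D * C) * ui D = (ui D * D) * (C * ui D)"
      by (simp_all only: mult.assoc)
    ultimately show ?thesis by (simp add: ui[OF Fil1_unit[OF DF]])
  qed
  have fx: "fh z x' = fh z (ui D)" "fh x' y = fh (ui D) y"
    unfolding x'
    by (rule fh_central(2)[OF Phi_linear F(1) uF F(3) C(1)[symmetric] Cu],
        rule fh_central(1)[OF Phi_linear uF F(2) F(3) Cu C(2)[symmetric]])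
  have 1: "fh e1 e2 * qm \<beta> = qm \<beta> * fh z x'" by (rule fh_intertwine[symmetric]) (use F xF e in auto)
  have 2: "pw m (qm \<xi>) * qm s0 = qm s0 * pw m (qm z)"
    by (rule pw_intertwine[symmetric]) (use F s in \<open>auto simp: qm_intertwine\<close>)
  have 3: "fh \<upsilon> \<xi> * qm s0 = qm s0 * fh y z" by (rule fh_intertwine[symmetric]) (use F s in auto)
  have bb: "qm \<beta>' * qm \<beta> = (1 :: ('i, 'k) tmat)" "qm S0 * qm s0 = (qm \<beta> :: ('i, 'k) tmat)"
    using b by (simp_all flip: qm_mult)
  have "qm \<beta>' * fh e1 e2 * (qm S0 * pw m (qm \<xi>)) * fh \<upsilon> \<xi> * (qm s0 * pw m (qm y)) * fh x' y =
     qm \<beta>' * fh e1 e2 * qm S0 * pw m (qm \<xi>) * (fh \<upsilon> \<xi> * qm s0) * pw m (qm y) * fh x' y"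
    by (simp only: mult.assoc)
  also have "\<dots> = qm \<beta>' * fh e1 e2 * qm S0 * (pw m (qm \<xi>) * qm s0) * fh y z * pw m (qm y) * fh x' y"
    by (simp only: 3 mult.assoc)
  also have "\<dots> = qm \<beta>' * fh e1 e2 * (qm S0 * qm s0) * pw m (qm z) * fh y z * pw m (qm y) * fh x' y"
    by (simp only: 2 mult.assoc)
  also have "\<dots> = qm \<beta>' * (fh e1 e2 * qm \<beta>) * pw m (qm z) * fh y z * pw m (qm y) * fh x' y"
    by (simp only: bb mult.assoc)
  also have "\<dots> = (qm \<beta>' * qm \<beta>) * fh z (ui D) * pw m (qm z) * fh y z * pw m (qm y) * fh (ui D) y"
    by (simp only: 1 fx mult.assoc)
  also have "\<dots> = hexa m z y * pw m (qm D)"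
    using pw_inv(2)[OF qm_Fil1[OF DF], of m]
    by (simp add: hexa_def D[symmetric] pw_ui[OF DF] bb mult.assoc)
  finally show ?thesis by (simp add: mult.assoc)
qed

text \<open>The hexagons sit at (z, y) = (zA, x34), (z123, x23), (zB, b24), (z234, x34), with yz
  equal to D4, a13, D4, b24: a loop around several strands is the product of loops around two parts
  of them. To first order zA, zB and z234 are t_14 + t_24, t_14 and t_24.\<close>

definition "zA = ui x34 * D4"
definition "zB = g3' * (g2' * x12 * g2) * g3"
definition "z123 = g2' * x12 * g2"
definition "z234 = g3' * x23 * g3"

lemma ui_eq: "a * b = 1 \<Longrightarrow> b * a = 1 \<Longrightarrow> ui a = (b :: 'a::ring_1)"
  unfolding ui_def by (rule Ugr_inv)

lemma zA: "zA = g3' * a13 * g3"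
proof -
  have "ui x34 = g3' * g3'" by (rule ui_eq) (simp_all add: x34_def mult.assoc)
  then show ?thesis by (simp add: zA_def D4_def a13_def mult.assoc)
qed

lemma z_D: "x34 * zA = D4" "x23 * z123 = a13" "b24 * zB = D4" "x34 * z234 = b24"
  unfolding zA by (simp_all add: x34_def a13_def x23_def z123_def b24_def zB_def z234_def D4_def x12_def mult.assoc)

lemma unip_z: "unip zA" "unip z123" "unip zB" "unip z234"
proof -
  have conj: "a * b = 1 \<Longrightarrow> unip x \<Longrightarrow> unip (a * x * b)" for a b x :: bmat
  proof -
    assume "a * b = 1" "unip x"
    moreover have "a * (x - 1) * b = a * x * b - a * b" by (simp add: algebra_simps)
    ultimately show ?thesis using Fil_multR[OF Fil_multL, of "x - 1" 1 a b] by simp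
  qed
  show "unip zA" unfolding zA by (rule conj) (simp_all add: unip_x)
  show 123: "unip z123" unfolding z123_def by (rule conj) (simp_all add: unip_x)
  show "unip zB" unfolding zB_def z123_def[symmetric] by (rule conj) (simp_all add: 123)
  show "unip z234" unfolding z234_def by (rule conj) (simp_all add: unip_x)
qed

end

context pentlim
begin

lemma comm_mult: "C * a = a * C \<Longrightarrow> C * b = b * C \<Longrightarrow> C * (a * b) = a * b * (C :: 'r::ring_1)"
  by (metis mult.assoc)

lemma shift_comp: "r * b = b * u \<Longrightarrow> u * c = c * u \<Longrightarrow> r * (b * c) = b * c * (u :: 'r::ring_1)"
  by (metis mult.assoc)

lemma commutes_C:
  "D4 * a13 * D4 = D4 * (D4 * a13)" (is ?P) "D4 * a13 * x34 = x34 * (D4 * a13)" (is ?Q)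
  "a13 * x12 * a13 = a13 * (a13 * x12)" (is ?R) "a13 * x12 * x23 = x23 * (a13 * x12)" (is ?S)
  "D4 * c12 * D4 = D4 * (D4 * c12)" (is ?T) "D4 * c12 * b24 = b24 * (D4 * c12)" (is ?U)
  "b24 * x23 * b24 = b24 * (b24 * x23)" (is ?V) "b24 * x23 * x34 = x34 * (b24 * x23)" (is ?W)
proof -
  have 1: "D4 * g1 = g1 * D4" and 2: "D4 * g2 = g2 * D4" using commutes(7,8) by simp_all
  have da: "D4 * a13 = a13 * D4" unfolding a13_def by (intro comm_mult 1 2)
  have dc: "D4 * c12 = c12 * D4" unfolding c12_def by (intro comm_mult 1 2)
  have dx: "D4 * x12 = x12 * D4" unfolding x12_def by (intro comm_mult 1 2)
  show ?P by (rule comm_mult[OF refl da, symmetric])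
  have 3: "D4 * a13 * g3 = g3 * (D4 * a13)" using commutes(10) by (simp only: da)
  then show ?Q unfolding x34_def by (intro comm_mult)
  have ae: "a13 * x12 = x12 * a13" unfolding x12_def using commutes(1) by (intro comm_mult) simp_all
  show ?R by (rule comm_mult[OF refl ae, symmetric])
  have 4: "a13 * x12 * g2 = g2 * (a13 * x12)" using commutes(9) by simp
  then show ?S unfolding x23_def by (intro comm_mult)
  show ?T by (rule comm_mult[OF refl dc, symmetric])
  \<comment> \<open>The full twist on four strands, which commutes with \<open>g2\<close> and
    \<open>g3\<close> and hence with \<open>b24\<close>. The product \<open>D4 * c12\<close> differs
    from it by the inverse of \<open>x23\<close>, which commutes with \<open>b24\<close> as
    well.\<close>
  let ?Z = "D4 * a13 * x12"
  have Z2: "?Z * g2 = g2 * ?Z"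
    using comm_mult[OF 2[symmetric] 4[symmetric]] by (simp only: mult.assoc)
  have Z3: "?Z * g3 = g3 * ?Z" by (rule comm_mult[OF 3[symmetric] commutes(3), symmetric])
  have Zb: "?Z * b24 = b24 * ?Z" unfolding b24_def by (intro comm_mult Z2 Z3)
  have cx: "c12 * x23 = a13 * x12"
  proof -
    have "c12 * x23 = g1 * (g2 * (g2 * (g1 * (g2 * g2))))" by (simp add: c12_def x23_def mult.assoc)
    also have "\<dots> = g1 * (g2 * (g1 * (g2 * (g1 * g2))))" by (subst b12.br(2)) (rule refl)
    also have "\<dots> = g1 * (g1 * (g2 * (g1 * (g1 * g2))))" by (subst b12.br(2)) (rule refl)
    also have "\<dots> = x12 * a13" by (simp add: x12_def a13_def mult.assoc)
    finally show ?thesis by (simp only: ae)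
  qed
  have C: "D4 * c12 = ?Z * (g2' * g2')"
  proof -
    have "?Z * (g2' * g2') = D4 * (c12 * x23) * (g2' * g2')" by (simp only: cx mult.assoc)
    then show ?thesis by (simp add: x23_def mult.assoc)
  qed
  have b2: "b24 * g2' = g2' * b24"
  proof -
    have "g2' * (b24 * g2) * g2' = g2' * (g2 * b24) * g2'" by (simp only: commutes(6))
    then show ?thesis by (simp add: mult.assoc)
  qed
  show ?U
  proof -
    have "b24 * (g2' * g2') = g2' * g2' * b24" by (intro comm_mult b2)
    from comm_mult[OF Zb[symmetric] this] show ?thesis by (simp only: C)
  qed
  have bx: "b24 * x23 = x23 * b24" unfolding x23_def using commutes(6) by (intro comm_mult) simp_all
  show ?V by (rule comm_mult[OF refl bx, symmetric])
  show ?W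
    unfolding x34_def using commutes(11) by (intro comm_mult) simp_all
qed

lemma ui_cancel: "unip a \<Longrightarrow> ui a * (a * b) = b"
  for a b :: "('i::finite, 'l::qalg) tmat"
  using ui(2)[OF Fil1_unit, of a] by (simp flip: mult.assoc)

text \<open>Each left side runs once around a hexagon, alternating reassociations f with crossings
  weighted by m-th powers. The element C is the full twist of the three strands or cables involved:
  (12), 3, 4 in the first case, 1, 2, 3 in the second, 1, (23), 4 in the third and 2, 3, 4 in the
  last. The braid \<beta> moves one of them past the other two.\<close>

lemma hexagon_values:
  "pw (- m) (qm D4) * qm (g3' * g2' * g1') * fh c12 b24 * (qm (g1 * g2) * pw m (qm a13)) * fh x34 a13 *
     (qm g3 * pw m (qm x34)) * fh a13 x34 = pw (- m) (qm D4) * hexa m zA x34 * pw m (qm D4)" (is ?P)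
  "pw (- m) (qm a13) * qm (g2' * g1') * fh x12 x23 * (qm g1 * pw m (qm x12)) * fh x23 x12 *
     (qm g2 * pw m (qm x23)) * fh x12 x23 = pw (- m) (qm a13) * hexa m z123 x23 * pw m (qm a13)" (is ?Q)
  "pw (- m) (qm D4) * qm (g3' * g2' * g1') * fh x12 d23 * (qm g1 * pw m (qm x12)) * fh d23 x12 *
     (qm (g2 * g3) * pw m (qm b24)) * fh c12 b24 = pw (- m) (qm D4) * hexa m zB b24 * pw m (qm D4)" (is ?R)
  "pw (- m) (qm b24) * qm (g3' * g2') * fh x23 x34 * (qm g2 * pw m (qm x23)) * fh x34 x23 *
     (qm g3 * pw m (qm x34)) * fh x23 x34 = pw (- m) (qm b24) * hexa m z234 x34 * pw m (qm b24)" (is ?S)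
proof -
  note a = mult.assoc
  show ?P
  proof (rule hexagon_factor[where C = "D4 * a13" and \<beta> = "g1 * g2 * g3"])
    show "c12 * (g1 * g2 * g3) = g1 * g2 * g3 * zA"
      by (simp add: zA c12_def a13_def a)
  qed (simp_all only: unip_x unip_z commutes_C Fil1_mult shift z_D ui_cancel, simp_all add: zA x34_def a)
  show ?Q
  proof (rule hexagon_factor[where C = "a13 * x12" and \<beta> = "g1 * g2"])
    show "x23 * (g1 * g2) = g1 * g2 * x12" using b12.aba by (simp add: x23_def x12_def a)
  qed (simp_all only: unip_x unip_z commutes_C Fil1_mult z_D ui_cancel, simp_all add: z123_def x12_def x23_def a)
  show ?R
  proof (rule hexagon_factor[where C = "D4 * c12" and \<beta> = "g1 * g2 * g3"])
  qed (simp_all only: unip_x unip_z commutes_C Fil1_mult shift z_D ui_cancel, simp_all add: zB_def x12_def d23_def b24_def a)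
  show ?S
  proof (rule hexagon_factor[where C = "b24 * x23" and \<beta> = "g2 * g3"])
    show "x34 * (g2 * g3) = g2 * g3 * x23" using b23.aba by (simp add: x23_def x34_def a)
  qed (simp_all only: unip_x unip_z commutes_C Fil1_mult z_D ui_cancel, simp_all add: z234_def x34_def x23_def a)
qed

lemma fh_commutes:
  assumes "unip a" "unip b" "c * a = a * c" "c * b = b * c"
  shows "fh a b * qm c = qm c * fh a b"
  by (rule fh_intertwine[symmetric]) (use assms in auto)

lemma fh_commutes_pw:
  assumes F: "unip a" "unip b" "unip c" "c * a = a * c" "c * b = b * c"
  shows "fh a b * pw m (qm c) = pw m (qm c) * fh a b"
  by (rule pw_intertwine) (use F fh_commutes[OF F(1,2,4,5)] in auto)

lemma fh_commutes_sq:
  assumes F: "unip a" "unip b" "unip (c * c)" "c * a = a * c" "c * b = b * c"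
  shows "fh a b * (qm c * pw m (qm (c * c))) = (qm c * pw m (qm (c * c))) * fh a b"
proof -
  have "c * c * a = a * (c * c)" "c * c * b = b * (c * c)" using F(4,5) by (metis mult.assoc)+
  then show ?thesis
    by (intro comm_mult fh_commutes fh_commutes_pw F)
qed

lemma hexagon_relation_hexa:
  obtains W1 W2 W3 W4 W1' W2' W3' W4' :: "(strand, 'k) tmat"
  where "unip W1" "unip W2" "unip W3" "unip W4"
    "W1' * W1 = 1" "W2' * W2 = 1" "W3' * W3 = 1" "W4' * W4 = 1"
    "(W1' * hexa m zA x34 * W1) * (W2' * hexa m zB z234 * W2) =
     (W3' * hexa m zB b24 * W3) * (W4' * hexa m z234 x34 * W4)"
proof -
  note P = pw_inv[OF qm_Fil1, of _ m] and sw = fh_swap[OF unip_x(1,7)] fh_swap[OF unip_x(7,1)]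
    fh_swap[OF unip_x(4,3)] fh_swap[OF unip_x(3,4)] fh_swap[OF unip_x(2,3)] fh_swap[OF unip_x(3,2)]
    fh_swap[OF unip_x(6,5)] fh_swap[OF unip_x(5,6)] fh_swap[OF unip_x(1,2)] fh_swap[OF unip_x(2,1)]
  let ?q = "fh a13 x34" and ?q' = "fh x34 a13" and ?u = "fh x12 x23" and ?u' = "fh x23 x12"
    and ?t = "fh c12 b24" and ?t' = "fh b24 c12"
  let ?s3 = "qm g3 * pw m (qm x34)" and ?s3' = "pw (- m) (qm x34) * qm g3'"
  have PI: "(qm a * pw m (qm x)) * (pw (- m) (qm x) * qm b) = (1 :: (strand, 'k) tmat)"
    "(pw (- m) (qm x) * qm b) * (qm a * pw m (qm x)) = (1 :: (strand, 'k) tmat)"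
    if "a * b = 1" "b * a = 1" "unip x" for a b x
  proof -
    have 1: "qm a * qm b = (1 :: (strand, 'k) tmat)" "qm b * qm a = (1 :: (strand, 'k) tmat)"
      using that by (simp_all flip: qm_mult)
    have "(qm a * pw m (qm x)) * (pw (- m) (qm x) * qm b) = qm a * (pw m (qm x) * pw (- m) (qm x)) * qm b"
      "(pw (- m) (qm x) * qm b) * (qm a * pw m (qm x)) = pw (- m) (qm x) * (qm b * qm a) * (pw m (qm x) :: (strand, 'k) tmat)"
      by (simp_all only: mult.assoc)
    then show "(qm a * pw m (qm x)) * (pw (- m) (qm x) * qm b) = (1 :: (strand, 'k) tmat)"
      "(pw (- m) (qm x) * qm b) * (qm a * pw m (qm x)) = (1 :: (strand, 'k) tmat)"
      by (simp_all add: 1 P that)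
  qed
  have rel: "(pw (- m) (qm D4) * qm (g3' * g2' * g1') * ?t * (qm (g1 * g2) * pw m (qm a13)) * ?q' * ?s3 * ?q) *
     ((?q' * ?s3' * ?q) * (pw (- m) (qm a13) * qm (g2' * g1') * ?u * (qm g1 * pw m (qm x12)) * ?u' *
       (qm g2 * pw m (qm x23)) * ?u) * (?q' * ?s3 * ?q)) =
    (?u' * (pw (- m) (qm D4) * qm (g3' * g2' * g1') * fh x12 d23 * (qm g1 * pw m (qm x12)) * fh d23 x12 *
       (qm (g2 * g3) * pw m (qm b24)) * ?t) * ?u) *
    ((?u' * ?t') * (pw (- m) (qm b24) * qm (g3' * g2') * fh x23 x34 * (qm g2 * pw m (qm x23)) * fh x34 x23 *
       ?s3 * fh x23 x34) * (?t * ?u))"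
  proof (rule hexagon_relation[OF sw(1-10)])
    show "fh x23 x34 * (qm (g1 * g2 * g3) * pw m (qm D4)) = (qm (g1 * g2 * g3) * pw m (qm D4)) * ?u"
    proof -
      let ?\<beta> = "qm (g1 * g2 * g3)"
      have A: "fh x23 x34 * ?\<beta> = ?\<beta> * ?u"
        by (rule fh_intertwine[symmetric]) (simp_all add: unip_x shift)
      have B: "?u * pw m (qm D4) = pw m (qm D4) * ?u"
      proof (rule fh_commutes_pw)
        show "D4 * x12 = x12 * D4" "D4 * x23 = x23 * D4" unfolding x12_def x23_def
          using commutes(7,8) by (intro comm_mult; simp)+
      qed (simp_all add: unip_x)
      show ?thesis by (rule shift_comp[OF A B])
    qed
    show "?q * (qm g1 * pw m (qm x12)) = (qm g1 * pw m (qm x12)) * ?q" unfolding x12_def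
      by (rule fh_commutes_sq) (simp_all add: unip_x commutes flip: x12_def)
    show "fh x12 d23 * ?s3 = ?s3 * fh x12 d23" unfolding x34_def
      by (rule fh_commutes_sq) (simp_all add: unip_x commutes flip: x34_def)
    show "?t * (qm g2 * pw m (qm x23)) = (qm g2 * pw m (qm x23)) * ?t" unfolding x23_def
      by (rule fh_commutes_sq) (simp_all add: unip_x commutes flip: x23_def)
  qed ((rule PI; simp add: unip_x mult.assoc)+, rule pentagon_fh)
  \<comment> \<open>This hexagon involves only strands 1, 2, 3. Conjugation by \<open>g3\<close>
    replaces strand 3 by strand 4, so that all four hexagons have arguments whose linear parts are
    sums of t_14, t_24, t_34, where leading terms can be compared in a free algebra.\<close>
  have sh: "qm g3' * hexa m z123 x23 * qm g3 = hexa m zB z234"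
  proof -
    let ?d = "ui (x23 * z123)" and ?e = "ui (z234 * zB)"
    have zz: "g3 * zB = z123 * g3" "g3 * z234 = x23 * g3" by (simp_all add: zB_def z123_def z234_def mult.assoc)
    have F: "unip (x23 * z123)" "unip (z234 * zB)" by (intro Fil1_mult unip_x unip_z)+
    have "g3 * (z234 * zB) = (x23 * z123) * g3" by (rule itw_mult[unfolded itw_def, OF zz(2) zz(1)])
    then have "?d * (g3 * (z234 * zB)) * ?e = ?d * ((x23 * z123) * g3) * ?e" by simp
    moreover have "?d * (g3 * (z234 * zB)) * ?e = ?d * g3 * ((z234 * zB) * ?e)"
      "?d * ((x23 * z123) * g3) * ?e = (?d * (x23 * z123)) * g3 * ?e" by (simp_all only: mult.assoc)
    ultimately have de: "g3 * ?e = ?d * g3" by (simp add: ui[OF Fil1_unit[OF F(1)]] ui[OF Fil1_unit[OF F(2)]])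
    have uF: "unip ?d" "unip ?e" using F by (auto intro: Fil1_ui)
    let ?G = "qm g3 :: (strand, 'k) tmat"
    have f: "?G * fh zB ?e = fh z123 ?d * ?G" "?G * fh z234 zB = fh x23 z123 * ?G" "?G * fh ?e z234 = fh ?d x23 * ?G"
      by (rule fh_intertwine; simp add: unip_x unip_z uF zz de)+
    have p: "?G * pw m (qm zB) = pw m (qm z123) * ?G" "?G * pw m (qm z234) = pw m (qm x23) * ?G"
      "?G * pw m (qm ?e) = pw m (qm ?d) * ?G"
      by (rule pw_intertwine; simp add: unip_x unip_z uF zz de flip: qm_mult)+
    have H: "?G * hexa m zB z234 = hexa m z123 x23 * ?G" unfolding hexa_def by (intro itw_mult[unfolded itw_def] f p)
    have "qm g3' * hexa m z123 x23 * ?G = (qm g3' * ?G) * hexa m zB z234" by (simp only: H mult.assoc)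
    then show ?thesis by (simp flip: qm_mult)
  qed
  \<comment> \<open>A conjugating factor has to be unipotent to leave leading terms unchanged. The
    crossing \<open>g3\<close> alone is not, but it occurs together with its inverse around a
    unipotent element.\<close>
  let ?V = "qm g3' * (pw m (qm a13) * ?q') * qm g3" and ?V' = "qm g3' * (?q * pw (- m) (qm a13)) * qm g3"
  have gg: "qm g3 * qm g3' = (1 :: (strand, 'k) tmat)" "qm g3' * qm g3 = (1 :: (strand, 'k) tmat)"
    by (simp_all flip: qm_mult)
  have VF: "unip ?V"
  proof -
    have F: "unip (pw m (qm a13) * ?q')" by (intro Fil1_mult pw_Fil qm_Fil1 fh_Fil unip_x)
    have "qm g3' * (pw m (qm a13) * ?q' - 1) * qm g3 = ?V - qm g3' * qm g3"
      unfolding right_diff_distrib left_diff_distrib by simp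
    then show ?thesis using Fil_multR[OF Fil_multL[OF F], of "qm g3'" "qm g3"] by (simp add: gg)
  qed
  have V: "?V' * ?V = 1"
  proof -
    have "?V' * ?V = qm g3' * (?q * (pw (- m) (qm a13) * ((qm g3 * qm g3') * pw m (qm a13)) * ?q')) * qm g3"
      by (simp only: mult.assoc)
    then show ?thesis by (simp add: gg P unip_x sw)
  qed
  have mid: "(?q' * ?s3' * ?q) * (pw (- m) (qm a13) * hexa m z123 x23 * pw m (qm a13)) * (?q' * ?s3 * ?q) =
     (?q' * pw (- m) (qm x34) * ?V') * hexa m zB z234 * (?V * pw m (qm x34) * ?q)"
  proof -
    have "(?q' * pw (- m) (qm x34) * ?V') * hexa m zB z234 * (?V * pw m (qm x34) * ?q) =
      ?q' * pw (- m) (qm x34) * (qm g3' * (?q * pw (- m) (qm a13))) * ((qm g3 * qm g3') * hexa m z123 x23 * (qm g3 * qm g3')) *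
       ((pw m (qm a13) * ?q') * qm g3 * pw m (qm x34) * ?q)"
      unfolding sh[symmetric] by (simp only: mult.assoc)
    also have "\<dots> = ?q' * (pw (- m) (qm x34) * qm g3') * ?q * (pw (- m) (qm a13) * hexa m z123 x23 * pw m (qm a13)) *
       (?q' * (qm g3 * pw m (qm x34)) * ?q)" by (simp only: gg mult_1_left mult_1_right mult.assoc)
    finally show ?thesis by (simp only: mult.assoc)
  qed
  show thesis
  proof (rule that[of "pw m (qm D4)" "?V * pw m (qm x34) * ?q" "pw m (qm D4) * ?u" "pw m (qm b24) * (?t * ?u)"
        "pw (- m) (qm D4)" "?q' * pw (- m) (qm x34) * ?V'" "?u' * pw (- m) (qm D4)" "(?u' * ?t') * pw (- m) (qm b24)"])
    have A: "a' * a = 1 \<Longrightarrow> b' * b = 1 \<Longrightarrow> (b' * a') * (a * b) = 1" for a a' b b' :: "(strand, 'k) tmat"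
    proof -
      assume "a' * a = 1" "b' * b = 1"
      moreover have "(b' * a') * (a * b) = b' * (a' * a) * b" by (simp only: mult.assoc)
      ultimately show ?thesis by simp
    qed
    show "?q' * pw (- m) (qm x34) * ?V' * (?V * pw m (qm x34) * ?q) = 1"
      using A[OF A[OF V P(2)[OF unip_x(3)]] sw(4)] by (simp only: mult.assoc)
    show "?u' * pw (- m) (qm D4) * (pw m (qm D4) * ?u) = 1" by (intro A P unip_x sw)
    show "?u' * ?t' * pw (- m) (qm b24) * (pw m (qm b24) * (?t * ?u)) = 1" by (intro A P unip_x sw)
    show "pw (- m) (qm D4) * hexa m zA x34 * pw m (qm D4) *
      (?q' * pw (- m) (qm x34) * ?V' * hexa m zB z234 * (?V * pw m (qm x34) * ?q)) =
      ?u' * pw (- m) (qm D4) * hexa m zB b24 * (pw m (qm D4) * ?u) *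
      (?u' * ?t' * pw (- m) (qm b24) * hexa m z234 x34 * (pw m (qm b24) * (?t * ?u)))"
      using rel unfolding hexagon_values mid by (simp only: mult.assoc)
  qed (intro Fil1_mult pw_Fil qm_Fil1 fh_Fil unip_x VF P)+
qed

end

text \<open>\<open>P\<close> is left multiplication by a series, and \<open>Q\<close> is the value
  of the same series at \<open>A\<close>. All operations that make up the hexagon preserve this
  relation, so its left hand side is a single universal series in log z and log y
  (\<open>hexa_ev\<close>). For \<open>A = Toep\<close> and \<open>P = Q\<close> the relation says
  that the matrix is a left multiplication.\<close>

definition rp :: "(letter \<Rightarrow> ('i::finite, 'k::qalg) tmat) \<Rightarrow> (letter, 'k) tmat \<Rightarrow> ('i, 'k) tmat \<Rightarrow> bool" where
  "rp A P Q \<longleftrightarrow> P = ev (col P) Toep \<and> Q = ev (col P) A"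

lemma rpI: "P = ev \<phi> Toep \<Longrightarrow> Q = ev \<phi> A \<Longrightarrow> rp A P Q"
  by (auto simp: rp_def)

lemma col_Nil_0: "P \<in> Fil 1 \<Longrightarrow> col P [] = 0"
  by (simp add: col_def FilD)

context
  fixes A :: "letter \<Rightarrow> ('i::finite, 'k::qalg) tmat"
  assumes A: "\<And>j. A j \<in> Fil 1"
begin

lemma rp_mult: "rp A P Q \<Longrightarrow> rp A P' Q' \<Longrightarrow> rp A (P * P') (Q * Q')"
  by (rule rpI[of _ "conv (col P) (col P')"])
     (simp_all add: rp_def ev_mult[OF A, symmetric] ev_mult[OF Toep_Fil, symmetric])

lemma rp_1: "rp A 1 1"
  by (rule rpI[of _ delta]) (simp_all add: A)

lemma rp_diff: "rp A P Q \<Longrightarrow> rp A P' Q' \<Longrightarrow> rp A (P - P') (Q - Q')"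
proof (rule rpI[of _ "\<lambda>w. col P w + - 1 * col P' w"])
  assume *: "rp A P Q" "rp A P' Q'"
  have e: "ev (\<lambda>w. col P w + - 1 * col P' w) B = ev (col P) B - ev (col P') B"
    for B :: "letter \<Rightarrow> ('x::finite, 'k) tmat"
    unfolding ev_add ev_cmult by (simp add: scm_minus_1)
  show "P - P' = ev (\<lambda>w. col P w + - 1 * col P' w) Toep" "Q - Q' = ev (\<lambda>w. col P w + - 1 * col P' w) A"
    using * unfolding e by (simp_all add: rp_def)
qed

lemma rp_ev:
  assumes "rp A P Q" "rp A P' Q'" "P \<in> Fil 1" "P' \<in> Fil 1"
  shows "rp A (ev \<phi> (pr P P')) (ev \<phi> (pr Q Q'))"
proof (rule rpI)
  let ?\<psi> = "pr (col P) (col P')"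
  have z: "?\<psi> j [] = 0" for j using assms(3,4) by (cases j) (auto simp: col_Nil_0)
  have e: "pr P P' = (\<lambda>j. ev (?\<psi> j) Toep)" "pr Q Q' = (\<lambda>j. ev (?\<psi> j) A)"
    using assms(1,2) unfolding rp_def by (intro ext; simp split: letter.split)+
  show "ev \<phi> (pr P P') = ev (psubst \<phi> ?\<psi>) Toep" unfolding e by (rule ev_ev[where \<psi> = ?\<psi>, OF Toep_Fil z])
  show "ev \<phi> (pr Q Q') = ev (psubst \<phi> ?\<psi>) A" unfolding e by (rule ev_ev[where \<psi> = ?\<psi>, OF A z])
qed

lemma rp_Fil: assumes "rp A P Q" "P \<in> Fil 1" shows "Q \<in> Fil 1"
proof -
  have "ev (col P) A \<in> Fil 1" by (rule ev_Fil[OF A]) (use assms(2) in \<open>auto simp: col_Nil_0\<close>)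
  then show ?thesis using assms(1) by (simp add: rp_def)
qed

lemma rp_ev1:
  assumes "rp A P Q" "P \<in> Fil 1"
  shows "rp A (ev1 F P) (ev1 F Q)"
proof -
  have "ev1 F P = ev (fser F LX) (pr P P)" "ev1 F Q = ev (fser F LX) (pr Q Q)"
    using assms rp_Fil[OF assms] by (subst ev_fser; auto)+
  then show ?thesis using rp_ev[OF assms(1,1) assms(2,2)] by simp
qed

lemma rp_lg: "rp A P Q \<Longrightarrow> unip P \<Longrightarrow> rp A (lg P) (lg Q)"
  unfolding lg_def by (intro rp_ev1 rp_diff rp_1)

lemma rp_pw: "rp A P Q \<Longrightarrow> unip P \<Longrightarrow> rp A (pw m P) (pw m Q)"
  unfolding pw_def ex_def by (intro rp_ev1 rp_lg lg_Fil)

end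

abbreviation toep :: "(letter, 'k::qalg) tmat \<Rightarrow> bool" where "toep M \<equiv> rp Toep M M"

lemma col_mult: "toep M \<Longrightarrow> toep N \<Longrightarrow> col (M * N) = conv (col M) (col N)"
  using ev_mult[of Toep "col M" "col N"] by (metis rp_def Toep_Fil col_ev_Toep)

lemma qm_ui_pw: "unip a \<Longrightarrow> qm (ui a) = pw (- 1) (qm a :: ('i::finite, 'k::qalg) tmat)"
  by (subst qm_ui) (simp_all add: ui_unip[OF qm_Fil1] pw_def)

lemma lw2: "lw 2 = {[], [LX], [LY], [LX, LX], [LX, LY], [LY, LX], [LY, LY]}"
proof (intro equalityI subsetI)
  fix w :: "letter list" assume "w \<in> lw 2"
  then have "\<exists>a b. w = [] \<or> w = [a] \<or> w = [a, b]"
    by (auto simp: numeral_2_eq_2 le_Suc_eq length_Suc_conv)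
  then obtain a b where "w = [] \<or> w = [a] \<or> w = [a, b]" by blast
  then show "w \<in> {[], [LX], [LY], [LX, LX], [LX, LY], [LY, LX], [LY, LY]}"
    by (cases a; cases b) auto
qed auto

context pentlim
begin

lemma rp_hexa:
  fixes Z Y :: "(letter, rat) tmat" and z y :: "('i::finite, rat) tmat"
  assumes A: "\<And>j. A j \<in> Fil 1" and r: "rp A (qm Z) (qm z)" "rp A (qm Y) (qm y)"
    and F: "unip Z" "unip Y" "unip z" "unip y"
  shows "rp A (hexa m Z Y) (hexa m z y)"
proof -
  have YZ: "unip (Y * Z)" "unip (y * z)" by (intro Fil1_mult F)+
  have x: "rp A (qm (ui (Y * Z))) (qm (ui (y * z)))"
    unfolding qm_ui_pw[OF YZ(1)] qm_ui_pw[OF YZ(2)]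
    unfolding qm_mult
    by (rule rp_pw[OF A rp_mult[OF A r(2) r(1)]]) (simp add: YZ(1) flip: qm_mult)
  have uF: "unip (ui (Y * Z))" by (rule Fil1_ui[OF YZ(1)])
  show ?thesis unfolding hexa_def fh_def
    by (intro rp_mult[OF A] rp_pw[OF A] rp_ev[OF A] rp_lg[OF A] r x lg_Fil qm_Fil1 F uF)
qed

lemma rp_gen:
  assumes "unip z" "unip y"
  shows "rp (pr (lg (qm z)) (lg (qm y))) (qm eLX) (qm z)" "rp (pr (lg (qm z)) (lg (qm y))) (qm eLY) (qm y)"
proof -
  let ?A = "pr (lg (qm z)) (lg (qm y))"
  have A: "?A j \<in> Fil 1" for j using assms by auto
  show "rp ?A (qm eLX) (qm z)"
    by (rule rpI[of _ "esr 1 LX"]) (use assms in \<open>simp_all add: qm_ex1 ex_ev A ex_ev[of Toep, OF Toep_Fil]\<close>)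
  show "rp ?A (qm eLY) (qm y)"
    by (rule rpI[of _ "esr 1 LY"]) (use assms in \<open>simp_all add: qm_ex1 ex_ev A ex_ev[of Toep, OF Toep_Fil]\<close>)
qed

definition hexc :: "'k \<Rightarrow> letter list \<Rightarrow> 'k" where "hexc m = col (hexa m eLX eLY)"

lemma hexa_ev:
  assumes F: "unip z" "unip y"
  shows "hexa m z y = ev (hexc m) (pr (lg (qm z)) (lg (qm y)))"
proof -
  have "pr (lg (qm z)) (lg (qm y)) j \<in> Fil 1" for j using F by auto
  from rp_hexa[OF this rp_gen[OF F] unip_eL F, of m] show ?thesis
    by (simp add: rp_def hexc_def)
qed

text \<open>For y = z all arguments are powers of z, so the three values of f are trivial, and the
  exponents add up to m + m - 2 m = 0.\<close>

lemma hexa_diag: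
  assumes F: "unip z"
  shows "hexa m z z = 1"
proof -
  have zz: "unip (z * z)" by (intro Fil1_mult F)
  then have uF: "unip (ui (z * z))" by (rule Fil1_ui)
  have uz: "ui (z * z) * z = z * ui (z * z)"
  proof -
    have "ui (z * z) * (z * (z * z)) * ui (z * z) = ui (z * z) * ((z * z) * z) * ui (z * z)"
      by (simp only: mult.assoc)
    moreover have "ui (z * z) * (z * (z * z)) * ui (z * z) = ui (z * z) * z * ((z * z) * ui (z * z))"
      "ui (z * z) * ((z * z) * z) * ui (z * z) = (ui (z * z) * (z * z)) * (z * ui (z * z))"
      by (simp_all only: mult.assoc)
    ultimately show ?thesis by (simp add: ui[OF Fil1_unit[OF zz]])
  qed
  have f: "fh z (ui (z * z)) = 1" "fh z z = 1" "fh (ui (z * z)) z = 1"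
    by (rule fh_commuting[OF Phi_linear]; use F uF uz in simp)+
  let ?B = "lg (qm z) :: ('a, 'k) tmat"
  have B: "?B \<in> Fil 1" using F by simp
  have "qm (z * z) = ex 2 ?B" using F ex_add[OF B, of 1 1] by (simp add: qm_mult)
  also have "\<dots> = ex 1 (scm 2 ?B)" by (simp add: ex_scm)
  finally have "lg (qm (z * z)) = scm 2 ?B" using B by (simp add: Fil_scm)
  then have "pw m (qm (ui (z * z))) = ex (- m * 2) ?B"
    unfolding pw_ui[OF zz] by (simp add: pw_def ex_scm)
  also have "\<dots> = ex (- m) ?B * ex (- m) ?B" unfolding mult_2_right by (rule ex_add[OF B])
  finally have "hexa m z z = ex m ?B * (ex m ?B * ex (- m) ?B) * ex (- m) ?B"
    unfolding hexa_def f by (simp add: pw_def mult.assoc)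
  then show ?thesis by (simp add: ex_inv[OF B])
qed

text \<open>Setting Y = X sends every word of length n to X^n, so the sum is the coefficient of X^n
  in the loop at equal arguments, which is 1 by \<open>hexa_diag\<close>.\<close>

lemma sum_hexc:
  assumes "n > 0"
  shows "(\<Sum>w | length w = n. hexc m w) = 0"
proof -
  have T: "pr (Toep LX) (Toep LX) j \<in> Fil 1" for j by (cases j) auto
  have "ev (hexc m) (pr (Toep LX) (Toep LX)) = 1"
    using hexa_ev[OF unip_eL(1,1), of m] hexa_diag[OF unip_eL(1), of m] by (simp add: qm_ex1)
  then have "0 = ent (ev (hexc m) (pr (Toep LX) (Toep LX))) (replicate n LX) []"
    using assms by (simp add: ent_1)
  also have "\<dots> = (\<Sum>w\<in>lw n. hexc m w * ent (wd (pr (Toep LX) (Toep LX)) w) (replicate n LX) [])"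
    by (rule ent_ev[OF T]) simp
  also have "\<dots> = (\<Sum>w\<in>lw n. if length w = n then hexc m w else 0)"
  proof (intro sum.cong refl)
    fix w
    have "wd (pr (Toep LX) (Toep LX)) w = (wd Toep (replicate (length w) LX) :: (letter, 'k) tmat)"
      by (induction w) (auto split: letter.split)
    then show "hexc m w * ent (wd (pr (Toep LX) (Toep LX)) w) (replicate n LX) [] =
      (if length w = n then hexc m w else 0)"
      by (auto simp: ent_wd_Toep dest: arg_cong[of _ _ length])
  qed
  also have "\<dots> = (\<Sum>w | length w = n. hexc m w)"
    by (simp add: sum.If_cases) (rule sum.cong, auto)
  finally show ?thesis by simp
qed

text \<open>The part of a series that determines the XY coefficient of products and powers: in a
  product the only mixed contribution is the X coefficient on the left times the Y coefficient on
  the right.\<close>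

definition tr :: "(letter, 'k) tmat \<Rightarrow> 'k \<Rightarrow> 'k \<Rightarrow> 'k \<Rightarrow> bool" where
  "tr M x y e \<longleftrightarrow> M = ev (col M) Toep \<and> col M [] = 1 \<and> col M [LX] = x \<and> col M [LY] = y \<and> col M [LX, LY] = e"

lemma tr_mult: "tr M x y e \<Longrightarrow> tr M' x' y' e' \<Longrightarrow> tr (M * M') (x + x') (y + y') (e + e' + x * y')"
proof -
  assume *: "tr M x y e" "tr M' x' y' e'"
  have "M * M' = ev (conv (col M) (col M')) Toep"
    using * ev_mult[where \<phi> = "col M" and \<psi> = "col M'" and A = Toep, OF Toep_Fil] by (simp add: tr_def)
  then have c: "col (M * M') = conv (col M) (col M')" "M * M' = ev (col (M * M')) Toep" by simp_all
  show ?thesis unfolding tr_def c(1) using * c by (auto simp: tr_def conv_def atMost_Suc)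
qed

lemma tr_Fil: "tr M x y e \<Longrightarrow> unip M"
proof -
  assume *: "tr M x y e"
  have "ev (\<lambda>w. col M w + - 1 * delta w) Toep \<in> Fil 1"
    by (rule ev_Fil[OF Toep_Fil]) (use * in \<open>auto simp: tr_def delta_def\<close>)
  then show ?thesis unfolding ev_add ev_cmult using * by (simp add: tr_def scm_minus_1)
qed

lemma tr_ev1:
  assumes "tr M x y e" "fps_nth F 0 = 1"
  shows "tr (ev1 F (M - 1)) (fps_nth F 1 * x) (fps_nth F 1 * y) (fps_nth F 1 * e + fps_nth F 2 * x * y)"
proof -
  have F: "unip M" by (rule tr_Fil[OF assms(1)])
  have r: "rp Toep M M" using assms(1) by (simp add: rp_def tr_def)
  have t: "ev1 F (M - 1) = ev (col (ev1 F (M - 1))) Toep"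
    using rp_ev1[OF Toep_Fil rp_diff[OF Toep_Fil r rp_1[OF Toep_Fil]] F] by (simp add: rp_def)
  have Me: "M = ev (col M) Toep" using assms(1) by (simp add: tr_def)
  have ev: "ent M u v = (\<Sum>w\<in>lw (length u). col M w * (if u = w @ v then 1 else 0))" for u v
    by (subst Me) (simp add: ev.rep_eq ent_wd_Toep)
  have XYY: "ent M [LX, LY] [LY] = x"
  proof -
    have "ent M [LX, LY] [LY] = (\<Sum>w\<in>lw 2. col M w * (if [LX, LY] = w @ [LY] then 1 else 0))" using ev[of "[LX, LY]" "[LY]"] by (simp add: numeral_2_eq_2)
    then show ?thesis using assms(1) unfolding lw2 by (simp add: tr_def)
  qed
  have XYX: "ent M [LX, LY] [LX] = 0"
  proof -
    have "ent M [LX, LY] [LX] = (\<Sum>w\<in>lw 2. col M w * (if [LX, LY] = w @ [LX] then 1 else 0))" using ev[of "[LX, LY]" "[LX]"] by (simp add: numeral_2_eq_2)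
    then show ?thesis unfolding lw2 by simp
  qed
  have sq: "ent ((M - 1) ^ 2) [LX, LY] [] = x * y"
  proof -
    have "ent ((M - 1) ^ 2) [LX, LY] [] = (\<Sum>w\<in>lw 2. ent (M - 1) [LX, LY] w * ent (M - 1) w [])"
      unfolding power2_eq_square by (rule ent_mult) simp
    also have "\<dots> = x * y"
      unfolding lw2 using assms(1) XYY XYX FilD[OF F, of "[LX, LY]"] by (auto simp: ent_1 tr_def col_def)
    finally show ?thesis .
  qed
  have c: "col (ev1 F (M - 1)) u = (\<Sum>k\<le>n. fps_nth F k * ent ((M - 1) ^ k) u [])" if "length u \<le> n" for u n
    unfolding col_def by (rule ent_ev1[OF F]) (use that in simp)
  have "col (ev1 F (M - 1)) [] = 1" using c[of "[]" 0] assms by (simp add: ent_1)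
  moreover have "col (ev1 F (M - 1)) [a] = fps_nth F 1 * col M [a]" for a
    using c[of "[a]" 1] by (simp add: One_nat_def ent_1 col_def)
  moreover have "col (ev1 F (M - 1)) [LX, LY] = fps_nth F 1 * e + fps_nth F 2 * x * y"
    using c[of "[LX, LY]" 2] sq assms(1) by (simp add: numeral_2_eq_2 One_nat_def ent_1 tr_def col_def mult.assoc)
  ultimately show ?thesis using t assms(1) by (simp add: tr_def)
qed

lemma half: "qi (1 / 2) + qi (1 / 2) = (1 :: 'k)" (is ?P) "2 * qi (1 / 2) = (1 :: 'k)"
proof -
  show ?P by (simp flip: qi_add)
  then show "2 * qi (1 / 2) = (1 :: 'k)" by (simp only: mult_2)
qed

text \<open>The binomial series of (1 + N)^m is 1 + m N + (m^2 - m) / 2 N^2 up to second order, and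
  N^2 has XY coefficient x y.\<close>

lemma tr_pw:
  assumes "tr M x y e"
  shows "tr (pw m M) (m * x) (m * y) (m * e + (m * m - m) * qi (1 / 2) * x * y)"
proof -
  let ?F = "expf m oo lnf"
  have l: "fps_nth (lnf :: 'k fps) 1 = 1" "fps_nth (lnf :: 'k fps) 2 = - qi (1 / 2)"
    by (simp_all add: lnf_def fps_ln_nth One_nat_def qi_minus[symmetric])
  have p: "pw m M = ev1 ?F (M - 1)"
    unfolding pw_def ex_def lg_def by (rule ev1_compose[OF tr_Fil[OF assms]]) simp
  have sq: "fps_nth (lnf ^ 2 :: 'k fps) 1 = 0" "fps_nth (lnf ^ 2 :: 'k fps) 2 = 1"
    using l by (simp_all add: power2_eq_square fps_mult_nth numeral_2_eq_2 One_nat_def)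
  have F: "fps_nth ?F 0 = 1" "fps_nth ?F 1 = m" "fps_nth ?F 2 = (m * m - m) * qi (1 / 2)"
    using l sq by (simp_all add: fps_compose_nth numeral_2_eq_2 One_nat_def power2_eq_square algebra_simps)
  show ?thesis unfolding p using tr_ev1[OF assms F(1)] by (simp add: F)
qed

text \<open>The values f(e^X, 1), f(1, e^X) and f(e^X, e^X) are trivial because the arguments
  commute. Their X^2 coefficients are the XX and YY coefficients of \<open>\<Phi>\<close> and, given
  that these vanish, the sum of the two mixed ones.\<close>

lemma Phi_quadratic: "\<Phi> [LX, LX] = 0" "\<Phi> [LY, LY] = 0" "\<Phi> [LY, LX] = - \<Phi> [LX, LY]" (is ?P)
proof -
  have l1: "lg 1 = (0 :: (letter, 'k) tmat)"
  proof -
    have "ex 1 (0 :: (letter, 'k) tmat) = 1" using ex_scm[of 1 "0 :: 'k" "0 :: (letter, 'k) tmat"] by simp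
    then show ?thesis using lg_ex[of "0 :: (letter, 'k) tmat"] by simp
  qed
  let ?T = "Toep LX :: (letter, 'k) tmat"
  let ?e = "\<lambda>P Q. ent (ev \<Phi> (pr P Q)) [LX, LX] []"
  have TT: "ent (?T * ?T) [LX, LX] [] = 1" by (simp add: ent_mult_Toep ent_Toep)
  have e: "?e P Q = \<Phi> [LX, LX] * ent (P * P) [LX, LX] [] + \<Phi> [LX, LY] * ent (P * Q) [LX, LX] [] +
     \<Phi> [LY, LX] * ent (Q * P) [LX, LX] [] + \<Phi> [LY, LY] * ent (Q * Q) [LX, LX] []"
    if "P \<in> Fil 1" "Q \<in> Fil 1" for P Q :: "(letter, 'k) tmat"
  proof -
    have "?e P Q = (\<Sum>w\<in>lw 2. \<Phi> w * ent (wd (pr P Q) w) [LX, LX] [])"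
      by (rule ent_ev) (use that in auto)
    then show ?thesis unfolding lw2 by (simp add: ent_1 Phi_linear algebra_simps)
  qed
  have "fh eLX 1 = 1" "fh 1 eLX = 1" "fh eLX eLX = 1"
    by (rule fh_commuting[OF Phi_linear]; simp)+
  then have "?e ?T 0 = 0" "?e 0 ?T = 0" "?e ?T ?T = 0"
    by (simp_all add: fh_def qm_ex1 l1 ent_1)
  then show "\<Phi> [LX, LX] = 0" "\<Phi> [LY, LY] = 0" ?P
    unfolding e[OF Toep_Fil Fil_zero] e[OF Fil_zero Toep_Fil] e[OF Toep_Fil Toep_Fil] TT
    by (auto simp: eq_neg_iff_add_eq_0 add.commute)
qed

end

lemma ent_lg_lead:
  fixes c :: "('i::finite, 'k::qalg) tmat"
  assumes "unip c" "length u = length v + 1"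
  shows "ent (lg c) u v = ent c u v"
proof -
  have "lg c - (c - 1) = ev1 (lnf - fps_X) (c - 1)" using assms by (simp add: lg_def ev1_diff)
  also have "\<dots> \<in> Fil 2"
    by (rule ev1_Fil[OF assms(1)]) (auto simp: lnf_def fps_ln_nth fps_X_def less_2_cases_iff One_nat_def)
  finally have "ent (lg c - (c - 1)) u v = 0" by (rule FilD) (use assms in simp)
  then show ?thesis using assms by (auto simp: ent_1)
qed

context pentlim
begin

text \<open>Up to second order f is 1 plus a multiple of the commutator of its logarithmic
  arguments, so only their linear parts enter, through a determinant.\<close>

lemma tr_fh:
  assumes t: "tr (qm p) x y e" "tr (qm q) x' y' e'" and F: "unip p" "unip q"
  shows "tr (fh p q) 0 0 (\<Phi> [LX, LY] * (x * y' - x' * y))"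
proof -
  let ?P = "lg (qm p) :: (letter, 'k) tmat" and ?Q = "lg (qm q) :: (letter, 'k) tmat"
  have PF: "?P \<in> Fil 1" "?Q \<in> Fil 1" using F by auto
  have rpq: "rp Toep (qm p) (qm p :: (letter, 'k) tmat)" "rp Toep (qm q) (qm q :: (letter, 'k) tmat)"
    using t by (simp_all add: rp_def tr_def)
  have r: "rp Toep ?P ?P" "rp Toep ?Q ?Q"
    by (intro rp_lg[OF Toep_Fil] rpq qm_Fil1 F)+
  have "rp Toep (fh p q) (fh p q)" unfolding fh_def by (rule rp_ev[OF Toep_Fil r PF])
  then have e: "fh p q = ev (col (fh p q)) Toep" by (simp add: rp_def)
  have lin: "col ?P [a] = col (qm p) [a]" "col ?Q [a] = col (qm q) [a]" for a
    unfolding col_def by (rule ent_lg_lead; use F in simp)+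
  have prod: "ent (A * B) [LX, LY] [] = col A [LX] * col B [LY]"
    if "rp Toep A A" "rp Toep B B" "A \<in> Fil 1" "B \<in> Fil 1" for A B :: "(letter, 'k) tmat"
    using col_mult[OF that(1,2)] col_Nil_0[OF that(3)] col_Nil_0[OF that(4)]
    unfolding col_def[of "A * B", symmetric] by (simp add: conv_def atMost_Suc)
  have c: "col (fh p q) u = (\<Sum>w\<in>lw n. \<Phi> w * ent (wd (pr ?P ?Q) w) u [])" if "length u \<le> n" for u n
    unfolding col_def fh_def by (rule ent_ev) (use PF that in auto)
  have "col (fh p q) [] = 1" using c[of "[]" 0] by (simp add: lw_def Phi_Nil ent_1)
  moreover have "col (fh p q) [a] = 0" for a
  proof -
    have lw1: "lw 1 = {[], [LX], [LY]}"
      by (auto simp: One_nat_def le_Suc_eq length_Suc_conv) (metis letter.exhaust)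
    show ?thesis using c[of "[a]" 1] unfolding lw1 by (simp add: ent_1 Phi_linear One_nat_def)
  qed
  moreover have "col (fh p q) [LX, LY] = \<Phi> [LX, LY] * (x * y' - x' * y)"
    using c[of "[LX, LY]" 2] t prod[OF r(1,2) PF] prod[OF r(2,1) PF(2,1)] prod[OF r(1,1) PF(1,1)] prod[OF r(2,2) PF(2,2)]
    unfolding lw2 lin
    by (simp add: ent_1 Phi_linear Phi_quadratic tr_def algebra_simps numeral_2_eq_2)
  ultimately show ?thesis using e by (simp add: tr_def)
qed

lemma tr_gen: "tr (qm eLX) 1 0 0" "tr (qm eLY) 0 1 0"
proof -
  have e: "qm (ex 1 (Toep j)) = (ev (esr 1 j) Toep :: (letter, 'k) tmat)" for j
    by (simp add: qm_ex1 ex_ev[of Toep, OF Toep_Fil])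
  show "tr (qm eLX) 1 0 0" "tr (qm eLY) 0 1 0"
    unfolding e tr_def by (simp_all add: esr_def)
qed

lemma tr_cong: "tr M x y e \<Longrightarrow> x = x' \<Longrightarrow> y = y' \<Longrightarrow> e = e' \<Longrightarrow> tr M x' y' e'"
  by simp

text \<open>To first order the third argument is minus the sum of the other two, so each of the
  three values of f contributes \<open>- \<Phi> [LX, LY]\<close> times the same determinant of
  linear parts. The product of the m-th powers contributes (m^2 + m) / 2 times this determinant. The
  coefficients are compared after doubling, which removes the halves.\<close>

lemma hexa_tr:
  assumes z: "tr (qm z) x y e" and y: "tr (qm w) x' y' e'" and F: "unip z" "unip w"
  shows "tr (hexa m z w) 0 0 (- 3 * \<Phi> [LX, LY] * (x * y' - x' * y) + (m * m + m) * qi (1 / 2) * (x * y' - x' * y))"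
proof -
  have wz: "unip (w * z)" by (intro Fil1_mult F)
  then have uF: "unip (ui (w * z))" by (rule Fil1_ui)
  let ?h = "qi (1 / 2) :: 'k"
  have twz: "tr (qm (w * z)) (x' + x) (y' + y) (e' + e + x' * y)"
    unfolding qm_mult by (rule tr_mult[OF y z])
  have tu: "tr (qm (ui (w * z))) (- 1 * (x' + x)) (- 1 * (y' + y)) (- 1 * (e' + e + x' * y) + (- 1 * - 1 - - 1) * ?h * (x' + x) * (y' + y))"
    unfolding qm_ui_pw[OF wz] by (rule tr_pw[OF twz])
  note f = tr_fh[OF z tu F(1) uF] tr_fh[OF y z F(2,1)] tr_fh[OF tu y uF F(2)]
  note p = tr_pw[OF z, of m] tr_pw[OF y, of m] tr_pw[OF tu, of m]
  note H = tr_mult[OF tr_mult[OF tr_mult[OF tr_mult[OF tr_mult[OF f(1) p(1)] f(2)] p(2)] f(3)] p(3)]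
  have h2: "(- 1 * - 1 - - 1) * ?h = 1" using half(2) by simp
  have hc: "?h * (2 * c) = c" "2 * (?h * c) = c" for c
  proof -
    have "?h * (2 * c) = (2 * ?h) * c" by (simp add: mult_ac)
    then show "?h * (2 * c) = c" by (simp only: half mult_1_left)
    show "2 * (?h * c) = c" using half(2) by (simp flip: mult.assoc)
  qed
  have h4: "4 * ?h = 2"
  proof -
    have "4 * ?h = 2 * (2 * ?h)" by simp
    then show ?thesis by (simp only: half mult_1_right)
  qed
  show ?thesis unfolding hexa_def
    by (rule tr_cong[OF H[unfolded h2]], (simp add: algebra_simps)[2], rule of_nat_cancel[of 2])
       (simp_all add: algebra_simps hc h4 half)
qed

lemma hexc_2: "hexc m [LX, LY] = (m * m + m) * qi (1 / 2) - 3 * \<Phi> [LX, LY]"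
  using hexa_tr[OF tr_gen unip_eL, of m] by (simp add: tr_def hexc_def)

lemma hexc_Nil: "hexc m [] = 1"
  using hexa_tr[OF tr_gen unip_eL, of m] by (simp add: tr_def hexc_def)

end

text \<open>If \<open>c j\<close> is read as the linear form with coefficients \<open>c j i\<close>,
  this is the coefficient of the monomial r in the product of these forms along w.\<close>

fun pc :: "('j \<Rightarrow> strand \<Rightarrow> 'k::comm_ring_1) \<Rightarrow> 'j list \<Rightarrow> strand list \<Rightarrow> 'k" where
  "pc c [] [] = 1"
| "pc c (j # w) (i # r) = c j i * pc c w r"
| "pc c _ _ = 0"

lemma pc_map:
  assumes "\<And>i j. i \<in> set r \<Longrightarrow> c j i = (if j = \<phi> i then 1 else 0)"
  shows "pc c w r = (if w = map \<phi> r then 1 else 0)"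
  using assms by (induction c w r rule: pc.induct) auto

lemma pc_zero: "i \<in> set r \<Longrightarrow> (\<And>j. c j i = 0) \<Longrightarrow> pc c w r = 0"
  by (induction c w r rule: pc.induct) auto

text \<open>The leading parts of the \<open>x\<^sub>i\<^sub>4\<close> act by appending letters on the words in which \<open>S4\<close> occurs exactly
  once, as the last letter, so that they generate a free algebra.\<close>

lemma wd_lead:
  fixes A :: "'j \<Rightarrow> (strand, 'k::qalg) tmat"
  assumes A: "\<And>j. A j \<in> Fil 1"
    and l: "\<And>j u v. length u = length v + 1 \<Longrightarrow>
      ent (A j) u v = (\<Sum>i\<in>{S1, S2, S3}. c j i * qi (Der i S4 u v))"
  shows "length u = length w + 1 \<Longrightarrow>
    (S4 \<notin> set u \<longrightarrow> ent (wd A w) u [S4] = 0) \<and>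
    (\<forall>u'. u = u' @ [S4] \<longrightarrow> S4 \<notin> set u' \<longrightarrow> ent (wd A w) u [S4] = pc c w (rev u'))"
proof (induction w arbitrary: u)
  case Nil
  then show ?case by (auto simp: ent_1)
next
  case (Cons j w)
  have step: "ent (wd A (j # w)) u [S4] = (\<Sum>s | length s = length w + 1. ent (A j) u s * ent (wd A w) s [S4])"
    using lead_mult[OF A wd_Fil[of A w, OF A], of u "[S4]" j] Cons.prems by (simp add: add.commute One_nat_def)
  have lj: "ent (A j) u s = (\<Sum>i\<in>{S1, S2, S3}. c j i * qi (Der i S4 u s))" if "length s = length w + 1" for s
    by (rule l) (use that Cons.prems in simp)
  have ne: "i \<noteq> S4" if "i \<in> {S1, S2, S3}" for i using that by auto
  show ?case
  proof (intro conjI impI allI)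
    assume u: "S4 \<notin> set u"
    have "ent (A j) u s * ent (wd A w) s [S4] = 0" if s: "length s = length w + 1" for s
    proof (cases "S4 \<in> set s")
      case True
      have "ent (A j) u s = 0" unfolding lj[OF s]
        by (rule sum.neutral) (auto simp: Der_drop[OF True u])
      then show ?thesis by simp
    next
      case False
      then show ?thesis using Cons.IH[OF s] by simp
    qed
    then show "ent (wd A (j # w)) u [S4] = 0" unfolding step by (intro sum.neutral) auto
  next
    fix u' assume u: "u = u' @ [S4]" "S4 \<notin> set u'"
    \<comment> \<open>The leftmost operator acts last, so it is the one that places its letter
      directly before \<open>S4\<close>. This accounts for the reversal of \<open>u'\<close> in the
      claim.\<close>
    obtain t i where u': "u' = t @ [i]" using Cons.prems u by (cases u' rule: rev_cases) auto
    have i: "i \<in> {S1, S2, S3}" using u u' by (cases i) auto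
    have z: "ent (A j) u s * ent (wd A w) s [S4] = 0" if s: "length s = length w + 1" "s \<noteq> t @ [S4]" for s
    proof (cases "S4 \<in> set s")
      case False
      then show ?thesis using Cons.IH[OF s(1)] by simp
    next
      case True
      have D: "Der k S4 u s = 0" if k: "k \<in> {S1, S2, S3}" for k
      proof (cases "S4 \<in> set (butlast s)")
        case True
        then show ?thesis unfolding u(1) using u(2) ne[OF k] by (rule Der_butlast)
      next
        case F: False
        have sne: "s \<noteq> []" using True by auto
        then have s4: "s = butlast s @ [S4]" using True F
          by (metis append_butlast_last_id in_set_butlastD last_ConsL rotate1.simps(2) set_rotate1 list.set_intros(1) set_ConsD Un_iff set_append)
        have "butlast s \<noteq> t" using s4 s(2) by metis
        then have "u' \<noteq> butlast s @ [k]" using u' by auto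
        then show ?thesis unfolding u(1) by (subst s4, subst Der_last[OF F u(2) ne[OF k]]) simp
      qed
      have "ent (A j) u s = 0" unfolding lj[OF s(1)] by (rule sum.neutral) (simp add: D)
      then show ?thesis by simp
    qed
    have lt: "length (t @ [S4]) = length w + 1" using Cons.prems u u' by simp
    have "ent (wd A (j # w)) u [S4] = (\<Sum>s\<in>{t @ [S4]}. ent (A j) u s * ent (wd A w) s [S4])"
      unfolding step by (rule sum.mono_neutral_right) (use z lt in auto)
    also have "\<dots> = ent (A j) u (t @ [S4]) * pc c w (rev t)"
      using Cons.IH[OF lt] u u' by simp
    also have "ent (A j) u (t @ [S4]) = (\<Sum>k\<in>{S1, S2, S3}. if k = i then c j k else 0)"
      unfolding lj[OF lt]
    proof (intro sum.cong refl)
      fix k assume "k \<in> {S1, S2, S3}"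
      then show "c j k * qi (Der k S4 u (t @ [S4])) = (if k = i then c j k else 0)"
        using Der_last[of S4 t u' k] u u' ne[of k] by auto
    qed
    also have "\<dots> = c j i" using i by (simp add: sum.delta')
    finally show "ent (wd A (j # w)) u [S4] = pc c (j # w) (rev u')" using u' by simp
  qed
qed

section \<open>The cocycle equation\<close>

text \<open>Leading terms of the hexagon satisfy a two-cocycle equation in a free associative algebra. It
  identifies the coefficients of words that arise from each other by exchanging one letter.\<close>

lemma cocycle_vanish:
  fixes h :: "letter list \<Rightarrow> 'k::qalg"
  assumes n: "n > 0"
    and coc: "\<And>r. length r = n \<Longrightarrow> S4 \<notin> set r \<Longrightarrow>
      h (map (\<lambda>i. if i = S3 then LY else LX) r) + (if S3 \<in> set r then 0 else h (map (\<lambda>i. if i = S1 then LX else LY) r)) =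
      h (map (\<lambda>i. if i = S1 then LX else LY) r) + (if S1 \<in> set r then 0 else h (map (\<lambda>i. if i = S2 then LX else LY) r))"
    and s: "(\<Sum>w | length w = n. h w) = 0"
    and two: "n = 2 \<Longrightarrow> h [LX, LY] = 0"
    and w: "length w = n"
  shows "h w = 0"
proof -
  have pX: "h (replicate n LX) = 0" using coc[of "replicate n S1"] n by simp
  have pY: "h (replicate n LY) = 0" using coc[of "replicate n S3"] n by simp
  define mixed where "mixed w \<longleftrightarrow> LX \<in> set w \<and> LY \<in> set w" for w
  have pure: "h w = 0" if "length w = n" "\<not> mixed w" for w
  proof -
    have "set w \<subseteq> {LX} \<or> set w \<subseteq> {LY}" using that(2) unfolding mixed_def by (metis letter.exhaust singleton_iff subsetI)
    then have "w = replicate n LX \<or> w = replicate n LY"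
      using that(1) by (metis replicate_eqI singletonD subsetD)
    then show ?thesis using pX pY by auto
  qed
  \<comment> \<open>The equation is used for a word that has \<open>S2\<close> in one position and
    otherwise both \<open>S1\<close> and \<open>S3\<close>. The terms that require one of these to
    be absent vanish, and the two others read \<open>S2\<close> as X on the left and as Y on the
    right.\<close>
  have flip: "h (a @ LX # b) = h (a @ LY # b)" if "mixed (a @ b)" "length (a @ LX # b) = n" for a b
  proof -
    let ?g = "\<lambda>l. if l = LX then S1 else S3"
    let ?r = "map ?g a @ S2 # map ?g b"
    have gX: "map (\<lambda>i. if i = S3 then LY else LX) (map ?g c) = c" for c
      by (induction c) (auto split: letter.split intro: letter.exhaust)
    have gY: "map (\<lambda>i. if i = S1 then LX else LY) (map ?g c) = c" for c
      by (induction c) (auto split: letter.split intro: letter.exhaust)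
    have "S1 \<in> set ?r" "S3 \<in> set ?r" "S4 \<notin> set ?r" using that(1) by (auto simp: mixed_def image_iff)
    then show ?thesis using coc[of ?r] that(2) gX[of a] gX[of b] gY[of a] gY[of b] by simp
  qed
  \<comment> \<open>As long as a Y remains elsewhere, a later X can be exchanged for Y; induction on
    the number of later X ends at the word X Y ... Y.\<close>
  have cX: "h (LX # t) = h (LX # replicate (n - 1) LY)" if "LY \<in> set t" "length t = n - 1" for t
    using that
  proof (induction "count_list t LX" arbitrary: t)
    case 0
    then have "LX \<notin> set t" by (simp add: count_list_0_iff)
    then have "t = replicate (n - 1) LY" using 0
      by (metis letter.exhaust replicate_eqI)
    then show ?case by simp
  next
    case (Suc k)
    then have "LX \<in> set t" by (metis count_list_0_iff nat.distinct(1))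
    then obtain a b where t: "t = a @ LX # b" by (meson split_list)
    have "h ((LX # a) @ LX # b) = h ((LX # a) @ LY # b)"
      by (rule flip) (use Suc t n in \<open>auto simp: mixed_def\<close>)
    moreover have "h (LX # a @ LY # b) = h (LX # replicate (n - 1) LY)"
      by (rule Suc.hyps(1)) (use Suc t in auto)
    ultimately show ?case using t by simp
  qed
  have k: "h w = h (LX # replicate (n - 1) LY)" if m: "mixed w" "length w = n" "n \<noteq> 2" for w
  proof (cases w)
    case Nil
    then show ?thesis using n that by simp
  next
    case (Cons l t)
    show ?thesis
    proof (cases l)
      case LX
      then show ?thesis using cX[of t] m Cons by (auto simp: mixed_def)
    next
      case LY
      then have tX: "LX \<in> set t" using m Cons by (auto simp: mixed_def)
      have yt: "h (LY # t') = h (LX # replicate (n - 1) LY)" if "mixed t'" "length t' = n - 1" for t'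
        using flip[of "[]" t'] cX[of t'] that n by (auto simp: mixed_def)
      show ?thesis
      proof (cases "LY \<in> set t")
        case True
        then show ?thesis using yt[of t] tX m Cons LY by (auto simp: mixed_def)
      next
        case False
        then obtain t2 where t: "t = LX # t2" using tX by (cases t) (metis letter.exhaust list.set_intros(1) empty_iff list.set(1))+
        have "t2 \<noteq> []" using m Cons t n by auto
        then have x2: "LX \<in> set t2" using False t by (cases t2) (metis letter.exhaust list.set_intros(1,2))+
        have "h ([LY] @ LX # t2) = h ([LY] @ LY # t2)"
          by (rule flip) (use x2 m Cons t LY in \<open>auto simp: mixed_def\<close>)
        moreover have "h (LY # (LY # t2)) = h (LX # replicate (n - 1) LY)"
          by (rule yt) (use x2 m Cons t in \<open>auto simp: mixed_def\<close>)
        ultimately show ?thesis using Cons LY t by simp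
      qed
    qed
  qed
  show ?thesis
  proof (cases "mixed w")
    case False
    then show ?thesis using pure w by simp
  next
    case True
    show ?thesis
    proof (cases "n = 2")
      \<comment> \<open>In degree two \<open>flip\<close> has no instance, since one remaining
        letter cannot be mixed. The assumption on XY and the vanishing sum settle this case.\<close>
      case n2: True
      have sum2: "{w :: letter list. length w = 2} = {[LX, LX], [LX, LY], [LY, LX], [LY, LY]}"
      proof -
        have "{w :: letter list. length w = 2} = lw 2 - lw 1" by auto
        moreover have "lw 1 = {[], [LX], [LY]}"
          by (auto simp: One_nat_def le_Suc_eq length_Suc_conv) (metis letter.exhaust)
        ultimately show ?thesis unfolding lw2 by auto
      qed
      have "h [LY, LX] = 0" using s pX pY two n2 unfolding n2 sum2 by (simp add: numeral_2_eq_2)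
      moreover have "w \<in> {[LX, LX], [LX, LY], [LY, LX], [LY, LY]}" using w n2 sum2 by blast
      ultimately show ?thesis using two n2 pX pY by (auto simp: numeral_2_eq_2)
    next
      case False
      \<comment> \<open>All mixed words have the same coefficient and all others have coefficient
        zero, so the vanishing sum is a positive integer multiple of \<open>?c\<close>; integers can
        be cancelled in a Q-algebra.\<close>
      let ?c = "h (LX # replicate (n - 1) LY)" and ?M = "{w. length w = n \<and> mixed w}"
      have "(\<Sum>w | length w = n. h w) = (\<Sum>w\<in>?M. h w)"
        by (rule sum.mono_neutral_right) (auto simp: pure)
      also have "\<dots> = (\<Sum>w\<in>?M. ?c)" by (rule sum.cong) (use k[OF _ _ False] in auto)
      finally have "of_nat (card ?M) * ?c = 0" using s by simp
      moreover have "card ?M > 0" using True w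
        by (subst card_gt_0_iff) (auto intro: finite_subset[OF _ finite_len[of n]])
      ultimately have "?c = 0" using of_nat_cancel[of "card ?M" ?c 0] by simp
      then show ?thesis using k[OF True w False] by simp
    qed
  qed
qed

text \<open>The difference between W' (M - 1) W and M - 1 consists of terms with an additional
  factor W' - 1 or W - 1 from \<open>Fil 1\<close>, which lie one step deeper in the
  filtration.\<close>

lemma conj_lead:
  fixes M W W' :: "('i::finite, 'k::qalg) tmat"
  assumes M: "M - 1 \<in> Fil n" and W: "unip W" "W' * W = 1"
  shows "W' * M * W - 1 \<in> Fil n"
    "length u = length v + n \<Longrightarrow> ent (W' * M * W - 1) u v = ent (M - 1) u v"
proof -
  have "W' = W' * (W * ui W)" using ui(1)[OF Fil1_unit[OF W(1)]] by simp
  then have W': "W' = ui W" using W(2) by (simp flip: mult.assoc)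
  have WF: "unip W'" unfolding W' by (rule Fil1_ui[OF W(1)])
  have "W' * (M - 1) * W = W' * M * W - W' * W" by (simp add: algebra_simps)
  then have e: "W' * M * W - 1 = W' * (M - 1) * W" using W by simp
  show "W' * M * W - 1 \<in> Fil n" unfolding e by (intro Fil_multR Fil_multL M)
  assume l: "length u = length v + n"
  have "W' * (M - 1) * W = (M - 1) + (W' - 1) * (M - 1) * W + (M - 1) * (W - 1)"
    by (simp add: algebra_simps)
  moreover have "ent ((W' - 1) * (M - 1) * W) u v = 0"
    by (rule FilD[OF Fil_multR[OF Fil_mult[OF WF M]]]) (use l in simp)
  moreover have "ent ((M - 1) * (W - 1)) u v = 0"
    by (rule FilD[OF Fil_mult[OF M W(1)]]) (use l in simp)
  ultimately show "ent (W' * M * W - 1) u v = ent (M - 1) u v" unfolding e by simp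
qed

lemma prod_lead:
  fixes M N :: "('i::finite, 'k::qalg) tmat"
  assumes "M - 1 \<in> Fil n" "N - 1 \<in> Fil n" "n > 0" "length u = length v + n"
  shows "ent (M * N - 1) u v = ent (M - 1) u v + ent (N - 1) u v"
proof -
  have "M * N - 1 = (M - 1) + (N - 1) + (M - 1) * (N - 1)" by (simp add: algebra_simps)
  moreover have "ent ((M - 1) * (N - 1)) u v = 0"
    by (rule FilD[OF Fil_mult[OF assms(1,2)]]) (use assms in simp)
  ultimately show ?thesis by simp
qed

text \<open>Tells which t_i4 occur in the linear part of the first argument of the hexagon (strands
  in \<open>a\<close>) and of the second (strands in \<open>b\<close>).\<close>

definition dc :: "strand set \<Rightarrow> strand set \<Rightarrow> letter \<Rightarrow> strand \<Rightarrow> rat" where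
  "dc a b j i = (if i \<in> pr a b j then 1 else 0)"

context pentlim
begin

lemma ld1_zA: "ld1 zA (\<lambda>u v. Der S1 S4 u v + Der S2 S4 u v)"
proof -
  have "ld1 zA (ent zA)" using unip_z(1) by (simp add: ld1_def)
  from ld1_mult[OF ld1_x(3) this] have "ld1 D4 (\<lambda>u v. Der S3 S4 u v + ent zA u v)" by (simp add: z_D)
  then show ?thesis using ld1_cabled(5) unip_z(1) unfolding ld1_def by fastforce
qed

lemma hexa_lead:
  fixes z y :: "('i::finite, rat) tmat"
  assumes F: "unip z" "unip y" and n: "\<And>w. 0 < length w \<Longrightarrow> length w < n \<Longrightarrow> hexc m w = 0" "n > 0"
  shows "hexa m z y - 1 \<in> Fil n"
    "length u = length v + n \<Longrightarrow> ent (hexa m z y - 1) u v =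
       (\<Sum>w | length w = n. hexc m w * ent (wd (pr (lg (qm z)) (lg (qm y))) w) u v)"
proof -
  let ?A = "pr (lg (qm z)) (lg (qm y)) :: letter \<Rightarrow> ('i, 'k) tmat"
  have A: "?A j \<in> Fil 1" for j using F by auto
  have e: "hexa m z y - 1 = ev (\<lambda>w. hexc m w + - 1 * delta w) ?A"
    unfolding ev_add ev_cmult hexa_ev[OF F] ev_delta[OF A] by (simp add: scm_minus_1)
  have low: "hexc m w + - 1 * delta w = 0" if "length w < n" for w
    using that n(1)[of w] hexc_Nil by (cases w) (auto simp: delta_def)
  show "hexa m z y - 1 \<in> Fil n" unfolding e by (rule ev_Fil[OF A low])
  assume l: "length u = length v + n"
  have "ent (hexa m z y - 1) u v = (\<Sum>w\<in>lw n. (hexc m w + - 1 * delta w) * ent (wd ?A w) u v)"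
    unfolding e by (rule ent_ev[OF A]) (use l in simp)
  also have "\<dots> = (\<Sum>w | length w = n. (hexc m w + - 1 * delta w) * ent (wd ?A w) u v)"
    by (rule sum.mono_neutral_right) (use low in auto)
  also have "\<dots> = (\<Sum>w | length w = n. hexc m w * ent (wd ?A w) u v)"
    by (rule sum.cong) (use n in \<open>auto simp: delta_def\<close>)
  finally show "ent (hexa m z y - 1) u v = (\<Sum>w | length w = n. hexc m w * ent (wd ?A w) u v)" .
qed

text \<open>By \<open>wd_lead\<close> this entry is the coefficient of the monomial r when the
  linear parts of z and y are substituted into the leading term of the loop; the word is reversed
  because the first operator acts last.\<close>

lemma hexa_entry:
  assumes z: "ld1 z (\<lambda>u v. \<Sum>i\<in>{S1, S2, S3}. dc a b LX i * Der i S4 u v)"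
    and y: "ld1 y (\<lambda>u v. \<Sum>i\<in>{S1, S2, S3}. dc a b LY i * Der i S4 u v)"
    and n: "\<And>w. 0 < length w \<Longrightarrow> length w < n \<Longrightarrow> hexc m w = 0" "n > 0"
    and r: "length r = n" "S4 \<notin> set r"
  shows "ent (hexa m z y - 1) (rev r @ [S4]) [S4] =
    (\<Sum>w | length w = n. hexc m w * pc (\<lambda>j i. qi (dc a b j i)) w r)"
proof -
  let ?A = "pr (lg (qm z)) (lg (qm y)) :: letter \<Rightarrow> (strand, 'k) tmat"
  have F: "unip z" "unip y" using z y by (auto simp: ld1_def)
  have A: "?A j \<in> Fil 1" for j using F by auto
  have l: "ent (?A j) u v = (\<Sum>i\<in>{S1, S2, S3}. qi (dc a b j i) * qi (Der i S4 u v))"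
    if "length u = length v + 1" for j u v
  proof (cases j)
    case LX
    have "ent (lg (qm z)) u v = ent (qm z :: (strand, 'k) tmat) u v" by (rule ent_lg_lead) (use F that in auto)
    then show ?thesis using z that LX by (simp add: ld1_def qi_add qi_mult)
  next
    case LY
    have "ent (lg (qm y)) u v = ent (qm y :: (strand, 'k) tmat) u v" by (rule ent_lg_lead) (use F that in auto)
    then show ?thesis using y that LY by (simp add: ld1_def qi_add qi_mult)
  qed
  have "ent (hexa m z y - 1) (rev r @ [S4]) [S4] =
    (\<Sum>w | length w = n. hexc m w * ent (wd ?A w) (rev r @ [S4]) [S4])"
    by (rule hexa_lead(2)[OF F n]) (use r in auto)
  also have "\<dots> = (\<Sum>w | length w = n. hexc m w * pc (\<lambda>j i. qi (dc a b j i)) w r)"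
  proof (intro sum.cong refl)
    fix w :: "letter list" assume "w \<in> {w. length w = n}"
    then have "ent (wd ?A w) (rev r @ [S4]) [S4] = pc (\<lambda>j i. qi (dc a b j i)) w (rev (rev r))"
      using wd_lead[of ?A "\<lambda>j i. qi (dc a b j i)" "rev r @ [S4]" w, OF A l] r by simp
    then show "hexc m w * ent (wd ?A w) (rev r @ [S4]) [S4] = hexc m w * pc (\<lambda>j i. qi (dc a b j i)) w r" by simp
  qed
  finally show ?thesis .
qed

lemma sum_pc:
  assumes "\<And>i j. i \<in> set r \<Longrightarrow> (i \<in> pr a b j) = (j = \<phi> i)" "length r = n"
  shows "(\<Sum>w | length w = n. hexc m w * pc (\<lambda>j i. qi (dc a b j i)) w r) = hexc m (map \<phi> r)"
proof -
  have "pc (\<lambda>j i. qi (dc a b j i) :: 'k) w r = (if w = map \<phi> r then 1 else 0)" for w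
    by (rule pc_map) (use assms(1) in \<open>simp add: dc_def\<close>)
  then have "(\<Sum>w | length w = n. hexc m w * pc (\<lambda>j i. qi (dc a b j i)) w r) =
     (\<Sum>w | length w = n. if w = map \<phi> r then hexc m w else 0)" by (intro sum.cong) auto
  then show ?thesis using assms(2) by (simp add: sum.delta')
qed

text \<open>Let h be the part of degree n of the loop and t_i = t_i4. Unipotent conjugation leaves
  leading terms unchanged and products add them, so the relation between four loops becomes h(t_1 +
  t_2, t_3) + h(t_1, t_2) = h(t_1, t_2 + t_3) + h(t_2, t_3). The claim is the coefficient of r; a
  pair of arguments that lacks a letter of r contributes zero.\<close>

lemma hexc_cocycle:
  assumes n: "\<And>w. 0 < length w \<Longrightarrow> length w < n \<Longrightarrow> hexc m w = 0" "n > 0"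
    and r: "length r = n" "S4 \<notin> set r"
  shows "hexc m (map (\<lambda>i. if i = S3 then LY else LX) r) + (if S3 \<in> set r then 0 else hexc m (map (\<lambda>i. if i = S1 then LX else LY) r)) =
      hexc m (map (\<lambda>i. if i = S1 then LX else LY) r) + (if S1 \<in> set r then 0 else hexc m (map (\<lambda>i. if i = S2 then LX else LY) r))"
proof -
  let ?u = "rev r @ [S4]" and ?v = "[S4]"
  have l: "length ?u = length ?v + n" using r by simp
  obtain W1 W2 W3 W4 W1' W2' W3' W4' :: "(strand, 'k) tmat"
    where W: "unip W1" "unip W2" "unip W3" "unip W4"
      "W1' * W1 = 1" "W2' * W2 = 1" "W3' * W3 = 1" "W4' * W4 = 1"
      and E: "(W1' * hexa m zA x34 * W1) * (W2' * hexa m zB z234 * W2) =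
       (W3' * hexa m zB b24 * W3) * (W4' * hexa m z234 x34 * W4)"
    by (rule hexagon_relation_hexa)
  have h: "hexa m zA x34 - 1 \<in> Fil n" "hexa m zB z234 - 1 \<in> Fil n"
    "hexa m zB b24 - 1 \<in> Fil n" "hexa m z234 x34 - 1 \<in> Fil n"
    by (rule hexa_lead(1); use n unip_z unip_x in simp)+
  note c = conj_lead[OF h(1) W(1,5)] conj_lead[OF h(2) W(2,6)] conj_lead[OF h(3) W(3,7)] conj_lead[OF h(4) W(4,8)]
  have e0: "ent (hexa m zA x34 - 1) ?u ?v + ent (hexa m zB z234 - 1) ?u ?v =
        ent (hexa m zB b24 - 1) ?u ?v + ent (hexa m z234 x34 - 1) ?u ?v"
    using arg_cong[OF E, of "\<lambda>M. ent (M - 1) ?u ?v"] prod_lead[OF c(1) c(3) n(2) l] prod_lead[OF c(5) c(7) n(2) l]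
      c(2)[OF l] c(4)[OF l] c(6)[OF l] c(8)[OF l] by simp
  have e1: "ent (hexa m zA x34 - 1) ?u ?v = hexc m (map (\<lambda>i. if i = S3 then LY else LX) r)"
  proof (subst hexa_entry[where a = "{S1, S2}" and b = "{S3}", OF _ _ n r])
    show "(\<Sum>w | length w = n. hexc m w * pc (\<lambda>j i. qi (dc {S1, S2} {S3} j i)) w r) =
      hexc m (map (\<lambda>i. if i = S3 then LY else LX) r)"
    proof (rule sum_pc[OF _ r(1)])
      fix i j assume "i \<in> set r"
      then have "i \<noteq> S4" using r by auto
      then show "(i \<in> pr {S1, S2} {S3} j) = (j = (if i = S3 then LY else LX))"
        by (cases i; cases j) auto
    qed
  qed (use ld1_zA ld1_x(3) in \<open>simp_all add: dc_def\<close>)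
  have e2: "ent (hexa m zB z234 - 1) ?u ?v =
    (if S3 \<in> set r then 0 else hexc m (map (\<lambda>i. if i = S1 then LX else LY) r))"
  proof (subst hexa_entry[where a = "{S1}" and b = "{S2}", OF _ _ n r])
    show "(\<Sum>w | length w = n. hexc m w * pc (\<lambda>j i. qi (dc {S1} {S2} j i)) w r) =
      (if S3 \<in> set r then 0 else hexc m (map (\<lambda>i. if i = S1 then LX else LY) r))"
    proof (cases "S3 \<in> set r")
      case True
      have "pc (\<lambda>j i. qi (dc {S1} {S2} j i) :: 'k) w r = 0" for w
        by (rule pc_zero[OF True]) (auto simp: dc_def split: letter.split)
      then show ?thesis using True by simp
    next
      case False
      have "(\<Sum>w | length w = n. hexc m w * pc (\<lambda>j i. qi (dc {S1} {S2} j i)) w r) =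
        hexc m (map (\<lambda>i. if i = S1 then LX else LY) r)"
      proof (rule sum_pc[OF _ r(1)])
        fix i j assume "i \<in> set r"
        then have "i \<noteq> S4" "i \<noteq> S3" using r False by auto
        then show "(i \<in> pr {S1} {S2} j) = (j = (if i = S1 then LX else LY))"
          by (cases i; cases j) auto
      qed
      then show ?thesis using False by simp
    qed
  qed (use ld1_x(7,8) in \<open>simp_all add: dc_def zB_def z234_def\<close>)
  have e3: "ent (hexa m zB b24 - 1) ?u ?v = hexc m (map (\<lambda>i. if i = S1 then LX else LY) r)"
  proof (subst hexa_entry[where a = "{S1}" and b = "{S2, S3}", OF _ _ n r])
    show "(\<Sum>w | length w = n. hexc m w * pc (\<lambda>j i. qi (dc {S1} {S2, S3} j i)) w r) =
      hexc m (map (\<lambda>i. if i = S1 then LX else LY) r)"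
    proof (rule sum_pc[OF _ r(1)])
      fix i j assume "i \<in> set r"
      then have "i \<noteq> S4" using r by auto
      then show "(i \<in> pr {S1} {S2, S3} j) = (j = (if i = S1 then LX else LY))"
        by (cases i; cases j) auto
    qed
  qed (use ld1_cabled(2) ld1_x(8) in \<open>simp_all add: dc_def zB_def\<close>)
  have e4: "ent (hexa m z234 x34 - 1) ?u ?v =
    (if S1 \<in> set r then 0 else hexc m (map (\<lambda>i. if i = S2 then LX else LY) r))"
  proof (subst hexa_entry[where a = "{S2}" and b = "{S3}", OF _ _ n r])
    show "(\<Sum>w | length w = n. hexc m w * pc (\<lambda>j i. qi (dc {S2} {S3} j i)) w r) =
      (if S1 \<in> set r then 0 else hexc m (map (\<lambda>i. if i = S2 then LX else LY) r))"
    proof (cases "S1 \<in> set r")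
      case True
      have "pc (\<lambda>j i. qi (dc {S2} {S3} j i) :: 'k) w r = 0" for w
        by (rule pc_zero[OF True]) (auto simp: dc_def split: letter.split)
      then show ?thesis using True by simp
    next
      case False
      have "(\<Sum>w | length w = n. hexc m w * pc (\<lambda>j i. qi (dc {S2} {S3} j i)) w r) =
        hexc m (map (\<lambda>i. if i = S2 then LX else LY) r)"
      proof (rule sum_pc[OF _ r(1)])
        fix i j assume "i \<in> set r"
        then have "i \<noteq> S4" "i \<noteq> S1" using r False by auto
        then show "(i \<in> pr {S2} {S3} j) = (j = (if i = S2 then LX else LY))"
          by (cases i; cases j) auto
      qed
      then show ?thesis using False by simp
    qed
  qed (use ld1_x(3,7) in \<open>simp_all add: dc_def z234_def\<close>)
  show ?thesis using e0 unfolding e1 e2 e3 e4 .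
qed

text \<open>Induction on the degree: once all lower coefficients vanish, those of the current degree
  are leading terms and satisfy the cocycle equation. The assumption on m is what degree two asks
  for.\<close>

lemma hexc_zero:
  assumes "(m * m + m) * qi (1 / 2) = 3 * \<Phi> [LX, LY]" "w \<noteq> []"
  shows "hexc m w = 0"
  using assms(2)
proof (induction "length w" arbitrary: w rule: less_induct)
  case less
  let ?n = "length w"
  have n: "?n > 0" using less(2) by simp
  have low: "hexc m w' = 0" if "0 < length w'" "length w' < ?n" for w'
    using less(1)[of w'] that by auto
  show ?case
    by (rule cocycle_vanish[OF n hexc_cocycle[OF low n] sum_hexc[OF n]])
       (use assms(1) in \<open>auto simp: hexc_2\<close>)
qed

lemma hexa_eq_1:
  fixes z y :: "('i::finite, rat) tmat"
  assumes "(m * m + m) * qi (1 / 2) = 3 * \<Phi> [LX, LY]" and F: "unip z" "unip y"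
  shows "hexa m z y = 1"
proof -
  have "hexc m = delta"
    using hexc_zero[OF assms(1)] hexc_Nil by (auto simp: delta_def)
  moreover have A: "pr (lg (qm z)) (lg (qm y)) j \<in> Fil 1" for j using F by auto
  ultimately show ?thesis unfolding hexa_ev[OF F] using ev_delta[OF A] by simp
qed

text \<open>The arguments are z = (e^X e^Y)^-1 and y = e^Y, so that the remaining one is e^X.
  Necessity is read off from the XY coefficient, sufficiency is \<open>hexa_eq_1\<close>.\<close>

theorem hexagon_iff:
  "hexa m (ui (eLX * eLY)) eLY = 1 \<longleftrightarrow> (m * m + m) * qi (1 / 2) = 3 * \<Phi> [LX, LY]"
proof
  have F: "unip (eLX * eLY)" by (intro Fil1_mult unip_eL)
  have uF: "unip (ui (eLX * eLY))" by (rule Fil1_ui[OF F])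
  have "tr (qm (eLX * eLY)) (1 + 0) (0 + 1) (0 + 0 + 1 * 1)"
    unfolding qm_mult by (rule tr_mult[OF tr_gen])
  from tr_pw[OF this, of "- 1"] have
    "tr (qm (ui (eLX * eLY))) (- 1 * (1 + 0)) (- 1 * (0 + 1)) (- 1 * (0 + 0 + 1 * 1) + (- 1 * - 1 - - 1) * qi (1 / 2) * (1 + 0) * (0 + 1))"
    unfolding qm_ui_pw[OF F] .
  from hexa_tr[OF this tr_gen(2) uF unip_eL(2), of m]
  have t: "tr (hexa m (ui (eLX * eLY)) eLY) 0 0 (3 * \<Phi> [LX, LY] - (m * m + m) * qi (1 / 2))"
    by (simp add: algebra_simps)
  show "(m * m + m) * qi (1 / 2) = 3 * \<Phi> [LX, LY]" if "hexa m (ui (eLX * eLY)) eLY = 1"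
    using t unfolding that by (simp add: tr_def col_def ent_1)
  show "hexa m (ui (eLX * eLY)) eLY = 1" if "(m * m + m) * qi (1 / 2) = 3 * \<Phi> [LX, LY]"
    by (rule hexa_eq_1[OF that uF unip_eL(2)])
qed

end

section \<open>The \<open>l\<close>-adic absolute value\<close>

locale padic = fixes l :: nat assumes l: "Factorial_Ring.prime l"
begin

abbreviation pa :: "rat \<Rightarrow> real" where "pa \<equiv> padic_abs l"

abbreviation vl :: "int \<Rightarrow> int" where "vl a \<equiv> int (multiplicity (int l) a)"

lemma l_gt1: "real l > 1" and l_prime_elem: "prime_elem (int l)" and l_not_unit: "\<not> is_unit (int l)"
proof -
  show "real l > 1" using prime_gt_1_nat[OF l] by simp
  have p: "Factorial_Ring.prime (int l)" using l by simp
  then show "prime_elem (int l)" by (rule prime_imp_prime_elem)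
  then show "\<not> is_unit (int l)" by (rule prime_elem_not_unit)
qed

lemma pa_frac:
  assumes "a \<noteq> 0" "b \<noteq> 0"
  shows "pa (of_int a / of_int b) = real l powi (vl b - vl a)"
proof -
  define q where "q = (of_int a / of_int b :: rat)"
  obtain n d where nd: "quotient_of q = (n, d)" by force
  have d: "d > 0" and q: "q = of_int n / of_int d" using quotient_of_denom_pos[OF nd] quotient_of_div[OF nd] by auto
  have q0: "q \<noteq> 0" using assms by (simp add: q_def)
  then have n0: "n \<noteq> 0" using q by auto
  have "of_int a * of_int d = (of_int n * of_int b :: rat)"
    using assms d q by (simp add: q_def field_simps)
  then have "a * d = n * b" by (simp flip: of_int_mult)
  then have "multiplicity (int l) (a * d) = multiplicity (int l) (n * b)" by simp
  then have "vl a + vl d = vl n + vl b"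
    using prime_elem_multiplicity_mult_distrib[OF l_prime_elem] assms d n0 by simp
  then have e: "vl d - vl n = vl b - vl a"
    by simp
  have "pa q = real l powi (vl d - vl n)"
    using q0 nd by (simp add: padic_abs_def)
  then show ?thesis unfolding e q_def .
qed

lemma rat_frac: "\<exists>a b. b \<noteq> 0 \<and> (q :: rat) = of_int a / of_int b"
proof -
  obtain n d where "quotient_of q = (n, d)" by force
  then show ?thesis using quotient_of_denom_pos quotient_of_div by (metis less_irrefl)
qed

lemma pa_0 [simp]: "pa 0 = 0" by (simp add: padic_abs_def)

lemma pa_nonneg [simp]: "pa q \<ge> 0" by (simp add: padic_abs_def)

lemma pa_pos: "q \<noteq> 0 \<Longrightarrow> pa q > 0" using l_gt1 by (simp add: padic_abs_def)

lemma pa_eq_0 [simp]: "pa q = 0 \<longleftrightarrow> q = 0" using pa_pos[of q] by fastforce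

lemma pa_mult: "pa (p * q) = pa p * pa q"
proof (cases "p = 0 \<or> q = 0")
  case False
  obtain a b c d where *: "b \<noteq> 0" "p = of_int a / of_int b" "d \<noteq> 0" "q = of_int c / of_int d"
    using rat_frac[of p] rat_frac[of q] by metis
  have ac: "a \<noteq> 0" "c \<noteq> 0" using False * by auto
  have pq: "p * q = of_int (a * c) / of_int (b * d)" by (simp add: *)
  have "pa (p * q) = real l powi (vl (b * d) - vl (a * c))"
    unfolding pq by (rule pa_frac) (use * ac in auto)
  also have "\<dots> = real l powi ((vl b - vl a) + (vl d - vl c))"
    using * ac by (simp add: prime_elem_multiplicity_mult_distrib[OF l_prime_elem] algebra_simps)
  also have "\<dots> = pa p * pa q"
    using l_gt1 * ac pa_frac[OF ac(1) *(1)] pa_frac[OF ac(2) *(3)] by (subst power_int_add) auto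
  finally show ?thesis .
qed auto

lemma pa_1 [simp]: "pa 1 = 1" using pa_mult[of 1 1] pa_pos[of 1] by simp

lemma pa_minus [simp]: "pa (- q) = pa q"
proof -
  have "pa (- 1) * pa (- 1) = 1" by (simp flip: pa_mult)
  then have "(pa (- 1))\<^sup>2 = 1" by (simp add: power2_eq_square)
  then have "pa (- 1) = 1" using pa_nonneg[of "- 1"] by (simp add: power2_eq_1_iff)
  then show ?thesis using pa_mult[of "- 1" q] by simp
qed

lemma pa_diff_commute: "pa (p - q) = pa (q - p)"
  using pa_minus[of "p - q"] by simp

lemma pa_le_iff:
  assumes "b \<noteq> 0" "a \<noteq> 0"
  shows "pa (of_int a / of_int b) \<le> real l powi k \<longleftrightarrow> vl b - vl a \<le> k"
  unfolding pa_frac[OF assms(2,1)] using l_gt1 power_int_strict_increasing[OF _ l_gt1] power_int_increasing[of _ _ "real l"]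
  by (meson less_imp_le not_le)

lemma pa_int: "pa (of_int a) \<le> 1"
proof (cases "a = 0")
  case False
  then show ?thesis using pa_le_iff[of 1 a 0] by simp
qed simp

lemma pa_add: "pa (p + q) \<le> max (pa p) (pa q)"
proof (cases "p = 0 \<or> q = 0 \<or> p + q = 0")
  case False
  obtain a b c d where *: "b \<noteq> 0" "p = of_int a / of_int b" "d \<noteq> 0" "q = of_int c / of_int d"
    using rat_frac[of p] rat_frac[of q] by metis
  have ac: "a \<noteq> 0" "c \<noteq> 0" using False * by auto
  let ?m = "multiplicity (int l)"
  define A where "A = a * d" define B where "B = c * b"
  have pe: "p = of_int A / of_int (b * d)" and qe: "q = of_int B / of_int (b * d)"
    and s: "p + q = of_int (A + B) / of_int (b * d)" using * by (simp_all add: A_def B_def field_simps)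
  have nz: "A \<noteq> 0" "B \<noteq> 0" "b * d \<noteq> 0" using * ac by (auto simp: A_def B_def)
  have nz': "A + B \<noteq> 0" using False s by (intro notI) simp
  have "int l ^ min (?m A) (?m B) dvd A" "int l ^ min (?m A) (?m B) dvd B"
    by (meson dvd_trans le_imp_power_dvd min.cobounded1 min.cobounded2 multiplicity_dvd)+
  then have "int l ^ min (?m A) (?m B) dvd A + B" by (rule dvd_add)
  then have m: "min (?m A) (?m B) \<le> ?m (A + B)"
    using l_not_unit nz' by (intro multiplicity_geI) auto
  have "pa (p + q) \<le> real l powi (int (?m (b * d)) - int (min (?m A) (?m B)))"
    unfolding s using m nz nz' by (subst pa_le_iff) auto
  also have "\<dots> \<le> max (pa p) (pa q)"
    unfolding pe qe pa_frac[OF nz(1,3)] pa_frac[OF nz(2,3)] by (cases "?m A \<le> ?m B") auto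
  finally show ?thesis .
qed (auto simp: add_eq_0_iff)

lemma pa_diff: "pa (p - q) \<le> max (pa p) (pa q)"
  using pa_add[of p "- q"] by simp

lemma pa_diff_less: "pa (p - q) < e \<Longrightarrow> pa (q - r) < e \<Longrightarrow> pa (p - r) < e"
  using pa_add[of "p - q" "q - r"] by simp

lemma pa_triangle: "pa (p + q) \<le> pa p + pa q"
proof -
  have "max (pa p) (pa q) \<le> pa p + pa q" by simp
  then show ?thesis using pa_add[of p q] by linarith
qed

lemma pa_abs_diff: "\<bar>pa p - pa q\<bar> \<le> pa (p - q)"
  using pa_triangle[of "p - q" q] pa_triangle[of "q - p" p] pa_diff_commute[of p q] by simp

lemma pa_power: "pa (q ^ n) = pa q ^ n" by (induction n) (auto simp: pa_mult)

lemma pa_l: "pa (of_nat l) = 1 / real l"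
proof -
  have "pa (of_int (int l) / of_int 1) = real l powi (- 1)"
    by (subst pa_frac) (use l_gt1 l_prime_elem in auto)
  then show ?thesis by (simp add: inverse_eq_divide)
qed

lemma pa_small: "e > 0 \<Longrightarrow> \<exists>k. (1 / real l) ^ k < e"
  using real_arch_pow_inv[of e "1 / real l"] l_gt1 by simp

lemma pa_dvd: "int l ^ k dvd a \<Longrightarrow> pa (of_int a) \<le> (1 / real l) ^ k"
proof -
  assume "int l ^ k dvd a"
  then obtain b where "a = int l ^ k * b" by blast
  then have "pa (of_int a) = pa (of_nat l) ^ k * pa (of_int b)" by (simp add: pa_mult pa_power)
  then show ?thesis unfolding pa_l using pa_int[of b] l_gt1 by (simp add: mult_left_le)
qed

lemma pa_dvd_iff: "pa (of_int a) < (1 / real l) ^ k \<Longrightarrow> int l ^ k dvd a"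
proof (cases "a = 0")
  case False
  assume "pa (of_int a) < (1 / real l) ^ k"
  moreover have "(1 / real l) ^ k = real l powi (- int k)"
    using l_gt1 by (simp add: power_int_minus power_one_over inverse_eq_divide)
  ultimately have "pa (of_int a / of_int 1) \<le> real l powi (- int k)" by simp
  then have "k \<le> multiplicity (int l) a" using False by (subst (asm) pa_le_iff) auto
  then show ?thesis by (rule multiplicity_dvd')
qed simp

section \<open>The field of \<open>l\<close>-adic numbers\<close>

abbreviation Cs where "Cs \<equiv> carrier (padic_cauchy l)"
abbreviation Ns where "Ns \<equiv> padic_null l"

lemma Cs_iff: "a \<in> Cs \<longleftrightarrow> (\<forall>e>0. \<exists>N. \<forall>m\<ge>N. \<forall>n\<ge>N. pa (a m - a n) < e)"
  by (simp add: padic_cauchy_def)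

lemma Ns_iff: "a \<in> Ns \<longleftrightarrow> (\<forall>e>0. \<exists>N. \<forall>n\<ge>N. pa (a n) < e)"
  by (simp add: padic_null_def lim_sequentially)

lemma CsD: "a \<in> Cs \<Longrightarrow> e > 0 \<Longrightarrow> \<exists>N. \<forall>m\<ge>N. \<forall>n\<ge>N. pa (a m - a n) < e"
  by (simp add: Cs_iff)

lemma Cs_bound: assumes "a \<in> Cs" shows "\<exists>B>0. \<forall>n. pa (a n) \<le> B"
proof -
  obtain N where N: "\<forall>m\<ge>N. \<forall>n\<ge>N. pa (a m - a n) < 1" using CsD[OF assms, of 1] by auto
  define B where "B = Max ((\<lambda>n. pa (a n)) ` {..N}) + 1"
  have b: "pa (a n) \<le> B - 1" if "n \<le> N" for n unfolding B_def using that by (simp add: Max_ge)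
  have B: "B > 0" using b[of 0] pa_nonneg[of "a 0"] by linarith
  have "pa (a n) \<le> B" for n
  proof (cases "n \<le> N")
    case True
    then show ?thesis using b[of n] by simp
  next
    case False
    then have "pa (a n - a N) < 1" using N by simp
    then show ?thesis using pa_triangle[of "a n - a N" "a N"] b[of N] by simp
  qed
  then show ?thesis using B by blast
qed

lemma Cs_add: assumes "a \<in> Cs" "b \<in> Cs" shows "(\<lambda>n. a n + b n) \<in> Cs"
  unfolding Cs_iff
proof (intro allI impI)
  fix e :: real assume e: "e > 0"
  obtain M N where M: "\<forall>m\<ge>M. \<forall>n\<ge>M. pa (a m - a n) < e" and N: "\<forall>m\<ge>N. \<forall>n\<ge>N. pa (b m - b n) < e"
    using CsD[OF assms(1) e] CsD[OF assms(2) e] by blast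
  have "pa ((a m + b m) - (a n + b n)) < e" if "m \<ge> max M N" "n \<ge> max M N" for m n
  proof -
    have "pa ((a m + b m) - (a n + b n)) = pa ((a m - a n) + (b m - b n))" by (simp add: algebra_simps)
    also have "\<dots> \<le> max (pa (a m - a n)) (pa (b m - b n))" by (rule pa_add)
    also have "\<dots> < e" using M N that by simp
    finally show ?thesis .
  qed
  then show "\<exists>N. \<forall>m\<ge>N. \<forall>n\<ge>N. pa ((a m + b m) - (a n + b n)) < e" by blast
qed

lemma pa_mult_diff: "pa (x * y - x' * y') \<le> max (pa x * pa (y - y')) (pa y' * pa (x - x'))"
proof -
  have "x * y - x' * y' = x * (y - y') + y' * (x - x')" by (simp add: algebra_simps)
  then show ?thesis using pa_add[of "x * (y - y')" "y' * (x - x')"] by (simp add: pa_mult)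
qed

lemma Cs_mult: assumes "a \<in> Cs" "b \<in> Cs" shows "(\<lambda>n. a n * b n) \<in> Cs"
  unfolding Cs_iff
proof (intro allI impI)
  fix e :: real assume e: "e > 0"
  obtain A B where A: "A > 0" "\<forall>n. pa (a n) \<le> A" and B: "B > 0" "\<forall>n. pa (b n) \<le> B"
    using Cs_bound[OF assms(1)] Cs_bound[OF assms(2)] by blast
  obtain M N where M: "\<forall>m\<ge>M. \<forall>n\<ge>M. pa (a m - a n) < e / B" and N: "\<forall>m\<ge>N. \<forall>n\<ge>N. pa (b m - b n) < e / A"
    using CsD[OF assms(1), of "e / B"] CsD[OF assms(2), of "e / A"] e A B by fastforce
  have "pa (a m * b m - a n * b n) < e" if "m \<ge> max M N" "n \<ge> max M N" for m n
  proof -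
    have "pa (a m) * pa (b m - b n) \<le> A * pa (b m - b n)" using A by (simp add: mult_right_mono)
    also have "\<dots> < A * (e / A)" using N that A by (intro mult_strict_left_mono) auto
    finally have 1: "pa (a m) * pa (b m - b n) < e" using A by simp
    have "pa (b n) * pa (a m - a n) \<le> B * pa (a m - a n)" using B by (simp add: mult_right_mono)
    also have "\<dots> < B * (e / B)" using M that B by (intro mult_strict_left_mono) auto
    finally have 2: "pa (b n) * pa (a m - a n) < e" using B by simp
    show ?thesis using pa_mult_diff[of "a m" "b m" "a n" "b n"] 1 2 by linarith
  qed
  then show "\<exists>N. \<forall>m\<ge>N. \<forall>n\<ge>N. pa (a m * b m - a n * b n) < e" by blast
qed

lemma Cs_const: "(\<lambda>n. c) \<in> Cs" by (simp add: Cs_iff)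

lemma Cs_minus: "a \<in> Cs \<Longrightarrow> (\<lambda>n. - a n) \<in> Cs"
  using Cs_mult[OF Cs_const[of "- 1"], of a] by simp

lemma Ns_Cs: "a \<in> Ns \<Longrightarrow> a \<in> Cs"
proof -
  assume a: "a \<in> Ns"
  have "\<exists>N. \<forall>m\<ge>N. \<forall>n\<ge>N. pa (a m - a n) < e" if e: "e > 0" for e
  proof -
    obtain N where "\<forall>n\<ge>N. pa (a n) < e" using a e by (auto simp: Ns_iff)
    then have "pa (a m - a n) < e" if "m \<ge> N" "n \<ge> N" for m n
      using pa_diff[of "a m" "a n"] that by (simp add: order.strict_trans1)
    then show ?thesis by blast
  qed
  then show ?thesis by (simp add: Cs_iff)
qed

lemma padic_ops [simp]:
  "\<zero>\<^bsub>padic_cauchy l\<^esub> = (\<lambda>n. 0)" "\<one>\<^bsub>padic_cauchy l\<^esub> = (\<lambda>n. 1)"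
  "a \<oplus>\<^bsub>padic_cauchy l\<^esub> b = (\<lambda>n. a n + b n)" "a \<otimes>\<^bsub>padic_cauchy l\<^esub> b = (\<lambda>n. a n * b n)"
  by (simp_all add: padic_cauchy_def)

lemma cring_padic_cauchy: "cring (padic_cauchy l)"
proof (rule cringI)
  show "abelian_group (padic_cauchy l)"
  proof (rule abelian_groupI)
    fix a assume "a \<in> Cs"
    then show "\<exists>y\<in>Cs. y \<oplus>\<^bsub>padic_cauchy l\<^esub> a = \<zero>\<^bsub>padic_cauchy l\<^esub>"
      by (intro bexI[of _ "\<lambda>n. - a n"]) (auto intro: Cs_minus)
  qed (auto intro: Cs_add Cs_const simp: algebra_simps)
  show "comm_monoid (padic_cauchy l)"
    by (rule comm_monoidI) (auto intro: Cs_mult Cs_const simp: algebra_simps)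
qed (auto simp: algebra_simps)

lemma padic_uminus: "a \<in> Cs \<Longrightarrow> \<ominus>\<^bsub>padic_cauchy l\<^esub> a = (\<lambda>n. - a n)"
proof -
  interpret cring "padic_cauchy l" by (rule cring_padic_cauchy)
  assume "a \<in> Cs"
  then show ?thesis by (intro minus_equality) (auto intro: Cs_minus)
qed

lemma Ns_mult: assumes "a \<in> Ns" "b \<in> Cs" shows "(\<lambda>n. a n * b n) \<in> Ns"
  unfolding Ns_iff
proof (intro allI impI)
  fix e :: real assume e: "e > 0"
  obtain B where B: "B > 0" "\<forall>n. pa (b n) \<le> B" using Cs_bound[OF assms(2)] by blast
  obtain N where N: "\<forall>n\<ge>N. pa (a n) < e / B" using assms(1) e B unfolding Ns_iff by (meson divide_pos_pos)
  have "pa (a n * b n) < e" if "n \<ge> N" for n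
  proof -
    have "pa (a n * b n) \<le> pa (a n) * B" using B by (simp add: pa_mult mult_left_mono)
    also have "\<dots> < e / B * B" using N that B by (intro mult_strict_right_mono) auto
    finally show ?thesis using B by simp
  qed
  then show "\<exists>N. \<forall>n\<ge>N. pa (a n * b n) < e" by blast
qed

lemma Ns_add: assumes "a \<in> Ns" "b \<in> Ns" shows "(\<lambda>n. a n + b n) \<in> Ns"
  unfolding Ns_iff
proof (intro allI impI)
  fix e :: real assume e: "e > 0"
  obtain M N where M: "\<forall>n\<ge>M. pa (a n) < e" and N: "\<forall>n\<ge>N. pa (b n) < e"
    using assms e unfolding Ns_iff by meson
  have "pa (a n + b n) < e" if "n \<ge> max M N" for n
    using pa_add[of "a n" "b n"] M N that by (simp add: order.strict_trans1)
  then show "\<exists>N. \<forall>n\<ge>N. pa (a n + b n) < e" by blast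
qed

lemma Ns_minus: "a \<in> Ns \<Longrightarrow> (\<lambda>n. - a n) \<in> Ns" by (simp add: Ns_iff)
lemma Ns_zero: "(\<lambda>n. 0) \<in> Ns" by (simp add: Ns_iff)

lemma ideal_Ns: "ideal Ns (padic_cauchy l)"
proof (rule idealI)
  interpret cring "padic_cauchy l" by (rule cring_padic_cauchy)
  show "ring (padic_cauchy l)" by (rule ring_axioms)
  show "subgroup Ns (add_monoid (padic_cauchy l))"
  proof (rule group.subgroupI[OF a_group])
    show "Ns \<subseteq> carrier (add_monoid (padic_cauchy l))" using Ns_Cs by auto
    show "Ns \<noteq> {}" using Ns_zero by auto
    fix a assume "a \<in> Ns"
    then show "inv\<^bsub>add_monoid (padic_cauchy l)\<^esub> a \<in> Ns"
      using padic_uminus[OF Ns_Cs] Ns_minus by (simp add: a_inv_def)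
  qed (simp add: Ns_add)
  fix a x assume "a \<in> Ns" "x \<in> Cs"
  then show "x \<otimes>\<^bsub>padic_cauchy l\<^esub> a \<in> Ns" "a \<otimes>\<^bsub>padic_cauchy l\<^esub> x \<in> Ns"
    using Ns_mult[of a x] by (simp_all add: mult.commute)
qed

lemma not_null_inverse:
  assumes "a \<in> Cs" "a \<notin> Ns"
  shows "\<exists>b\<in>Cs. \<exists>N. \<forall>n\<ge>N. a n * b n = 1"
proof -
  obtain e where e: "e > 0" "\<forall>N. \<exists>n\<ge>N. pa (a n) \<ge> e" using assms(2) unfolding Ns_iff by (meson not_less)
  obtain N where N: "\<forall>m\<ge>N. \<forall>n\<ge>N. pa (a m - a n) < e" using CsD[OF assms(1) e(1)] by blast
  \<comment> \<open>By the ultrametric inequality a term that differs by less than e from one of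
    size at least e has size at least e itself.\<close>
  have low: "pa (a n) \<ge> e" if "n \<ge> N" for n
  proof -
    obtain m where m: "m \<ge> N" "pa (a m) \<ge> e" using e by blast
    then show ?thesis using pa_add[of "a m - a n" "a n"] N that by (fastforce simp: max_def split: if_splits)
  qed
  then have nz: "a n \<noteq> 0" if "n \<ge> N" for n using that e(1) by fastforce
  have "(\<lambda>n. 1 / a n) \<in> Cs"
    unfolding Cs_iff
  proof (intro allI impI)
    fix d :: real assume d: "d > 0"
    obtain M where M: "\<forall>m\<ge>M. \<forall>n\<ge>M. pa (a m - a n) < d * (e * e)" using CsD[OF assms(1), of "d * (e * e)"] d e by auto
    have "pa (1 / a m - 1 / a n) < d" if mn: "m \<ge> max M N" "n \<ge> max M N" for m n
    proof -
      have "a m \<noteq> 0" "a n \<noteq> 0" using nz mn by auto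
      then have "(1 / a m - 1 / a n) * (a m * a n) = a n - a m" by (simp add: field_simps)
      then have "pa (1 / a m - 1 / a n) * (pa (a m) * pa (a n)) = pa (a n - a m)" by (simp flip: pa_mult)
      also have "\<dots> < d * (e * e)" using M mn by simp
      finally have 1: "pa (1 / a m - 1 / a n) * (pa (a m) * pa (a n)) < d * (e * e)" .
      have "e * e \<le> pa (a m) * pa (a n)" using low mn e by (intro mult_mono) auto
      then have "pa (1 / a m - 1 / a n) * (e * e) \<le> pa (1 / a m - 1 / a n) * (pa (a m) * pa (a n))"
        by (rule mult_left_mono) simp
      then have "pa (1 / a m - 1 / a n) * (e * e) < d * (e * e)" using 1 by simp
      then show ?thesis using e by simp
    qed
    then show "\<exists>N. \<forall>m\<ge>N. \<forall>n\<ge>N. pa (1 / a m - 1 / a n) < d" by blast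
  qed
  then show ?thesis using nz by (intro bexI[of _ "\<lambda>n. 1 / a n"]) auto
qed

lemma eventually_0_Ns: "\<forall>n\<ge>N. a n = 0 \<Longrightarrow> a \<in> Ns"
  unfolding Ns_iff by (metis pa_0)

lemma field_Ql: "field (Ql l)"
  unfolding Ql_def
proof (rule maximalideal.quotient_is_field[OF _ cring_padic_cauchy], rule maximalidealI[OF ideal_Ns])
  have "(\<lambda>n. 1) \<notin> Ns" by (auto simp: Ns_iff intro!: exI[of _ "1/2"])
  then show "Cs \<noteq> Ns" using Cs_const by blast
  fix J assume J: "ideal J (padic_cauchy l)" "Ns \<subseteq> J" "J \<subseteq> Cs"
  interpret J: ideal J "padic_cauchy l" by (rule J(1))
  show "J = Ns \<or> J = Cs"
  proof (cases "J = Ns")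
    case False
    then obtain a where a: "a \<in> J" "a \<notin> Ns" using J by blast
    obtain b N where b: "b \<in> Cs" "\<forall>n\<ge>N. a n * b n = 1" using not_null_inverse[of a] a J by blast
    have ab: "(\<lambda>n. a n * b n) \<in> J" using J.I_r_closed[OF a(1) b(1)] by simp
    have "(\<lambda>n. 1 - a n * b n) \<in> J" using eventually_0_Ns[of N "\<lambda>n. 1 - a n * b n"] b J by auto
    from additive_subgroup.a_closed[OF J.additive_subgroup_axioms this ab]
    have "\<one>\<^bsub>padic_cauchy l\<^esub> \<in> J" by simp
    then have "J = Cs" by (rule J.one_imp_carrier)
    then show ?thesis by simp
  qed simp
qed

definition cl :: "(nat \<Rightarrow> rat) \<Rightarrow> (nat \<Rightarrow> rat) set" where "cl a = Ns +>\<^bsub>padic_cauchy l\<^esub> a"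

lemma cl_iff: "a \<in> Cs \<Longrightarrow> b \<in> cl a \<longleftrightarrow> (\<lambda>n. b n - a n) \<in> Ns"
proof
  assume a: "a \<in> Cs"
  show "(\<lambda>n. b n - a n) \<in> Ns" if "b \<in> cl a"
    using that by (auto simp: cl_def a_r_coset_def r_coset_def)
  assume "(\<lambda>n. b n - a n) \<in> Ns"
  moreover have "b = (\<lambda>n. (b n - a n) + a n)" by simp
  ultimately show "b \<in> cl a" unfolding cl_def a_r_coset_def r_coset_def by fastforce
qed

lemma cl_self: "a \<in> Cs \<Longrightarrow> a \<in> cl a" by (simp add: cl_iff Ns_zero)

lemma cl_eq: "a \<in> Cs \<Longrightarrow> b \<in> Cs \<Longrightarrow> cl a = cl b \<longleftrightarrow> (\<lambda>n. a n - b n) \<in> Ns"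
proof
  assume ab: "a \<in> Cs" "b \<in> Cs"
  show "(\<lambda>n. a n - b n) \<in> Ns" if "cl a = cl b" using cl_self[OF ab(1)] that cl_iff[OF ab(2)] by simp
  assume d: "(\<lambda>n. a n - b n) \<in> Ns"
  have "(\<lambda>n. c n - a n) \<in> Ns \<longleftrightarrow> (\<lambda>n. c n - b n) \<in> Ns" for c
    using Ns_add[OF _ d, of "\<lambda>n. c n - a n"] Ns_add[OF _ Ns_minus[OF d], of "\<lambda>n. c n - b n"]
    by auto
  then show "cl a = cl b" by (auto simp: cl_iff ab)
qed

lemma Ql_carrier: "carrier (Ql l) = cl ` Cs"
  by (auto simp: Ql_def FactRing_def A_RCOSETS_def' cl_def)

lemma cl_hom: "cl \<in> ring_hom (padic_cauchy l) (Ql l)"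
  unfolding cl_def Ql_def by (rule ideal.rcos_ring_hom[OF ideal_Ns])

lemma cl_ops:
  "a \<in> Cs \<Longrightarrow> b \<in> Cs \<Longrightarrow> cl a \<oplus>\<^bsub>Ql l\<^esub> cl b = cl (\<lambda>n. a n + b n)"
  "a \<in> Cs \<Longrightarrow> b \<in> Cs \<Longrightarrow> cl a \<otimes>\<^bsub>Ql l\<^esub> cl b = cl (\<lambda>n. a n * b n)"
  "\<one>\<^bsub>Ql l\<^esub> = cl (\<lambda>n. 1)" (is ?P) "\<zero>\<^bsub>Ql l\<^esub> = cl (\<lambda>n. 0)" (is ?Q)
proof -
  show "a \<in> Cs \<Longrightarrow> b \<in> Cs \<Longrightarrow> cl a \<oplus>\<^bsub>Ql l\<^esub> cl b = cl (\<lambda>n. a n + b n)"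
    "a \<in> Cs \<Longrightarrow> b \<in> Cs \<Longrightarrow> cl a \<otimes>\<^bsub>Ql l\<^esub> cl b = cl (\<lambda>n. a n * b n)"
    using ring_hom_add[OF cl_hom] ring_hom_mult[OF cl_hom] by simp_all
  show ?P using ring_hom_one[OF cl_hom] by simp
  have "Ns = cl (\<lambda>n. 0)" by (auto simp: cl_iff Cs_const)
  then show ?Q by (simp add: Ql_def FactRing_def)
qed

lemma cl_minus:
  assumes "a \<in> Cs" "b \<in> Cs" shows "cl a \<ominus>\<^bsub>Ql l\<^esub> cl b = cl (\<lambda>n. a n - b n)"
proof -
  interpret field "Ql l" by (rule field_Ql)
  have "\<ominus>\<^bsub>Ql l\<^esub> cl b = cl (\<lambda>n. - b n)"
    using assms Cs_minus[OF assms(2)] by (intro minus_equality) (auto simp: Ql_carrier cl_ops)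
  then show ?thesis using assms Cs_minus[OF assms(2)] by (simp add: a_minus_def cl_ops)
qed

end

section \<open>The metric of the l-adic field and limits of rational functions along filters\<close>

context padic
begin

lemma Ql_abs_cl:
  assumes "a \<in> Cs" shows "(\<lambda>n. pa (a n)) \<longlonglongrightarrow> Ql_abs l (cl a)"
proof -
  have "Cauchy (\<lambda>n. pa (a n))"
  proof (rule metric_CauchyI)
    fix e :: real assume "e > 0"
    then obtain N where "\<forall>m\<ge>N. \<forall>n\<ge>N. pa (a m - a n) < e" using CsD[OF assms] by blast
    then show "\<exists>N. \<forall>m\<ge>N. \<forall>n\<ge>N. dist (pa (a m)) (pa (a n)) < e"
      unfolding dist_real_def using order.strict_trans1[OF pa_abs_diff] by (intro exI[of _ N]) simp
  qed
  then obtain r where r: "(\<lambda>n. pa (a n)) \<longlonglongrightarrow> r"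
    using real_Cauchy_convergent unfolding convergent_def by blast
  have "(\<lambda>n. pa (b n)) \<longlonglongrightarrow> r" if "b \<in> cl a" for b
  proof -
    have "(\<lambda>n. pa (b n - a n)) \<longlonglongrightarrow> 0" using that assms by (simp add: cl_iff padic_null_def)
    then have "(\<lambda>n. pa (b n) - pa (a n)) \<longlonglongrightarrow> 0"
      by (rule Lim_null_comparison[rotated]) (simp add: pa_abs_diff)
    from tendsto_add[OF this r] show ?thesis by simp
  qed
  then have "Ql_abs l (cl a) = r"
    unfolding Ql_abs_def using cl_self[OF assms] by (intro the_equality) (auto intro: LIMSEQ_unique)
  then show ?thesis using r by simp
qed

lemma Ql_dist_cl: "a \<in> Cs \<Longrightarrow> b \<in> Cs \<Longrightarrow> (\<lambda>n. pa (a n - b n)) \<longlonglongrightarrow> Ql_dist l (cl a) (cl b)"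
  using Ql_abs_cl[of "\<lambda>n. a n - b n"] Cs_add[of a "\<lambda>n. - b n"] Cs_minus[of b]
  by (simp add: Ql_dist_def Ql_carrier cl_minus)

lemma Metric_space_Ql: "Metric_space (carrier (Ql l)) (Ql_dist l)"
proof
  have nonneg: "0 \<le> Ql_dist l x y" if xy: "x \<in> carrier (Ql l)" "y \<in> carrier (Ql l)" for x y
  proof -
    obtain a b where "x = cl a" "y = cl b" "a \<in> Cs" "b \<in> Cs" using xy by (auto simp: Ql_carrier)
    then show ?thesis using LIMSEQ_le_const[OF Ql_dist_cl[of a b], of 0] by auto
  qed
  show "0 \<le> Ql_dist l x y" for x y
    using nonneg[of x y] by (auto simp: Ql_dist_def)
  show "Ql_dist l x y = Ql_dist l y x" for x y
  proof (cases "x \<in> carrier (Ql l) \<and> y \<in> carrier (Ql l)")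
    case True
    then obtain a b where ab: "x = cl a" "y = cl b" "a \<in> Cs" "b \<in> Cs" by (auto simp: Ql_carrier)
    have "(\<lambda>n. pa (a n - b n)) = (\<lambda>n. pa (b n - a n))" by (rule ext) (rule pa_diff_commute)
    then show ?thesis using Ql_dist_cl[of a b] Ql_dist_cl[of b a] ab by (auto intro: LIMSEQ_unique)
  qed (auto simp: Ql_dist_def)
  fix x y assume "x \<in> carrier (Ql l)" "y \<in> carrier (Ql l)"
  then obtain a b where ab: "x = cl a" "y = cl b" "a \<in> Cs" "b \<in> Cs" by (auto simp: Ql_carrier)
  have "Ql_dist l x y = 0 \<longleftrightarrow> (\<lambda>n. pa (a n - b n)) \<longlonglongrightarrow> 0"
    using Ql_dist_cl[of a b] ab by (auto intro: LIMSEQ_unique)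
  then show "(Ql_dist l x y = 0) = (x = y)" using cl_eq[of a b] ab by (simp add: padic_null_def)
  fix z assume "z \<in> carrier (Ql l)"
  then obtain c where c: "z = cl c" "c \<in> Cs" by (auto simp: Ql_carrier)
  have "pa (a n - c n) \<le> pa (a n - b n) + pa (b n - c n)" for n
    using pa_triangle[of "a n - b n" "b n - c n"] by simp
  then show "Ql_dist l x z \<le> Ql_dist l x y + Ql_dist l y z"
    using Ql_dist_cl[of a c] Ql_dist_cl[of a b] Ql_dist_cl[of b c] ab c
    by (auto intro!: LIMSEQ_le[OF _ tendsto_add])
qed

text \<open>The limit is represented by a rational Cauchy sequence and \<phi> is compared with its
  terms, so that all estimates stay among rational numbers. The nested quantifiers say that the
  distance from \<phi> g to the limit becomes small along the filter.\<close>

definition plim :: "('g \<Rightarrow> rat) \<Rightarrow> 'g filter \<Rightarrow> (nat \<Rightarrow> rat) set \<Rightarrow> bool" where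
  "plim \<phi> F x \<longleftrightarrow> (\<exists>a\<in>Cs. x = cl a \<and>
     (\<forall>e>0. eventually (\<lambda>g. eventually (\<lambda>n. pa (\<phi> g - a n) < e) sequentially) F))"

definition \<iota> :: "rat \<Rightarrow> (nat \<Rightarrow> rat) set" where "\<iota> q = cl (\<lambda>n. q)"

lemma plim_carrier: "plim \<phi> F x \<Longrightarrow> x \<in> carrier (Ql l)"
  by (auto simp: plim_def Ql_carrier)

lemma plim_const: "plim (\<lambda>_. q) F (\<iota> q)"
  unfolding plim_def \<iota>_def by (intro bexI[of _ "\<lambda>n. q"]) (auto simp: Cs_const)

lemma plim_add: assumes "plim \<phi> F x" "plim \<psi> F y" shows "plim (\<lambda>g. \<phi> g + \<psi> g) F (x \<oplus>\<^bsub>Ql l\<^esub> y)"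
proof -
  obtain a b where ab: "a \<in> Cs" "x = cl a" "b \<in> Cs" "y = cl b"
    and A: "\<And>e. e > 0 \<Longrightarrow> eventually (\<lambda>g. eventually (\<lambda>n. pa (\<phi> g - a n) < e) sequentially) F"
    and B: "\<And>e. e > 0 \<Longrightarrow> eventually (\<lambda>g. eventually (\<lambda>n. pa (\<psi> g - b n) < e) sequentially) F"
    using assms unfolding plim_def by blast
  show ?thesis unfolding plim_def
  proof (intro bexI[of _ "\<lambda>n. a n + b n"] conjI allI impI)
    fix e :: real assume e: "e > 0"
    show "eventually (\<lambda>g. eventually (\<lambda>n. pa (\<phi> g + \<psi> g - (a n + b n)) < e) sequentially) F"
      using A[OF e] B[OF e]
    proof eventually_elim
      case (elim g)
      from elim(1) elim(2) show ?case
      proof eventually_elim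
        case (elim n)
        have "pa (\<phi> g + \<psi> g - (a n + b n)) = pa ((\<phi> g - a n) + (\<psi> g - b n))" by (simp add: algebra_simps)
        then show ?case using pa_add[of "\<phi> g - a n" "\<psi> g - b n"] elim by simp
      qed
    qed
  qed (use ab in \<open>auto simp: cl_ops Cs_add\<close>)
qed

lemma plim_mult: assumes "plim \<phi> F x" "plim \<psi> F y" shows "plim (\<lambda>g. \<phi> g * \<psi> g) F (x \<otimes>\<^bsub>Ql l\<^esub> y)"
proof -
  obtain a b where ab: "a \<in> Cs" "x = cl a" "b \<in> Cs" "y = cl b"
    and A: "\<And>e. e > 0 \<Longrightarrow> eventually (\<lambda>g. eventually (\<lambda>n. pa (\<phi> g - a n) < e) sequentially) F"
    and B: "\<And>e. e > 0 \<Longrightarrow> eventually (\<lambda>g. eventually (\<lambda>n. pa (\<psi> g - b n) < e) sequentially) F"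
    using assms unfolding plim_def by blast
  obtain K L where K: "K > 0" "\<forall>n. pa (a n) \<le> K" and L: "L > 0" "\<forall>n. pa (b n) \<le> L"
    using Cs_bound[OF ab(1)] Cs_bound[OF ab(3)] by blast
  show ?thesis unfolding plim_def
  proof (intro bexI[of _ "\<lambda>n. a n * b n"] conjI allI impI)
    fix e :: real assume e: "e > 0"
    define M where "M = max K 1"
    have M: "M > 0" using K by (simp add: M_def)
    have eL: "e / L > 0" and eM: "e / M > 0" using e L M by auto
    show "eventually (\<lambda>g. eventually (\<lambda>n. pa (\<phi> g * \<psi> g - a n * b n) < e) sequentially) F"
      using A[OF zero_less_one] A[OF eL] B[OF eM]
    proof eventually_elim
      case (elim g)
      from elim(1,2,3) show ?case
      proof eventually_elim
        case (elim n)
        have "pa (\<phi> g) \<le> max (pa (\<phi> g - a n)) (pa (a n))" using pa_add[of "\<phi> g - a n" "a n"] by simp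
        also have "\<dots> \<le> M" using elim(1) K by (auto simp: M_def intro: order_trans[OF _ max.cobounded1])
        finally have "pa (\<phi> g) * pa (\<psi> g - b n) \<le> M * pa (\<psi> g - b n)" by (rule mult_right_mono) simp
        also have "\<dots> < M * (e / M)" using elim(3) M by (intro mult_strict_left_mono)
        finally have 1: "pa (\<phi> g) * pa (\<psi> g - b n) < e" using M by simp
        have "pa (b n) * pa (\<phi> g - a n) \<le> L * pa (\<phi> g - a n)" using L by (simp add: mult_right_mono)
        also have "\<dots> < L * (e / L)" using elim(2) L by (intro mult_strict_left_mono) auto
        finally have 2: "pa (b n) * pa (\<phi> g - a n) < e" using L by simp
        show ?case using pa_mult_diff[of "\<phi> g" "\<psi> g" "a n" "b n"] 1 2 by linarith
      qed
    qed
  qed (use ab in \<open>auto simp: cl_ops Cs_mult\<close>)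
qed

lemma plim_unique: assumes "plim \<phi> F x" "plim \<phi> F y" "F \<noteq> bot" shows "x = y"
proof -
  obtain a b where ab: "a \<in> Cs" "x = cl a" "b \<in> Cs" "y = cl b"
    and A: "\<And>e. e > 0 \<Longrightarrow> eventually (\<lambda>g. eventually (\<lambda>n. pa (\<phi> g - a n) < e) sequentially) F"
    and B: "\<And>e. e > 0 \<Longrightarrow> eventually (\<lambda>g. eventually (\<lambda>n. pa (\<phi> g - b n) < e) sequentially) F"
    using assms unfolding plim_def by blast
  have "(\<lambda>n. a n - b n) \<in> Ns" unfolding Ns_iff
  proof (intro allI impI)
    fix e :: real assume e: "e > 0"
    have "eventually (\<lambda>g. eventually (\<lambda>n. pa (\<phi> g - a n) < e) sequentially \<and> eventually (\<lambda>n. pa (\<phi> g - b n) < e) sequentially) F"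
      using A[OF e] B[OF e] by eventually_elim auto
    then obtain g where "eventually (\<lambda>n. pa (\<phi> g - a n) < e) sequentially" "eventually (\<lambda>n. pa (\<phi> g - b n) < e) sequentially"
      using eventually_happens[of _ F] assms(3) by blast
    then have "eventually (\<lambda>n. pa (a n - b n) < e) sequentially"
    proof eventually_elim
      case (elim n)
      show ?case by (rule pa_diff_less[of _ "\<phi> g"]) (use elim pa_diff_commute[of "a n" "\<phi> g"] in auto)
    qed
    then show "\<exists>N. \<forall>n\<ge>N. pa (a n - b n) < e" by (simp add: eventually_sequentially)
  qed
  then show ?thesis using ab by (simp add: cl_eq)
qed

lemma plim_mono: "plim \<phi> F x \<Longrightarrow> F' \<le> F \<Longrightarrow> plim \<phi> F' x"
  unfolding plim_def by (meson filter_leD)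

lemma plim_filtermap: "plim \<phi> (filtermap h F) x \<longleftrightarrow> plim (\<lambda>g. \<phi> (h g)) F x"
  by (simp add: plim_def eventually_filtermap)

lemma plim_cong: assumes "eventually (\<lambda>g. \<phi> g = \<psi> g) F" "plim \<phi> F x" shows "plim \<psi> F x"
proof -
  have "eventually (\<lambda>g. eventually (\<lambda>n. pa (\<psi> g - a n) < e) sequentially) F"
    if "eventually (\<lambda>g. eventually (\<lambda>n. pa (\<phi> g - a n) < e) sequentially) F" for a e
    using assms(1) that by (rule eventually_elim2) simp
  then show ?thesis using assms(2) unfolding plim_def by blast
qed

lemma plim_small:
  assumes "\<And>e. e > 0 \<Longrightarrow> eventually (\<lambda>g. pa (\<phi> g) < e) F"
  shows "plim \<phi> F (\<iota> 0)"
  unfolding plim_def \<iota>_def by (intro bexI[of _ "\<lambda>n. 0"]) (use assms in \<open>auto simp: Cs_const\<close>)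

lemma plim_0_small: assumes "plim \<phi> F (\<iota> 0)" "e > 0" shows "eventually (\<lambda>g. pa (\<phi> g) < e) F"
proof -
  obtain a where a: "a \<in> Cs" "\<iota> 0 = cl a"
    and A: "eventually (\<lambda>g. eventually (\<lambda>n. pa (\<phi> g - a n) < e) sequentially) F"
    using assms unfolding plim_def by blast
  have "a \<in> Ns" using a cl_eq[of a "\<lambda>n. 0"] by (simp add: \<iota>_def Cs_const)
  then obtain N where N: "\<forall>n\<ge>N. pa (a n) < e" using assms(2) by (auto simp: Ns_iff)
  show ?thesis using A
  proof eventually_elim
    case (elim g)
    then obtain M where "\<forall>n\<ge>M. pa (\<phi> g - a n) < e" by (auto simp: eventually_sequentially)
    then have "pa (\<phi> g - a (max M N)) < e" "pa (a (max M N)) < e" using N by auto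
    then show ?case using pa_add[of "\<phi> g - a (max M N)" "a (max M N)"] by simp
  qed
qed

text \<open>Completeness of the l-adic field: \<open>g n\<close> is a point whose value is within 1
  / (n + 1) of almost all values along the filter, and the values at these points form a Cauchy
  sequence for the limit.\<close>

lemma plim_exists:
  assumes F: "F \<noteq> bot" and c: "\<And>e. e > 0 \<Longrightarrow> eventually (\<lambda>g. eventually (\<lambda>h. pa (\<phi> g - \<phi> h) < e) F) F"
  shows "\<exists>x. plim \<phi> F x"
proof -
  have "\<exists>g. eventually (\<lambda>h. pa (\<phi> g - \<phi> h) < 1 / real (Suc n)) F" for n
    using eventually_happens[OF c[of "1 / real (Suc n)"]] F by auto
  then obtain g where g: "\<And>n. eventually (\<lambda>h. pa (\<phi> (g n) - \<phi> h) < 1 / real (Suc n)) F" by metis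
  define a where "a n = \<phi> (g n)" for n
  have small: "\<exists>N. \<forall>n\<ge>N. 1 / real (Suc n) < e" if e: "e > 0" for e
  proof -
    obtain N where N: "1 / real (Suc N) < e" using reals_Archimedean[OF e] by (auto simp: inverse_eq_divide)
    have "1 / real (Suc n) \<le> 1 / real (Suc N)" if "n \<ge> N" for n using that by (simp add: frac_le)
    then show ?thesis using N by (meson order.strict_trans1)
  qed
  have "a \<in> Cs" unfolding Cs_iff
  proof (intro allI impI)
    fix e :: real assume "e > 0"
    then obtain N where N: "\<forall>n\<ge>N. 1 / real (Suc n) < e" using small by blast
    have "pa (a m - a n) < e" if "m \<ge> N" "n \<ge> N" for m n
    proof -
      have "eventually (\<lambda>h. pa (a m - \<phi> h) < e \<and> pa (a n - \<phi> h) < e) F"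
        using g[of m] g[of n]
      proof eventually_elim
        case (elim h)
        then show ?case using N that unfolding a_def by (meson order.strict_trans)
      qed
      then obtain h where "pa (a m - \<phi> h) < e" "pa (a n - \<phi> h) < e" using eventually_happens F by blast
      then show ?thesis using pa_diff_less[of "a m" "\<phi> h" e "a n"] pa_diff_commute[of "\<phi> h" "a n"] by simp
    qed
    then show "\<exists>N. \<forall>m\<ge>N. \<forall>n\<ge>N. pa (a m - a n) < e" by blast
  qed
  moreover have "eventually (\<lambda>h. eventually (\<lambda>n. pa (\<phi> h - a n) < e) sequentially) F" if e: "e > 0" for e
  proof -
    obtain N where N: "\<forall>n\<ge>N. 1 / real (Suc n) < e" using small[OF e] by blast
    obtain M where M: "\<forall>m\<ge>M. \<forall>n\<ge>M. pa (a m - a n) < e" using CsD[OF \<open>a \<in> Cs\<close> e] by blast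
    show ?thesis using g[of "max M N"]
    proof eventually_elim
      case (elim h)
      have 1: "pa (\<phi> h - a (max M N)) < e"
        using elim N pa_diff_commute[of "\<phi> h"] unfolding a_def by (metis max.cobounded2 order.strict_trans)
      have "pa (\<phi> h - a n) < e" if "n \<ge> M" for n
        by (rule pa_diff_less[OF 1]) (use M that in auto)
      then show ?case unfolding eventually_sequentially by blast
    qed
  qed
  ultimately show ?thesis unfolding plim_def by blast
qed

lemma plim_dist:
  assumes "plim \<phi> F x" "plim \<phi> F' y" "e > 0"
    and "\<And>P P'. eventually P F \<Longrightarrow> eventually P' F' \<Longrightarrow> \<exists>g h. P g \<and> P' h \<and> pa (\<phi> g - \<phi> h) < e"
  shows "Ql_dist l x y \<le> e"
proof -
  obtain a b where ab: "a \<in> Cs" "x = cl a" "b \<in> Cs" "y = cl b"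
    and A: "eventually (\<lambda>g. eventually (\<lambda>n. pa (\<phi> g - a n) < e) sequentially) F"
    and B: "eventually (\<lambda>g. eventually (\<lambda>n. pa (\<phi> g - b n) < e) sequentially) F'"
    using assms(1-3) unfolding plim_def by blast
  obtain g h where gh: "eventually (\<lambda>n. pa (\<phi> g - a n) < e) sequentially"
    "eventually (\<lambda>n. pa (\<phi> h - b n) < e) sequentially" "pa (\<phi> g - \<phi> h) < e" using assms(4)[OF A B] by blast
  from gh(1,2) have "eventually (\<lambda>n. pa (a n - b n) \<le> e) sequentially"
  proof eventually_elim
    case (elim n)
    have "pa (a n - \<phi> h) < e" by (rule pa_diff_less[of _ "\<phi> g"]) (use elim gh pa_diff_commute[of "a n"] in auto)
    then show ?case using pa_diff_less[of "a n" "\<phi> h" e "b n"] elim by simp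
  qed
  then show ?thesis using ab Ql_dist_cl[of a b] by (auto intro: tendsto_upperbound)
qed

lemma \<iota>_hom: "\<iota> q \<in> carrier (Ql l)" "\<iota> (p + q) = \<iota> p \<oplus>\<^bsub>Ql l\<^esub> \<iota> q" "\<iota> (p * q) = \<iota> p \<otimes>\<^bsub>Ql l\<^esub> \<iota> q" "\<iota> 1 = \<one>\<^bsub>Ql l\<^esub>" "\<iota> 0 = \<zero>\<^bsub>Ql l\<^esub>"
  by (simp_all add: \<iota>_def cl_ops Cs_const Ql_carrier)

end

section \<open>Pro-\<open>l\<close> completions\<close>

abbreviation Pro where "Pro \<equiv> pro_completion"

text \<open>The quotient by the kernel is isomorphic to a subgroup of L, so by Lagrange its order
  divides a power of l. Intersections and preimages are shown to belong to the index set by writing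
  them as kernels.\<close>

lemma pro_index_kernel:
  assumes "Group.group G" "Group.group L" "h \<in> hom G L" "order L = l ^ k" "Factorial_Ring.prime l"
  shows "kernel G L h \<in> pro_index l G"
proof -
  interpret group_hom G L h using assms by (simp add: group_hom_def group_hom_axioms_def)
  define L' where "L' = L\<lparr>carrier := h ` carrier G\<rparr>"
  have im: "subgroup (h ` carrier G) L" by (rule img_is_subgroup)
  interpret L': group_hom G L' h
    using assms im unfolding L'_def
    by (simp add: group_hom_def group_hom_axioms_def H.subgroup_imp_group hom_def)
  have ker: "kernel G L' h = kernel G L h" by (simp add: kernel_def L'_def)
  have "bij_betw (\<lambda>A. the_elem (h ` A)) (carrier (G Mod kernel G L h)) (h ` carrier G)"
    using L'.FactGroup_iso_set by (simp add: L'_def ker[unfolded L'_def] iso_def)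
  then have "order (G Mod kernel G L h) = card (h ` carrier G)"
    unfolding order_def by (rule bij_betw_same_card)
  also have "\<dots> dvd l ^ k" using H.lagrange[OF im] unfolding assms(4) by (metis dvd_triv_right)
  finally have "\<exists>j. order (G Mod kernel G L h) = l ^ j"
    using divides_primepow_nat[OF assms(5)] by blast
  then show ?thesis using normal_kernel by (simp add: pro_index_def)
qed

locale pro_group = Group.group G for G :: "'a monoid" (structure) + fixes l :: nat assumes prime_l: "Factorial_Ring.prime l"
begin

lemma pro_indexD:
  assumes "N \<in> pro_index l G"
  shows "N \<lhd> G" "subgroup N G" "Group.group (G Mod N)" "\<exists>k. order (G Mod N) = l ^ k"
    "(#>) N \<in> hom G (G Mod N)"
  using assms normal_imp_subgroup normal.factorgroup_is_group normal.r_coset_hom_Mod by (auto simp: pro_index_def)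

lemma coset_eq_iff:
  assumes "subgroup N G" "x \<in> carrier G" "y \<in> carrier G"
  shows "N #> x = N #> y \<longleftrightarrow> x \<otimes> inv y \<in> N"
proof
  assume "N #> x = N #> y"
  then have "x \<in> N #> y" using rcos_self[OF assms(2,1)] by simp
  then show "x \<otimes> inv y \<in> N" using subgroup.rcos_module_imp[OF assms(1) group_axioms assms(3)] by blast
next
  assume "x \<otimes> inv y \<in> N"
  then have "x \<in> N #> y" using subgroup.rcos_module_rev[OF assms(1) group_axioms assms(3,2)] by blast
  then show "N #> x = N #> y" using repr_independence[OF _ assms(3,1)] by simp
qed

lemma kernel_coset: "subgroup N G \<Longrightarrow> kernel G (G Mod N) ((#>) N) = N"
  using coset_join1[of N] coset_join2[of _ N] subgroup.subset[of N G] by (auto simp: kernel_def)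

lemma pro_index_Int:
  assumes "M \<in> pro_index l G" "N \<in> pro_index l G"
  shows "M \<inter> N \<in> pro_index l G"
proof -
  note M = pro_indexD[OF assms(1)] and N = pro_indexD[OF assms(2)]
  obtain j k where jk: "order (G Mod M) = l ^ j" "order (G Mod N) = l ^ k" using M N by blast
  have "(\<lambda>g. (M #> g, N #> g)) \<in> hom G ((G Mod M) \<times>\<times> (G Mod N))"
    using M(5) N(5) by (auto simp: hom_def Pi_iff)
  moreover have "order ((G Mod M) \<times>\<times> (G Mod N)) = l ^ (j + k)"
    using jk by (simp add: order_def card_cartesian_product power_add)
  ultimately have "kernel G ((G Mod M) \<times>\<times> (G Mod N)) (\<lambda>g. (M #> g, N #> g)) \<in> pro_index l G"
    by (intro pro_index_kernel[OF group_axioms DirProd_group[OF M(3) N(3)]] prime_l)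
  moreover have "kernel G ((G Mod M) \<times>\<times> (G Mod N)) (\<lambda>g. (M #> g, N #> g)) = M \<inter> N"
    using kernel_coset[OF M(2)] kernel_coset[OF N(2)] by (auto simp: kernel_def)
  ultimately show ?thesis by simp
qed

lemma carrier_pro_index: "carrier G \<in> pro_index l G"
proof -
  define T where "T = G\<lparr>carrier := {\<one>}\<rparr>"
  have "Group.group T" unfolding T_def using subgroup_imp_group[OF triv_subgroup] .
  moreover have "(\<lambda>_. \<one>) \<in> hom G T" by (simp add: T_def hom_def)
  moreover have "order T = l ^ 0" by (simp add: T_def order_def)
  ultimately have "kernel G T (\<lambda>_. \<one>) \<in> pro_index l G"
    using pro_index_kernel[OF group_axioms] prime_l by blast
  then show ?thesis by (simp add: kernel_def T_def)
qed

lemma pro_carrier_iff: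
  "c \<in> carrier (Pro l G) \<longleftrightarrow> c \<in> extensional (pro_index l G) \<and>
     (\<forall>N\<in>pro_index l G. \<exists>g\<in>carrier G. c N = N #> g) \<and>
     (\<forall>M\<in>pro_index l G. \<forall>N\<in>pro_index l G. M \<subseteq> N \<longrightarrow> c M \<subseteq> c N)"
  by (auto simp: pro_completion_def PiE_iff carrier_FactGroup image_iff)

lemma pro_carrierD:
  assumes "c \<in> carrier (Pro l G)"
  shows "c \<in> extensional (pro_index l G)"
    "N \<in> pro_index l G \<Longrightarrow> \<exists>g\<in>carrier G. c N = N #> g"
    "M \<in> pro_index l G \<Longrightarrow> N \<in> pro_index l G \<Longrightarrow> M \<subseteq> N \<Longrightarrow> c M \<subseteq> c N"
  using assms by (simp_all add: pro_carrier_iff)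

lemma pro_mem:
  assumes "c \<in> carrier (Pro l G)" "N \<in> pro_index l G" "g \<in> c N"
  shows "g \<in> carrier G" "c N = N #> g"
proof -
  obtain x where x: "x \<in> carrier G" "c N = N #> x" using pro_carrierD(2)[OF assms(1,2)] by blast
  have g: "g \<in> N #> x" using assms(3) x(2) by simp
  show "g \<in> carrier G"
    by (rule subgroup.elemrcos_carrier[OF pro_indexD(2)[OF assms(2)] group_axioms x(1) g])
  show "c N = N #> g" unfolding x(2) by (rule repr_independence[OF g x(1) pro_indexD(2)[OF assms(2)]])
qed

lemma pro_nonempty:
  assumes "c \<in> carrier (Pro l G)" "N \<in> pro_index l G"
  shows "\<exists>g. g \<in> c N"
  using pro_carrierD(2)[OF assms] rcos_self[OF _ pro_indexD(2)[OF assms(2)]] by blast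

lemma pro_eqI:
  assumes "c \<in> carrier (Pro l G)" "d \<in> carrier (Pro l G)"
    "\<And>N. N \<in> pro_index l G \<Longrightarrow> \<exists>g. g \<in> c N \<and> g \<in> d N"
  shows "c = d"
proof
  fix N
  show "c N = d N"
  proof (cases "N \<in> pro_index l G")
    case True
    obtain g where g: "g \<in> c N" "g \<in> d N" using assms(3)[OF True] by blast
    show ?thesis using pro_mem(2)[OF assms(1) True g(1)] pro_mem(2)[OF assms(2) True g(2)] by simp
  next
    case False
    then show ?thesis using assms(1,2)[THEN pro_carrierD(1)] by (simp add: extensional_def)
  qed
qed

lemma group_pro_completion: "Group.group (Pro l G)"
proof -
  let ?P = "product_group (pro_index l G) (\<lambda>N. G Mod N)"
  have P: "Group.group ?P" using pro_indexD(3) by simp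
  have "subgroup (carrier (Pro l G)) ?P"
  proof (rule group.subgroupI[OF P])
    show "carrier (Pro l G) \<subseteq> carrier ?P" by (auto simp: pro_completion_def)
    have "\<one>\<^bsub>?P\<^esub> \<in> carrier (Pro l G)"
      unfolding pro_carrier_iff using coset_join2[OF one_closed pro_indexD(2)] subgroup.one_closed[OF pro_indexD(2)]
      by (auto intro!: bexI[of _ \<one>])
    then show "carrier (Pro l G) \<noteq> {}" by blast
    fix c assume c: "c \<in> carrier (Pro l G)"
    then have cP: "c \<in> (\<Pi>\<^sub>E N\<in>pro_index l G. carrier (G Mod N))" by (simp add: pro_completion_def)
    have i: "(inv\<^bsub>?P\<^esub> c) N = set_inv (c N)" if "N \<in> pro_index l G" for N
      using that cP normal.inv_FactGroup[OF pro_indexD(1)[OF that]] pro_indexD(3)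
      by (subst inv_product_group) (auto simp: PiE_iff)
    show "inv\<^bsub>?P\<^esub> c \<in> carrier (Pro l G)"
      unfolding pro_carrier_iff
    proof (intro conjI ballI impI)
      show "inv\<^bsub>?P\<^esub> c \<in> extensional (pro_index l G)"
        using cP pro_indexD(3) by (subst inv_product_group) (auto simp: PiE_iff)
      fix N assume N: "N \<in> pro_index l G"
      obtain g where g: "g \<in> carrier G" "c N = N #> g" using pro_carrierD(2)[OF c N] by blast
      then show "\<exists>g\<in>carrier G. (inv\<^bsub>?P\<^esub> c) N = N #> g"
        using i[OF N] normal.rcos_inv[OF pro_indexD(1)[OF N] g(1)] by auto
    next
      fix M N assume MN: "M \<in> pro_index l G" "N \<in> pro_index l G" "M \<subseteq> N"
      show "(inv\<^bsub>?P\<^esub> c) M \<subseteq> (inv\<^bsub>?P\<^esub> c) N"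
        unfolding i[OF MN(1)] i[OF MN(2)] SET_INV_def using pro_carrierD(3)[OF c MN] by blast
    qed
    fix d assume d: "d \<in> carrier (Pro l G)"
    show "c \<otimes>\<^bsub>?P\<^esub> d \<in> carrier (Pro l G)"
      unfolding pro_carrier_iff
    proof (intro conjI ballI impI)
      show "c \<otimes>\<^bsub>?P\<^esub> d \<in> extensional (pro_index l G)" by simp
      fix N assume N: "N \<in> pro_index l G"
      obtain g h where "g \<in> carrier G" "c N = N #> g" "h \<in> carrier G" "d N = N #> h"
        using pro_carrierD(2)[OF c N] pro_carrierD(2)[OF d N] by blast
      then show "\<exists>g\<in>carrier G. (c \<otimes>\<^bsub>?P\<^esub> d) N = N #> g"
        using N normal.rcos_sum[OF pro_indexD(1)[OF N]] by (intro bexI[of _ "g \<otimes> h"]) auto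
    next
      fix M N assume MN: "M \<in> pro_index l G" "N \<in> pro_index l G" "M \<subseteq> N"
      show "(c \<otimes>\<^bsub>?P\<^esub> d) M \<subseteq> (c \<otimes>\<^bsub>?P\<^esub> d) N"
        using mono_set_mult[OF pro_carrierD(3)[OF c MN] pro_carrierD(3)[OF d MN], of G] MN by simp
    qed
  qed
  from group.subgroup_imp_group[OF P this] show ?thesis by (simp add: pro_completion_def)
qed

lemma pro_mult: "N \<in> pro_index l G \<Longrightarrow> (c \<otimes>\<^bsub>Pro l G\<^esub> d) N = c N <#> d N"
  and pro_one: "\<one>\<^bsub>Pro l G\<^esub> = (\<lambda>N\<in>pro_index l G. N)"
  by (simp_all add: pro_completion_def)

lemma pro_incl_hom: "pro_incl l G \<in> hom G (Pro l G)"
proof (rule homI)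
  fix x assume x: "x \<in> carrier G"
  then show c: "pro_incl l G x \<in> carrier (Pro l G)"
    unfolding pro_carrier_iff by (auto simp: pro_incl_def r_coset_def)
  fix y assume y: "y \<in> carrier G"
  show "pro_incl l G (x \<otimes> y) = pro_incl l G x \<otimes>\<^bsub>Pro l G\<^esub> pro_incl l G y"
    using x y normal.rcos_sum[OF pro_indexD(1)]
    by (auto simp: pro_incl_def pro_completion_def intro!: restrict_ext)
qed

text \<open>The trace on G of the neighbourhoods of a point of the completion, although G need not
  embed in it. Statements about c become statements about all elements g of the discrete group that
  are close to c.\<close>

definition cf :: "('a set \<Rightarrow> 'a set) \<Rightarrow> 'a filter" where
  "cf c = (INF N\<in>pro_index l G. principal (c N))"

lemma eventually_cf:
  assumes c: "c \<in> carrier (Pro l G)"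
  shows "eventually P (cf c) \<longleftrightarrow> (\<exists>N\<in>pro_index l G. \<forall>g\<in>c N. P g)"
  unfolding cf_def
proof (subst eventually_INF_base)
  show "pro_index l G \<noteq> {}" using carrier_pro_index by blast
  fix M N assume MN: "M \<in> pro_index l G" "N \<in> pro_index l G"
  have "c (M \<inter> N) \<subseteq> c M" "c (M \<inter> N) \<subseteq> c N"
    using pro_carrierD(3)[OF c pro_index_Int[OF MN]] MN by simp_all
  then show "\<exists>x\<in>pro_index l G. principal (c x) \<le> inf (principal (c M)) (principal (c N))"
    using pro_index_Int[OF MN] by auto
qed (simp add: eventually_principal)

lemma cf_not_bot: "c \<in> carrier (Pro l G) \<Longrightarrow> cf c \<noteq> bot"
  using pro_nonempty by (auto simp: eventually_cf trivial_limit_def[symmetric] simp flip: eventually_False)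

lemma eventually_cf_mem:
  assumes "c \<in> carrier (Pro l G)" "N \<in> pro_index l G"
  shows "eventually (\<lambda>g. g \<in> carrier G \<and> g \<in> c N) (cf c)"
  unfolding eventually_cf[OF assms(1)] using pro_mem(1)[OF assms] assms(2) by blast

end

context pro_group
begin

lemma topspace_pro: "topspace (pro_topology l G) = carrier (Pro l G)"
  by (auto simp: pro_topology_def pro_completion_def)

lemma continuous_pro_coord:
  assumes "N \<in> pro_index l G"
  shows "continuous_map (pro_topology l G) (discrete_topology (carrier (G Mod N))) (\<lambda>c. c N)"
  unfolding pro_topology_def
  by (rule continuous_map_from_subtopology)
     (use continuous_map_product_projection[OF assms, of "\<lambda>N. discrete_topology (carrier (G Mod N))"] in simp)

lemma openin_pro_coord:
  assumes "N \<in> pro_index l G"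
  shows "openin (pro_topology l G) {d \<in> carrier (Pro l G). d N = A}"
proof -
  have "openin (pro_topology l G) {d \<in> topspace (pro_topology l G). d N \<in> {A} \<inter> carrier (G Mod N)}"
    by (rule openin_continuous_map_preimage[OF continuous_pro_coord[OF assms]]) simp
  moreover have "d N \<in> carrier (G Mod N)" if "d \<in> carrier (Pro l G)" for d
    using pro_carrierD(2)[OF that assms] by (auto simp: carrier_FactGroup)
  then have "{d \<in> topspace (pro_topology l G). d N \<in> {A} \<inter> carrier (G Mod N)} = {d \<in> carrier (Pro l G). d N = A}"
    by (auto simp: topspace_pro)
  ultimately show ?thesis by simp
qed

lemma pro_index_Inter:
  assumes "finite J" "J \<subseteq> pro_index l G"
  shows "\<exists>N\<in>pro_index l G. \<forall>M\<in>J. N \<subseteq> M"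
  using assms
proof (induction J)
  case empty
  then show ?case using carrier_pro_index by blast
next
  case (insert M J)
  then obtain N where "N \<in> pro_index l G" "\<forall>M\<in>J. N \<subseteq> M" by auto
  then show ?case using pro_index_Int[of M N] insert(4) by (intro bexI[of _ "M \<inter> N"]) auto
qed

lemma pro_nbhd:
  assumes "openin (pro_topology l G) U" "c \<in> U"
  shows "\<exists>N\<in>pro_index l G. \<forall>d\<in>carrier (Pro l G). d N = c N \<longrightarrow> d \<in> U"
proof -
  obtain T where T: "openin (product_topology (\<lambda>N. discrete_topology (carrier (G Mod N))) (pro_index l G)) T"
    and U: "U = T \<inter> carrier (Pro l G)"
    using assms(1) by (auto simp: pro_topology_def openin_subtopology)
  have c: "c \<in> carrier (Pro l G)" "c \<in> T" using assms(2) U by auto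
  obtain V where V: "finite {i \<in> pro_index l G. V i \<noteq> carrier (G Mod i)}" "c \<in> Pi\<^sub>E (pro_index l G) V" "Pi\<^sub>E (pro_index l G) V \<subseteq> T"
    using T c(2) by (auto simp: openin_product_topology_alt)
  obtain N where N: "N \<in> pro_index l G" "\<forall>M\<in>{i \<in> pro_index l G. V i \<noteq> carrier (G Mod i)}. N \<subseteq> M"
    using pro_index_Inter[OF V(1)] by auto
  show ?thesis
  proof (intro bexI[OF _ N(1)] ballI impI)
    fix d assume d: "d \<in> carrier (Pro l G)" "d N = c N"
    have "d M \<in> V M" if M: "M \<in> pro_index l G" for M
    proof (cases "V M = carrier (G Mod M)")
      case True
      then show ?thesis using pro_carrierD(2)[OF d(1) M] by (auto simp: carrier_FactGroup)
    next
      case False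
      then have NM: "N \<subseteq> M" using N(2) M by blast
      obtain g where g: "g \<in> c N" using pro_nonempty[OF c(1) N(1)] by blast
      have gc: "g \<in> c M" using pro_carrierD(3)[OF c(1) N(1) M NM] g by blast
      have gd: "g \<in> d M" using pro_carrierD(3)[OF d(1) N(1) M NM] g d(2) by blast
      have "d M = c M" using pro_mem(2)[OF c(1) M gc] pro_mem(2)[OF d(1) M gd] by simp
      then show ?thesis using V(2) M by (auto simp: PiE_iff)
    qed
    then have "d \<in> Pi\<^sub>E (pro_index l G) V" using pro_carrierD(1)[OF d(1)] by (auto simp: PiE_iff)
    then show "d \<in> U" using V(3) U d(1) by blast
  qed
qed

lemma Hausdorff_pro: "Hausdorff_space (pro_topology l G)"
  unfolding pro_topology_def
  by (intro Hausdorff_space_subtopology) (simp add: Hausdorff_space_product_topology)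

lemma pro_incl_dense:
  assumes c: "c \<in> carrier (Pro l G)"
  shows "c \<in> (pro_topology l G) closure_of (pro_incl l G ` carrier G)"
  unfolding in_closure_of topspace_pro
proof (intro conjI allI impI c)
  fix U assume U: "c \<in> U \<and> openin (pro_topology l G) U"
  obtain N where N: "N \<in> pro_index l G" "\<forall>d\<in>carrier (Pro l G). d N = c N \<longrightarrow> d \<in> U"
    using pro_nbhd[of U c] U by blast
  obtain g where g: "g \<in> carrier G" "c N = N #> g" using pro_carrierD(2)[OF c N(1)] by blast
  then show "\<exists>y. y \<in> pro_incl l G ` carrier G \<and> y \<in> U"
    using N pro_incl_hom by (intro exI[of _ "pro_incl l G g"]) (auto simp: pro_incl_def hom_def Pi_iff)
qed

lemma pow_order_mem:
  assumes "N \<in> pro_index l G" "d \<in> carrier G" "order (G Mod N) dvd e"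
  shows "d [^] (e :: nat) \<in> N"
proof -
  interpret N: normal N G by (rule pro_indexD(1)[OF assms(1)])
  interpret Q: Group.group "G Mod N" by (rule pro_indexD(3)[OF assms(1)])
  have dN: "N #> d \<in> carrier (G Mod N)" using assms(2) by (auto simp: carrier_FactGroup)
  obtain k where e: "e = order (G Mod N) * k" using assms(3) by blast
  have "N #> d [^] e = (N #> d) [^]\<^bsub>G Mod N\<^esub> e" by (rule N.FactGroup_pow[OF assms(2), symmetric])
  also have "\<dots> = N"
    unfolding e using Q.pow_order_eq_1[OF dN] Q.nat_pow_pow[OF dN, of "order (G Mod N)" k] Q.nat_pow_one by simp
  finally show ?thesis using coset_join1[of N "d [^] e"] assms(2) N.subgroup_axioms by simp
qed

end

locale pro_hom = G: pro_group G l + H: pro_group H l for G :: "'a monoid" and H :: "'b monoid" and l +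
  fixes h assumes hom: "h \<in> hom G H"
begin

sublocale group_hom G H h
  using hom by unfold_locales

definition pre :: "'b set \<Rightarrow> 'a set" where "pre M = {g \<in> carrier G. h g \<in> M}"

lemma pre_index: assumes M: "M \<in> pro_index l H" shows "pre M \<in> pro_index l G"
proof -
  obtain k where k: "order (H Mod M) = l ^ k" using H.pro_indexD(4)[OF M] by blast
  have "(\<lambda>g. M #>\<^bsub>H\<^esub> h g) \<in> hom G (H Mod M)"
    using hom H.pro_indexD(5)[OF M] by (auto simp: hom_def Pi_iff)
  then have "kernel G (H Mod M) (\<lambda>g. M #>\<^bsub>H\<^esub> h g) \<in> pro_index l G"
    by (rule pro_index_kernel[OF G.group_axioms H.pro_indexD(3)[OF M] _ k G.prime_l])
  moreover have "kernel G (H Mod M) (\<lambda>g. M #>\<^bsub>H\<^esub> h g) = pre M"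
    using H.coset_join1[of M] H.coset_join2[of _ M] H.pro_indexD(2)[OF M] by (auto simp: kernel_def pre_def)
  ultimately show ?thesis by simp
qed

text \<open>The extension of h to the completions: c modulo the preimage of M determines the image
  modulo M. The chosen representative is immaterial by \<open>hatp_eq\<close>.\<close>

definition hatp :: "('a set \<Rightarrow> 'a set) \<Rightarrow> 'b set \<Rightarrow> 'b set" where
  "hatp c = (\<lambda>M\<in>pro_index l H. M #>\<^bsub>H\<^esub> h (SOME g. g \<in> c (pre M)))"

lemma hatp_eq:
  assumes c: "c \<in> carrier (Pro l G)" and M: "M \<in> pro_index l H" and g: "g \<in> c (pre M)"
  shows "hatp c M = M #>\<^bsub>H\<^esub> h g"
proof -
  define k where "k = (SOME g. g \<in> c (pre M))"
  have k: "k \<in> c (pre M)" unfolding k_def using g by (rule someI)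
  note P = pre_index[OF M]
  have kg: "k \<in> carrier G" "g \<in> carrier G" "pre M #>\<^bsub>G\<^esub> k = pre M #>\<^bsub>G\<^esub> g"
    using G.pro_mem[OF c P k] G.pro_mem[OF c P g] by auto
  have "k \<otimes>\<^bsub>G\<^esub> inv\<^bsub>G\<^esub> g \<in> pre M" using G.coset_eq_iff[OF G.pro_indexD(2)[OF P] kg(1,2)] kg(3) by simp
  then have "h k \<otimes>\<^bsub>H\<^esub> inv\<^bsub>H\<^esub> h g \<in> M" using kg by (simp add: pre_def)
  then show ?thesis
    using H.coset_eq_iff[OF H.pro_indexD(2)[OF M], of "h k" "h g"] kg M by (simp add: hatp_def k_def)
qed

lemma hatp_closed: assumes c: "c \<in> carrier (Pro l G)" shows "hatp c \<in> carrier (Pro l H)"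
  unfolding H.pro_carrier_iff
proof (intro conjI ballI impI)
  show "hatp c \<in> extensional (pro_index l H)" by (simp add: hatp_def)
  fix M assume M: "M \<in> pro_index l H"
  obtain g where g: "g \<in> c (pre M)" using G.pro_nonempty[OF c pre_index[OF M]] by blast
  then show "\<exists>g\<in>carrier H. hatp c M = M #>\<^bsub>H\<^esub> g"
    using hatp_eq[OF c M g] G.pro_mem(1)[OF c pre_index[OF M] g] by (intro bexI[of _ "h g"]) auto
next
  fix M N assume M: "M \<in> pro_index l H" and N: "N \<in> pro_index l H" and MN: "M \<subseteq> N"
  have "pre M \<subseteq> pre N" using MN by (auto simp: pre_def)
  then have le: "c (pre M) \<subseteq> c (pre N)" by (rule G.pro_carrierD(3)[OF c pre_index[OF M] pre_index[OF N]])
  obtain g where g: "g \<in> c (pre M)" using G.pro_nonempty[OF c pre_index[OF M]] by blast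
  then have "g \<in> c (pre N)" using le by blast
  then show "hatp c M \<subseteq> hatp c N"
    unfolding hatp_eq[OF c M g] using hatp_eq[OF c N] MN by (auto simp: r_coset_def)
qed

lemma hatp_mem:
  assumes c: "c \<in> carrier (Pro l G)" and M: "M \<in> pro_index l H" and g: "g \<in> c (pre M)"
  shows "h g \<in> hatp c M"
  unfolding hatp_eq[OF assms]
  using H.rcos_self[OF _ H.pro_indexD(2)[OF M]] G.pro_mem(1)[OF c pre_index[OF M] g] by simp

lemma hatp_hom: "hatp \<in> hom (Pro l G) (Pro l H)"
proof (rule homI)
  fix c assume c: "c \<in> carrier (Pro l G)"
  then show hc: "hatp c \<in> carrier (Pro l H)" by (rule hatp_closed)
  fix d assume d: "d \<in> carrier (Pro l G)"
  interpret CG: Group.group "Pro l G" by (rule G.group_pro_completion)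
  interpret CH: Group.group "Pro l H" by (rule H.group_pro_completion)
  show "hatp (c \<otimes>\<^bsub>Pro l G\<^esub> d) = hatp c \<otimes>\<^bsub>Pro l H\<^esub> hatp d"
  proof (rule H.pro_eqI)
    show cd: "hatp (c \<otimes>\<^bsub>Pro l G\<^esub> d) \<in> carrier (Pro l H)" using c d by (simp add: hatp_closed)
    show "hatp c \<otimes>\<^bsub>Pro l H\<^esub> hatp d \<in> carrier (Pro l H)" using c d by (simp add: hatp_closed)
    fix M assume M: "M \<in> pro_index l H"
    note P = pre_index[OF M]
    obtain g k where g: "g \<in> c (pre M)" and k: "k \<in> d (pre M)"
      using G.pro_nonempty[OF c P] G.pro_nonempty[OF d P] by blast
    have gk: "g \<in> carrier G" "k \<in> carrier G" using G.pro_mem(1)[OF c P g] G.pro_mem(1)[OF d P k] by auto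
    have "g \<otimes>\<^bsub>G\<^esub> k \<in> (c \<otimes>\<^bsub>Pro l G\<^esub> d) (pre M)"
      unfolding G.pro_mult[OF P] using g k by (auto simp: set_mult_def)
    then have "h (g \<otimes>\<^bsub>G\<^esub> k) \<in> hatp (c \<otimes>\<^bsub>Pro l G\<^esub> d) M"
      using hatp_mem[OF _ M] c d by simp
    moreover have "h (g \<otimes>\<^bsub>G\<^esub> k) \<in> (hatp c \<otimes>\<^bsub>Pro l H\<^esub> hatp d) M"
      unfolding H.pro_mult[OF M] using hatp_mem[OF c M g] hatp_mem[OF d M k] gk by (auto simp: set_mult_def)
    ultimately show "\<exists>g. g \<in> hatp (c \<otimes>\<^bsub>Pro l G\<^esub> d) M \<and> g \<in> (hatp c \<otimes>\<^bsub>Pro l H\<^esub> hatp d) M"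
      by blast
  qed
qed

lemma hatp_incl: assumes g: "g \<in> carrier G" shows "hatp (pro_incl l G g) = pro_incl l H (h g)"
proof (rule H.pro_eqI)
  have c: "pro_incl l G g \<in> carrier (Pro l G)" using G.pro_incl_hom g by (auto simp: hom_def)
  show "hatp (pro_incl l G g) \<in> carrier (Pro l H)" by (rule hatp_closed[OF c])
  show "pro_incl l H (h g) \<in> carrier (Pro l H)" using H.pro_incl_hom g by (auto simp: hom_def Pi_iff)
  fix M assume M: "M \<in> pro_index l H"
  have "g \<in> pro_incl l G g (pre M)"
    using G.rcos_self[OF g G.pro_indexD(2)] pre_index[OF M] by (simp add: pro_incl_def)
  from hatp_mem[OF c M this] have "h g \<in> hatp (pro_incl l G g) M" .
  moreover have "h g \<in> pro_incl l H (h g) M"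
    using H.rcos_self[OF _ H.pro_indexD(2)[OF M]] g M by (simp add: pro_incl_def)
  ultimately show "\<exists>k. k \<in> hatp (pro_incl l G g) M \<and> k \<in> pro_incl l H (h g) M" by blast
qed

lemma hatp_continuous: "continuous_map (pro_topology l G) (pro_topology l H) hatp"
  unfolding pro_topology_def[of l H] continuous_map_in_subtopology continuous_map_componentwise
proof (intro conjI ballI)
  show "hatp ` topspace (pro_topology l G) \<subseteq> extensional (pro_index l H)" by (auto simp: hatp_def)
  show "hatp \<in> topspace (pro_topology l G) \<rightarrow> carrier (Pro l H)"
    using hatp_closed by (auto simp: G.topspace_pro)
  fix M assume M: "M \<in> pro_index l H"
  note P = pre_index[OF M]
  let ?\<phi> = "\<lambda>A. M #>\<^bsub>H\<^esub> h (SOME g. g \<in> A)"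
  have "?\<phi> \<in> carrier (G Mod pre M) \<rightarrow> carrier (H Mod M)"
  proof
    fix A assume "A \<in> carrier (G Mod pre M)"
    then obtain g where g: "g \<in> carrier G" "A = pre M #>\<^bsub>G\<^esub> g" by (auto simp: carrier_FactGroup)
    then have "(SOME g. g \<in> A) \<in> A" using someI[of "\<lambda>g. g \<in> A" g] G.rcos_self[OF g(1) G.pro_indexD(2)[OF P]] by simp
    then have "(SOME g. g \<in> A) \<in> carrier G"
      using subgroup.elemrcos_carrier[OF G.pro_indexD(2)[OF P] G.group_axioms g(1)] g by simp
    then show "?\<phi> A \<in> carrier (H Mod M)" by (auto simp: carrier_FactGroup)
  qed
  then have "continuous_map (discrete_topology (carrier (G Mod pre M))) (discrete_topology (carrier (H Mod M))) ?\<phi>"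
    by simp
  from continuous_map_compose[OF G.continuous_pro_coord[OF P] this]
  show "continuous_map (pro_topology l G) (discrete_topology (carrier (H Mod M))) (\<lambda>c. hatp c M)"
    using M by (simp add: hatp_def o_def)
qed

lemma eventually_hatp:
  assumes c: "c \<in> carrier (Pro l G)" and M: "M \<in> pro_index l H"
  shows "eventually (\<lambda>g. g \<in> carrier G \<and> hatp c M = M #>\<^bsub>H\<^esub> h g) (G.cf c)"
  using G.eventually_cf_mem[OF c pre_index[OF M]] by eventually_elim (simp add: hatp_eq[OF c M])

lemma filtermap_cf:
  assumes c: "c \<in> carrier (Pro l G)"
  shows "filtermap h (G.cf c) \<le> H.cf (hatp c)"
proof (rule filter_leI)
  fix P assume "eventually P (H.cf (hatp c))"
  then obtain M where M: "M \<in> pro_index l H" "\<forall>g\<in>hatp c M. P g"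
    unfolding H.eventually_cf[OF hatp_closed[OF c]] by blast
  show "eventually P (filtermap h (G.cf c))"
    unfolding eventually_filtermap G.eventually_cf[OF c]
    by (rule bexI[OF _ pre_index[OF M(1)]]) (use M hatp_mem[OF c M(1)] in blast)
qed

end

section \<open>Continuous homomorphisms out of the completions of the free group\<close>

text \<open>Of the target only a right unit and left cancellation are used, the form in which
  group-like series provide them (\<open>nc_r_one\<close>, \<open>nc_cancel\<close>). The value on
  an inverse letter is determined by cancelling the value of the letter.\<close>

lemma F2_hom_eq_cancel:
  assumes one: "u \<in> carrier H" "\<And>e. e \<in> carrier H \<Longrightarrow> e \<otimes>\<^bsub>H\<^esub> u = e"
    and cancel: "\<And>a b c. a \<in> carrier H \<Longrightarrow> b \<in> carrier H \<Longrightarrow> c \<in> carrier H \<Longrightarrow> a \<otimes>\<^bsub>H\<^esub> b = a \<otimes>\<^bsub>H\<^esub> c \<Longrightarrow> b = c"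
    and h: "h \<in> hom F2 H" and k: "k \<in> hom F2 H" and eq: "h F2_x = k F2_x" "h F2_y = k F2_y" and g: "g \<in> carrier F2"
  shows "h g = k g"
proof -
  interpret F: Group.group F2 by (rule group_F2)
  have c: "h g \<in> carrier H" "k g \<in> carrier H" if "g \<in> carrier F2" for g using h k that by (auto simp: hom_def)
  have m: "h (a \<star> b) = h a \<otimes>\<^bsub>H\<^esub> h b" "k (a \<star> b) = k a \<otimes>\<^bsub>H\<^esub> k b"
    if "a \<in> carrier F2" "b \<in> carrier F2" for a b using h k that by (auto simp: hom_def)
  have idem: "e = u" if "e \<in> carrier H" "e \<otimes>\<^bsub>H\<^esub> e = e" for e
    using cancel[of e e u] that one by simp
  have inv: "h (iv s \<star> g) = k (iv s \<star> g)"
    if s: "s \<in> carrier F2" "h s = k s" and g: "g \<in> carrier F2" "h g = k g" for s g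
  proof (rule cancel[of "h s"])
    have "s \<star> (iv s \<star> g) = g" using s g by (simp flip: F.m_assoc)
    then show "h s \<otimes>\<^bsub>H\<^esub> h (iv s \<star> g) = h s \<otimes>\<^bsub>H\<^esub> k (iv s \<star> g)"
      using m(1)[of s "iv s \<star> g"] m(2)[of s "iv s \<star> g"] s g by simp
  qed (use s g c in auto)
  show ?thesis using g
  proof (induction rule: F2_induct)
    case one
    have "h \<one>\<^bsub>F2\<^esub> = u" "k \<one>\<^bsub>F2\<^esub> = u"
      by (rule idem; use c m[of "\<one>\<^bsub>F2\<^esub>" "\<one>\<^bsub>F2\<^esub>"] in simp)+
    then show ?case by simp
  qed (use m eq inv in simp_all)
qed

text \<open>Two continuous homomorphisms with the same values on the generators agree on the image
  of \<open>F2\<close>, hence on its closure since the target is Hausdorff. This replaces the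
  description in \<open>cont_hom\<close> by an explicit map.\<close>

lemma cont_hom_eq:
  assumes TG: "topspace TG = carrier G" and i: "i \<in> hom F2 G"
    and dense: "\<And>c. c \<in> carrier G \<Longrightarrow> c \<in> TG closure_of (i ` carrier F2)"
    and TH: "Hausdorff_space TH"
    and one: "u \<in> carrier H" "\<And>e. e \<in> carrier H \<Longrightarrow> e \<otimes>\<^bsub>H\<^esub> u = e"
    and cancel: "\<And>a b c. a \<in> carrier H \<Longrightarrow> b \<in> carrier H \<Longrightarrow> c \<in> carrier H \<Longrightarrow> a \<otimes>\<^bsub>H\<^esub> b = a \<otimes>\<^bsub>H\<^esub> c \<Longrightarrow> b = c"
    and k: "k \<in> hom G H" "k \<in> extensional (carrier G)" "continuous_map TG TH k" "k (i F2_x) = a" "k (i F2_y) = b"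
  shows "cont_hom G TG (i F2_x) (i F2_y) H TH a b = k"
  unfolding cont_hom_def
proof (rule the_equality)
  fix h assume h: "h \<in> hom G H \<and> h \<in> extensional (carrier G) \<and> continuous_map TG TH h \<and> h (i F2_x) = a \<and> h (i F2_y) = b"
  show "h = k"
  proof
    fix c
    show "h c = k c"
    proof (cases "c \<in> carrier G")
      case True
      have "(h \<circ> i) g = (k \<circ> i) g" if "g \<in> carrier F2" for g
        by (rule F2_hom_eq_cancel[OF one cancel]) (use h k i that in \<open>auto simp: hom_def Pi_iff\<close>)
      then show ?thesis
        using forall_in_closure_of_eq[OF dense[OF True] TH, of h k] h k by auto
    next
      case False
      then show ?thesis using h k by (auto simp: extensional_def)
    qed
  qed
qed (use k in simp)

section \<open>The pro-nilpotent completion\<close>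

lemma pro_groupI: "Group.group G \<Longrightarrow> l \<in> primes \<Longrightarrow> pro_group G l"
  by (simp add: pro_group_def pro_group_axioms_def)

lemma nil_carrier: "f \<in> carrier (nil_completion G) \<longleftrightarrow> f \<in> extensional primes \<and> (\<forall>l\<in>primes. f l \<in> carrier (Pro l G))"
  by (auto simp: nil_completion_def PiE_iff)

lemma nil_mult: "l \<in> primes \<Longrightarrow> (f \<otimes>\<^bsub>nil_completion G\<^esub> g) l = f l \<otimes>\<^bsub>Pro l G\<^esub> g l"
  and nil_one: "\<one>\<^bsub>nil_completion G\<^esub> = (\<lambda>l\<in>primes. \<one>\<^bsub>Pro l G\<^esub>)"
  by (simp_all add: nil_completion_def)

lemma group_nil_completion: "Group.group G \<Longrightarrow> Group.group (nil_completion G)"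
  unfolding nil_completion_def by (rule product_group) (rule pro_group.group_pro_completion[OF pro_groupI])

lemma nil_incl_hom: assumes "Group.group G" shows "nil_incl G \<in> hom G (nil_completion G)"
proof (rule homI)
  fix x assume x: "x \<in> carrier G"
  have h: "pro_incl l G \<in> hom G (Pro l G)" if "l \<in> primes" for l
    by (rule pro_group.pro_incl_hom[OF pro_groupI[OF assms that]])
  then show "nil_incl G x \<in> carrier (nil_completion G)" using x by (auto simp: nil_carrier nil_incl_def hom_def)
  fix y assume "y \<in> carrier G"
  then show "nil_incl G (x \<otimes>\<^bsub>G\<^esub> y) = nil_incl G x \<otimes>\<^bsub>nil_completion G\<^esub> nil_incl G y"
    using x h by (auto simp: nil_incl_def nil_completion_def hom_def intro!: restrict_ext)
qed

lemma topspace_nil: "Group.group G \<Longrightarrow> topspace (nil_topology G) = carrier (nil_completion G)"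
  unfolding nil_topology_def nil_completion_def
  using pro_group.topspace_pro[OF pro_groupI] by (auto simp: PiE_iff)

lemma Hausdorff_nil: "Group.group G \<Longrightarrow> Hausdorff_space (nil_topology G)"
  unfolding nil_topology_def Hausdorff_space_product_topology
  using pro_group.Hausdorff_pro[OF pro_groupI] by blast

text \<open>A Chinese remainder argument in a group that may be nonabelian: one element of G
  approximates given points of the pro-l completions for finitely many primes simultaneously. It
  makes G dense in its pro-nilpotent completion.\<close>

lemma nil_approximation:
  assumes G: "Group.group G" and P: "finite P" "P \<subseteq> primes"
    and N: "\<And>l. l \<in> P \<Longrightarrow> N l \<in> pro_index l G" and f: "\<And>l. l \<in> P \<Longrightarrow> f l \<in> carrier (Pro l G)"
  shows "\<exists>g\<in>carrier G. \<forall>l\<in>P. g \<in> f l (N l)"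
  using P N f
proof (induction P)
  case empty
  then show ?case using group.subgroup_self[OF G] subgroup.one_closed by blast
next
  case (insert q P)
  interpret G: Group.group G by (rule G)
  interpret q: pro_group G q using G insert by (simp add: pro_groupI)
  obtain g where g: "g \<in> carrier G" "\<forall>l\<in>P. g \<in> f l (N l)" using insert by auto
  have Nq: "N q \<in> pro_index q G" and fq: "f q \<in> carrier (Pro q G)" using insert by auto
  obtain k where k: "k \<in> f q (N q)" using q.pro_nonempty[OF fq Nq] by blast
  have kG: "k \<in> carrier G" using q.pro_mem[OF fq Nq k] by simp
  define d where "d = inv\<^bsub>G\<^esub> g \<otimes>\<^bsub>G\<^esub> k"
  have d: "d \<in> carrier G" using g kG by (simp add: d_def)
  define E where "E = (\<Prod>l\<in>P. order (G Mod N l))"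
  have pw: "\<exists>j. order (G Mod N l) = l ^ j" if "l \<in> P" for l
    using that insert(5)[of l] by (auto simp: pro_index_def)
  obtain j where j: "order (G Mod N q) = q ^ j" using Nq by (auto simp: pro_index_def)
  have qp: "Factorial_Ring.prime q" "\<And>l. l \<in> P \<Longrightarrow> Factorial_Ring.prime l" using insert by auto
  have cop: "coprime (order (G Mod N l)) (q ^ j)" if l: "l \<in> P" for l
  proof -
    have "l \<noteq> q" using l insert by blast
    then have "coprime l q" using primes_coprime[OF qp(2)[OF l] qp(1)] by blast
    then show ?thesis using pw[OF l] by auto
  qed
  have "coprime E (q ^ j)" unfolding E_def by (rule prod_coprime_left) (rule cop)
  moreover have "E \<noteq> 0"
    unfolding E_def prod_zero_iff[OF insert(1)] using pw qp(2) by (metis not_prime_0 power_not_zero)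
  \<comment> \<open>The exponent E x is a multiple of all earlier quotient orders and is 1 modulo
    the order at q. Multiplying g by this power of d = g^-1 k therefore changes nothing at the
    earlier primes and turns g into k modulo \<open>N q\<close>.\<close>
  ultimately obtain x y where xy: "E * x = q ^ j * y + 1" using bezout_nat[of E "q ^ j"] by auto
  define g' where "g' = g \<otimes>\<^bsub>G\<^esub> d [^]\<^bsub>G\<^esub> (E * x)"
  have g': "g' \<in> carrier G" using g d by (simp add: g'_def)
  have "g' \<in> f l (N l)" if l: "l \<in> insert q P" for l
  proof (cases "l = q")
    case True
    interpret n: normal "N q" G by (rule q.pro_indexD(1)[OF Nq])
    have "d [^]\<^bsub>G\<^esub> (q ^ j * y) \<in> N q" by (rule q.pow_order_mem[OF Nq d]) (simp add: j)
    then have e: "N q #>\<^bsub>G\<^esub> d [^]\<^bsub>G\<^esub> (q ^ j * y) = N q #>\<^bsub>G\<^esub> \<one>\<^bsub>G\<^esub>"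
      using d G.coset_join2[OF _ n.subgroup_axioms] G.coset_mult_one[OF n.subset] by simp
    have "N q #>\<^bsub>G\<^esub> d [^]\<^bsub>G\<^esub> (E * x) = (N q #>\<^bsub>G\<^esub> d [^]\<^bsub>G\<^esub> (q ^ j * y)) <#>\<^bsub>G\<^esub> (N q #>\<^bsub>G\<^esub> d)"
      using d by (simp add: xy n.rcos_sum flip: G.nat_pow_mult)
    also have "\<dots> = N q #>\<^bsub>G\<^esub> d" unfolding e using d by (simp add: n.rcos_sum)
    finally have "N q #>\<^bsub>G\<^esub> g' = N q #>\<^bsub>G\<^esub> (g \<otimes>\<^bsub>G\<^esub> d)"
      using g d by (simp add: g'_def flip: n.rcos_sum)
    also have "\<dots> = N q #>\<^bsub>G\<^esub> k" using g kG by (simp add: d_def flip: G.m_assoc)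
    also have "\<dots> = f q (N q)" using q.pro_mem(2)[OF fq Nq k] by simp
    finally show ?thesis using True G.rcos_self[OF g' n.subgroup_axioms] by simp
  next
    case False
    then have l: "l \<in> P" using l by blast
    interpret l: pro_group G l using G insert l by (simp add: pro_groupI subset_iff)
    have Nl: "N l \<in> pro_index l G" and fl: "f l \<in> carrier (Pro l G)" using insert l by auto
    interpret n: normal "N l" G by (rule l.pro_indexD(1)[OF Nl])
    have "order (G Mod N l) dvd E * x" unfolding E_def using dvd_prodI[OF insert(1) l] by (rule dvd_mult2)
    then have "d [^]\<^bsub>G\<^esub> (E * x) \<in> N l" by (rule l.pow_order_mem[OF Nl d])
    then have e: "N l #>\<^bsub>G\<^esub> d [^]\<^bsub>G\<^esub> (E * x) = N l #>\<^bsub>G\<^esub> \<one>\<^bsub>G\<^esub>"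
      using d G.coset_join2[OF _ n.subgroup_axioms] G.coset_mult_one[OF n.subset] by simp
    have "N l #>\<^bsub>G\<^esub> g' = (N l #>\<^bsub>G\<^esub> g) <#>\<^bsub>G\<^esub> (N l #>\<^bsub>G\<^esub> d [^]\<^bsub>G\<^esub> (E * x))" using g d by (simp add: g'_def n.rcos_sum)
    also have "\<dots> = N l #>\<^bsub>G\<^esub> g" unfolding e using g by (simp add: n.rcos_sum)
    also have "\<dots> = f l (N l)" using l.pro_mem(2)[OF fl Nl] g l by simp
    finally show ?thesis using G.rcos_self[OF g' n.subgroup_axioms] by simp
  qed
  then show ?case using g' by blast
qed

lemma nil_incl_dense:
  assumes G: "Group.group G" and f: "f \<in> carrier (nil_completion G)"
  shows "f \<in> (nil_topology G) closure_of (nil_incl G ` carrier G)"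
  unfolding in_closure_of topspace_nil[OF G]
proof (intro conjI allI impI f)
  fix T assume T: "f \<in> T \<and> openin (nil_topology G) T"
  then obtain U where U: "finite {l \<in> primes. U l \<noteq> topspace (pro_topology l G)}" "\<And>l. l \<in> primes \<Longrightarrow> openin (pro_topology l G) (U l)"
    "f \<in> Pi\<^sub>E primes U" "Pi\<^sub>E primes U \<subseteq> T"
    unfolding nil_topology_def openin_product_topology_alt by meson
  define P where "P = {l \<in> primes. U l \<noteq> topspace (pro_topology l G)}"
  have fl: "f l \<in> carrier (Pro l G)" if "l \<in> primes" for l using f that by (simp add: nil_carrier)
  have "\<exists>N\<in>pro_index l G. \<forall>d\<in>carrier (Pro l G). d N = f l N \<longrightarrow> d \<in> U l" if "l \<in> primes" for l
    by (rule pro_group.pro_nbhd[OF pro_groupI[OF G that] U(2)[OF that]]) (use U(3) that in \<open>auto simp: PiE_iff\<close>)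
  then obtain N where N: "\<And>l. l \<in> primes \<Longrightarrow> N l \<in> pro_index l G"
    "\<And>l d. l \<in> primes \<Longrightarrow> d \<in> carrier (Pro l G) \<Longrightarrow> d (N l) = f l (N l) \<Longrightarrow> d \<in> U l" by metis
  obtain g where g: "g \<in> carrier G" "\<forall>l\<in>P. g \<in> f l (N l)"
    using nil_approximation[OF G, of P N f] U(1) N(1) fl by (auto simp: P_def)
  have gi: "nil_incl G g \<in> carrier (nil_completion G)" using nil_incl_hom[OF G] g(1) by (auto simp: hom_def)
  have "nil_incl G g l \<in> U l" if l: "l \<in> primes" for l
  proof (cases "l \<in> P")
    case True
    interpret pro_group G l by (rule pro_groupI[OF G l])
    have "f l (N l) = N l #>\<^bsub>G\<^esub> g" using pro_mem(2)[OF fl[OF l] N(1)[OF l]] g(2) True by blast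
    then show ?thesis
      using gi l N(1)[OF l] by (intro N(2)[OF l]) (auto simp: nil_carrier nil_incl_def pro_incl_def)
  next
    case False
    then show ?thesis using l gi pro_group.topspace_pro[OF pro_groupI[OF G l]] by (simp add: P_def nil_carrier)
  qed
  then have "nil_incl G g \<in> Pi\<^sub>E primes U" by (auto simp: nil_incl_def PiE_iff)
  then show "\<exists>y. y \<in> nil_incl G ` carrier G \<and> y \<in> T" using g(1) U(4) by blast
qed

lemma pro_homI: "Group.group G \<Longrightarrow> Group.group H \<Longrightarrow> h \<in> hom G H \<Longrightarrow> l \<in> primes \<Longrightarrow> pro_hom G H l h"
  by (simp add: pro_hom_def pro_hom_axioms_def pro_groupI)

definition hatn :: "'a monoid \<Rightarrow> 'b monoid \<Rightarrow> ('a \<Rightarrow> 'b) \<Rightarrow> (nat \<Rightarrow> 'a set \<Rightarrow> 'a set) \<Rightarrow> nat \<Rightarrow> 'b set \<Rightarrow> 'b set" where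
  "hatn G H h f = (\<lambda>l\<in>primes. pro_hom.hatp G H l h (f l))"

lemma hatn:
  assumes G: "Group.group G" and H: "Group.group H" and h: "h \<in> hom G H"
  shows "hatn G H h \<in> hom (nil_completion G) (nil_completion H)" (is ?P)
    and "continuous_map (nil_topology G) (nil_topology H) (hatn G H h)" (is ?Q)
    and "g \<in> carrier G \<Longrightarrow> hatn G H h (nil_incl G g) = nil_incl H (h g)"
proof -
  note P = pro_homI[OF G H h]
  note hh = pro_hom.hatp_hom[OF P]
  show ?P
  proof (rule homI)
    fix c assume c: "c \<in> carrier (nil_completion G)"
    then show "hatn G H h c \<in> carrier (nil_completion H)"
      using hh[THEN hom_in_carrier] by (simp add: nil_carrier hatn_def)
    fix d assume d: "d \<in> carrier (nil_completion G)"
    have "hatn G H h (c \<otimes>\<^bsub>nil_completion G\<^esub> d) l = (hatn G H h c \<otimes>\<^bsub>nil_completion H\<^esub> hatn G H h d) l" for l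
      using c d hh[THEN hom_mult] by (cases "l \<in> primes") (simp_all add: nil_carrier hatn_def nil_mult, simp add: nil_completion_def)
    then show "hatn G H h (c \<otimes>\<^bsub>nil_completion G\<^esub> d) = hatn G H h c \<otimes>\<^bsub>nil_completion H\<^esub> hatn G H h d" by blast
  qed
  show ?Q
    unfolding nil_topology_def continuous_map_componentwise
  proof (intro conjI ballI)
    show "hatn G H h ` topspace (product_topology (\<lambda>l. pro_topology l G) primes) \<subseteq> extensional primes"
      by (auto simp: hatn_def)
    fix l assume l: "l \<in> primes"
    from continuous_map_compose[OF continuous_map_product_projection[OF l, of "\<lambda>l. pro_topology l G"] pro_hom.hatp_continuous[OF P[OF l]]]
    show "continuous_map (product_topology (\<lambda>l. pro_topology l G) primes) (pro_topology l H) (\<lambda>f. hatn G H h f l)"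
      using l by (simp add: hatn_def o_def)
  qed
  show "hatn G H h (nil_incl G g) = nil_incl H (h g)" if "g \<in> carrier G"
    using that pro_hom.hatp_incl[OF P] by (auto simp: hatn_def nil_incl_def intro!: restrict_ext)
qed

lemma nil_subst_eval:
  assumes H: "Group.group H" and ab: "a \<in> carrier H" "b \<in> carrier H" and f: "f \<in> carrier F2nil"
  shows "nil_subst H f (nil_incl H a) (nil_incl H b) = hatn F2 H (F2hom H a b) f"
proof -
  note F = F2hom[OF H ab]
  interpret N: Group.group "nil_completion H" by (rule group_nil_completion[OF H])
  note hn = hatn[OF group_F2 H F(1)]
  have "cont_hom F2nil (nil_topology F2) (nil_incl F2 F2_x) (nil_incl F2 F2_y) (nil_completion H) (nil_topology H)
    (nil_incl H a) (nil_incl H b) = restrict (hatn F2 H (F2hom H a b)) (carrier F2nil)"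
  proof (rule cont_hom_eq)
    show "topspace (nil_topology F2) = carrier F2nil" by (rule topspace_nil[OF group_F2])
    show "nil_incl F2 \<in> hom F2 F2nil" by (rule nil_incl_hom[OF group_F2])
    then have ix: "nil_incl F2 F2_x \<in> carrier F2nil" "nil_incl F2 F2_y \<in> carrier F2nil" by (auto simp: hom_def)
    show "c \<in> nil_topology F2 closure_of nil_incl F2 ` carrier F2" if "c \<in> carrier F2nil" for c
      by (rule nil_incl_dense[OF group_F2 that])
    show "Hausdorff_space (nil_topology H)" by (rule Hausdorff_nil[OF H])
    show "\<one>\<^bsub>nil_completion H\<^esub> \<in> carrier (nil_completion H)" by simp
    show "restrict (hatn F2 H (F2hom H a b)) (carrier F2nil) \<in> hom F2nil (nil_completion H)"
      using hn(1) group.subgroup_self[OF group_nil_completion[OF group_F2]] subgroup.m_closed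
      by (fastforce simp: hom_def)
    show "continuous_map (nil_topology F2) (nil_topology H) (restrict (hatn F2 H (F2hom H a b)) (carrier F2nil))"
      by (rule continuous_map_eq[OF hn(2)]) (simp add: topspace_nil[OF group_F2])
    show "restrict (hatn F2 H (F2hom H a b)) (carrier F2nil) (nil_incl F2 F2_x) = nil_incl H a"
      "restrict (hatn F2 H (F2hom H a b)) (carrier F2nil) (nil_incl F2 F2_y) = nil_incl H b"
      using hn(3) ix F by simp_all
  qed (auto simp: extensional_def)
  then show ?thesis using f by (simp add: nil_subst_def nx_def ny_def)
qed

section \<open>Unipotent integral representations are \<open>l\<close>-adically continuous\<close>

definition imult :: "int \<Rightarrow> rat \<Rightarrow> bool" where "imult q x \<longleftrightarrow> (\<exists>z. x = of_int (q * z))"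

lemma imult_0 [simp]: "imult q 0" by (auto simp: imult_def intro: exI[of _ 0])
lemma imult_add: "imult q x \<Longrightarrow> imult q y \<Longrightarrow> imult q (x + y)"
  unfolding imult_def by (metis distrib_left of_int_add)
lemma imult_minus: "imult q x \<Longrightarrow> imult q (- x)"
  unfolding imult_def by (metis mult_minus_right of_int_minus)
lemma imult_sum: "(\<And>i. i \<in> A \<Longrightarrow> imult q (f i)) \<Longrightarrow> imult q (sum f A)"
  by (induction A rule: infinite_finite_induct) (auto intro: imult_add)
lemma imult_mult: "imult q x \<Longrightarrow> imult 1 y \<Longrightarrow> imult q (x * y)" "imult 1 x \<Longrightarrow> imult q y \<Longrightarrow> imult q (x * y)"
  unfolding imult_def by (metis mult.assoc mult.left_commute mult_1 of_int_mult)+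
text \<open>The factor \<open>d ^ (length u - length v)\<close> clears the denominators of exponentials.\<close>

definition sce :: "nat \<Rightarrow> ('i, rat) tmat \<Rightarrow> 'i list \<Rightarrow> 'i list \<Rightarrow> rat" where
  "sce d A u v = ent A u v * of_nat d ^ (length u - length v)"

lemma sce_simps [simp]: "sce d (A + B) u v = sce d A u v + sce d B u v"
  "sce d (A - B) u v = sce d A u v - sce d B u v" "sce d (- A) u v = - sce d A u v" "sce d 0 u v = 0"
  for A B :: "('i::finite, rat) tmat"
  by (simp_all add: sce_def algebra_simps)

lemma sce_lower: "length u < length v \<Longrightarrow> sce d A u v = 0" by (simp add: sce_def)

lemma sce_1: "sce d (1 :: ('i::finite, rat) tmat) u v = (if u = v then 1 else 0)"
  by (simp add: sce_def ent_1)

lemma sce_mult: "sce d (A * B :: ('i::finite, rat) tmat) u v = (\<Sum>w\<in>lw (length u). sce d A u w * sce d B w v)"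
proof -
  have "ent A u w * ent B w v * of_nat d ^ (length u - length v) = sce d A u w * sce d B w v" if "w \<in> lw (length u)" for w
  proof (cases "length w < length v")
    case False
    then have "length u - length v = (length u - length w) + (length w - length v)" using that by simp
    then show ?thesis by (simp add: sce_def power_add)
  qed (simp add: sce_lower)
  then show ?thesis unfolding sce_def[of d "A * B"] ent_mult_self sum_distrib_right by (rule sum.cong[OF refl])
qed

text \<open>Congruence to zero modulo q of the scaled entries, in rows of length at most n and up to
  degree difference j. The case q = 1, j = n is integrality. The bound n is needed because the
  denominators of exponentials grow with the degree.\<close>

definition icong :: "nat \<Rightarrow> nat \<Rightarrow> int \<Rightarrow> nat \<Rightarrow> ('i, rat) tmat \<Rightarrow> bool" where
  "icong d n q j A \<longleftrightarrow> (\<forall>u v. length u \<le> n \<longrightarrow> length u \<le> length v + j \<longrightarrow> imult q (sce d A u v))"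

lemma icong_0 [simp]: "icong d n q j (0 :: ('i::finite, rat) tmat)" by (simp add: icong_def)
lemma icong_add: "icong d n q j A \<Longrightarrow> icong d n q j B \<Longrightarrow> icong d n q j (A + B)" for A B :: "('i::finite, rat) tmat"
  by (simp add: icong_def imult_add)
lemma icong_minus: "icong d n q j A \<Longrightarrow> icong d n q j (- A)" for A :: "('i::finite, rat) tmat"
  by (simp add: icong_def imult_minus)
lemma icong_diff: "icong d n q j A \<Longrightarrow> icong d n q j B \<Longrightarrow> icong d n q j (A - B)" for A B :: "('i::finite, rat) tmat"
  using icong_add[OF _ icong_minus, of d n q j A B] by simp
lemma icong_one: "icong d n 1 j (1 :: ('i::finite, rat) tmat)" by (auto simp: icong_def sce_1 imult_def)

lemma icong_mult:
  fixes A B :: "('i::finite, rat) tmat"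
  assumes "icong d n q j A" "icong d n 1 j B" shows "icong d n q j (A * B)" "icong d n q j (B * A)"
proof -
  have *: "imult q (\<Sum>w\<in>lw (length u). sce d A u w * sce d B w v)" "imult q (\<Sum>w\<in>lw (length u). sce d B u w * sce d A w v)"
    if n: "length u \<le> n" and j: "length u \<le> length v + j" for u v
  proof -
    have "imult q (sce d A u w * sce d B w v) \<and> imult q (sce d B u w * sce d A w v)" if "w \<in> lw (length u)" for w
    proof (cases "length w < length v")
      case False
      then have "imult q (sce d A u w)" "imult 1 (sce d B w v)" "imult 1 (sce d B u w)" "imult q (sce d A w v)"
        using that n j assms by (auto simp: icong_def)
      then show ?thesis using imult_mult by blast
    qed (simp add: sce_lower)
    then show "imult q (\<Sum>w\<in>lw (length u). sce d A u w * sce d B w v)" "imult q (\<Sum>w\<in>lw (length u). sce d B u w * sce d A w v)"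
      by (auto intro!: imult_sum)
  qed
  show "icong d n q j (A * B)" "icong d n q j (B * A)"
    unfolding icong_def sce_mult using * by blast+
qed

text \<open>If a degree difference of at most j + 1 is split in two and the first part exceeds j,
  the second is at most 0. So one of the two factors is always divisible by q.\<close>

lemma icong_square:
  fixes B :: "('i::finite, rat) tmat"
  assumes B: "icong d n q j B" "icong d n 1 n B" shows "icong d n q (Suc j) (B * B)"
proof -
  have "imult q (sce d B u w * sce d B w v)"
    if uv: "length u \<le> n" "length u \<le> length v + Suc j" and w: "w \<in> lw (length u)" for u v w
  proof (cases "length w < length v")
    case False
    have i: "imult 1 (sce d B u w)" "imult 1 (sce d B w v)" using B(2) uv w by (auto simp: icong_def)
    show ?thesis
    proof (cases "length u \<le> length w + j")
      case True
      then have "imult q (sce d B u w)" using B(1) uv by (simp add: icong_def)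
      then show ?thesis using i by (intro imult_mult)
    next
      case False
      then have "length w \<le> length v + j" using uv by simp
      then have "imult q (sce d B w v)" using B(1) uv w by (simp add: icong_def)
      then show ?thesis using i by (intro imult_mult)
    qed
  qed (simp add: sce_lower)
  then show ?thesis unfolding icong_def sce_mult by (auto intro!: imult_sum)
qed

lemma icong_full: "icong d n q n A \<Longrightarrow> icong d n q j A"
  by (simp add: icong_def)

lemma power_expand:
  fixes B :: "('i::finite, rat) tmat"
  assumes B: "icong d n 1 n B"
  shows "\<exists>C. icong d n 1 n C \<and> (1 + B) ^ e = 1 + of_nat e * B + B * B * C"
proof (induction e)
  case 0
  then show ?case by (intro exI[of _ 0]) simp
next
  case (Suc e)
  then obtain C where C: "icong d n 1 n C" "(1 + B) ^ e = 1 + of_nat e * B + B * B * C" by blast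
  have e: "icong d n 1 n (of_nat e :: ('i, rat) tmat)" for e
    by (induction e) (auto intro: icong_add icong_one)
  have "icong d n 1 n (of_nat e + C * (1 + B))"
    using C B e by (intro icong_add icong_mult icong_one)
  moreover have "(1 + B) ^ Suc e = 1 + of_nat (Suc e) * B + B * B * (of_nat e + C * (1 + B))"
    unfolding power_Suc2 C(2) by (simp add: algebra_simps) (metis mult.assoc mult_of_nat_commute)
  ultimately show ?case by blast
qed

lemma icong_of_nat: "icong d n 1 n B \<Longrightarrow> icong d n (int q) n (of_nat q * B)" for B :: "('i::finite, rat) tmat"
proof -
  have "sce d (of_nat q * B) u v = of_nat q * sce d B u v" for u v
    by (induction q) (simp_all add: distrib_right)
  then show "icong d n 1 n B \<Longrightarrow> icong d n (int q) n (of_nat q * B)"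
    unfolding icong_def imult_def by (metis mult_1 of_int_mult of_int_of_nat_eq)
qed

text \<open>With B = A^(q^j) - 1 the next power satisfies A^(q^(j+1)) - 1 = q B + B^2 C. The first
  term is divisible by q in all degrees, and squaring gains one degree for the second. Unipotence
  starts the induction.\<close>

lemma icong_power:
  fixes A :: "('i::finite, rat) tmat"
  assumes A: "icong d n 1 n A" "unip A"
  shows "icong d n (int q) j (A ^ (q ^ j) - 1)"
proof (induction j)
  case 0
  have "sce d (A - 1) u v = 0" if "length u \<le> length v" for u v
    using A(2) that by (simp add: sce_def Fil_def del: sce_simps ent_diff)
  then show ?case by (simp add: icong_def del: sce_simps)
next
  case (Suc j)
  define B where "B = A ^ (q ^ j) - 1"
  have i: "icong d n 1 n (A ^ e)" for e
    by (induction e) (auto intro: icong_mult icong_one A)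
  have B: "icong d n 1 n B" unfolding B_def by (intro icong_diff i icong_one)
  have "A ^ (q ^ Suc j) = (1 + B) ^ q" by (simp add: B_def power_mult[symmetric] mult.commute)
  then obtain C where C: "icong d n 1 n C" "A ^ (q ^ Suc j) - 1 = of_nat q * B + B * B * C"
    using power_expand[OF B, of q] by auto
  show ?case unfolding C(2)
    by (intro icong_add icong_mult icong_square icong_full[OF icong_of_nat] icong_full[OF C(1)] B Suc[folded B_def])
qed

text \<open>A prime p other than l that divides the order would give a subgroup of order p by
  Sylow's theorem; its elements have orders dividing both p and l^s and are trivial.\<close>

lemma (in Group.group) finite_order_power:
  assumes fin: "finite (carrier G)" and l: "Factorial_Ring.prime l"
    and e: "\<And>x. x \<in> carrier G \<Longrightarrow> x [^] (l ^ s :: nat) = \<one>"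
  shows "\<exists>k. order G = l ^ k"
proof -
  have pos: "order G > 0" using fin by (simp add: order_gt_0_iff_finite)
  have only: "p = l" if p: "Factorial_Ring.prime p" "p dvd order G" for p
  proof (rule ccontr)
    assume "p \<noteq> l"
    obtain m where "order G = p ^ 1 * m" using p(2) by auto
    then obtain H where H: "subgroup H G" "card H = p"
      using sylow_thm[OF p(1) group_axioms, of 1 m] fin by auto
    interpret H: Group.group "G\<lparr>carrier := H\<rparr>" using subgroup_imp_group[OF H(1)] .
    have "H \<subseteq> {\<one>}"
    proof
      fix x assume x: "x \<in> H"
      then have xG: "x \<in> carrier G" using subgroup.subset[OF H(1)] by blast
      have "x [^]\<^bsub>G\<lparr>carrier := H\<rparr>\<^esub> p = \<one>" using H.pow_order_eq_1[of x] x H(2) by (simp add: order_def)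
      then have "x [^] p = \<one>" by (simp add: nat_pow_consistent[symmetric])
      then have "ord x dvd p" using pow_eq_id[OF xG] by blast
      moreover have "ord x dvd l ^ s" using e[OF xG] pow_eq_id[OF xG] by blast
      moreover have "coprime p (l ^ s)" using primes_coprime[OF p(1) l \<open>p \<noteq> l\<close>] by simp
      ultimately have "ord x = 1" by (metis coprime_common_divisor_nat)
      then show "x \<in> {\<one>}" using ord_eq_1[OF xG] by simp
    qed
    then have "card H \<le> 1" using card_mono[of "{\<one>}" H] by simp
    then show False using H(2) prime_gt_1_nat[OF p(1)] by simp
  qed
  obtain q where q: "order G = l ^ multiplicity l (order G) * q" "\<not> l dvd q"
    using multiplicity_decompose'[of "order G" l] pos l not_prime_unit by (metis less_irrefl)
  have "q = 1"
  proof (rule ccontr)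
    assume "q \<noteq> 1"
    then obtain p where "Factorial_Ring.prime p" "p dvd q" using prime_factor_nat by blast
    then show False using only[of p] q by (metis dvd_mult)
  qed
  then show ?thesis using q(1) by auto
qed

text \<open>The congruence subgroup modulo l^k in degrees up to n. Entries modulo l^k separate its
  cosets, so the quotient is finite; by \<open>icong_power\<close> with q = l^k and j = n, the power
  l^(k n) of every element falls into the subgroup. A finite group with such an exponent has l-power
  order.\<close>

theorem (in pro_group) unipotent_pro_index:
  fixes r :: "'a \<Rightarrow> ('i::finite, rat) tmat"
  assumes r: "r \<in> hom G Ugr" and int: "\<And>g. g \<in> carrier G \<Longrightarrow> icong d n 1 n (r g)"
    and unip: "\<And>g. g \<in> carrier G \<Longrightarrow> unip (r g)"
  shows "{g \<in> carrier G. icong d n (int l ^ k) n (r g - 1)} \<in> pro_index l G"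
proof -
  define N where "N = {g \<in> carrier G. icong d n (int l ^ k) n (r g - 1)}"
  have m: "r (x \<otimes> y) = r x * r y" if "x \<in> carrier G" "y \<in> carrier G" for x y
    using r that by (simp add: hom_def)
  have one: "r \<one> = 1"
    using hom_one[OF r is_group group_Ugr] by simp
  have inv: "r x * r (inv x) = 1" "r (inv x) * r x = 1" if "x \<in> carrier G" for x
    using m[of x "inv x"] m[of "inv x" x] one that by simp_all
  have pw: "r (x [^] (e::nat)) = r x ^ e" if "x \<in> carrier G" for x e
    using that by (induction e) (simp_all add: one m power_Suc2 del: power_Suc)
  have mem: "g \<otimes> inv h \<in> N" if "g \<in> carrier G" "h \<in> carrier G" "icong d n (int l ^ k) n (r g - r h)" for g h
  proof -
    have "icong d n (int l ^ k) n ((r g - r h) * r (inv h))" using that int by (intro icong_mult) auto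
    moreover have "(r g - r h) * r (inv h) = r (g \<otimes> inv h) - 1"
      using inv(1)[OF that(2)] that by (simp add: left_diff_distrib m)
    ultimately show ?thesis using that by (simp add: N_def)
  qed
  have sub: "subgroup N G"
  proof (rule subgroupI)
    show "N \<subseteq> carrier G" by (auto simp: N_def)
    show "N \<noteq> {}" using mem[of \<one> \<one>] by auto
    fix x assume x: "x \<in> N"
    then have "icong d n (int l ^ k) n (- (r x - 1))" by (intro icong_minus) (simp add: N_def)
    then show "inv x \<in> N" using mem[of \<one> x] x by (simp add: one N_def)
    fix y assume y: "y \<in> N"
    then have "icong d n (int l ^ k) n ((r x - 1) + (r y - 1) * r (inv y))"
      using x int by (intro icong_add icong_mult) (auto simp: N_def)
    then have "icong d n (int l ^ k) n (r x - r (inv y))"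
      using inv(1)[of y] y by (simp add: left_diff_distrib N_def)
    then show "x \<otimes> y \<in> N" using mem[of x "inv y"] x y by (simp add: N_def)
  qed
  have norm: "N \<lhd> G"
  proof (rule normal_invI[OF sub])
    fix x h assume x: "x \<in> carrier G" and h: "h \<in> N"
    then have hG: "h \<in> carrier G" by (simp add: N_def)
    have "icong d n (int l ^ k) n (r x * (r h - 1))"
      using int h x by (intro icong_mult) (auto simp: N_def)
    then show "x \<otimes> h \<otimes> inv x \<in> N"
      using mem[of "x \<otimes> h" x] x hG by (simp add: m right_diff_distrib)
  qed
  define P where "P = {(u :: 'i list, v :: 'i list). length u \<le> n \<and> length v \<le> n}"
  have finP: "finite P"
  proof -
    have "P = lw n \<times> lw n" by (auto simp: P_def)
    then show ?thesis by simp
  qed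
  define \<phi> where "\<phi> g = (\<lambda>(u, v)\<in>P. \<lfloor>sce d (r g) u v\<rfloor> mod int l ^ k)" for g
  have lpos: "int l ^ k > 0" using prime_gt_0_nat[OF prime_l] by simp
  have "\<phi> ` carrier G \<subseteq> PiE P (\<lambda>_. {0..<int l ^ k})" using lpos by (auto simp: \<phi>_def)
  moreover have "finite (PiE P (\<lambda>_. {0..<int l ^ k}))" using finP by (intro finite_PiE) auto
  ultimately have finim: "finite (\<phi> ` carrier G)" by (rule finite_subset)
  have sep: "N #> g = N #> h" if gh: "g \<in> carrier G" "h \<in> carrier G" "\<phi> g = \<phi> h" for g h
  proof -
    have "imult (int l ^ k) (sce d (r g) u v - sce d (r h) u v)" if u: "length u \<le> n" for u v
    proof (cases "length u < length v")
      case False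
      then have "(u, v) \<in> P" using u by (simp add: P_def)
      then have e: "\<lfloor>sce d (r g) u v\<rfloor> mod int l ^ k = \<lfloor>sce d (r h) u v\<rfloor> mod int l ^ k"
        using fun_cong[OF gh(3), of "(u, v)"] by (simp add: \<phi>_def)
      have "\<exists>a. sce d (r g) u v = of_int a" "\<exists>b. sce d (r h) u v = of_int b"
        using int[OF gh(1)] int[OF gh(2)] u by (auto simp: icong_def imult_def)
      then obtain a b where ab: "sce d (r g) u v = of_int a" "sce d (r h) u v = of_int b" by blast
      have "int l ^ k dvd a - b" using e by (simp add: ab mod_eq_dvd_iff)
      then show ?thesis unfolding imult_def ab by (metis dvdE of_int_diff)
    qed (simp add: sce_lower)
    then have "icong d n (int l ^ k) n (r g - r h)" by (simp add: icong_def)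
    then show ?thesis using mem[OF gh(1,2)] coset_eq_iff[OF sub gh(1,2)] by simp
  qed
  have "carrier (G Mod N) \<subseteq> (\<lambda>y. N #> (SOME g. g \<in> carrier G \<and> \<phi> g = y)) ` (\<phi> ` carrier G)"
  proof
    fix A assume "A \<in> carrier (G Mod N)"
    then obtain g where g: "g \<in> carrier G" "A = N #> g" by (auto simp: carrier_FactGroup)
    define h where "h = (SOME h. h \<in> carrier G \<and> \<phi> h = \<phi> g)"
    have "h \<in> carrier G \<and> \<phi> h = \<phi> g" unfolding h_def by (rule someI[of _ g]) (simp add: g)
    then have "A = N #> h" using sep[of g h] g by simp
    then show "A \<in> (\<lambda>y. N #> (SOME g. g \<in> carrier G \<and> \<phi> g = y)) ` (\<phi> ` carrier G)"
      using g(1) by (auto simp: h_def)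
  qed
  then have fin: "finite (carrier (G Mod N))" using finim by (auto intro: finite_subset)
  interpret n: normal N G by (rule norm)
  interpret Q: Group.group "G Mod N" by (rule n.factorgroup_is_group)
  have "\<exists>j. order (G Mod N) = l ^ j"
  proof (rule Q.finite_order_power[OF fin prime_l])
    fix A assume "A \<in> carrier (G Mod N)"
    then obtain g where g: "g \<in> carrier G" "A = N #> g" by (auto simp: carrier_FactGroup)
    have "icong d n (int (l ^ k)) n (r g ^ ((l ^ k) ^ n) - 1)"
      by (rule icong_power[OF int[OF g(1)] unip[OF g(1)]])
    then have "icong d n (int l ^ k) n (r (g [^] (l ^ (k * n))) - 1)"
      unfolding pw[OF g(1)] power_mult[of l k n] of_nat_power .
    then have "g [^] (l ^ (k * n)) \<in> N" using nat_pow_closed[OF g(1)] unfolding N_def by blast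
    then have "N #> g [^] (l ^ (k * n)) = N" using coset_join2[OF _ sub] g(1) by simp
    then show "A [^]\<^bsub>G Mod N\<^esub> (l ^ (k * n)) = \<one>\<^bsub>G Mod N\<^esub>" using g by (simp add: n.FactGroup_pow)
  qed
  then show ?thesis unfolding N_def[symmetric] pro_index_def using norm by blast
qed

text \<open>For positive k one of the factors n! absorbs the denominator k!, and the others are
  integers; this is why \<open>fact n\<close> serves as the scaling constant in degrees up to
  n.\<close>

lemma imult_exp:
  assumes "imult 1 c" "k \<le> n"
  shows "imult 1 (c ^ k * (1 / fact k) * of_nat (fact n) ^ k)"
proof -
  have c: "imult 1 (c ^ k)" by (induction k) (use assms(1) imult_mult(1)[of 1] in \<open>auto simp: imult_def[of 1 1] intro: exI[of _ 1]\<close>)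
  have f: "imult 1 (1 / fact k * of_nat (fact n) ^ k)"
  proof (cases k)
    case 0
    then show ?thesis by (auto simp: imult_def intro: exI[of _ 1])
  next
    case (Suc j)
    obtain q where q: "fact n = (fact k * q :: nat)" using fact_dvd[OF assms(2)] by blast
    then have e: "of_nat (fact n) = (fact k * of_nat q :: rat)" by (metis of_nat_fact of_nat_mult)
    have "1 / fact k * of_nat (fact n) ^ k = (of_nat (q * fact n ^ j) :: rat)"
      unfolding Suc power_Suc of_nat_mult of_nat_power by (subst (1) e) (simp add: Suc)
    also have "\<dots> = of_int (1 * int (q * fact n ^ j))" by simp
    finally show ?thesis unfolding imult_def by blast
  qed
  have "c ^ k * (1 / fact k) * of_nat (fact n) ^ k = c ^ k * (1 / fact k * of_nat (fact n) ^ k)"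
    by (rule mult.assoc)
  then show ?thesis using imult_mult(1)[OF c f] by simp
qed

lemma icong_ex_Toep:
  fixes j :: "'i::finite"
  assumes "imult 1 c"
  shows "icong (fact n) n 1 n (ex c (Toep j))"
  unfolding icong_def
proof (intro allI impI)
  fix u v :: "'i list" assume u: "length u \<le> n"
  have e: "ent (ex c (Toep j)) u v = (\<Sum>w\<in>lw (length u). esr c j w * (if u = w @ v then 1 else 0))"
    by (simp add: ex_ev[of Toep, OF Toep_Fil, symmetric] ent_ev[of Toep, OF Toep_Fil, of _ _ "length u"] ent_wd_Toep)
  show "imult 1 (sce (fact n) (ex c (Toep j)) u v)"
    unfolding sce_def e sum_distrib_right
  proof (rule imult_sum)
    fix w :: "'i list" assume "w \<in> lw (length u)"
    have "imult 1 (esr c j w * of_nat (fact n) ^ (length u - length v))" if "u = w @ v"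
      using imult_exp[OF assms, of "length w" n] u that by (auto simp: esr_def)
    then show "imult 1 (esr c j w * (if u = w @ v then 1 else 0) * of_nat (fact n) ^ (length u - length v))"
      by auto
  qed
qed

lemma icong_F2hom:
  assumes "g \<in> carrier F2"
  shows "icong (fact n) n 1 n (F2hom Ugr eLX eLY g)"
  using assms
proof (induction rule: F2_induct)
  have T: "Toep j \<in> Fil 1" for j :: letter by simp
  note r = F2hom_rec[OF group_Ugr ex1_unit[OF T[of LX], of 1] ex1_unit[OF T[of LY], of 1], unfolded Ugr_simps(1,2)]
  have m: "imult 1 1" "imult 1 (- 1)" by (auto simp: imult_def intro: exI[of _ "1"] exI[of _ "- 1"])
  have i: "inv\<^bsub>Ugr\<^esub> eLX = ex (- 1) (Toep LX)" "inv\<^bsub>Ugr\<^esub> eLY = ex (- 1) (Toep LY)"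
    using ui_unip[of eLX] ui_unip[of eLY] by (simp_all add: ui_def)
  note I = icong_ex_Toep[OF m(1)] icong_ex_Toep[OF m(2)]
  { case one show ?case unfolding r(5)[OF F2_one] by (rule icong_one)
  next case (x g) show ?case unfolding r(1)[OF x(1)] by (rule icong_mult(1)[OF I(1) x(2)])
  next case (y g) show ?case unfolding r(2)[OF y(1)] by (rule icong_mult(1)[OF I(1) y(2)])
  next case (xi g) show ?case unfolding r(3)[OF xi(1)] i by (rule icong_mult(1)[OF I(2) xi(2)])
  next case (yi g) show ?case unfolding r(4)[OF yi(1)] i by (rule icong_mult(1)[OF I(2) yi(2)]) }
qed

lemma (in pro_group) entries_uniform:
  fixes r :: "'a \<Rightarrow> ('i::finite, rat) tmat"
  assumes r: "r \<in> hom G Ugr" and int: "\<And>g n. g \<in> carrier G \<Longrightarrow> icong (d n) n 1 n (r g)" and d: "\<And>n. d n > 0"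
    and unip: "\<And>g. g \<in> carrier G \<Longrightarrow> unip (r g)" and e: "e > 0"
  shows "\<exists>M\<in>pro_index l G. \<forall>g\<in>carrier G. \<forall>h\<in>carrier G. g \<otimes> inv h \<in> M \<longrightarrow>
    padic_abs l (ent (r g) u v - ent (r h) u v) < e"
proof -
  interpret p: padic l by unfold_locales (rule prime_l)
  define n where "n = length u"
  define D where "D = (of_nat (d n) ^ (length u - length v) :: rat)"
  have D: "padic_abs l D > 0" using d[of n] by (intro p.pa_pos) (simp add: D_def)
  \<comment> \<open>The entry is known to be divisible by l^k only after multiplication by D; k is
    chosen so large that division by D still leaves less than e.\<close>
  obtain k where k: "(1 / real l) ^ k < e * padic_abs l D" using p.pa_small[of "e * padic_abs l D"] e D by auto
  let ?M = "{g \<in> carrier G. icong (d n) n (int l ^ k) n (r g - 1)}"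
  show ?thesis
  proof (intro bexI[of _ ?M] ballI impI)
    show "?M \<in> pro_index l G" by (rule unipotent_pro_index[OF r int unip])
    fix g h assume gh: "g \<in> carrier G" "h \<in> carrier G" "g \<otimes> inv h \<in> ?M"
    have "(r (g \<otimes> inv h) - 1) * r h = r g - r h"
    proof -
      have "r (g \<otimes> inv h) * r h = r (g \<otimes> inv h \<otimes> h)" using r gh(1,2) by (simp add: hom_def)
      also have "g \<otimes> inv h \<otimes> h = g" using gh by (simp add: m_assoc)
      finally show ?thesis by (simp add: left_diff_distrib)
    qed
    moreover have "icong (d n) n (int l ^ k) n ((r (g \<otimes> inv h) - 1) * r h)"
      using gh int[OF gh(2)] by (intro icong_mult) auto
    ultimately have "imult (int l ^ k) (sce (d n) (r g - r h) u v)" by (simp add: icong_def n_def del: sce_simps)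
    then obtain z where z: "(ent (r g) u v - ent (r h) u v) * D = of_int (int l ^ k * z)"
      by (auto simp: imult_def sce_def D_def)
    have "padic_abs l (ent (r g) u v - ent (r h) u v) * padic_abs l D \<le> (1 / real l) ^ k"
      unfolding p.pa_mult[symmetric] z by (rule p.pa_dvd) simp
    also have "\<dots> < e * padic_abs l D" by (rule k)
    finally show "padic_abs l (ent (r g) u v - ent (r h) u v) < e" using D by simp
  qed
qed

lemma ser_uniform:
  assumes "l \<in> primes" "e > 0"
  shows "\<exists>M\<in>pro_index l F2. \<forall>g\<in>carrier F2. \<forall>h\<in>carrier F2. g \<star> iv h \<in> M \<longrightarrow>
    padic_abs l (ser g w - ser h w) < e"
  unfolding ser_def col_def
proof (rule pro_group.entries_uniform[OF pro_groupI[OF group_F2 assms(1)], where d = fact])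
  have T: "Toep j \<in> Fil 1" for j :: letter by simp
  show "F2hom Ugr eLX eLY \<in> hom F2 Ugr" by (rule F2hom(1)[OF group_Ugr ex1_unit[OF T] ex1_unit[OF T]])
  show "unip (F2hom Ugr eLX eLY g)" if "g \<in> carrier F2" for g using that by (simp add: F2hom_unip)
qed (simp_all add: icong_F2hom assms(2))

section \<open>The series of elements of the free group are group-like\<close>

text \<open>The sum of \<phi> over all shuffles of u and v with multiplicity, that is, the pairing
  of the shuffle product with \<phi>. It turns the coproduct condition into a recursion on
  words.\<close>

fun sh :: "('j list \<Rightarrow> rat) \<Rightarrow> 'j list \<Rightarrow> 'j list \<Rightarrow> rat" where
  "sh \<phi> [] v = \<phi> v"
| "sh \<phi> (a # u) [] = \<phi> (a # u)"
| "sh \<phi> (a # u) (b # v) = sh (\<lambda>w. \<phi> (a # w)) u (b # v) + sh (\<lambda>w. \<phi> (b # w)) (a # u) v"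

lemma sh_Nil2 [simp]: "sh \<phi> u [] = \<phi> u" by (cases u) auto

lemma sh_linear: "sh (\<lambda>w. c * \<phi> w + \<psi> w) u v = c * sh \<phi> u v + sh \<psi> u v"
  by (induction \<phi> u v arbitrary: \<psi> rule: sh.induct) (auto simp: algebra_simps)

lemma sh_0 [simp]: "sh (\<lambda>w. 0) u v = 0"
  using sh_linear[of 1 "\<lambda>w. 0" "\<lambda>w. 0" u v] by simp

lemma sh_cmult [simp]: "sh (\<lambda>w. c * \<phi> w) u v = c * sh \<phi> u v"
  using sh_linear[of c \<phi> "\<lambda>w. 0" u v] by simp

lemma conv_Cons: "conv \<phi> \<psi> (a # w) = \<phi> [] * \<psi> (a # w) + conv (\<lambda>w. \<phi> (a # w)) \<psi> w"
  by (simp add: conv_def sum.atMost_Suc_shift del: sum.atMost_Suc)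

text \<open>The compatibility of the shuffle product with splitting a word in two: cutting a shuffle
  of u and v means cutting u and v and shuffling the pieces. It makes group-like series closed under
  multiplication.\<close>

lemma sh_conv:
  "sh (conv \<phi> \<psi>) u v = (\<Sum>i\<le>length u. \<Sum>j\<le>length v. sh \<phi> (take i u) (take j v) * sh \<psi> (drop i u) (drop j v))"
proof (induction \<phi> u v rule: sh.induct)
  case (3 \<phi> a u b v)
  show ?case
    unfolding sh.simps(3)[of "conv \<phi> \<psi>"] conv_Cons sh_linear 3
    by (simp add: sum.atMost_Suc_shift sum.distrib algebra_simps del: sum.atMost_Suc)
qed (simp_all add: conv_def)

definition grouplike :: "('j list \<Rightarrow> rat) \<Rightarrow> bool" where
  "grouplike \<phi> \<longleftrightarrow> (\<forall>u v. sh \<phi> u v = \<phi> u * \<phi> v)"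

lemma grouplike_conv: "grouplike \<phi> \<Longrightarrow> grouplike \<psi> \<Longrightarrow> grouplike (conv \<phi> \<psi>)"
  unfolding grouplike_def sh_conv conv_def by (simp add: sum_product mult_ac)

text \<open>The offset \<open>s\<close> counts letters already removed, since the coefficient still
  depends on the full length of the word. The two branches of the recursion add up by Pascal's
  rule.\<close>

lemma sh_exp:
  "sh (\<lambda>w. if w = replicate (length w) j then m ^ length w * c (length w + s) else 0) u v =
   (if u = replicate (length u) j \<and> v = replicate (length v) j
    then of_nat (length u + length v choose length u) * m ^ (length u + length v) * c (length u + length v + s) else 0)"
  for c :: "nat \<Rightarrow> rat"
proof (induction u arbitrary: v s)
  case (Cons a u)
  let ?f = "\<lambda>s w. if w = replicate (length w) j then m ^ length w * c (length w + s) else (0::rat)"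
  have f: "?f s (k # w) = (if k = j then m * ?f (Suc s) w else 0)" for s k w by simp
  show ?case
  proof (induction v arbitrary: s)
    case (Cons b v)
    have e: "sh (?f s) (a # u) (b # v) = (if a = j then m * sh (?f (Suc s)) u (b # v) else 0) + (if b = j then m * sh (?f (Suc s)) (a # u) v else 0)"
      unfolding sh.simps(3)[of "?f s"] f by simp
    show ?case unfolding e Cons.IH \<open>\<And>v s. sh (?f s) u v = _\<close> by (simp add: algebra_simps)
  qed simp
qed simp

lemma grouplike_esr: "grouplike (esr (m :: rat) j)"
proof -
  have e: "esr m j = (\<lambda>w. if w = replicate (length w) j then m ^ length w * (1 / fact (length w + 0)) else 0)"
    by (rule ext) (simp add: esr_def)
  show ?thesis unfolding grouplike_def unfolding e sh_exp[where c = "\<lambda>n. 1 / fact n"]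
    by (auto simp: binomial_fact power_add)
qed

lemma grouplike_delta: "grouplike (delta :: letter list \<Rightarrow> rat)"
proof -
  have "delta = (esr 0 LX :: letter list \<Rightarrow> rat)"
    by (rule ext) (auto simp: fser_def delta_def)
  then show ?thesis using grouplike_esr[of 0 LX] by simp
qed

lemma grouplike_ser: "g \<in> carrier F2 \<Longrightarrow> grouplike (ser g)"
proof (induction rule: F2_induct)
  case one
  have "ser \<one>\<^bsub>F2\<^esub> = delta"
    using F2hom_rec(5)[OF group_Ugr ex1_unit[OF Toep_Fil] ex1_unit[OF Toep_Fil] F2_one, of "1::rat" LX "1::rat" LY]
    by (auto simp: ser_def col_def fun_eq_iff ent_1 delta_def)
  then show ?case using grouplike_delta by simp
qed (auto simp: ser_mult ser_gen ser_inv grouplike_esr intro: grouplike_conv)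

text \<open>The index set of \<open>nc_coproduct\<close>. Whether position 0 belongs to I decides
  from which word the first letter is taken, which reproduces the recursion of
  \<open>sh\<close>.\<close>

definition shI :: "'j list \<Rightarrow> 'j list \<Rightarrow> ('j list \<times> nat set) set" where
  "shI u v = {(w, I). I \<subseteq> {..<length w} \<and> nths w I = u \<and> nths w (- I) = v}"

lemma nths_Nil_iff: "nths w I = [] \<longleftrightarrow> (\<forall>i<length w. i \<notin> I)"
  unfolding set_empty[symmetric] set_nths by auto

lemma nths_all_iff: "I \<subseteq> {..<length w} \<Longrightarrow> nths w (- I) = [] \<longleftrightarrow> I = {..<length w}"
  by (auto simp: nths_Nil_iff subset_iff)

lemma nths_none_iff: "I \<subseteq> {..<length w} \<Longrightarrow> nths w I = [] \<longleftrightarrow> I = {}"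
  by (auto simp: nths_Nil_iff subset_iff)

lemma shI_Nil: "shI [] v = {(v, {})}"
proof -
  have "I = {} \<and> w = v" if "I \<subseteq> {..<length w}" "nths w I = []" "nths w (- I) = v" for w I
    using that nths_none_iff[OF that(1)] by (simp add: nths_all)
  then show ?thesis by (auto simp: shI_def nths_all)
qed

lemma shI_Nil2: "shI u [] = {(u, {..<length u})}"
proof -
  have "I = {..<length w} \<and> w = u" if "I \<subseteq> {..<length w}" "nths w I = u" "nths w (- I) = []" for w I
    using that nths_all_iff[OF that(1)] by (simp add: nths_all)
  then show ?thesis by (auto simp: shI_def nths_all nths_Nil_iff)
qed

lemma shI_Cons:
  "shI (a # u) (b # v) = (\<lambda>(w, I). (a # w, insert 0 (Suc ` I))) ` shI u (b # v) \<union> (\<lambda>(w, I). (b # w, Suc ` I)) ` shI (a # u) v"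
    (is "?L = ?R")
proof (intro equalityI subsetI)
  fix p assume "p \<in> ?L"
  then obtain w I where p: "p = (w, I)" "I \<subseteq> {..<length w}" "nths w I = a # u" "nths w (- I) = b # v"
    by (auto simp: shI_def)
  then obtain c w' where w: "w = c # w'" by (cases w) auto
  define J where "J = {j. Suc j \<in> I}"
  have J: "J \<subseteq> {..<length w'}" and Jc: "{j. Suc j \<in> - I} = - J" using p(2) w by (auto simp: J_def)
  show "p \<in> ?R"
  proof (cases "0 \<in> I")
    case True
    have "I = insert 0 (Suc ` J)" using True by (auto simp: J_def image_iff) (metis not0_implies_Suc)
    moreover have "c = a" "(w', J) \<in> shI u (b # v)"
      using p w True J Jc by (auto simp: shI_def nths_Cons J_def[symmetric])
    ultimately show ?thesis using p w by force
  next
    case False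
    have "I = Suc ` J" using False by (auto simp: J_def image_iff) (metis not0_implies_Suc)
    moreover have "c = b" "(w', J) \<in> shI (a # u) v"
      using p w False J Jc by (auto simp: shI_def nths_Cons J_def[symmetric])
    ultimately show ?thesis using p w by force
  qed
next
  fix p assume "p \<in> ?R"
  moreover have "{j. Suc j = 0 \<or> Suc j \<in> Suc ` I} = I" "{j. Suc j \<in> Suc ` I} = I"
    "{j. Suc j \<notin> Suc ` I} = - I" for I by auto
  ultimately show "p \<in> ?L" by (auto simp: shI_def nths_Cons Compl_eq)
qed

lemma shI_sum: "finite (shI u v) \<and> (\<Sum>(w, I)\<in>shI u v. \<phi> w) = sh \<phi> u v"
proof (induction \<phi> u v rule: sh.induct)
  case (3 \<phi> a u b v)
  have i: "inj_on (\<lambda>(w :: 'a list, I). (a # w, insert 0 (Suc ` I))) A" "inj_on (\<lambda>(w :: 'a list, I). (b # w, Suc ` I)) A" for A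
    by (auto simp: inj_on_def dest!: arg_cong[of "insert 0 _" _ "\<lambda>A. {j. Suc j \<in> A}"])
  have d: "((\<lambda>(w, I). (a # w, insert 0 (Suc ` I))) ` shI u (b # v)) \<inter> ((\<lambda>(w, I). (b # w, Suc ` I)) ` shI (a # u) v) = {}"
    by auto
  show ?case
    unfolding shI_Cons using 3 d
    by (subst sum.union_disjoint) (auto simp: sum.reindex[OF i(1)[unfolded case_prod_unfold]] sum.reindex[OF i(2)[unfolded case_prod_unfold]] o_def case_prod_unfold)
qed (auto simp: shI_Nil shI_Nil2)

lemmas finite_shI = conjunct1[OF shI_sum]

section \<open>Power series over a field and over a commutative algebra mapping to it\<close>

text \<open>Connects the type-class calculus of matrices with the carrier-based series
  \<open>ncps R\<close>. The instances are the embedding of the rationals in \<open>Ql l\<close> and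
  the projections of the product ring to \<open>Qlbar l\<close>. Exponential, logarithm and powers
  of series become \<open>ex\<close>, \<open>lg\<close> and \<open>pw\<close> of left
  multiplications.\<close>

locale alg_to_field = R: Ring.field R for R :: "('b, 'm) ring_scheme" (structure) +
  fixes \<pi> :: "'k::qalg \<Rightarrow> 'b"
  assumes pi_closed [simp, intro]: "\<pi> x \<in> carrier R" and pi_add: "\<pi> (x + y) = \<pi> x \<oplus> \<pi> y"
    and pi_mult: "\<pi> (x * y) = \<pi> x \<otimes> \<pi> y" and pi_1 [simp]: "\<pi> 1 = \<one>"
begin

lemma pi_0 [simp]: "\<pi> 0 = \<zero>"
  using pi_add[of 0 0] R.add.l_cancel_one[of "\<pi> 0" "\<pi> 0"] by simp

lemma pi_minus: "\<pi> (- x) = \<ominus> \<pi> x"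
  using pi_add[of "- x" x] R.minus_equality[of "\<pi> (- x)" "\<pi> x"] by simp

lemma pi_diff: "\<pi> (x - y) = \<pi> x \<ominus> \<pi> y"
  using pi_add[of x "- y"] by (simp add: pi_minus a_minus_def)

lemma pi_sum: "finite A \<Longrightarrow> \<pi> (sum f A) = (\<Oplus>x\<in>A. \<pi> (f x))"
  by (induction A rule: finite_induct) (simp_all add: pi_add Pi_def)

lemma pi_of_nat: "[n] \<cdot> \<one> = \<pi> (of_nat n)" for n :: nat
  by (induction n) (simp_all add: pi_add R.add.m_comm)

lemma pi_power: "\<pi> x [^] n = \<pi> (x ^ n)" for n :: nat
  by (induction n) (simp_all add: pi_mult power_Suc2 del: power_Suc)

lemma pi_inverse: "n > 0 \<Longrightarrow> inv ([n] \<cdot> \<one>) = \<pi> (qi (1 / of_nat n))" for n :: nat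
proof (rule R.comm_inv_char)
  assume "n > 0"
  then have "qi (of_nat n) * qi (1 / of_nat n) = (1 :: 'k)"
    unfolding qi_mult[symmetric] by simp
  then have "of_nat n * qi (1 / of_nat n) = (1 :: 'k)" by (simp add: qi_of_nat)
  then show "[n] \<cdot> \<one> \<otimes> \<pi> (qi (1 / of_nat n)) = \<one>"
    by (simp add: pi_of_nat flip: pi_mult)
qed (simp_all add: pi_of_nat)

lemma nc_mult: "(\<lambda>w. \<pi> (\<phi> w)) \<otimes>\<^bsub>ncps R\<^esub> (\<lambda>w. \<pi> (\<psi> w)) = (\<lambda>w. \<pi> (conv \<phi> \<psi> w))"
  by (rule ext) (simp add: ncps_def conv_def pi_sum pi_mult Pi_def)

lemma nc_one: "\<one>\<^bsub>ncps R\<^esub> = (\<lambda>w. \<pi> (delta w))"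
  by (rule ext) (simp add: ncps_def delta_def)

lemma nc_var: "nc_var R s = (\<lambda>w. \<pi> (if w = [s] then 1 else 0))"
  by (rule ext) (simp add: nc_var_def)

lemma abelian_group_ncps: "abelian_group (ncps R)"
proof (rule abelian_groupI)
  fix \<phi> assume "\<phi> \<in> carrier (ncps R)"
  then show "\<exists>\<psi>\<in>carrier (ncps R). \<psi> \<oplus>\<^bsub>ncps R\<^esub> \<phi> = \<zero>\<^bsub>ncps R\<^esub>"
    by (intro bexI[of _ "\<lambda>w. \<ominus> \<phi> w"]) (auto simp: ncps_def R.l_neg)
qed (auto simp: ncps_def fun_eq_iff R.a_ac)

lemma nc_diff: "(\<lambda>w. \<pi> (\<phi> w)) \<ominus>\<^bsub>ncps R\<^esub> (\<lambda>w. \<pi> (\<psi> w)) = (\<lambda>w. \<pi> (\<phi> w - \<psi> w))"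
proof -
  interpret N: abelian_group "ncps R" by (rule abelian_group_ncps)
  have "\<ominus>\<^bsub>ncps R\<^esub> (\<lambda>w. \<pi> (\<psi> w)) = (\<lambda>w. \<pi> (- \<psi> w))"
    by (rule N.minus_equality) (auto simp: ncps_def simp flip: pi_add)
  then show ?thesis by (simp add: a_minus_def) (simp add: ncps_def flip: pi_add)
qed

text \<open>The second part, that a power is again a left multiplication, is carried along because
  the induction step needs a series to convolve with.\<close>

lemma nc_pow:
  "(\<lambda>w. \<pi> (\<phi> w)) [^]\<^bsub>ncps R\<^esub> n = (\<lambda>w. \<pi> (col (ev \<phi> Toep ^ n) w)) \<and> (\<exists>\<psi>. ev \<phi> Toep ^ n = ev \<psi> Toep)"
  for n :: nat and \<phi> :: "letter list \<Rightarrow> 'k"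
proof (induction n)
  case 0
  have "ev delta Toep = (1 :: (letter, 'k) tmat)" by simp
  then show ?case by (auto simp: nat_pow_def nc_one col_def ent_1 delta_def fun_eq_iff intro: exI[of _ delta])
next
  case (Suc n)
  then obtain \<psi> where p: "ev \<phi> Toep ^ n = ev \<psi> Toep" by blast
  then have "(\<lambda>w. \<pi> (\<phi> w)) [^]\<^bsub>ncps R\<^esub> n = (\<lambda>w. \<pi> (\<psi> w))" using Suc by simp
  moreover have "ev \<phi> Toep ^ Suc n = ev (conv \<psi> \<phi>) Toep" unfolding power_Suc2 p by (simp add: ev_mult)
  ultimately show ?case by (auto simp: nat_pow_def nc_mult)
qed

lemma ev_Toep_Fil: "\<phi> [] = 0 \<Longrightarrow> ev \<phi> Toep \<in> Fil 1"
  by (rule ev_Fil) auto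

lemma nc_exp:
  fixes \<phi> :: "letter list \<Rightarrow> 'k"
  assumes "\<phi> [] = 0"
  shows "nc_exp R (\<lambda>w. \<pi> (\<phi> w)) = (\<lambda>w. \<pi> (col (ex 1 (ev \<phi> Toep)) w))"
proof
  fix w
  have "nc_exp R (\<lambda>w. \<pi> (\<phi> w)) w = (\<Oplus>n\<in>{..length w}. \<pi> (qi (1 / fact n) * col (ev \<phi> Toep ^ n) w))"
    unfolding nc_exp_def using pi_inverse[of "fact n" for n]
    by (intro R.finsum_cong) (auto simp: nc_pow pi_mult simp_implies_def)
  also have "\<dots> = \<pi> (col (ex 1 (ev \<phi> Toep)) w)"
    unfolding ex_def col_def ent_ev1[OF ev_Toep_Fil[of \<phi>, OF assms], of w "[]" "length w", simplified]
    by (subst pi_sum) simp_all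
  finally show "nc_exp R (\<lambda>w. \<pi> (\<phi> w)) w = \<pi> (col (ex 1 (ev \<phi> Toep)) w)" .
qed

lemma nc_log:
  fixes \<phi> :: "letter list \<Rightarrow> 'k"
  assumes "\<phi> [] = 1"
  shows "nc_log R (\<lambda>w. \<pi> (\<phi> w)) = (\<lambda>w. \<pi> (col (lg (ev \<phi> Toep)) w))"
proof
  fix w
  define \<psi> where "\<psi> = (\<lambda>w. \<phi> w - delta w)"
  have e: "ev \<phi> Toep - 1 = ev \<psi> Toep"
    using ev_add[of \<psi> delta Toep] by (simp add: \<psi>_def)
  have F: "ev \<psi> Toep \<in> Fil 1" by (rule ev_Toep_Fil) (simp add: \<psi>_def assms delta_def)
  have s: "(\<ominus> \<one>) [^] (n + 1) = \<pi> ((- 1) ^ (n + 1))" for n :: nat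
    using pi_power[of "- 1" "n + 1"] by (simp add: pi_minus)
  have l: "fps_nth lnf n = (- 1) ^ (n + 1) * qi (1 / of_nat n)" if "n \<ge> 1" for n
  proof -
    have "fps_nth (fps_ln 1) n = (- 1) ^ (n + 1) * (1 / of_nat n :: rat)"
      using that by (cases n) (simp_all add: fps_ln_def flip: Suc_eq_plus1)
    then have "fps_nth lnf n = qi ((- 1) ^ (n + 1)) * qi (1 / of_nat n)" unfolding lnf_def qfps_nth by (metis qi_mult)
    then show ?thesis by (simp add: qi_power qi_minus)
  qed
  have "nc_log R (\<lambda>w. \<pi> (\<phi> w)) w = (\<Oplus>n\<in>{1..length w}. \<pi> (fps_nth lnf n * col (ev \<psi> Toep ^ n) w))"
    unfolding nc_log_def nc_one nc_diff \<psi>_def[symmetric]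
    by (intro R.finsum_cong) (auto simp: nc_pow pi_mult pi_inverse s l simp_implies_def \<psi>_def)
  also have "\<dots> = \<pi> (\<Sum>n\<in>{1..length w}. fps_nth lnf n * col (ev \<psi> Toep ^ n) w)" by (subst pi_sum) simp_all
  also have "(\<Sum>n\<in>{1..length w}. fps_nth lnf n * col (ev \<psi> Toep ^ n) w) = (\<Sum>n\<le>length w. fps_nth lnf n * col (ev \<psi> Toep ^ n) w)"
    by (rule sum.mono_neutral_left) (auto simp: not_le)
  also have "\<dots> = col (lg (ev \<phi> Toep)) w"
    unfolding lg_def e col_def by (rule ent_ev1[OF F, symmetric]) simp
  finally show "nc_log R (\<lambda>w. \<pi> (\<phi> w)) w = \<pi> (col (lg (ev \<phi> Toep)) w)" .
qed

lemma lg_ev_Toep: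
  fixes \<phi> :: "letter list \<Rightarrow> 'k"
  assumes "\<phi> [] = 1"
  shows "lg (ev \<phi> Toep) = ev (col (lg (ev \<phi> Toep))) Toep" (is ?P) "col (lg (ev \<phi> Toep)) [] = 0" (is ?Q)
proof -
  have "ev \<phi> Toep - 1 = ev (\<lambda>w. \<phi> w - delta w) Toep"
    using ev_add[of "\<lambda>w. \<phi> w - delta w" delta Toep] by simp
  moreover have "ev (\<lambda>w. \<phi> w - delta w) Toep \<in> (Fil 1 :: (letter, 'k) tmat set)"
    by (rule ev_Toep_Fil) (simp add: assms delta_def)
  ultimately have F: "ev \<phi> Toep - 1 \<in> (Fil 1 :: (letter, 'k) tmat set)" by simp
  show ?Q by (rule col_Nil_0[OF lg_Fil[OF F]])
  have "rp Toep (ev \<phi> Toep) (ev \<phi> Toep)" by (rule rpI) simp_all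
  from rp_lg[OF Toep_Fil this F] show ?P by (simp add: rp_def)
qed

lemma nc_powr:
  fixes \<phi> :: "letter list \<Rightarrow> 'k"
  assumes "\<phi> [] = 1"
  shows "nc_powr R (\<lambda>w. \<pi> (\<phi> w)) (\<pi> m) = (\<lambda>w. \<pi> (col (pw m (ev \<phi> Toep)) w))"
proof -
  note L = lg_ev_Toep[of \<phi>, OF assms]
  have "nc_powr R (\<lambda>w. \<pi> (\<phi> w)) (\<pi> m) = nc_exp R (\<lambda>w. \<pi> (m * col (lg (ev \<phi> Toep)) w))"
    by (simp add: nc_powr_def nc_log[of \<phi>, OF assms] pi_mult)
  also have "\<dots> = (\<lambda>w. \<pi> (col (ex 1 (ev (\<lambda>w. m * col (lg (ev \<phi> Toep)) w) Toep)) w))"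
    by (rule nc_exp) (simp add: L(2))
  also have "ev (\<lambda>w. m * col (lg (ev \<phi> Toep)) w) Toep = scm m (lg (ev \<phi> Toep))"
    unfolding ev_cmult L(1)[symmetric] ..
  finally show ?thesis by (simp add: ex_scm pw_def)
qed

text \<open>In the coefficient at w the empty prefix contributes the unknown coefficient itself, as
  \<phi> has constant term 1; all other terms involve shorter words, on which the induction has
  already reached equality.\<close>

lemma nc_cancel:
  assumes \<phi>: "\<phi> \<in> carrier (ncps R)" "\<phi> [] = \<one>" and \<psi>: "\<psi> \<in> carrier (ncps R)" "\<psi>' \<in> carrier (ncps R)"
    and eq: "\<phi> \<otimes>\<^bsub>ncps R\<^esub> \<psi> = \<phi> \<otimes>\<^bsub>ncps R\<^esub> \<psi>'"
  shows "\<psi> = \<psi>'"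
proof
  have c: "\<phi> w \<in> carrier R" "\<psi> w \<in> carrier R" "\<psi>' w \<in> carrier R" for w
    using \<phi> \<psi> by (simp_all add: ncps_def)
  have m: "(\<phi> \<otimes>\<^bsub>ncps R\<^esub> \<rho>) w = (\<Oplus>i\<in>{..<length w}. \<phi> (take (Suc i) w) \<otimes> \<rho> (drop (Suc i) w)) \<oplus> \<rho> w"
    if "\<And>w. \<rho> w \<in> carrier R" for \<rho> w
  proof (cases "length w")
    case 0
    then show ?thesis using that \<phi>(2) by (simp add: ncps_def)
  next
    case (Suc n)
    show ?thesis
      unfolding ncps_def ring_record_simps Suc using that c \<phi>(2)
      by (subst R.finsum_Suc2) (auto simp: Pi_def lessThan_Suc_atMost)
  qed
  show "\<psi> w = \<psi>' w" for w
  proof (induction "length w" arbitrary: w rule: less_induct)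
    case less
    have "(\<Oplus>i\<in>{..<length w}. \<phi> (take (Suc i) w) \<otimes> \<psi> (drop (Suc i) w)) =
          (\<Oplus>i\<in>{..<length w}. \<phi> (take (Suc i) w) \<otimes> \<psi>' (drop (Suc i) w))"
      by (rule R.finsum_cong) (auto simp: simp_implies_def c less)
    then show ?case using fun_cong[OF eq, of w] m[of \<psi> w] m[of \<psi>' w] c by (simp add: Pi_def)
  qed
qed

end

section \<open>Elements of the pro-\<open>l\<close> free group as \<open>l\<close>-adic power series\<close>

lemma (in alg_to_field) nc_r_one:
  assumes "\<phi> \<in> carrier (ncps R)"
  shows "\<phi> \<otimes>\<^bsub>ncps R\<^esub> \<one>\<^bsub>ncps R\<^esub> = \<phi>"
proof
  fix w
  have c: "\<phi> w \<in> carrier R" for w using assms by (simp add: ncps_def)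
  have "(\<Oplus>i\<in>{..length w}. \<phi> (take i w) \<otimes> (if length w \<le> i then \<one> else \<zero>))
    = (\<Oplus>i\<in>{..length w}. if length w = i then \<phi> (take i w) else \<zero>)"
    by (rule R.finsum_cong) (auto simp: simp_implies_def c)
  also have "\<dots> = \<phi> w"
    using R.finsum_singleton[of "length w" "{..length w}" "\<lambda>i. \<phi> (take i w)"] by (simp add: c)
  finally show "(\<phi> \<otimes>\<^bsub>ncps R\<^esub> \<one>\<^bsub>ncps R\<^esub>) w = \<phi> w" by (simp add: ncps_def)
qed

context padic
begin

sublocale Q: Ring.field "Ql l" by (rule field_Ql)
sublocale P: pro_group F2 l using l group_F2 by (simp add: pro_groupI)
sublocale A: alg_to_field "Ql l" \<iota>
  by unfold_locales (simp_all add: \<iota>_hom)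

lemma plim_finsum:
  "finite S \<Longrightarrow> (\<And>x. x \<in> S \<Longrightarrow> plim (\<phi> x) F (a x)) \<Longrightarrow> plim (\<lambda>g. \<Sum>x\<in>S. \<phi> x g) F (finsum (Ql l) a S)"
proof (induction S rule: finite_induct)
  case empty
  then show ?case using plim_const[of 0] by (simp add: \<iota>_hom)
next
  case (insert x S)
  have "a y \<in> carrier (Ql l)" if "y \<in> insert x S" for y using plim_carrier[OF insert.prems[OF that]] .
  then show ?case using insert by (simp add: plim_add Pi_def)
qed

lemma ser_plim_ex:
  assumes c: "c \<in> carrier (Pro l F2)"
  shows "\<exists>x. plim (\<lambda>g. ser g w) (P.cf c) x"
proof (rule plim_exists[OF P.cf_not_bot[OF c]])
  fix e :: real assume "e > 0"
  then obtain M where M: "M \<in> pro_index l F2"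
    "\<forall>g\<in>carrier F2. \<forall>h\<in>carrier F2. g \<star> iv h \<in> M \<longrightarrow> pa (ser g w - ser h w) < e"
    using ser_uniform[of l e w] l by auto
  have *: "pa (ser g w - ser h w) < e" if g: "g \<in> c M" and h: "h \<in> c M" for g h
    using M(2) P.pro_mem[OF c M(1) g] P.pro_mem[OF c M(1) h] P.coset_eq_iff[OF P.pro_indexD(2)[OF M(1)]] by metis
  show "eventually (\<lambda>g. eventually (\<lambda>h. pa (ser g w - ser h w) < e) (P.cf c)) (P.cf c)"
    unfolding P.eventually_cf[OF c] using * M(1) by blast
qed

text \<open>The series c(e^X, e^Y), obtained as the coefficientwise l-adic limit of the series of
  words close to c. \<open>F2_to_Ql_sl\<close> identifies it with the value of the continuous
  homomorphism.\<close>

definition sl :: "(letter gword set set \<Rightarrow> letter gword set set) \<Rightarrow> letter list \<Rightarrow> (nat \<Rightarrow> rat) set" where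
  "sl c w = (THE x. plim (\<lambda>g. ser g w) (P.cf c) x)"

lemma plim_sl: "c \<in> carrier (Pro l F2) \<Longrightarrow> plim (\<lambda>g. ser g w) (P.cf c) (sl c w)"
  unfolding sl_def using ser_plim_ex[of c w] plim_unique[OF _ _ P.cf_not_bot[of c]] by (blast intro: theI)

lemma sl_closed: "c \<in> carrier (Pro l F2) \<Longrightarrow> sl c w \<in> carrier (Ql l)"
  by (rule plim_carrier[OF plim_sl])

lemma eventually_F2: "c \<in> carrier (Pro l F2) \<Longrightarrow> eventually (\<lambda>g. g \<in> carrier F2) (P.cf c)"
  by (rule eventually_mono[OF P.eventually_cf_mem[OF _ P.carrier_pro_index]]) simp_all

lemma sl_unique:
  assumes c: "c \<in> carrier (Pro l F2)" and "plim \<phi> (P.cf c) x" "\<And>g. g \<in> carrier F2 \<Longrightarrow> \<phi> g = ser g w"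
  shows "sl c w = x"
proof (rule plim_unique[OF plim_sl[OF c] _ P.cf_not_bot[OF c]])
  show "plim (\<lambda>g. ser g w) (P.cf c) x"
    by (rule plim_cong[OF eventually_mono[OF eventually_F2[OF c]] assms(2)]) (rule assms(3))
qed

lemma sl_points: assumes c: "c \<in> carrier (Pro l F2)" shows "sl c \<in> carrier (F2_points (Ql l))"
proof -
  have "sl c [] = \<one>\<^bsub>Ql l\<^esub>"
    using sl_unique[OF c plim_const[of 1]] by (simp add: ser_Nil \<iota>_hom)
  moreover have "nc_coproduct (Ql l) (sl c) u v = sl c u \<otimes>\<^bsub>Ql l\<^esub> sl c v" for u v
  proof (rule plim_unique[OF _ _ P.cf_not_bot[OF c]])
    have e: "nc_coproduct (Ql l) (sl c) u v = finsum (Ql l) (\<lambda>x. sl c (fst x)) (shI u v)"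
      by (simp add: nc_coproduct_def shI_def case_prod_unfold)
    have "plim (\<lambda>g. \<Sum>x\<in>shI u v. ser g (fst x)) (P.cf c) (nc_coproduct (Ql l) (sl c) u v)"
      unfolding e by (intro plim_finsum finite_shI plim_sl[OF c])
    then show "plim (\<lambda>g. ser g u * ser g v) (P.cf c) (nc_coproduct (Ql l) (sl c) u v)"
      by (rule plim_cong[rotated])
         (use eventually_F2[OF c] grouplike_ser shI_sum[of u v] in \<open>auto elim!: eventually_mono simp: grouplike_def case_prod_unfold\<close>)
    show "plim (\<lambda>g. ser g u * ser g v) (P.cf c) (sl c u \<otimes>\<^bsub>Ql l\<^esub> sl c v)"
      by (intro plim_mult plim_sl[OF c])
  qed
  ultimately show ?thesis using sl_closed[OF c] by (simp add: F2_points_def ncps_def)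
qed

text \<open>The limit is taken over pairs of words close to c and d: their product is close to the
  product of c and d, and the coefficients of the product are convolutions of the coefficients of
  the two words.\<close>

lemma sl_mult:
  assumes c: "c \<in> carrier (Pro l F2)" and d: "d \<in> carrier (Pro l F2)"
  shows "sl (c \<otimes>\<^bsub>Pro l F2\<^esub> d) = sl c \<otimes>\<^bsub>ncps (Ql l)\<^esub> sl d"
proof
  fix w
  interpret C: Group.group "Pro l F2" by (rule P.group_pro_completion)
  let ?F = "prod_filter (P.cf c) (P.cf d)"
  have cd: "c \<otimes>\<^bsub>Pro l F2\<^esub> d \<in> carrier (Pro l F2)" using c d by simp
  have nb: "?F \<noteq> bot" using P.cf_not_bot[OF c] P.cf_not_bot[OF d] by (simp add: prod_filter_eq_bot)
  have f1: "filtermap fst ?F \<le> P.cf c" and f2: "filtermap snd ?F \<le> P.cf d"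
    by (simp_all add: filtermap_fst_prod_filter filtermap_snd_prod_filter)
  have mem: "eventually (\<lambda>x. fst x \<in> c N \<and> snd x \<in> d N) ?F" if N: "N \<in> pro_index l F2" for N
    unfolding eventually_prod_filter
    using P.eventually_cf_mem[OF c N] P.eventually_cf_mem[OF d N] by (intro exI[of _ "\<lambda>g. g \<in> carrier F2 \<and> g \<in> c N"] exI[of _ "\<lambda>g. g \<in> carrier F2 \<and> g \<in> d N"]) auto
  have le: "filtermap (\<lambda>x. fst x \<star> snd x) ?F \<le> P.cf (c \<otimes>\<^bsub>Pro l F2\<^esub> d)"
  proof (rule filter_leI)
    fix T assume "eventually T (P.cf (c \<otimes>\<^bsub>Pro l F2\<^esub> d))"
    then obtain N where N: "N \<in> pro_index l F2" "\<forall>g\<in>c N <#>\<^bsub>F2\<^esub> d N. T g"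
      unfolding P.eventually_cf[OF cd] using P.pro_mult by auto
    show "eventually T (filtermap (\<lambda>x. fst x \<star> snd x) ?F)"
      unfolding eventually_filtermap using mem[OF N(1)] by eventually_elim (use N(2) in \<open>auto simp: set_mult_def\<close>)
  qed
  show "sl (c \<otimes>\<^bsub>Pro l F2\<^esub> d) w = (sl c \<otimes>\<^bsub>ncps (Ql l)\<^esub> sl d) w"
  proof (rule plim_unique[OF _ _ nb])
    show "plim (\<lambda>x. ser (fst x \<star> snd x) w) ?F (sl (c \<otimes>\<^bsub>Pro l F2\<^esub> d) w)"
      using plim_mono[OF plim_sl[OF cd] le] by (simp add: plim_filtermap)
    have "plim (\<lambda>x. \<Sum>i\<le>length w. ser (fst x) (take i w) * ser (snd x) (drop i w)) ?F
       (\<Oplus>\<^bsub>Ql l\<^esub>i\<in>{..length w}. sl c (take i w) \<otimes>\<^bsub>Ql l\<^esub> sl d (drop i w))"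
      using plim_mono[OF plim_sl[OF c] f1] plim_mono[OF plim_sl[OF d] f2]
      by (intro plim_finsum plim_mult) (simp_all add: plim_filtermap)
    then have "plim (\<lambda>x. \<Sum>i\<le>length w. ser (fst x) (take i w) * ser (snd x) (drop i w)) ?F ((sl c \<otimes>\<^bsub>ncps (Ql l)\<^esub> sl d) w)"
      by (simp add: ncps_def)
    then show "plim (\<lambda>x. ser (fst x \<star> snd x) w) ?F ((sl c \<otimes>\<^bsub>ncps (Ql l)\<^esub> sl d) w)"
    proof (rule plim_cong[rotated])
      show "eventually (\<lambda>x. (\<Sum>i\<le>length w. ser (fst x) (take i w) * ser (snd x) (drop i w)) = ser (fst x \<star> snd x) w) ?F"
        using mem[OF P.carrier_pro_index]
      proof eventually_elim
        case (elim x)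
        then have "fst x \<in> carrier F2" "snd x \<in> carrier F2"
          using P.pro_mem(1)[OF c P.carrier_pro_index] P.pro_mem(1)[OF d P.carrier_pro_index] by auto
        then show ?case by (simp add: ser_mult conv_def)
      qed
    qed
  qed
qed

lemma sl_incl: assumes g: "g \<in> carrier F2" shows "sl (pro_incl l F2 g) w = \<iota> (ser g w)"
proof -
  have c: "pro_incl l F2 g \<in> carrier (Pro l F2)" using P.pro_incl_hom g by (simp add: hom_in_carrier)
  have "plim (\<lambda>h. ser h w - ser g w) (P.cf (pro_incl l F2 g)) (\<iota> 0)"
  proof (rule plim_small)
    fix e :: real assume "e > 0"
    then obtain M where M: "M \<in> pro_index l F2"
      "\<forall>g\<in>carrier F2. \<forall>h\<in>carrier F2. g \<star> iv h \<in> M \<longrightarrow> pa (ser g w - ser h w) < e"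
      using ser_uniform[of l e w] l by auto
    have gM: "g \<in> pro_incl l F2 g M" using M(1) P.rcos_self[OF g P.pro_indexD(2)[OF M(1)]] by (simp add: pro_incl_def)
    have "pa (ser h w - ser g w) < e" if h: "h \<in> pro_incl l F2 g M" for h
      using M(2) g P.pro_mem[OF c M(1) gM] P.pro_mem[OF c M(1) h] P.coset_eq_iff[OF P.pro_indexD(2)[OF M(1)]] by metis
    then show "eventually (\<lambda>h. pa (ser h w - ser g w) < e) (P.cf (pro_incl l F2 g))"
      unfolding P.eventually_cf[OF c] using M(1) by blast
  qed
  from plim_add[OF this plim_const[of "ser g w"]]
  have "plim (\<lambda>h. ser h w) (P.cf (pro_incl l F2 g)) (\<iota> (ser g w))" by (simp add: \<iota>_hom)
  then show ?thesis by (rule sl_unique[OF c]) simp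
qed

lemma sl_continuous: "continuous_map (pro_topology l F2) (F2_Ql_topology l) sl"
  unfolding F2_Ql_topology_def continuous_map_in_subtopology continuous_map_componentwise
proof (intro conjI ballI)
  show "sl ` topspace (pro_topology l F2) \<subseteq> extensional UNIV" by simp
  show "sl \<in> topspace (pro_topology l F2) \<rightarrow> carrier (F2_points (Ql l))"
    using sl_points by (simp add: P.topspace_pro)
  fix w
  interpret M: Metric_space "carrier (Ql l)" "Ql_dist l" by (rule Metric_space_Ql)
  show "continuous_map (pro_topology l F2) (Ql_topology l) (\<lambda>c. sl c w)"
    unfolding Ql_topology_def M.continuous_map_to_metric
  proof (intro ballI allI impI)
    fix c and e :: real assume "c \<in> topspace (pro_topology l F2)" and e: "e > 0"
    then have c: "c \<in> carrier (Pro l F2)" by (simp add: P.topspace_pro)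
    obtain M where M: "M \<in> pro_index l F2"
      "\<forall>g\<in>carrier F2. \<forall>h\<in>carrier F2. g \<star> iv h \<in> M \<longrightarrow> pa (ser g w - ser h w) < e / 2"
      using ser_uniform[of l "e / 2" w] l e by auto
    have "sl d w \<in> M.mball (sl c w) e" if d: "d \<in> carrier (Pro l F2)" "d M = c M" for d
    proof -
      have "Ql_dist l (sl c w) (sl d w) \<le> e / 2"
      proof (rule plim_dist[OF plim_sl[OF c] plim_sl[OF d(1)]])
        show "e / 2 > 0" using e by simp
        fix T T' assume "eventually T (P.cf c)" "eventually T' (P.cf d)"
        then have ev: "eventually (\<lambda>g. T g \<and> g \<in> carrier F2 \<and> g \<in> c M) (P.cf c)" "eventually (\<lambda>g. T' g \<and> g \<in> carrier F2 \<and> g \<in> d M) (P.cf d)"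
          using P.eventually_cf_mem[OF c M(1)] P.eventually_cf_mem[OF d(1) M(1)] by (simp_all add: eventually_conj_iff)
        then obtain g h where gh: "T g" "g \<in> carrier F2" "g \<in> c M" "T' h" "h \<in> carrier F2" "h \<in> c M"
          using eventually_happens'[OF P.cf_not_bot[OF c] ev(1)] eventually_happens'[OF P.cf_not_bot[OF d(1)] ev(2)] d(2) by auto
        have "g \<star> iv h \<in> M"
          using P.pro_mem(2)[OF c M(1) gh(3)] P.pro_mem(2)[OF c M(1) gh(6)] P.coset_eq_iff[OF P.pro_indexD(2)[OF M(1)] gh(2,5)] by simp
        then show "\<exists>g h. T g \<and> T' h \<and> pa (ser g w - ser h w) < e / 2" using gh M(2) by blast
      qed
      then show ?thesis using e sl_closed[OF c] sl_closed[OF d(1)] by (simp add: M.in_mball)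
    qed
    then show "\<exists>U. openin (pro_topology l F2) U \<and> c \<in> U \<and> (\<forall>d\<in>U. sl d w \<in> M.mball (sl c w) e)"
      using P.openin_pro_coord[OF M(1), of "c M"] c by (intro exI[of _ "{d \<in> carrier (Pro l F2). d M = c M}"]) auto
  qed
qed

lemma nc_exp_var: "nc_exp (Ql l) (nc_var (Ql l) s) = (\<lambda>w. \<iota> (esr 1 s w))"
proof -
  have "ev (\<lambda>w. if w = [s] then 1 else 0) Toep = (Toep s :: (letter, rat) tmat)"
    by (rule tmat_eqI) (auto simp: ev.rep_eq ent_wd_Toep ent_Toep if_distrib[of "\<lambda>x. x * _"] sum.delta cong: if_cong)
  then show ?thesis unfolding A.nc_var by (subst A.nc_exp) (simp_all add: ex_ev[of Toep, OF Toep_Fil, symmetric])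
qed

theorem F2_to_Ql_sl: assumes c: "c \<in> carrier (Pro l F2)" shows "F2_to_Ql l c = sl c"
proof -
  interpret C: Group.group "Pro l F2" by (rule P.group_pro_completion)
  let ?k = "restrict sl (carrier (Pro l F2))"
  note gx = hom_in_carrier[OF P.pro_incl_hom F2_x_carrier] hom_in_carrier[OF P.pro_incl_hom F2_y_carrier]
  have "F2_to_Ql l = ?k"
    unfolding F2_to_Ql_def
  proof (rule cont_hom_eq)
    show "topspace (pro_topology l F2) = carrier (Pro l F2)" by (rule P.topspace_pro)
    show "pro_incl l F2 \<in> hom F2 (Pro l F2)" by (rule P.pro_incl_hom)
    show "c \<in> pro_topology l F2 closure_of pro_incl l F2 ` carrier F2" if "c \<in> carrier (Pro l F2)" for c
      by (rule P.pro_incl_dense[OF that])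
    have "Hausdorff_space (Ql_topology l)" unfolding Ql_topology_def
      by (rule Metric_space.Hausdorff_space_mtopology[OF Metric_space_Ql])
    then show "Hausdorff_space (F2_Ql_topology l)"
      unfolding F2_Ql_topology_def by (intro Hausdorff_space_subtopology) (simp add: Hausdorff_space_product_topology)
    \<comment> \<open>The image of the unit is idempotent, so left cancellation identifies it with
      the unit series. This also shows that the unit series is group-like.\<close>
    have one: "sl (\<one>\<^bsub>Pro l F2\<^esub>) = \<one>\<^bsub>ncps (Ql l)\<^esub>"
    proof -
      have "sl \<one>\<^bsub>Pro l F2\<^esub> \<otimes>\<^bsub>ncps (Ql l)\<^esub> sl \<one>\<^bsub>Pro l F2\<^esub> = sl \<one>\<^bsub>Pro l F2\<^esub>"
        using sl_mult[of "\<one>\<^bsub>Pro l F2\<^esub>" "\<one>\<^bsub>Pro l F2\<^esub>"] by simp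
      also have "\<dots> = sl \<one>\<^bsub>Pro l F2\<^esub> \<otimes>\<^bsub>ncps (Ql l)\<^esub> \<one>\<^bsub>ncps (Ql l)\<^esub>"
        by (rule A.nc_r_one[symmetric]) (simp add: ncps_def sl_closed)
      finally have eq: "sl \<one>\<^bsub>Pro l F2\<^esub> \<otimes>\<^bsub>ncps (Ql l)\<^esub> sl \<one>\<^bsub>Pro l F2\<^esub>
        = sl \<one>\<^bsub>Pro l F2\<^esub> \<otimes>\<^bsub>ncps (Ql l)\<^esub> \<one>\<^bsub>ncps (Ql l)\<^esub>" .
      show ?thesis
        by (rule A.nc_cancel[OF _ _ _ _ eq]) (use sl_points[OF C.one_closed] in \<open>simp_all add: F2_points_def ncps_def\<close>)
    qed
    show "\<one>\<^bsub>ncps (Ql l)\<^esub> \<in> carrier (F2_points (Ql l))" using sl_points[OF C.one_closed] one by simp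
    show "e \<otimes>\<^bsub>F2_points (Ql l)\<^esub> \<one>\<^bsub>ncps (Ql l)\<^esub> = e" if "e \<in> carrier (F2_points (Ql l))" for e
      using A.nc_r_one[of e] that by (simp add: F2_points_def)
    show "b = c" if "a \<in> carrier (F2_points (Ql l))" "b \<in> carrier (F2_points (Ql l))" "c \<in> carrier (F2_points (Ql l))"
      "a \<otimes>\<^bsub>F2_points (Ql l)\<^esub> b = a \<otimes>\<^bsub>F2_points (Ql l)\<^esub> c" for a b c
      using that by (intro A.nc_cancel[of a b c]) (auto simp: F2_points_def)
    show "?k \<in> hom (Pro l F2) (F2_points (Ql l))"
    proof (rule homI)
      fix x assume x: "x \<in> carrier (Pro l F2)"
      then show "?k x \<in> carrier (F2_points (Ql l))" by (simp add: sl_points)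
      fix y assume y: "y \<in> carrier (Pro l F2)"
      have "x \<otimes>\<^bsub>Pro l F2\<^esub> y \<in> carrier (Pro l F2)" by (rule C.m_closed[OF x y])
      then show "?k (x \<otimes>\<^bsub>Pro l F2\<^esub> y) = ?k x \<otimes>\<^bsub>F2_points (Ql l)\<^esub> ?k y"
        using x y sl_mult[OF x y] by (simp add: F2_points_def)
    qed
    show "?k \<in> extensional (carrier (Pro l F2))" by simp
    show "continuous_map (pro_topology l F2) (F2_Ql_topology l) ?k"
      by (rule continuous_map_eq[OF sl_continuous]) (simp add: P.topspace_pro)
    show "?k (pro_incl l F2 F2_x) = nc_exp (Ql l) (nc_var (Ql l) LX)" "?k (pro_incl l F2 F2_y) = nc_exp (Ql l) (nc_var (Ql l) LY)"
      using gx by (simp_all add: nc_exp_var sl_incl ser_gen fun_eq_iff)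
  qed
  then show ?thesis using c by simp
qed

end

section \<open>The product of the fields \<open>\<^term>\<open>Qlbar l\<close>\<close>\<close>

context padic
begin

sublocale B: algebraically_closed "Qlbar l"
proof -
  interpret C: algebraic_closure "Qlbar l" "ring.indexed_const (Ql l) ` carrier (Ql l)"
    unfolding Qlbar_def by (rule Q.alg_closureE(1))
  show "algebraically_closed (Qlbar l)" by unfold_locales
qed

lemma Ql_embed_hom: "Ql_embed l \<in> ring_hom (Ql l) (Qlbar l)"
  unfolding Qlbar_def Ql_embed_def by (rule Q.alg_closureE(2))

lemma Qlbar_sqrt:
  assumes a: "a \<in> carrier (Qlbar l)"
  shows "\<exists>x\<in>carrier (Qlbar l). x \<otimes>\<^bsub>Qlbar l\<^esub> x = a"
proof -
  \<comment> \<open>The polynomial T^2 - a, with coefficients listed from the leading one. Over an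
    algebraically closed field it has two roots counted with multiplicity.\<close>
  define p where "p = [\<one>\<^bsub>Qlbar l\<^esub>, \<zero>\<^bsub>Qlbar l\<^esub>, \<ominus>\<^bsub>Qlbar l\<^esub> a]"
  have p: "p \<in> carrier (poly_ring (Qlbar l))"
    using a by (simp add: p_def univ_poly_def polynomial_def)
  have "size (B.roots p) = 2" using B.roots_over_carrier[OF p] by (simp add: B.splitted_def p_def)
  then obtain x where "x \<in># B.roots p" by (metis multiset_nonemptyE size_empty zero_neq_numeral)
  then have "B.is_root p x" using B.roots_mem_iff_is_root[OF p] by simp
  then have x: "x \<in> carrier (Qlbar l)" "B.eval p x = \<zero>\<^bsub>Qlbar l\<^esub>" by (auto simp: B.is_root_def)
  then have "x \<otimes>\<^bsub>Qlbar l\<^esub> x \<ominus>\<^bsub>Qlbar l\<^esub> a = \<zero>\<^bsub>Qlbar l\<^esub>"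
    using a by (simp add: p_def numeral_2_eq_2 a_minus_def)
  then show ?thesis using x(1) a by (intro bexI[of _ x]) simp_all
qed

end

lemma padicI: "l \<in> primes \<Longrightarrow> padic l" by (simp add: padic_def)

lemma Qlbar_field: "l \<in> primes \<Longrightarrow> Ring.field (Qlbar l)"
proof -
  assume "l \<in> primes"
  then interpret padic l by (rule padicI)
  show ?thesis by (rule B.field_axioms)
qed

text \<open>All primes in one commutative ring, which has zero divisors but is a Q-algebra. The
  hexagon for all primes becomes one matrix equation over it, and the matrix calculus runs only
  once.\<close>

typedef kk = "\<Pi>\<^sub>E l\<in>primes. carrier (Qlbar l)"
proof
  have "\<zero>\<^bsub>Qlbar l\<^esub> \<in> carrier (Qlbar l)" if "l \<in> primes" for l
  proof -
    interpret Ring.field "Qlbar l" by (rule Qlbar_field[OF that])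
    show ?thesis by simp
  qed
  then show "(\<lambda>l\<in>primes. \<zero>\<^bsub>Qlbar l\<^esub>) \<in> (\<Pi>\<^sub>E l\<in>primes. carrier (Qlbar l))" by simp
qed

lemma Rep_kk_carrier: "l \<in> primes \<Longrightarrow> Rep_kk x l \<in> carrier (Qlbar l)"
  using Rep_kk[of x] by (auto simp: PiE_iff)

lemma kk_eqI: "(\<And>l. l \<in> primes \<Longrightarrow> Rep_kk x l = Rep_kk y l) \<Longrightarrow> x = y"
  using Rep_kk[of x] Rep_kk[of y] by (intro Rep_kk_inject[THEN iffD1] PiE_ext) auto

lemma Rep_Abs_kk: "(\<And>l. l \<in> primes \<Longrightarrow> f l \<in> carrier (Qlbar l)) \<Longrightarrow> l \<in> primes \<Longrightarrow> Rep_kk (Abs_kk (\<lambda>l\<in>primes. f l)) l = f l"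
  by (subst Abs_kk_inverse) auto

instantiation kk :: qalg
begin

definition "0 = Abs_kk (\<lambda>l\<in>primes. \<zero>\<^bsub>Qlbar l\<^esub>)"
definition "1 = Abs_kk (\<lambda>l\<in>primes. \<one>\<^bsub>Qlbar l\<^esub>)"
definition "x + y = Abs_kk (\<lambda>l\<in>primes. Rep_kk x l \<oplus>\<^bsub>Qlbar l\<^esub> Rep_kk y l)"
definition "x * y = Abs_kk (\<lambda>l\<in>primes. Rep_kk x l \<otimes>\<^bsub>Qlbar l\<^esub> Rep_kk y l)"
definition "- x = Abs_kk (\<lambda>l\<in>primes. \<ominus>\<^bsub>Qlbar l\<^esub> Rep_kk x l)"
definition "x - y = Abs_kk (\<lambda>l\<in>primes. Rep_kk x l \<ominus>\<^bsub>Qlbar l\<^esub> Rep_kk y l)"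
definition "qi q = Abs_kk (\<lambda>l\<in>primes. Ql_embed l (padic.\<iota> l q))"

lemma Rep_kk_ops:
  assumes lp: "l \<in> primes"
  shows "Rep_kk 0 l = \<zero>\<^bsub>Qlbar l\<^esub>" (is ?P) "Rep_kk 1 l = \<one>\<^bsub>Qlbar l\<^esub>" (is ?Q)
    "Rep_kk (x + y) l = Rep_kk x l \<oplus>\<^bsub>Qlbar l\<^esub> Rep_kk y l" (is ?R)
    "Rep_kk (x * y) l = Rep_kk x l \<otimes>\<^bsub>Qlbar l\<^esub> Rep_kk y l" (is ?S)
    "Rep_kk (- x) l = \<ominus>\<^bsub>Qlbar l\<^esub> Rep_kk x l" (is ?T)
    "Rep_kk (x - y) l = Rep_kk x l \<ominus>\<^bsub>Qlbar l\<^esub> Rep_kk y l" (is ?U)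
    "Rep_kk (qi q) l = Ql_embed l (padic.\<iota> l q)" (is ?V)
proof -
  have c: "\<zero>\<^bsub>Qlbar l\<^esub> \<in> carrier (Qlbar l) \<and> \<one>\<^bsub>Qlbar l\<^esub> \<in> carrier (Qlbar l) \<and>
    Rep_kk x l \<oplus>\<^bsub>Qlbar l\<^esub> Rep_kk y l \<in> carrier (Qlbar l) \<and> Rep_kk x l \<otimes>\<^bsub>Qlbar l\<^esub> Rep_kk y l \<in> carrier (Qlbar l) \<and>
    \<ominus>\<^bsub>Qlbar l\<^esub> Rep_kk x l \<in> carrier (Qlbar l) \<and> Rep_kk x l \<ominus>\<^bsub>Qlbar l\<^esub> Rep_kk y l \<in> carrier (Qlbar l) \<and>
    Ql_embed l (padic.\<iota> l q) \<in> carrier (Qlbar l)" if lp: "l \<in> primes" for l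
  proof -
    interpret padic l by (rule padicI[OF lp])
    show ?thesis
      using Rep_kk_carrier[OF lp, of x] Rep_kk_carrier[OF lp, of y] ring_hom_closed[OF Ql_embed_hom \<iota>_hom(1)] by simp
  qed
  show ?P ?Q
    ?R
    ?S
    ?T
    ?U
    ?V
    unfolding zero_kk_def one_kk_def plus_kk_def times_kk_def uminus_kk_def minus_kk_def qi_kk_def
    using lp by (simp_all only: Rep_Abs_kk c)
qed

instance
proof
  fix a b c :: kk and p q :: rat
  have 1: "Rep_kk (a + b + c) l = Rep_kk (a + (b + c)) l \<and> Rep_kk (a + b) l = Rep_kk (b + a) l \<and> Rep_kk (0 + a) l = Rep_kk a l
    \<and> Rep_kk (- a + a) l = Rep_kk 0 l \<and> Rep_kk (a - b) l = Rep_kk (a + - b) l \<and> Rep_kk (a * b * c) l = Rep_kk (a * (b * c)) l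
    \<and> Rep_kk (a * b) l = Rep_kk (b * a) l \<and> Rep_kk (1 * a) l = Rep_kk a l \<and> Rep_kk ((a + b) * c) l = Rep_kk (a * c + b * c) l
    \<and> Rep_kk (qi (p + q)) l = Rep_kk (qi p + qi q) l \<and> Rep_kk (qi (p * q)) l = Rep_kk (qi p * qi q) l \<and> Rep_kk (qi 1) l = Rep_kk 1 l
    \<and> Rep_kk 0 l \<noteq> Rep_kk 1 l" if lp: "l \<in> primes" for l
  proof -
    interpret padic l by (rule padicI[OF lp])
    note r = Rep_kk_carrier[OF lp]
    show ?thesis
      using r[of a] r[of b] r[of c]
      by (simp add: Rep_kk_ops[OF lp] B.a_ac B.m_ac B.r_neg B.r_distr a_minus_def \<iota>_hom
          ring_hom_add[OF Ql_embed_hom] ring_hom_mult[OF Ql_embed_hom] ring_hom_one[OF Ql_embed_hom])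
  qed
  show "a + b + c = a + (b + c)" "a + b = b + a" "0 + a = a" "- a + a = 0" "a - b = a + - b" "a * b * c = a * (b * c)"
    "a * b = b * a" "1 * a = a" "(a + b) * c = a * c + b * c" "qi (p + q) = (qi p + qi q :: kk)" "qi (p * q) = (qi p * qi q :: kk)"
    "qi 1 = (1 :: kk)"
    using 1 by (blast intro: kk_eqI)+
  have "(2 :: nat) \<in> primes" using two_is_prime_nat by simp
  then show "(0 :: kk) \<noteq> 1" using 1 by metis
qed

end

context padic
begin

sublocale K: alg_to_field "Qlbar l" "\<lambda>x. Rep_kk x l"
  using l by unfold_locales (simp_all add: Rep_kk_carrier Rep_kk_ops)

end

section \<open>Limits along an element of the pro-nilpotent completion\<close>

text \<open>Convergence at every prime separately, along the words close to the component f_l.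
  Limits are taken in \<open>Ql l\<close>, where the metric lives, and only then embedded in the
  algebraic closure.\<close>

definition klim :: "(nat \<Rightarrow> letter gword set set \<Rightarrow> letter gword set set) \<Rightarrow> (letter gword set \<Rightarrow> rat) \<Rightarrow> kk \<Rightarrow> bool" where
  "klim f \<phi> a \<longleftrightarrow> (\<forall>l\<in>primes. \<exists>b. Rep_kk a l = Ql_embed l b \<and> padic.plim l \<phi> (pro_group.cf F2 l (f l)) b)"

lemma klimD: "klim f \<phi> a \<Longrightarrow> l \<in> primes \<Longrightarrow>
    \<exists>b. Rep_kk a l = Ql_embed l b \<and> padic.plim l \<phi> (pro_group.cf F2 l (f l)) b"
  by (simp add: klim_def)

definition kser :: "(nat \<Rightarrow> letter gword set set \<Rightarrow> letter gword set set) \<Rightarrow> letter list \<Rightarrow> kk" where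
  "kser f w = Abs_kk (\<lambda>l\<in>primes. Ql_embed l (F2_to_Ql l (f l) w))"

lemma Rep_kser:
  assumes f: "f \<in> carrier F2nil" and lp: "l \<in> primes"
  shows "Rep_kk (kser f w) l = Ql_embed l (F2_to_Ql l (f l) w)"
  unfolding kser_def
proof (rule Rep_Abs_kk[OF _ lp])
  fix l :: nat assume lp: "l \<in> primes"
  interpret padic l by (rule padicI[OF lp])
  have "f l \<in> carrier (Pro l F2)" using f lp by (simp add: nil_carrier)
  then show "Ql_embed l (F2_to_Ql l (f l) w) \<in> carrier (Qlbar l)"
    by (simp add: F2_to_Ql_sl sl_closed ring_hom_closed[OF Ql_embed_hom])
qed

lemma klim_unique:
  assumes f: "f \<in> carrier F2nil" and k: "klim f \<phi> a" "klim f \<phi> b"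
  shows "a = b"
proof (rule kk_eqI)
  fix l :: nat assume lp: "l \<in> primes"
  interpret padic l by (rule padicI[OF lp])
  have c: "f l \<in> carrier (Pro l F2)" using f lp by (simp add: nil_carrier)
  obtain a' where a: "Rep_kk a l = Ql_embed l a'" "plim \<phi> (P.cf (f l)) a'" using klimD[OF k(1) lp] by auto
  obtain b' where b: "Rep_kk b l = Ql_embed l b'" "plim \<phi> (P.cf (f l)) b'" using klimD[OF k(2) lp] by auto
  show "Rep_kk a l = Rep_kk b l"
    using plim_unique[OF a(2) b(2) P.cf_not_bot[OF c]] a(1) b(1) by simp
qed

lemma ratlim_klim:
  assumes f: "f \<in> carrier F2nil"
  shows "ratlim (klim f) (kser f)"
proof
  have c: "f l \<in> carrier (Pro l F2)" if "l \<in> primes" for l using f that by (simp add: nil_carrier)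
  show "klim f (\<lambda>_. q) (qi q)" for q
    unfolding klim_def using padic.plim_const[OF padicI] Rep_kk_ops(7) by blast
  show "klim f (\<lambda>g. \<phi> g + \<psi> g) (a + b)" if "klim f \<phi> a" "klim f \<psi> b" for \<phi> \<psi> a b
    unfolding klim_def
  proof
    fix l :: nat assume lp: "l \<in> primes"
    interpret padic l by (rule padicI[OF lp])
    obtain a' b' where ab: "Rep_kk a l = Ql_embed l a'" "plim \<phi> (P.cf (f l)) a'" "Rep_kk b l = Ql_embed l b'" "plim \<psi> (P.cf (f l)) b'"
      using klimD[OF \<open>klim f \<phi> a\<close> lp] klimD[OF \<open>klim f \<psi> b\<close> lp] by (elim exE conjE) rule
    show "\<exists>x. Rep_kk (a + b) l = Ql_embed l x \<and> plim (\<lambda>g. \<phi> g + \<psi> g) (P.cf (f l)) x"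
      using plim_add[OF ab(2,4)] ring_hom_add[OF Ql_embed_hom plim_carrier[OF ab(2)] plim_carrier[OF ab(4)]] ab(1,3)
      by (intro exI[of _ "a' \<oplus>\<^bsub>Ql l\<^esub> b'"]) (simp add: Rep_kk_ops[OF lp])
  qed
  show "klim f (\<lambda>g. \<phi> g * \<psi> g) (a * b)" if "klim f \<phi> a" "klim f \<psi> b" for \<phi> \<psi> a b
    unfolding klim_def
  proof
    fix l :: nat assume lp: "l \<in> primes"
    interpret padic l by (rule padicI[OF lp])
    obtain a' b' where ab: "Rep_kk a l = Ql_embed l a'" "plim \<phi> (P.cf (f l)) a'" "Rep_kk b l = Ql_embed l b'" "plim \<psi> (P.cf (f l)) b'"
      using klimD[OF \<open>klim f \<phi> a\<close> lp] klimD[OF \<open>klim f \<psi> b\<close> lp] by (elim exE conjE) rule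
    show "\<exists>x. Rep_kk (a * b) l = Ql_embed l x \<and> plim (\<lambda>g. \<phi> g * \<psi> g) (P.cf (f l)) x"
      using plim_mult[OF ab(2,4)] ring_hom_mult[OF Ql_embed_hom plim_carrier[OF ab(2)] plim_carrier[OF ab(4)]] ab(1,3)
      by (intro exI[of _ "a' \<otimes>\<^bsub>Ql l\<^esub> b'"]) (simp add: Rep_kk_ops[OF lp])
  qed
  show "klim f \<phi> a \<Longrightarrow> klim f \<phi> b \<Longrightarrow> a = b" for \<phi> a b by (rule klim_unique[OF f])
  show "klim f \<psi> a" if e: "\<And>g. g \<in> carrier F2 \<Longrightarrow> \<phi> g = \<psi> g" and "klim f \<phi> a" for \<phi> \<psi> a
    unfolding klim_def
  proof
    fix l :: nat assume lp: "l \<in> primes"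
    interpret padic l by (rule padicI[OF lp])
    have "eventually (\<lambda>g. \<phi> g = \<psi> g) (P.cf (f l))"
      by (rule eventually_mono[OF eventually_F2[OF c[OF lp]]]) (rule e)
    from plim_cong[OF this] show "\<exists>x. Rep_kk a l = Ql_embed l x \<and> plim \<psi> (P.cf (f l)) x"
      using \<open>klim f \<phi> a\<close> lp unfolding klim_def by blast
  qed
  show "klim f (\<lambda>g. ser g w) (kser f w)" for w
    unfolding klim_def
  proof
    fix l :: nat assume lp: "l \<in> primes"
    interpret padic l by (rule padicI[OF lp])
    show "\<exists>x. Rep_kk (kser f w) l = Ql_embed l x \<and> plim (\<lambda>g. ser g w) (P.cf (f l)) x"
      using plim_sl[OF c[OF lp]] Rep_kser[OF f lp] F2_to_Ql_sl[OF c[OF lp]] by auto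
  qed
qed

section \<open>Pure braids on four strings as classes of words\<close>

abbreviation L4 :: "nat gword set" where "L4 \<equiv> lists ({1..<4} \<times> UNIV)"
abbreviation bw :: "nat gword \<Rightarrow> nat gword set" where "bw \<equiv> cls {1..<4} (braid_rels 4)"

lemma B4_presented: "braid_group 4 = presented_group {1..<4} (braid_rels 4)"
  by (simp add: braid_group_def)

lemma group_B4: "Group.group (braid_group 4)"
  unfolding B4_presented by (rule group_presented)

lemma gword_perm_simps [simp]:
  "gword_perm [] = id" "gword_perm ((i, b) # w) = tsp i (i + 1) \<circ> gword_perm w"
  by (simp_all add: gword_perm_def)

lemma gword_perm_append: "gword_perm (u @ v) = gword_perm u \<circ> gword_perm v"
  by (induction u) (auto simp: o_assoc)

lemma gword_perm_permutes: "w \<in> L4 \<Longrightarrow> gword_perm w permutes {1..4}"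
proof (induction w)
  case (Cons a w)
  obtain i b where a: "a = (i, b)" by force
  have i: "i \<in> {1..4}" "i + 1 \<in> {1..4}" using Cons.prems a by auto
  show ?case
    unfolding a gword_perm_simps by (rule permutes_compose[OF Cons.IH permutes_swap_id[OF i]]) (use Cons.prems in simp)
qed (simp add: permutes_id)

lemma gword_perm_pres_eq: "pres_eq {1..<4} (braid_rels 4) u v \<Longrightarrow> gword_perm u = gword_perm v"
proof (induction rule: pres_eq.induct)
  case (pres_rel u v)
  then show ?case
    by (auto simp: braid_rels_def fun_eq_iff Transposition.transpose_def)
qed (auto simp: gword_perm_append fun_eq_iff)

lemma braid_rels_4:
  assumes "(u, v) \<in> braid_rels 4"
  shows "u = [(1, True), (3, True)] \<and> v = [(3, True), (1, True)] \<or>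
    u = [(1, True), (2, True), (1, True)] \<and> v = [(2, True), (1, True), (2, True)] \<or>
    u = [(2, True), (3, True), (2, True)] \<and> v = [(3, True), (2, True), (3, True)]"
proof -
  consider i j where "1 \<le> i" "i + 2 \<le> j" "j < 4" "u = [(i, True), (j, True)]" "v = [(j, True), (i, True)]"
    | i where "1 \<le> i" "i + 1 < 4" "u = [(i, True), (i + 1, True), (i, True)]" "v = [(i + 1, True), (i, True), (i + 1, True)]"
    using assms by (auto simp: braid_rels_def)
  then show ?thesis
  proof cases
    case 1
    then have "i = 1 \<and> j = 3" by arith
    then show ?thesis using 1 by simp
  next
    case 2
    then have "i = 1 \<or> i = 2" by arith
    then show ?thesis using 2 by auto
  qed
qed

lemma braid_perm_bw: "w \<in> L4 \<Longrightarrow> braid_perm (bw w) = gword_perm w"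
proof -
  assume w: "w \<in> L4"
  have "gword_perm ` bw w = {gword_perm w}"
    using cls_self[OF w] gword_perm_pres_eq by (fastforce simp: cls_def)
  then show ?thesis by (simp add: braid_perm_def)
qed

lemma braid_perm_hom: "braid_perm \<in> hom (braid_group 4) (sym_group 4)"
  by (rule homI)
     (auto simp: B4_presented carrier_presented mult_cls braid_perm_bw sym_group_carrier sym_group_mult
        gword_perm_append gword_perm_permutes)

lemma group_hom_braid_perm: "group_hom (braid_group 4) (sym_group 4) braid_perm"
  using group_B4 braid_perm_hom sym_group_is_group by (simp add: group_hom_def group_hom_axioms_def)

lemma group_K4: "Group.group K4"
  unfolding pure_braid_group_def
  by (rule group.subgroup_imp_group[OF group_B4 group_hom.subgroup_kernel[OF group_hom_braid_perm]])

lemma K4_simps: "\<one>\<^bsub>K4\<^esub> = \<one>\<^bsub>braid_group 4\<^esub>" "monoid.mult K4 = monoid.mult (braid_group 4)"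
  by (simp_all add: pure_braid_group_def)

lemma K4_carrier: "A \<in> carrier K4 \<longleftrightarrow> (\<exists>w\<in>L4. A = bw w \<and> gword_perm w = id)"
proof -
  have "A \<in> carrier K4 \<longleftrightarrow> A \<in> carrier (braid_group 4) \<and> braid_perm A = id"
    by (simp add: pure_braid_group_def kernel_def sym_group_one)
  then show ?thesis by (auto simp: B4_presented carrier_presented braid_perm_bw)
qed

lemma K4_B4: "A \<in> carrier K4 \<Longrightarrow> A \<in> carrier (braid_group 4)"
  by (simp add: pure_braid_group_def kernel_def)

lemma braid_ops:
  "\<one>\<^bsub>braid_group 4\<^esub> = bw []" "i \<in> {1..<4} \<Longrightarrow> braid_sigma 4 i = bw [(i, True)]"
  "u \<in> L4 \<Longrightarrow> v \<in> L4 \<Longrightarrow> bw u \<otimes>\<^bsub>braid_group 4\<^esub> bw v = bw (u @ v)"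
  "u \<in> L4 \<Longrightarrow> inv\<^bsub>braid_group 4\<^esub> (bw u) = bw (winv u)"
  by (simp_all add: B4_presented one_presented braid_sigma_def pres_gen_cls mult_cls inv_cls)

lemma bw_square: "u \<in> L4 \<Longrightarrow> bw u [^]\<^bsub>braid_group 4\<^esub> (2::nat) = bw (u @ u)"
proof -
  interpret B: Group.group "braid_group 4" by (rule group_B4)
  assume u: "u \<in> L4"
  then have "bw u \<in> carrier (braid_group 4)" by (simp add: B4_presented cls_in_carrier)
  then show ?thesis using u by (simp add: numeral_2_eq_2 braid_ops(3))
qed

abbreviation xg :: "nat \<Rightarrow> nat \<Rightarrow> nat gword set" where "xg \<equiv> pure_braid_gen 4"

lemma pure_braid_gen_word:
  "xg 1 2 = bw [(1, True), (1, True)]"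
  "xg 2 3 = bw [(2, True), (2, True)]"
  "xg 3 4 = bw [(3, True), (3, True)]"
  "xg 1 3 = bw [(2, True), (1, True), (1, True), (2, False)]"
  "xg 2 4 = bw [(3, True), (2, True), (2, True), (3, False)]"
  by (simp_all add: pure_braid_gen_def Let_def braid_ops bw_square upt_rec winv_def)

lemma pure_braid_gen_K4:
  "xg 1 2 \<in> carrier K4" "xg 2 3 \<in> carrier K4" "xg 3 4 \<in> carrier K4"
  "xg 1 3 \<in> carrier K4" "xg 2 4 \<in> carrier K4"
proof -
  have K: "bw w \<in> carrier K4" if "w \<in> L4" "gword_perm w = id" for w
    using that by (auto simp: K4_carrier)
  show "xg 1 2 \<in> carrier K4" "xg 2 3 \<in> carrier K4" "xg 3 4 \<in> carrier K4"
    "xg 1 3 \<in> carrier K4" "xg 2 4 \<in> carrier K4"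
    unfolding pure_braid_gen_word by (rule K; auto simp: fun_eq_iff Transposition.transpose_def)+
qed

section \<open>The Artin representation of the braid group\<close>

text \<open>Matrices of braids have no denominators at all, so their scaling constant in the
  congruence estimates is 1. Inverses stay integral because the inverse of 1 + letter is a geometric
  series.\<close>

definition intm :: "('i::finite, rat) tmat \<Rightarrow> bool" where "intm A \<longleftrightarrow> (\<forall>u v. imult 1 (ent A u v))"

lemma imult_one [simp]: "imult 1 1" by (auto simp: imult_def intro: exI[of _ 1])

lemma intm_ops:
  "intm 1" "intm A \<Longrightarrow> intm B \<Longrightarrow> intm (A + B)" "intm A \<Longrightarrow> intm B \<Longrightarrow> intm (A - B)"
  "intm A \<Longrightarrow> intm B \<Longrightarrow> intm (A * B)" "intm (Toep i)"
  by (auto simp: intm_def ent_1 ent_mult_self ent_Toep imult_add intro!: imult_sum imult_mult(1)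
      imult_add[of 1 _ "- _", simplified] imult_minus)

lemma intm_icong: "intm A \<Longrightarrow> icong 1 n 1 n A"
  by (simp add: intm_def icong_def sce_def)

lemma intm_ui_Yt: "intm (ui (Yt b))"
  unfolding intm_def
proof (intro allI)
  fix u v :: "'a list"
  show "imult 1 (ent (ui (Yt b)) u v)"
  proof (induction u)
    case Nil
    then show ?case using Fil1_ui[OF Yt_Fil, of b] by (simp add: ent_unip)
  next
    case (Cons a u)
    have "ui (Yt b) = 1 - Toep b * ui (Yt b)" using Yt_inv(1)[of b] by (simp add: Yt_def algebra_simps eq_diff_eq)
    then have "ent (ui (Yt b)) (a # u) v = ent 1 (a # u) v - ent (Toep b * ui (Yt b)) (a # u) v"
      by (metis ent_diff)
    also have "imult 1 \<dots>" using imult_add[of 1 _ "- _", simplified] Cons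
      by (auto simp: ent_Toep_mult ent_1 imult_minus imult_add[of 1 1 "- _", simplified])
    finally show ?case .
  qed
qed

lemma intm_Msub: assumes S: "\<And>i. intm (S i)" shows "intm (Msub S)"
proof -
  have "imult 1 (msub S v u)" for u v
    by (induction v arbitrary: u) (use S in \<open>auto simp: intm_def intro!: imult_sum imult_mult(1)\<close>)
  then show ?thesis by (auto simp: intm_def Msub.rep_eq)
qed

lemma intm_Ms: "intm (Ms a b)" "intm (Ms' a b)"
proof -
  have Y: "intm (Yt i)" for i :: 'a unfolding Yt_def by (intro intm_ops)
  show "intm (Ms a b)" "intm (Ms' a b)"
    unfolding Ms_def Ms'_def by (rule intm_Msub; auto simp: Ssub_def Ssub'_def intro!: intm_ops intm_ui_Yt Y)+
qed

definition rgen :: "nat \<Rightarrow> bmat" where "rgen i = (if i = 1 then g1 else if i = 2 then g2 else g3)"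
definition rgen' :: "nat \<Rightarrow> bmat" where "rgen' i = (if i = 1 then g1' else if i = 2 then g2' else g3')"

lemma rgen_inv: "rgen i * rgen' i = 1" "rgen' i * rgen i = 1"
  by (simp_all add: rgen_def rgen'_def g1_def g2_def g3_def g1'_def g2'_def g3'_def)

lemma inv_rgen [simp]: "inv\<^bsub>Ugr\<^esub> (rgen i) = rgen' i" by (rule Ugr_inv[OF rgen_inv])

lemma rgen_unit: "rgen i \<in> carrier Ugr" using rgen_inv by auto

interpretation artin: pres_hom "{1..<4}" "braid_rels 4" Ugr rgen
proof -
  interpret U: Group.group Ugr by (rule group_Ugr)
  show "pres_hom {1..<4} (braid_rels 4) Ugr rgen"
  proof
    show "rgen \<in> {1..<4} \<rightarrow> carrier Ugr" using rgen_unit by blast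
    fix u v assume "(u, v) \<in> braid_rels 4"
    then consider "u = [(1, True), (3, True)]" "v = [(3, True), (1, True)]"
      | "u = [(1, True), (2, True), (1, True)]" "v = [(2, True), (1, True), (2, True)]"
      | "u = [(2, True), (3, True), (2, True)]" "v = [(3, True), (2, True), (3, True)]"
      using braid_rels_4 by blast
    then show "gev Ugr rgen u = gev Ugr rgen v"
    proof cases
      case 1
      then show ?thesis using Ms_commute[of S1 S2 S3 S4] by (simp add: rgen_def g1_def g3_def)
    next
      case 2
      then show ?thesis using Ms_braid[of S1 S2 S3] by (simp add: rgen_def g1_def g2_def mult.assoc)
    next
      case 3
      then show ?thesis using Ms_braid[of S2 S3 S4] by (simp add: rgen_def g2_def g3_def mult.assoc)
    qed
  qed
qed

definition artin :: "nat gword set \<Rightarrow> bmat" where "artin = plift Ugr rgen"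

lemma artin_bw: "w \<in> L4 \<Longrightarrow> artin (bw w) = gev Ugr rgen w"
  unfolding artin_def by (rule artin.plift_cls)

lemma artin_hom: "artin \<in> hom K4 Ugr"
  using artin.plift_hom K4_B4 unfolding artin_def hom_def K4_simps B4_presented[symmetric] by blast

primrec strand_no :: "strand \<Rightarrow> nat" where
  "strand_no S1 = 1" | "strand_no S2 = 2" | "strand_no S3 = 3" | "strand_no S4 = 4"

lemma strand_no_iff [simp]:
  "strand_no s = 1 \<longleftrightarrow> s = S1" "strand_no s = 2 \<longleftrightarrow> s = S2" "strand_no s = 3 \<longleftrightarrow> s = S3" "strand_no s = 4 \<longleftrightarrow> s = S4"
  by (cases s; simp)+

lemma deg0_gev:
  assumes "w \<in> L4"
  shows "\<exists>\<pi>. deg0 (gev Ugr rgen w) \<pi> \<and> (\<forall>s. strand_no (\<pi> s) = gword_perm w (strand_no s))"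
  using assms
proof (induction w)
  case Nil
  show ?case
  proof (intro exI conjI)
    show "deg0 (gev Ugr rgen []) id" unfolding gev_simps Ugr_simps by (rule deg0_1)
  qed simp
next
  case (Cons a w)
  obtain i b where a: "a = (i, b)" by force
  have i: "i \<in> {1..<4}" and w: "w \<in> L4" using Cons.hyps unfolding a by auto
  obtain \<pi> where \<pi>: "deg0 (gev Ugr rgen w) \<pi>" "\<And>s. strand_no (\<pi> s) = gword_perm w (strand_no s)" using Cons.IH by blast
  have "i = 1 \<or> i = 2 \<or> i = 3" using i by auto
  then have "\<exists>\<tau>. deg0 (if b then rgen i else rgen' i) \<tau> \<and> (\<forall>s. strand_no (\<tau> s) = tsp i (i + 1) (strand_no s))"
  proof (elim disjE)
    assume i: "i = 1"
    show ?thesis using deg0_Ms[of S1 S2] unfolding i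
      by (intro exI[of _ "tsp S1 S2"]) (auto simp: rgen_def rgen'_def g1_def g1'_def Transposition.transpose_def split: strand.splits)
  next
    assume i: "i = 2"
    show ?thesis using deg0_Ms[of S2 S3] unfolding i
      by (intro exI[of _ "tsp S2 S3"]) (auto simp: rgen_def rgen'_def g2_def g2'_def Transposition.transpose_def split: strand.splits)
  next
    assume i: "i = 3"
    show ?thesis using deg0_Ms[of S3 S4] unfolding i
      by (intro exI[of _ "tsp S3 S4"]) (auto simp: rgen_def rgen'_def g3_def g3'_def Transposition.transpose_def split: strand.splits)
  qed
  then obtain \<tau> where "deg0 (if b then rgen i else rgen' i) \<tau>" "\<And>s. strand_no (\<tau> s) = tsp i (i + 1) (strand_no s)" by blast
  note \<tau> = this
  show ?case
  proof (intro exI conjI)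
    have "gev Ugr rgen (a # w) = (if b then rgen i else rgen' i) * gev Ugr rgen w" by (simp add: a)
    then show "deg0 (gev Ugr rgen (a # w)) (\<tau> \<circ> \<pi>)" using deg0_mult[OF \<tau>(1) \<pi>(1)] by (simp only:)
    show "\<forall>s. strand_no ((\<tau> \<circ> \<pi>) s) = gword_perm (a # w) (strand_no s)" using \<tau>(2) \<pi>(2) by (simp add: a)
  qed
qed

text \<open>The degree-preserving part of the matrix is the permutation of the braid, which is
  trivial for a pure braid.\<close>

lemma artin_unip: assumes "A \<in> carrier K4" shows "unip (artin A)"
proof -
  obtain w where w: "w \<in> L4" "A = bw w" "gword_perm w = id" using assms K4_carrier by blast
  obtain \<pi> where \<pi>: "deg0 (gev Ugr rgen w) \<pi>" "\<And>s. strand_no (\<pi> s) = strand_no s" using deg0_gev[OF w(1)] w(3) by auto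
  have "\<pi> s = s" for s using \<pi>(2)[of s] by (cases "\<pi> s"; cases s) simp_all
  then have "\<pi> = id" by auto
  then show ?thesis using \<pi>(1) w by (simp add: artin_bw deg0_id)
qed

lemma intm_artin: assumes "A \<in> carrier K4" shows "intm (artin A)"
proof -
  obtain w where w: "w \<in> L4" "A = bw w" using assms K4_carrier by blast
  have "intm (rgen i)" "intm (rgen' i)" for i
    by (simp_all add: rgen_def rgen'_def g1_def g2_def g3_def g1'_def g2'_def g3'_def intm_Ms)
  then have "intm (gev Ugr rgen w)"
  proof (induction w)
    case Nil
    then show ?case using intm_ops(1) by simp
  next
    case (Cons a w)
    have "gev Ugr rgen (a # w) = (if snd a then rgen (fst a) else rgen' (fst a)) * gev Ugr rgen w" by (cases a) simp
    then show ?case using Cons intm_ops(4) by metis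
  qed
  then show ?thesis using w by (simp add: artin_bw)
qed

lemma artin_gens:
  "artin (xg 1 2) = x12" "artin (xg 2 3) = x23" "artin (xg 3 4) = x34"
  "artin (xg 1 3) = x13" "artin (xg 2 4) = x24"
  unfolding pure_braid_gen_word
  by (subst artin_bw, simp, simp only: gev_simps inv_rgen Ugr_simps if_True if_False,
      simp add: rgen_def rgen'_def x12_def x23_def x34_def x13_def x24_def mult.assoc)+

lemma eventually_nil_subst:
  assumes H: "Group.group H" and ab: "a \<in> carrier H" "b \<in> carrier H" and f: "f \<in> carrier F2nil"
    and l: "l \<in> primes" and M: "M \<in> pro_index l H"
  shows "eventually (\<lambda>g. g \<in> carrier F2 \<and> nil_subst H f (nil_incl H a) (nil_incl H b) l M = M #>\<^bsub>H\<^esub> F2hom H a b g)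
    (pro_group.cf F2 l (f l))"
proof -
  interpret pro_hom F2 H l "F2hom H a b" by (rule pro_homI[OF group_F2 H F2hom(1)[OF H ab] l])
  have "f l \<in> carrier (Pro l F2)" using f l by (simp add: nil_carrier)
  from eventually_hatp[OF this M] show ?thesis
    using l by (simp add: nil_subst_eval[OF H ab f] hatn_def)
qed

text \<open>The left side of the pentagon for a word g of the discrete free group in place of f.
  Together with \<open>pent_rhs\<close> it measures, inside \<open>K4\<close>, how far g is from
  satisfying the pentagon.\<close>

definition pent_lhs :: "letter gword set \<Rightarrow> nat gword set" where
  "pent_lhs g = F2hom K4 (xg 1 2) (xg 2 3 \<otimes>\<^bsub>K4\<^esub> xg 2 4) g \<otimes>\<^bsub>K4\<^esub>
     F2hom K4 (xg 1 3 \<otimes>\<^bsub>K4\<^esub> xg 2 3) (xg 3 4) g"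

definition pent_rhs :: "letter gword set \<Rightarrow> nat gword set" where
  "pent_rhs g = F2hom K4 (xg 2 3) (xg 3 4) g \<otimes>\<^bsub>K4\<^esub>
     F2hom K4 (xg 1 2 \<otimes>\<^bsub>K4\<^esub> xg 1 3) (xg 2 4 \<otimes>\<^bsub>K4\<^esub> xg 3 4) g \<otimes>\<^bsub>K4\<^esub>
     F2hom K4 (xg 1 2) (xg 2 3) g"

lemma pent_closed:
  assumes g: "g \<in> carrier F2"
  shows "pent_lhs g \<in> carrier K4" "pent_rhs g \<in> carrier K4"
proof -
  interpret K: Group.group K4 by (rule group_K4)
  show "pent_lhs g \<in> carrier K4" "pent_rhs g \<in> carrier K4"
    unfolding pent_lhs_def pent_rhs_def
    by (intro K.m_closed F2hom_closed[OF group_K4] pure_braid_gen_K4 g)+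
qed

lemma pent_hom:
  assumes H: "Group.group H" and h: "h \<in> hom K4 H" and g: "g \<in> carrier F2"
  shows "h (pent_lhs g) = F2hom H (h (xg 1 2)) (h (xg 2 3) \<otimes>\<^bsub>H\<^esub> h (xg 2 4)) g \<otimes>\<^bsub>H\<^esub>
      F2hom H (h (xg 1 3) \<otimes>\<^bsub>H\<^esub> h (xg 2 3)) (h (xg 3 4)) g" (is ?P)
    "h (pent_rhs g) = F2hom H (h (xg 2 3)) (h (xg 3 4)) g \<otimes>\<^bsub>H\<^esub>
     F2hom H (h (xg 1 2) \<otimes>\<^bsub>H\<^esub> h (xg 1 3)) (h (xg 2 4) \<otimes>\<^bsub>H\<^esub> h (xg 3 4)) g \<otimes>\<^bsub>H\<^esub>
     F2hom H (h (xg 1 2)) (h (xg 2 3)) g" (is ?Q)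
proof -
  interpret K: Group.group K4 by (rule group_K4)
  note P = pure_braid_gen_K4
  have c: "F2hom K4 a b g \<in> carrier K4" "h (F2hom K4 a b g) = F2hom H (h a) (h b) g" if "a \<in> carrier K4" "b \<in> carrier K4" for a b
    using that F2hom_closed[OF group_K4 that g] F2hom_comp[OF group_K4 H h that g] by auto
  show ?P
    ?Q
    unfolding pent_lhs_def pent_rhs_def
    by (simp_all add: hom_mult[OF h] c P K.m_closed)
qed

section \<open>Consequences of the pentagon for words close to f\<close>

locale pentagon =
  fixes f :: "nat \<Rightarrow> letter gword set set \<Rightarrow> letter gword set set"
  assumes f: "f \<in> carrier F2nil"
    and pentagon:
      "nil_subst K4 f (braid_x 1 2) (braid_x 2 3 \<otimes>\<^bsub>K4nil\<^esub> braid_x 2 4) \<otimes>\<^bsub>K4nil\<^esub>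
         nil_subst K4 f (braid_x 1 3 \<otimes>\<^bsub>K4nil\<^esub> braid_x 2 3) (braid_x 3 4)
       = nil_subst K4 f (braid_x 2 3) (braid_x 3 4) \<otimes>\<^bsub>K4nil\<^esub>
         nil_subst K4 f (braid_x 1 2 \<otimes>\<^bsub>K4nil\<^esub> braid_x 1 3)
                        (braid_x 2 4 \<otimes>\<^bsub>K4nil\<^esub> braid_x 3 4) \<otimes>\<^bsub>K4nil\<^esub>
         nil_subst K4 f (braid_x 1 2) (braid_x 2 3)"
begin

text \<open>Modulo M each of the five substitutions of f takes the value that it takes at any word
  sufficiently close to f_l, so the pentagon for f becomes a congruence for such words.\<close>

lemma eventually_pent:
  assumes l: "l \<in> primes" and M: "M \<in> pro_index l K4"
  shows "eventually (\<lambda>g. g \<in> carrier F2 \<and> pent_lhs g \<otimes>\<^bsub>K4\<^esub> inv\<^bsub>K4\<^esub> pent_rhs g \<in> M) (pro_group.cf F2 l (f l))"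
proof -
  interpret K: Group.group K4 by (rule group_K4)
  interpret P: pro_group K4 l by (rule pro_groupI[OF group_K4 l])
  interpret N: normal M K4 by (rule P.pro_indexD(1)[OF M])
  note X = pure_braid_gen_K4
  have bx: "braid_x i j \<otimes>\<^bsub>K4nil\<^esub> braid_x i' j' = nil_incl K4 (xg i j \<otimes>\<^bsub>K4\<^esub> xg i' j')"
    if "xg i j \<in> carrier K4" "xg i' j' \<in> carrier K4" for i j i' j'
    using hom_mult[OF nil_incl_hom[OF group_K4] that] by (simp add: braid_x_def)
  note ev = eventually_nil_subst[OF group_K4 _ _ f l M]
  note e = pentagon[THEN fun_cong[of _ _ l], THEN fun_cong[of _ _ M],
    unfolded bx[OF X(2,5)] bx[OF X(4,2)] bx[OF X(1,4)] bx[OF X(5,3)], unfolded braid_x_def nil_mult[OF l] P.pro_mult[OF M]]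
  show ?thesis
    using ev[OF X(1) K.m_closed[OF X(2,5)]] ev[OF K.m_closed[OF X(4,2)] X(3)] ev[OF X(2,3)]
      ev[OF K.m_closed[OF X(1,4)] K.m_closed[OF X(5,3)]] ev[OF X(1,2)]
  proof eventually_elim
    case (elim g)
    then have g: "g \<in> carrier F2" by simp
    note c = F2hom_closed[OF group_K4 _ _ g]
    have "(M #>\<^bsub>K4\<^esub> F2hom K4 (xg 1 2) (xg 2 3 \<otimes>\<^bsub>K4\<^esub> xg 2 4) g) <#>\<^bsub>K4\<^esub>
        (M #>\<^bsub>K4\<^esub> F2hom K4 (xg 1 3 \<otimes>\<^bsub>K4\<^esub> xg 2 3) (xg 3 4) g) =
      (M #>\<^bsub>K4\<^esub> F2hom K4 (xg 2 3) (xg 3 4) g) <#>\<^bsub>K4\<^esub>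
        (M #>\<^bsub>K4\<^esub> F2hom K4 (xg 1 2 \<otimes>\<^bsub>K4\<^esub> xg 1 3) (xg 2 4 \<otimes>\<^bsub>K4\<^esub> xg 3 4) g) <#>\<^bsub>K4\<^esub>
        (M #>\<^bsub>K4\<^esub> F2hom K4 (xg 1 2) (xg 2 3) g)"
      using e by (simp only: elim[THEN conjunct2])
    then have "M #>\<^bsub>K4\<^esub> pent_lhs g = M #>\<^bsub>K4\<^esub> pent_rhs g"
      unfolding pent_lhs_def pent_rhs_def by (simp add: N.rcos_sum c X K.m_closed)
    then show ?case
      using g P.coset_eq_iff[OF P.pro_indexD(2)[OF M] pent_closed[OF g]] by simp
  qed
qed

sublocale R: ratlim "klim f" "kser f" by (rule ratlim_klim[OF f])

text \<open>For words close to f_l the two sides of the pentagon agree modulo a deep subgroup of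
  \<open>K4\<close>, and uniform continuity of the entries makes their matrices l-adically
  close.\<close>

sublocale PL: pentagon_limit "klim f" "kser f"
proof
  fix u v
  show "klim f (\<lambda>g. ent (F2hom Ugr x12 (x23 * x24) g * F2hom Ugr (x13 * x23) x34 g -
      F2hom Ugr x23 x34 g * F2hom Ugr (x12 * x13) (x24 * x34) g * F2hom Ugr x12 x23 g) u v) 0"
    unfolding klim_def
  proof (intro ballI exI conjI)
    fix l :: nat assume lp: "l \<in> primes"
    interpret padic l by (rule padicI[OF lp])
    interpret PK: pro_group K4 l by (rule pro_groupI[OF group_K4 lp])
    show "Rep_kk 0 l = Ql_embed l (\<iota> 0)"
      using Rep_kk_ops(7)[OF lp, of 0] by simp
    show "plim (\<lambda>g. ent (F2hom Ugr x12 (x23 * x24) g * F2hom Ugr (x13 * x23) x34 g -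
      F2hom Ugr x23 x34 g * F2hom Ugr (x12 * x13) (x24 * x34) g * F2hom Ugr x12 x23 g) u v) (P.cf (f l)) (\<iota> 0)"
    proof (rule plim_small)
      fix e :: real assume e: "e > 0"
      obtain M where M: "M \<in> pro_index l K4" "\<forall>g\<in>carrier K4. \<forall>h\<in>carrier K4. g \<otimes>\<^bsub>K4\<^esub> inv\<^bsub>K4\<^esub> h \<in> M \<longrightarrow>
          pa (ent (artin g) u v - ent (artin h) u v) < e"
        using PK.entries_uniform[OF artin_hom intm_icong[OF intm_artin] zero_less_one artin_unip e] by blast
      show "eventually (\<lambda>g. pa (ent (F2hom Ugr x12 (x23 * x24) g * F2hom Ugr (x13 * x23) x34 g -
        F2hom Ugr x23 x34 g * F2hom Ugr (x12 * x13) (x24 * x34) g * F2hom Ugr x12 x23 g) u v) < e) (P.cf (f l))"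
        using eventually_pent[OF lp M(1)]
      proof eventually_elim
        case (elim g)
        then have "pa (ent (artin (pent_lhs g)) u v - ent (artin (pent_rhs g)) u v) < e"
          using M(2) pent_closed by blast
        then show ?case
          using pent_hom[OF group_Ugr artin_hom conjunct1[OF elim]] by (simp add: artin_gens)
      qed
    qed
  qed
qed

end

section \<open>A homomorphism from the pure braid group to the free group\<close>

text \<open>Sending the first and the third generator to the same element maps the braid group on four
  strings to the one on three strings, whose pure subgroup modulo its centre is free on the images of
  the squares of the generators. The map is written down by the Reidemeister-Schreier method: the
  states are the cosets of the pure subgroup, and every letter moves a state and contributes a weight.\<close>

datatype coset = C12 | C13 | C21 | C23 | C31 | C32

definition step :: "nat \<Rightarrow> coset \<Rightarrow> coset" where
  "step i s = (if i = 2
     then (case s of C12 \<Rightarrow> C32 | C13 \<Rightarrow> C23 | C21 \<Rightarrow> C31 | C23 \<Rightarrow> C13 | C31 \<Rightarrow> C21 | C32 \<Rightarrow> C12)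
     else (case s of C12 \<Rightarrow> C13 | C13 \<Rightarrow> C12 | C21 \<Rightarrow> C23 | C23 \<Rightarrow> C21 | C31 \<Rightarrow> C32 | C32 \<Rightarrow> C31))"

text \<open>Letters that lead away from \<open>C12\<close> along shortest words have weight one, and
  both sides of the braid relation reach \<open>C21\<close>. A letter leading back has as weight the
  conjugate of the square of the generator by the shortest word to its end state. It is expressed
  through x and y, the squares of the two generators, with the full twist set to 1.\<close>

definition weight :: "nat \<Rightarrow> coset \<Rightarrow> letter gword set" where
  "weight i s = (if i = 2
     then (case s of C32 \<Rightarrow> F2_y | C23 \<Rightarrow> iv (F2_x \<star> F2_y) | C21 \<Rightarrow> F2_x | _ \<Rightarrow> \<one>\<^bsub>F2\<^esub>)
     else (case s of C13 \<Rightarrow> F2_x | C31 \<Rightarrow> iv (F2_y \<star> F2_x) | C21 \<Rightarrow> F2_y | _ \<Rightarrow> \<one>\<^bsub>F2\<^esub>))"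

primrec steps :: "nat gword \<Rightarrow> coset \<Rightarrow> coset" where
  "steps [] s = s" | "steps (a # w) s = steps w (step (fst a) s)"

text \<open>An inverse letter undoes the positive letter that starts at the state it leads to, hence
  the weight at the new state. For the states themselves the sign makes no difference because
  \<open>step i\<close> is an involution.\<close>

primrec weights :: "nat gword \<Rightarrow> coset \<Rightarrow> letter gword set" where
  "weights [] s = \<one>\<^bsub>F2\<^esub>"
| "weights (a # w) s = (if snd a then weight (fst a) s else iv (weight (fst a) (step (fst a) s)))
     \<star> weights w (step (fst a) s)"

interpretation F: Group.group F2 by (rule group_F2)

lemma F2_cancel [simp]: "a \<in> carrier F2 \<Longrightarrow> b \<in> carrier F2 \<Longrightarrow> iv a \<star> (a \<star> b) = b"
  "a \<in> carrier F2 \<Longrightarrow> b \<in> carrier F2 \<Longrightarrow> a \<star> (iv a \<star> b) = b"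
  by (simp_all flip: F.m_assoc)

lemma weight_closed [simp]: "weight i s \<in> carrier F2"
  by (simp add: weight_def split: coset.split)

lemma step_step [simp]: "step i (step i s) = s"
  by (simp add: step_def split: coset.split)

lemma weights_closed [simp]: "weights w s \<in> carrier F2"
  by (induction w arbitrary: s) auto

lemma steps_append: "steps (u @ v) s = steps v (steps u s)"
  by (induction u arbitrary: s) auto

lemma weights_append: "weights (u @ v) s = weights u s \<star> weights v (steps u s)"
  by (induction u arbitrary: s) (auto simp: F.m_assoc)

lemma weights_pres_eq:
  "pres_eq {1..<4} (braid_rels 4) u v \<Longrightarrow> steps u s = steps v s \<and> weights u s = weights v s"
proof (induction arbitrary: s rule: pres_eq.induct)
  case (pres_rel u v)
  from braid_rels_4[OF pres_rel(1)] show ?case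
    by (elim disjE conjE; cases s; simp add: step_def weight_def F.inv_mult_group F.m_assoc)
qed (auto simp: steps_append weights_append)

definition theta :: "nat gword set \<Rightarrow> letter gword set" where
  "theta A = weights (SOME w. w \<in> A) C12"

lemma theta_bw: "w \<in> L4 \<Longrightarrow> theta (bw w) = weights w C12"
proof -
  assume w: "w \<in> L4"
  have "(SOME v. v \<in> bw w) \<in> bw w" by (rule someI[of _ w]) (rule cls_self[OF w])
  then show ?thesis unfolding theta_def using weights_pres_eq[of w _ C12] by (auto simp: cls_def)
qed

text \<open>The braid group on three strings permutes the three ways of pairing off four points.\<close>

definition pairing :: "nat \<Rightarrow> nat \<Rightarrow> nat" where
  "pairing a b = (if (a, b) \<in> {(1, 2), (2, 1), (3, 4), (4, 3)} then 1
     else if (a, b) \<in> {(2, 3), (3, 2), (1, 4), (4, 1)} then 2 else 3)"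

lemma pairing_values:
  "pairing 1 2 = 1" "pairing 2 1 = 1" "pairing 3 4 = 1" "pairing 4 3 = 1" "pairing 2 3 = 2" "pairing 3 2 = 2" "pairing 1 4 = 2" "pairing 4 1 = 2" "pairing 1 3 = 3" "pairing 3 1 = 3" "pairing 2 4 = 3" "pairing 4 2 = 3"
  by (simp_all add: pairing_def)
lemma pairing_distinct:
  assumes "a \<in> {1, 2, 3, 4}" "b \<in> {1, 2, 3, 4}" "c \<in> {1, 2, 3, 4}" "d \<in> {1, 2, 3, 4}" "distinct [a, b, c, d]"
  shows "pairing b a = pairing a b \<and> pairing b d = pairing a c \<and> ((pairing a b, pairing b c, pairing a c) \<in> {(1,2,3),(1,3,2),(2,1,3),(2,3,1),(3,1,2),(3,2,1)})"
proof -
  have a: "a = 1 \<or> a = 2 \<or> a = 3 \<or> a = 4" "b = 1 \<or> b = 2 \<or> b = 3 \<or> b = 4" "c = 1 \<or> c = 2 \<or> c = 3 \<or> c = 4" "d = 1 \<or> d = 2 \<or> d = 3 \<or> d = 4"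
   "a \<noteq> b" "a \<noteq> c" "a \<noteq> d" "b \<noteq> c" "b \<noteq> d" "c \<noteq> d"
    using assms by simp_all
  show ?thesis using a by (elim disjE) (simp_all add: pairing_values)
qed

text \<open>The two digits of a state are the pairings formed by the strands in positions 1, 2 and
  in positions 2, 3. Positions 3, 4 form the same pairing as 1, 2, which is why the third generator
  moves states as the first does.\<close>

definition pcoset :: "nat \<Rightarrow> nat \<Rightarrow> nat \<Rightarrow> coset" where
  "pcoset a b c = (let i = pairing a b; j = pairing b c in
     if i = 1 then (if j = 2 then C12 else C13) else if i = 2 then (if j = 1 then C21 else C23) else (if j = 1 then C31 else C32))"

lemma pcoset_step:
  assumes "a \<in> {1, 2, 3, 4}" "b \<in> {1, 2, 3, 4}" "c \<in> {1, 2, 3, 4}" "d \<in> {1, 2, 3, 4}" "distinct [a, b, c, d]"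
  shows "pcoset b a c = step 1 (pcoset a b c)" (is ?P) "pcoset a c b = step 2 (pcoset a b c)" (is ?Q) "pcoset a b d = step 3 (pcoset a b c)" (is ?R)
proof -
  note p = pairing_distinct[OF assms]
  then have "pairing b a = pairing a b" "pairing b d = pairing a c" by simp_all
  moreover have "pairing c b = pairing b c"
    by (rule conjunct1[OF pairing_distinct[OF assms(2,3,1,4)]]) (use assms(5) in auto)
  moreover have "(pairing a b, pairing b c, pairing a c) \<in> {(1, 2, 3), (1, 3, 2), (2, 1, 3), (2, 3, 1), (3, 1, 2), (3, 2, 1)}"
    using p by blast
  ultimately show ?P ?Q ?R
    by (auto simp: pcoset_def step_def Let_def)
qed

lemma steps_perm:
  assumes "w \<in> L4" "p permutes {1..4}"
  shows "steps w (pcoset (p 1) (p 2) (p 3)) = pcoset (p (gword_perm w 1)) (p (gword_perm w 2)) (p (gword_perm w 3))"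
  using assms
proof (induction w arbitrary: p)
  case (Cons a w)
  obtain i b where a: "a = (i, b)" by force
  have i: "i \<in> {1..<4}" and w: "w \<in> L4" using Cons.hyps unfolding a by auto
  then have i4: "i \<in> {1..4}" "i + 1 \<in> {1..4}" by auto
  let ?t = "tsp i (i + 1)"
  define q where "q = p \<circ> ?t"
  have q: "q permutes {1..4}" unfolding q_def by (rule permutes_compose[OF permutes_swap_id[OF i4] Cons.prems])
  have "p k \<in> {1, 2, 3, 4}" if "k \<in> {1..4}" for k
    using permutes_in_image[OF Cons.prems, of k] that by auto
  then have r: "p 1 \<in> {1, 2, 3, 4}" "p 2 \<in> {1, 2, 3, 4}" "p 3 \<in> {1, 2, 3, 4}" "p 4 \<in> {1, 2, 3, 4}" by (simp_all del: insert_iff)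
  have d: "distinct [p 1, p 2, p 3, p 4]"
    by (simp add: inj_eq[OF permutes_inj[OF Cons.prems]])
  have "i = 1 \<or> i = 2 \<or> i = 3" using i by auto
  then have "step i (pcoset (p 1) (p 2) (p 3)) = pcoset (q 1) (q 2) (q 3)"
    using pcoset_step[OF r d] by (elim disjE) (simp_all add: q_def Transposition.transpose_def)
  then show ?case using Cons.IH[OF q] by (simp add: a q_def)
qed simp

lemma steps_pure: "w \<in> L4 \<Longrightarrow> gword_perm w = id \<Longrightarrow> steps w C12 = C12"
  using steps_perm[of w id] by (simp add: permutes_id pcoset_def pairing_values)

lemma theta_hom: "theta \<in> hom K4 F2"
proof (rule homI)
  fix A assume "A \<in> carrier K4"
  then show "theta A \<in> carrier F2" by (simp add: theta_def)
  fix B assume "B \<in> carrier K4"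
  with \<open>A \<in> carrier K4\<close> obtain u v where "u \<in> L4" "A = bw u" "gword_perm u = id" "v \<in> L4" "B = bw v"
    unfolding K4_carrier by blast
  then show "theta (A \<otimes>\<^bsub>K4\<^esub> B) = theta A \<star> theta B"
    by (simp add: K4_simps braid_ops theta_bw weights_append steps_pure)
qed

lemma theta_gens:
  "theta (xg 1 2) = F2_x" "theta (xg 2 3) = F2_y" "theta (xg 3 4) = F2_x"
  "theta (xg 1 3) = iv (F2_y \<star> F2_x)" "theta (xg 2 4) = iv (F2_x \<star> F2_y)"
  unfolding pure_braid_gen_word by (subst theta_bw; simp add: step_def weight_def)+

section \<open>The two-cycle relation\<close>

text \<open>The integers are the exponent sums of the two letters. On powers of a single element a
  word depends only on these.\<close>

lemma ser_linear:
  assumes "g \<in> carrier F2"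
  shows "\<exists>a b :: int. ser g [LX] = of_int a \<and> ser g [LY] = of_int b \<and>
    (\<forall>c\<in>carrier F2. \<forall>p q :: int. F2hom F2 (c [^]\<^bsub>F2\<^esub> p) (c [^]\<^bsub>F2\<^esub> q) g = c [^]\<^bsub>F2\<^esub> (p * a + q * b))"
  using assms
proof (induction rule: F2_induct)
  define \<rho> where "\<rho> c p q = F2hom F2 (c [^]\<^bsub>F2\<^esub> p) (c [^]\<^bsub>F2\<^esub> q)" for c and p q :: int
  have rec: "\<rho> c p q (F2_x \<star> g) = c [^]\<^bsub>F2\<^esub> p \<star> \<rho> c p q g" "\<rho> c p q (F2_y \<star> g) = c [^]\<^bsub>F2\<^esub> q \<star> \<rho> c p q g"
    "\<rho> c p q (iv F2_x \<star> g) = c [^]\<^bsub>F2\<^esub> (- p) \<star> \<rho> c p q g"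
    "\<rho> c p q (iv F2_y \<star> g) = c [^]\<^bsub>F2\<^esub> (- q) \<star> \<rho> c p q g" "\<rho> c p q \<one>\<^bsub>F2\<^esub> = \<one>\<^bsub>F2\<^esub>"
    if "c \<in> carrier F2" "g \<in> carrier F2" for c g p q
    using that F2hom_rec[OF group_F2, of "c [^]\<^bsub>F2\<^esub> p" "c [^]\<^bsub>F2\<^esub> q" g] by (simp_all add: \<rho>_def F.int_pow_neg)
  have step: "\<exists>a b :: int. ser h [LX] = of_int a \<and> ser h [LY] = of_int b \<and> (\<forall>c\<in>carrier F2. \<forall>p q. \<rho> c p q h = c [^]\<^bsub>F2\<^esub> (p * a + q * b))"
    if ex: "\<exists>a b :: int. ser g [LX] = of_int a \<and> ser g [LY] = of_int b \<and> (\<forall>c\<in>carrier F2. \<forall>p q. \<rho> c p q g = c [^]\<^bsub>F2\<^esub> (p * a + q * b))"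
    and h: "ser h [LX] = of_int i + ser g [LX]" "ser h [LY] = of_int j + ser g [LY]"
    and hr: "\<And>c p q. c \<in> carrier F2 \<Longrightarrow> \<rho> c p q h = c [^]\<^bsub>F2\<^esub> (p * i + q * j) \<star> \<rho> c p q g" for g h and i j :: int
  proof -
    obtain a b where ab: "ser g [LX] = of_int a" "ser g [LY] = of_int b"
      "\<forall>c\<in>carrier F2. \<forall>p q. \<rho> c p q g = c [^]\<^bsub>F2\<^esub> (p * a + q * b)" using ex by blast
    have "\<rho> c p q h = c [^]\<^bsub>F2\<^esub> (p * (i + a) + q * (j + b))" if "c \<in> carrier F2" for c p q
      using ab(3)[rule_format, OF that] hr[OF that] that
      by (simp add: algebra_simps flip: F.int_pow_mult)
    then show ?thesis using h ab(1,2) by (intro exI[of _ "i + a"] exI[of _ "j + b"]) simp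
  qed
  {
    case one
    show ?case using rec(5)[OF _ F2_one, unfolded \<rho>_def] ser_linear_rec(5)[OF F2_one] by (intro exI[of _ 0]) simp
  next
    case (x g)
    show ?case by (rule step[of g _ 1 0, unfolded \<rho>_def])
      (use x rec(1)[OF _ x(1), unfolded \<rho>_def] ser_linear_rec(1)[OF x(1)] in simp_all)
  next
    case (y g)
    show ?case by (rule step[of g _ 0 1, unfolded \<rho>_def])
      (use y rec(2)[OF _ y(1), unfolded \<rho>_def] ser_linear_rec(2)[OF y(1)] in simp_all)
  next
    case (xi g)
    show ?case by (rule step[of g _ "- 1" 0, unfolded \<rho>_def])
      (use xi rec(3)[OF _ xi(1), unfolded \<rho>_def] ser_linear_rec(3)[OF xi(1)] in simp_all)
  next
    case (yi g)
    show ?case by (rule step[of g _ 0 "- 1", unfolded \<rho>_def])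
      (use yi rec(4)[OF _ yi(1), unfolded \<rho>_def] ser_linear_rec(4)[OF yi(1)] in simp_all)
  }
qed

lemma F2hom_self: "g \<in> carrier F2 \<Longrightarrow> F2hom F2 F2_x F2_y g = g"
  using F2_hom_eq[OF group_F2 F2hom(1)[OF group_F2 F2_x_carrier F2_y_carrier], of "\<lambda>x. x"]
  by (simp add: F2hom[OF group_F2] hom_def)

text \<open>The arguments on the left become (x, x^-1) and (x^-1, x), which gives x^(a - b) x^(b -
  a) = 1. On the right they become (y, x), (y^-1, y^-1) and (x, y), and the middle one yields the
  power -(a + b) of y.\<close>

lemma theta_pent:
  assumes g: "g \<in> carrier F2"
  shows "\<exists>a b :: int. ser g [LX] = of_int a \<and> ser g [LY] = of_int b \<and> theta (pent_lhs g) = \<one>\<^bsub>F2\<^esub> \<and>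
    theta (pent_rhs g) = F2hom F2 F2_y F2_x g \<star> F2_y [^]\<^bsub>F2\<^esub> (- (a + b)) \<star> g"
proof -
  obtain a b where ab: "ser g [LX] = of_int a" "ser g [LY] = of_int b"
    and pw: "\<And>c p q. c \<in> carrier F2 \<Longrightarrow> F2hom F2 (c [^]\<^bsub>F2\<^esub> (p :: int)) (c [^]\<^bsub>F2\<^esub> (q :: int)) g = c [^]\<^bsub>F2\<^esub> (p * a + q * b)"
    using ser_linear[OF g] by blast
  have p1: "c [^]\<^bsub>F2\<^esub> (1 :: int) = c" "c [^]\<^bsub>F2\<^esub> (- 1 :: int) = iv c" if "c \<in> carrier F2" for c
    using that F.int_pow_neg[OF that, of 1] F.int_pow_1[OF that] by simp_all
  have "F2hom F2 F2_x (iv F2_x) g = F2_x [^]\<^bsub>F2\<^esub> (a - b)" "F2hom F2 (iv F2_x) F2_x g = F2_x [^]\<^bsub>F2\<^esub> (- a + b)"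
    "F2hom F2 (iv F2_y) (iv F2_y) g = F2_y [^]\<^bsub>F2\<^esub> (- (a + b))"
    using pw[of F2_x 1 "- 1"] pw[of F2_x "- 1" 1] pw[of F2_y "- 1" "- 1"] by (simp_all add: p1)
  moreover have "F2_y \<star> iv (F2_x \<star> F2_y) = iv F2_x" "iv (F2_y \<star> F2_x) \<star> F2_y = iv F2_x"
    "F2_x \<star> iv (F2_y \<star> F2_x) = iv F2_y" "iv (F2_x \<star> F2_y) \<star> F2_x = iv F2_y"
    by (simp_all add: F.inv_mult_group F.m_assoc)
  moreover have "F2_x [^]\<^bsub>F2\<^esub> (a - b) \<star> F2_x [^]\<^bsub>F2\<^esub> (- a + b) = \<one>\<^bsub>F2\<^esub>"
    using F.int_pow_mult[OF F2_x_carrier, of "a - b" "- a + b"] by simp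
  ultimately show ?thesis
    using ab pent_hom[OF group_F2 theta_hom g] F2hom_self[OF g] unfolding theta_gens
    by (intro exI[of _ a] exI[of _ b]) simp
qed

lemma nil_eqI:
  assumes G: "Group.group G" and c: "c \<in> carrier (nil_completion G)" and d: "d \<in> carrier (nil_completion G)"
    and eq: "\<And>l N. l \<in> primes \<Longrightarrow> N \<in> pro_index l G \<Longrightarrow> c l N = d l N"
  shows "c = d"
proof (rule extensionalityI)
  show "c \<in> extensional primes" "d \<in> extensional primes" using c d by (simp_all add: nil_carrier)
  fix l assume l: "l \<in> primes"
  interpret pro_group G l by (rule pro_groupI[OF G l])
  have cd: "c l \<in> carrier (Pro l G)" "d l \<in> carrier (Pro l G)" using c d l by (simp_all add: nil_carrier)
  show "c l = d l" by (rule extensionalityI[OF pro_carrierD(1)[OF cd(1)] pro_carrierD(1)[OF cd(2)] eq[OF l]])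
qed

context pentagon
begin

text \<open>The linear coefficients of \<open>\<Phi>\<close> vanish and the embedding in the
  algebraic closure is injective, so the exponent sums of words close to f_l become divisible by
  high powers of l.\<close>

lemma linear_small:
  assumes lp: "l \<in> primes" and e: "e > 0" and w: "w = [LX] \<or> w = [LY]"
  shows "eventually (\<lambda>g. padic_abs l (ser g w) < e) (pro_group.cf F2 l (f l))"
proof -
  interpret padic l by (rule padicI[OF lp])
  have c: "f l \<in> carrier (Pro l F2)" using f lp by (simp add: nil_carrier)
  have "kser f w = 0" using PL.Phi_linear w by auto
  then have "Ql_embed l (sl (f l) w) = Ql_embed l (\<iota> 0)"
    using Rep_kser[OF f lp, of w] F2_to_Ql_sl[OF c] Rep_kk_ops(7)[OF lp, of 0] by simp
  then have "sl (f l) w = \<iota> 0"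
    unfolding Ql_embed_def using Q.indexed_const_is_inj by (auto dest: injD)
  then have "plim (\<lambda>g. ser g w) (P.cf (f l)) (\<iota> 0)" using plim_sl[OF c, of w] by simp
  from plim_0_small[OF this e] show ?thesis .
qed

text \<open>By \<open>theta\<close> the pentagon puts h y^(-(a + b)) g into N, where h = g(y, x).
  For words close to f_l the order of the quotient divides the exponent sums a and b, so the power
  of y lies in N. Conjugation by g brings the factors into the order g h.\<close>

lemma eventually_swap:
  assumes lp: "l \<in> primes" and N: "N \<in> pro_index l F2"
  shows "eventually (\<lambda>g. g \<in> carrier F2 \<and> g \<star> F2hom F2 F2_y F2_x g \<in> N) (pro_group.cf F2 l (f l))"
proof -
  interpret padic l by (rule padicI[OF lp])
  interpret T: pro_hom K4 F2 l theta by (rule pro_homI[OF group_K4 group_F2 theta_hom lp])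
  interpret N: normal N F2 by (rule P.pro_indexD(1)[OF N])
  obtain k where k: "order (F2 Mod N) = l ^ k" using P.pro_indexD(4)[OF N] by blast
  have e: "(1 / real l) ^ k > 0" using l_gt1 by simp
  show ?thesis
    using eventually_pent[OF lp T.pre_index[OF N]] linear_small[OF lp e disjI1[OF refl]] linear_small[OF lp e disjI2[OF refl]]
  proof eventually_elim
    case (elim g)
    then have g: "g \<in> carrier F2" and sm: "pa (ser g [LX]) < (1 / real l) ^ k" "pa (ser g [LY]) < (1 / real l) ^ k" by auto
    obtain a b where ab: "ser g [LX] = of_int a" "ser g [LY] = of_int b" "theta (pent_lhs g) = \<one>\<^bsub>F2\<^esub>"
      "theta (pent_rhs g) = F2hom F2 F2_y F2_x g \<star> F2_y [^]\<^bsub>F2\<^esub> (- (a + b)) \<star> g"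
      using theta_pent[OF g] by blast
    define h where "h = F2hom F2 F2_y F2_x g"
    have h: "h \<in> carrier F2" unfolding h_def by (intro F2hom_closed group_F2 g F2_x_carrier F2_y_carrier)
    have "int l ^ k dvd a" "int l ^ k dvd b" using sm pa_dvd_iff[of a k] pa_dvd_iff[of b k] ab(1,2) by simp_all
    then obtain z where z: "- (a + b) = int (l ^ k) * z" by (metis dvd_add dvdE dvd_minus_iff of_nat_power)
    define n where "n = F2_y [^]\<^bsub>F2\<^esub> (- (a + b))"
    have "F2_y [^]\<^bsub>F2\<^esub> (l ^ k) \<in> N" by (rule P.pow_order_mem[OF N F2_y_carrier]) (simp add: k)
    then have n: "n \<in> N" unfolding n_def z
      using F.subgroup_int_pow_closed[OF N.subgroup_axioms, of "F2_y [^]\<^bsub>F2\<^esub> (l ^ k)" z]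
        F.int_pow_pow[OF F2_y_carrier, of "int (l ^ k)" z, unfolded int_pow_int] by simp
    have hng: "h \<star> n \<star> g \<in> carrier F2" using h n g N.subset by blast
    have "theta (pent_lhs g \<otimes>\<^bsub>K4\<^esub> inv\<^bsub>K4\<^esub> pent_rhs g) \<in> N" using elim by (auto simp: T.pre_def)
    then have "iv (h \<star> n \<star> g) \<in> N"
      using pent_closed[OF g] ab(3) ab(4)[folded h_def n_def] hng by simp
    then have "h \<star> n \<star> g \<in> N" using N.m_inv_closed F.inv_inv[OF hng] by metis
    then have "g \<star> (h \<star> n \<star> g) \<star> iv g \<in> N" using N.inv_op_closed2[OF g] by simp
    moreover have nF: "n \<in> carrier F2" using n N.subset by blast
    have "g \<star> (h \<star> n \<star> g) \<star> iv g = g \<star> h \<star> n"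
      using g h nF by (simp add: F.m_assoc)
    ultimately have "g \<star> h \<star> n \<star> iv n \<in> N" using n by (simp add: N.m_closed del: F.r_inv)
    then have "g \<star> h \<in> N" using g h nF by (simp add: F.m_assoc)
    then show ?case using g by (simp add: h_def)
  qed
qed

lemma two_cycle: "nil_subst F2 f nx ny \<otimes>\<^bsub>F2nil\<^esub> nil_subst F2 f ny nx = \<one>\<^bsub>F2nil\<^esub>"
proof -
  have "(nil_subst F2 f nx ny \<otimes>\<^bsub>F2nil\<^esub> nil_subst F2 f ny nx) l N = N"
    if lp: "l \<in> primes" and N: "N \<in> pro_index l F2" for l N
  proof -
    interpret padic l by (rule padicI[OF lp])
    interpret N: normal N F2 by (rule P.pro_indexD(1)[OF N])
    have c: "f l \<in> carrier (Pro l F2)" using f lp by (simp add: nil_carrier)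
    note ev = eventually_nil_subst[OF group_F2 _ _ f lp N]
    have "eventually (\<lambda>g. (nil_subst F2 f nx ny \<otimes>\<^bsub>F2nil\<^esub> nil_subst F2 f ny nx) l N = N) (P.cf (f l))"
      using ev[OF F2_x_carrier F2_y_carrier] ev[OF F2_y_carrier F2_x_carrier] eventually_swap[OF lp N]
    proof eventually_elim
      case (elim g)
      have h: "F2hom F2 F2_y F2_x g \<in> carrier F2" using elim by (intro F2hom_closed group_F2) auto
      then have "(nil_subst F2 f nx ny \<otimes>\<^bsub>F2nil\<^esub> nil_subst F2 f ny nx) l N = N #>\<^bsub>F2\<^esub> (g \<star> F2hom F2 F2_y F2_x g)"
        using elim by (simp add: nil_mult[OF lp] P.pro_mult[OF N] nx_def ny_def F2hom_self N.rcos_sum)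
      also have "\<dots> = N" using elim h by (intro F.coset_join2 N.subgroup_axioms) auto
      finally show ?case .
    qed
    then show ?thesis using eventually_happens'[OF P.cf_not_bot[OF c]] by blast
  qed
  note eq = this
  have cl: "nil_subst F2 f nx ny \<in> carrier F2nil" "nil_subst F2 f ny nx \<in> carrier F2nil"
    unfolding nx_def ny_def using hom_in_carrier[OF hatn(1)[OF group_F2 group_F2 F2hom(1)[OF group_F2]] f]
    by (simp_all add: nil_subst_eval[OF group_F2 _ _ f])
  interpret FN: Group.group F2nil by (rule group_nil_completion[OF group_F2])
  show ?thesis by (rule nil_eqI[OF group_F2]) (use cl eq FN.one_closed in \<open>auto simp: nil_one pro_group.pro_one[OF pro_groupI[OF group_F2]]\<close>)
qed

text \<open>The relation g(x, y) g(y, x) = 1 modulo deep subgroups passes to the series by uniform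
  continuity, with the series of the unit element as limit.\<close>

sublocale PT: pentlim "klim f" "kser f"
proof
  fix w
  show "klim f (\<lambda>g. ser (g \<star> F2hom F2 F2_y F2_x g) w) (delta w)"
    unfolding klim_def
  proof (intro ballI exI conjI)
    fix l :: nat assume lp: "l \<in> primes"
    interpret padic l by (rule padicI[OF lp])
    have "delta w = (qi (delta w) :: kk)" by (simp add: delta_def)
    then show "Rep_kk (delta w) l = Ql_embed l (\<iota> (delta w))" using Rep_kk_ops(7)[OF lp, of "delta w"] by simp
    have "plim (\<lambda>g. ser (g \<star> F2hom F2 F2_y F2_x g) w - delta w) (P.cf (f l)) (\<iota> 0)"
    proof (rule plim_small)
      fix e :: real assume "e > 0"
      then obtain M where M: "M \<in> pro_index l F2"
        "\<forall>g\<in>carrier F2. \<forall>h\<in>carrier F2. g \<star> iv h \<in> M \<longrightarrow> pa (ser g w - ser h w) < e"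
        using ser_uniform[OF lp, of e w] by blast
      show "eventually (\<lambda>g. pa (ser (g \<star> F2hom F2 F2_y F2_x g) w - delta w) < e) (P.cf (f l))"
        using eventually_swap[OF lp M(1)]
      proof eventually_elim
        case (elim g)
        have "F2hom F2 F2_y F2_x g \<in> carrier F2" using elim by (intro F2hom_closed group_F2) auto
        then show ?case using elim M(2)[rule_format, of "g \<star> F2hom F2 F2_y F2_x g" "\<one>\<^bsub>F2\<^esub>"] by (simp add: ser_one)
      qed
    qed
    from plim_add[OF this plim_const[of "delta w"]]
    show "plim (\<lambda>g. ser (g \<star> F2hom F2 F2_y F2_x g) w) (P.cf (f l)) (\<iota> (delta w))" by (simp add: \<iota>_hom)
  qed
qed

end
lemma toep_ev: "toep (ev \<phi> Toep)"
  by (rule rpI) simp_all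

lemma toep_qm: "toep M \<Longrightarrow> toep (qm M)"
proof -
  assume M: "toep M"
  have "qm (ev (col M) Toep) = ev (\<lambda>w. qi (col M w)) Toep"
    by (rule tmat_eqI) (auto simp: ev.rep_eq qi_sum qi_mult ent_wd_Toep intro!: sum.cong)
  then show ?thesis using M toep_ev by (metis rp_def)
qed

lemma toep_unip: "toep M \<Longrightarrow> unip M \<Longrightarrow> \<exists>\<phi>. \<phi> [] = 1 \<and> M = ev \<phi> Toep"
proof -
  assume M: "toep M" "unip M"
  have "col M [] = 1" using ent_unip[OF M(2), of "[]" "[]"] by (simp add: col_def)
  then show ?thesis using M(1) unfolding rp_def by blast
qed

abbreviation ez :: "letter gword set \<Rightarrow> (letter, rat) tmat" where "ez \<equiv> F2hom Ugr eLX eLY"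

lemma eL_carrier: "eLX \<in> carrier Ugr" "eLY \<in> carrier Ugr"
  by (rule ex1_unit[OF Toep_Fil])+

lemma ez_hom: "ez \<in> hom F2 Ugr"
  by (rule F2hom(1)[OF group_Ugr eL_carrier])

lemma ez_unip: "a \<in> carrier F2 \<Longrightarrow> unip (ez a)"
  by (rule F2hom_unip) simp_all

lemma toep_ez: "a \<in> carrier F2 \<Longrightarrow> toep (ez a)"
proof -
  assume "a \<in> carrier F2"
  then have ez: "ez a = ev (ser a) Toep" using ser_main[of a 1 1, THEN conjunct1] by simp
  show "toep (ez a)" unfolding ez by (rule toep_ev)
qed

section \<open>The hexagon relation in terms of matrices\<close>

abbreviation rk :: "nat \<Rightarrow> (letter, kk) tmat \<Rightarrow> letter list \<Rightarrow> qlbar" where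
  "rk l M \<equiv> \<lambda>w. Rep_kk (col M w) l"

lemma F2_to_Qlbar_incl:
  assumes lp: "l \<in> primes" and a: "a \<in> carrier F2"
  shows "F2_to_Qlbar l (nil_incl F2 a l) = rk l (qm (ez a))"
proof
  fix w
  interpret padic l by (rule padicI[OF lp])
  have "pro_incl l F2 a \<in> carrier (Pro l F2)" using P.pro_incl_hom a by (rule hom_in_carrier)
  then have "F2_to_Ql l (nil_incl F2 a l) w = \<iota> (ser a w)"
    using lp a by (simp add: nil_incl_def F2_to_Ql_sl sl_incl)
  then show "F2_to_Qlbar l (nil_incl F2 a l) w = rk l (qm (ez a)) w"
    using Rep_kk_ops(7)[OF lp] by (simp add: F2_to_Qlbar_def ser_def col_def)
qed

context pentagon
begin

text \<open>Both sides are limits of the series of g(a, b) as g tends to f_l: on the left because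
  the words g(a, b) approach the substituted element, on the right by \<open>tl_fh\<close>. Limits
  are unique.\<close>

lemma F2_to_Qlbar_subst:
  assumes lp: "l \<in> primes" and a: "a \<in> carrier F2" and b: "b \<in> carrier F2"
  shows "F2_to_Qlbar l (nil_subst F2 f (nil_incl F2 a) (nil_incl F2 b) l) = rk l (R.fh (ez a) (ez b))"
proof
  fix w
  interpret padic l by (rule padicI[OF lp])
  interpret H: pro_hom F2 F2 l "F2hom F2 a b" by (rule pro_homI[OF group_F2 group_F2 F2hom(1)[OF group_F2 a b] lp])
  have c: "f l \<in> carrier (Pro l F2)" using f lp by (simp add: nil_carrier)
  have s: "nil_subst F2 f (nil_incl F2 a) (nil_incl F2 b) l = H.hatp (f l)"
    using lp by (simp add: nil_subst_eval[OF group_F2 a b f] hatn_def)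
  have "plim (\<lambda>g. ser g w) (filtermap (F2hom F2 a b) (P.cf (f l))) (sl (H.hatp (f l)) w)"
    by (rule plim_mono[OF plim_sl[OF H.hatp_closed[OF c]] H.filtermap_cf[OF c]])
  then have 1: "plim (\<lambda>g. ser (F2hom F2 a b g) w) (P.cf (f l)) (sl (H.hatp (f l)) w)"
    unfolding plim_filtermap .
  have "klim f (\<lambda>g. ent (F2hom Ugr (ez a) (ez b) g) w []) (col (R.fh (ez a) (ez b)) w)"
    using R.tl_fh[OF ez_unip[OF a] ez_unip[OF b]] by (simp add: R.tl_def col_def)
  moreover have "ent (F2hom Ugr (ez a) (ez b) g) w [] = ser (F2hom F2 a b g) w" if "g \<in> carrier F2" for g
    using F2hom_comp[OF group_F2 group_Ugr ez_hom a b that] by (simp add: ser_def col_def)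
  ultimately have "klim f (\<lambda>g. ser (F2hom F2 a b g) w) (col (R.fh (ez a) (ez b)) w)"
    using R.lim_cong[of "\<lambda>g. ent (F2hom Ugr (ez a) (ez b) g) w []" "\<lambda>g. ser (F2hom F2 a b g) w"] by blast
  from klimD[OF this lp] obtain x where x: "rk l (R.fh (ez a) (ez b)) w = Ql_embed l x"
    "plim (\<lambda>g. ser (F2hom F2 a b g) w) (P.cf (f l)) x" by blast
  have "x = sl (H.hatp (f l)) w" by (rule plim_unique[OF x(2) 1 P.cf_not_bot[OF c]])
  then show "F2_to_Qlbar l (nil_subst F2 f (nil_incl F2 a) (nil_incl F2 b) l) w = rk l (R.fh (ez a) (ez b)) w"
    unfolding s x(1) F2_to_Qlbar_def F2_to_Ql_sl[OF H.hatp_closed[OF c]] by simp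
qed

lemma toep_fh:
  assumes "a \<in> carrier F2" "b \<in> carrier F2"
  shows "toep (R.fh (ez a) (ez b))"
  unfolding R.fh_def
  by (intro rp_ev[OF Toep_Fil] rp_lg[OF Toep_Fil] toep_qm toep_ez qm_Fil1 ez_unip lg_Fil assms)

lemma hexagon_at_iff:
  assumes lp: "l \<in> primes"
  shows "hexagon_at l (Rep_kk lam l) f \<longleftrightarrow>
    rk l (PT.hexa ((lam - 1) * qi (1 / 2)) (ui (eLX * eLY)) eLY) = rk l 1"
    and "toep (PT.hexa m (ui (eLX * eLY)) eLY)" (is ?P)
proof -
  interpret padic l by (rule padicI[OF lp])
  interpret F: Group.group F2 by (rule group_F2)
  interpret U: Group.group "Ugr :: (letter, rat) tmat monoid" by (rule group_Ugr)
  interpret E: group_hom F2 "Ugr :: (letter, rat) tmat monoid" ez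
    using ez_hom group_F2 group_Ugr by (simp add: group_hom_def group_hom_axioms_def)
  interpret N: group_hom F2 F2nil "nil_incl F2"
    using nil_incl_hom[OF group_F2] group_F2 group_nil_completion[OF group_F2] by (simp add: group_hom_def group_hom_axioms_def)
  define z where "z = iv (F2_x \<star> F2_y)"
  have xyz: "F2_x \<in> carrier F2" "F2_y \<in> carrier F2" "z \<in> carrier F2" by (simp_all add: z_def)
  have nz: "nz = nil_incl F2 z" by (simp add: nz_def nx_def ny_def z_def)
  have exy: "ez F2_x = eLX" "ez F2_y = eLY" by (rule F2hom(2,3)[OF group_Ugr eL_carrier])+
  have ez: "ez z = ui (eLX * eLY)" using E.hom_inv[of "F2_x \<star> F2_y"] E.hom_mult[of F2_x F2_y] exy by (simp add: z_def ui_def del: Ugr_simps(3))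
  have "F2_x = iv (F2_y \<star> z)" by (simp add: z_def F.inv_mult_group flip: F.m_assoc)
  then have "ez F2_x = inv\<^bsub>Ugr\<^esub> (ez F2_y * ez z)"
    using E.hom_inv[of "F2_y \<star> z"] E.hom_mult[of F2_y z] xyz by (simp del: Ugr_simps(3))
  \<comment> \<open>In \<open>hexa\<close> the third argument is (yz)^-1; for z = (xy)^-1 this is x
    again.\<close>
  then have x: "ui (eLY * ui (eLX * eLY)) = eLX" by (simp add: exy ez ui_def)
  have h: "PT.hexa m (ui (eLX * eLY)) eLY =
      R.fh (ez z) (ez F2_x) * pw m (qm (ez z)) * R.fh (ez F2_y) (ez z) * pw m (qm (ez F2_y)) * R.fh (ez F2_x) (ez F2_y) * pw m (qm (ez F2_x))" for m
    unfolding PT.hexa_def x exy ez ..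
  have tp: "toep (pw m (qm (ez a)))" if "a \<in> carrier F2" for a and m :: kk
    by (intro rp_pw[OF Toep_Fil] toep_qm toep_ez qm_Fil1 ez_unip that)
  note t = toep_fh[OF xyz(3,1)] tp[OF xyz(3)] toep_fh[OF xyz(2,3)] tp[OF xyz(2)] toep_fh[OF xyz(1,2)] tp[OF xyz(1)]
  show ?P unfolding h by (intro rp_mult[OF Toep_Fil] t)
  define m where "m = (lam - 1) * qi (1 / 2)"
  have m: "(Rep_kk lam l \<ominus>\<^bsub>Qlbar l\<^esub> \<one>\<^bsub>Qlbar l\<^esub>) \<otimes>\<^bsub>Qlbar l\<^esub> inv\<^bsub>Qlbar l\<^esub> ([(2::nat)] \<cdot>\<^bsub>Qlbar l\<^esub> \<one>\<^bsub>Qlbar l\<^esub>) = Rep_kk m l"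
    unfolding m_def using K.pi_inverse[of 2] by (simp add: K.pi_mult K.pi_diff)
  have p: "nc_powr (Qlbar l) (F2_to_Qlbar l (nil_incl F2 a l)) (Rep_kk m l) = rk l (pw m (qm (ez a)))" if a: "a \<in> carrier F2" for a
  proof -
    obtain \<phi> :: "letter list \<Rightarrow> kk" where \<phi>: "\<phi> [] = 1" "qm (ez a) = ev \<phi> Toep"
      using toep_unip[OF toep_qm[OF toep_ez[OF a]] qm_Fil1[OF ez_unip[OF a]]] by blast
    show ?thesis unfolding F2_to_Qlbar_incl[OF lp a] using K.nc_powr[of \<phi>, OF \<phi>(1)] by (simp add: \<phi>(2))
  qed
  have mult: "rk l A \<otimes>\<^bsub>F2_points (Qlbar l)\<^esub> rk l B = rk l (A * B)" if "toep A" "toep B" for A B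
    using K.nc_mult[of "col A" "col B"] col_mult[OF that] by (simp add: F2_points_def)
  have one: "\<one>\<^bsub>F2_points (Qlbar l)\<^esub> = rk l 1"
    using K.nc_one by (simp add: F2_points_def col_def ent_1 delta_def)
  show "hexagon_at l (Rep_kk lam l) f \<longleftrightarrow> rk l (PT.hexa ((lam - 1) * qi (1 / 2)) (ui (eLX * eLY)) eLY) = rk l 1"
    unfolding hexagon_at_def Let_def m nz nx_def ny_def m_def[symmetric] h one
    by (simp only: p F2_to_Qlbar_subst[OF lp] xyz mult t rp_mult[OF Toep_Fil])
qed

text \<open>Equality at every prime is equality in the product ring, so that
  \<open>hexagon_iff\<close> applies once to the whole family.\<close>

lemma hexagon_all_iff:
  "(\<forall>l\<in>primes. hexagon_at l (Rep_kk lam l) f) \<longleftrightarrow> lam * lam = 24 * kser f [LX, LY] + 1"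
proof -
  define m where "m = (lam - 1) * qi (1 / 2)"
  define H where "H = PT.hexa m (ui (eLX * eLY)) eLY"
  have "(2 :: nat) \<in> primes" using two_is_prime_nat by simp
  then have tH: "toep H" unfolding H_def by (rule hexagon_at_iff(2))
  have "(\<forall>l\<in>primes. hexagon_at l (Rep_kk lam l) f) \<longleftrightarrow> (\<forall>l\<in>primes. rk l H = rk l 1)"
    by (simp add: hexagon_at_iff(1) H_def m_def)
  also have "\<dots> \<longleftrightarrow> col H = col 1"
    by (metis kk_eqI ext)
  also have "\<dots> \<longleftrightarrow> H = 1"
    using tH rp_1[of Toep, OF Toep_Fil] by (auto simp: rp_def)
  also have "\<dots> \<longleftrightarrow> (m * m + m) * qi (1 / 2) = 3 * kser f [LX, LY]"
    unfolding H_def by (rule PT.hexagon_iff)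
  also have "\<dots> \<longleftrightarrow> lam * lam = 24 * kser f [LX, LY] + 1"
  proof -
    define h where "h = (qi (1 / 2) :: kk)"
    have h: "2 * h = 1" using qi_mult[of 2 "1 / 2", where ?'a = kk] qi_of_nat[of 2, where ?'a = kk] by (simp add: h_def)
    \<comment> \<open>With h = 1 / 2 and m = (\<lambda> - 1) h the left side is (m^2 + m) / 2.
      Writing the linear term with the factor 2 h = 1 makes it homogeneous in h, and (\<lambda> -
      1)^2 + 2 (\<lambda> - 1) = \<lambda>^2 - 1. Clearing h^3 = 1 / 8 multiplies the 3 on the other
      side to 24.\<close>
    have "((lam - 1) * h * ((lam - 1) * h) + (lam - 1) * h) * h = (lam * lam - 1) * (h * h * h)"
    proof -
      have "((lam - 1) * h * ((lam - 1) * h) + (lam - 1) * h) * h = ((lam - 1) * h * ((lam - 1) * h) + (lam - 1) * h * (2 * h)) * h"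
        unfolding h by simp
      also have "\<dots> = (lam * lam - 1) * (h * h * h)" by (simp add: algebra_simps)
      finally show ?thesis .
    qed
    moreover have "8 * (h * h * h) = 1"
    proof -
      have "8 * (h * h * h) = (2 * h) * (2 * h) * (2 * h)" by (simp add: algebra_simps)
      then show ?thesis unfolding h by simp
    qed
    moreover have "x * (h * h * h) = 3 * c \<longleftrightarrow> x = 24 * c" if "8 * (h * h * h) = 1" for x c :: kk
    proof
      assume "x * (h * h * h) = 3 * c"
      then have "8 * (x * (h * h * h)) = 8 * (3 * c)" by simp
      moreover have "8 * (x * (h * h * h)) = x * (8 * (h * h * h))" by (simp add: mult.left_commute)
      ultimately show "x = 24 * c" using that by simp
    next
      assume x: "x = 24 * c"
      have "24 * c * (h * h * h) = 3 * c * (8 * (h * h * h))" by (simp add: algebra_simps)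
      then show "x * (h * h * h) = 3 * c" using that x by simp
    qed
    ultimately show ?thesis unfolding m_def h_def[symmetric] by (simp add: diff_eq_eq)
  qed
  finally show ?thesis .
qed

theorem gt_pair_iff:
  assumes lam: "lam \<in> (\<Pi>\<^sub>E l\<in>primes. carrier (Qlbar l))"
  shows "gt_pair lam f \<longleftrightarrow> (\<forall>l\<in>primes. lam l \<in> square_roots (Qlbar l)
    ([(24::nat)] \<cdot>\<^bsub>Qlbar l\<^esub> Ql_embed l (c2 l (f l)) \<oplus>\<^bsub>Qlbar l\<^esub> \<one>\<^bsub>Qlbar l\<^esub>))"
proof -
  define k where "k = Abs_kk lam"
  have k: "lam = Rep_kk k" using Abs_kk_inverse[OF lam] by (simp add: k_def)
  have "gt_pair lam f \<longleftrightarrow> k * k = 24 * kser f [LX, LY] + 1"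
    using two_cycle hexagon_all_iff[of k] by (simp add: gt_pair_def k)
  also have "\<dots> \<longleftrightarrow> (\<forall>l\<in>primes. Rep_kk (k * k) l = Rep_kk (24 * kser f [LX, LY] + 1) l)"
    by (metis kk_eqI)
  also have "\<dots> \<longleftrightarrow> (\<forall>l\<in>primes. lam l \<in> square_roots (Qlbar l)
    ([(24::nat)] \<cdot>\<^bsub>Qlbar l\<^esub> Ql_embed l (c2 l (f l)) \<oplus>\<^bsub>Qlbar l\<^esub> \<one>\<^bsub>Qlbar l\<^esub>))"
  proof (intro ball_cong refl)
    fix l assume lp: "l \<in> primes"
    interpret padic l by (rule padicI[OF lp])
    have c: "Ql_embed l (c2 l (f l)) = Rep_kk (kser f [LX, LY]) l" by (simp add: c2_def Rep_kser[OF f lp])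
    have "[n] \<cdot>\<^bsub>Qlbar l\<^esub> Rep_kk x l = Rep_kk (of_nat n * x) l" for n :: nat and x
      by (induction n) (simp_all add: K.pi_add distrib_right B.a_comm)
    from this[of 24 "kser f [LX, LY]"]
    have "Rep_kk (24 * kser f [LX, LY] + 1) l = [(24::nat)] \<cdot>\<^bsub>Qlbar l\<^esub> Rep_kk (kser f [LX, LY]) l \<oplus>\<^bsub>Qlbar l\<^esub> \<one>\<^bsub>Qlbar l\<^esub>"
      by (simp add: K.pi_add)
    moreover have "Rep_kk (k * k) l = lam l [^]\<^bsub>Qlbar l\<^esub> (2::nat)"
      by (simp add: K.pi_mult k numeral_2_eq_2 K.pi_closed)
    ultimately show "Rep_kk (k * k) l = Rep_kk (24 * kser f [LX, LY] + 1) l \<longleftrightarrow> lam l \<in> square_roots (Qlbar l)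
      ([(24::nat)] \<cdot>\<^bsub>Qlbar l\<^esub> Ql_embed l (c2 l (f l)) \<oplus>\<^bsub>Qlbar l\<^esub> \<one>\<^bsub>Qlbar l\<^esub>)"
      unfolding c by (simp add: square_roots_def k K.pi_closed)
  qed
  finally show ?thesis .
qed

lemma gt_pair_exists: "\<exists>lam \<in> (\<Pi>\<^sub>E l\<in>primes. carrier (Qlbar l)). gt_pair lam f"
proof -
  let ?a = "\<lambda>l. [(24::nat)] \<cdot>\<^bsub>Qlbar l\<^esub> Ql_embed l (c2 l (f l)) \<oplus>\<^bsub>Qlbar l\<^esub> \<one>\<^bsub>Qlbar l\<^esub>"
  have "\<exists>s. s \<in> square_roots (Qlbar l) (?a l)" if lp: "l \<in> primes" for l
  proof -
    interpret padic l by (rule padicI[OF lp])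
    have "Ql_embed l (c2 l (f l)) \<in> carrier (Qlbar l)"
      unfolding c2_def Rep_kser[OF f lp, symmetric] by (rule K.pi_closed)
    then have "?a l \<in> carrier (Qlbar l)" by simp
    from Qlbar_sqrt[OF this] obtain s where s: "s \<in> carrier (Qlbar l)" "s \<otimes>\<^bsub>Qlbar l\<^esub> s = ?a l" by blast
    then have "s \<in> square_roots (Qlbar l) (?a l)" by (simp add: square_roots_def numeral_2_eq_2)
    then show ?thesis by blast
  qed
  then obtain s where s: "\<And>l. l \<in> primes \<Longrightarrow> s l \<in> square_roots (Qlbar l) (?a l)" by metis
  have "restrict s primes \<in> (\<Pi>\<^sub>E l\<in>primes. carrier (Qlbar l))"
    using s by (auto simp: square_roots_def)
  moreover from this have "gt_pair (restrict s primes) f" using s by (subst gt_pair_iff) simp_all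
  ultimately show ?thesis by blast
qed

end

theorem corollary13:
  fixes f :: "nat \<Rightarrow> letter gword set set \<Rightarrow> letter gword set set"
  assumes "f \<in> carrier F2nil"
    and pentagon:
      "nil_subst K4 f (braid_x 1 2) (braid_x 2 3 \<otimes>\<^bsub>K4nil\<^esub> braid_x 2 4) \<otimes>\<^bsub>K4nil\<^esub>
         nil_subst K4 f (braid_x 1 3 \<otimes>\<^bsub>K4nil\<^esub> braid_x 2 3) (braid_x 3 4)
       = nil_subst K4 f (braid_x 2 3) (braid_x 3 4) \<otimes>\<^bsub>K4nil\<^esub>
         nil_subst K4 f (braid_x 1 2 \<otimes>\<^bsub>K4nil\<^esub> braid_x 1 3)
                        (braid_x 2 4 \<otimes>\<^bsub>K4nil\<^esub> braid_x 3 4) \<otimes>\<^bsub>K4nil\<^esub>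
         nil_subst K4 f (braid_x 1 2) (braid_x 2 3)"
  shows "(\<exists>lam \<in> (\<Pi>\<^sub>E l\<in>primes. carrier (Qlbar l)). gt_pair lam f) \<and>
         (\<forall>lam \<in> (\<Pi>\<^sub>E l\<in>primes. carrier (Qlbar l)). gt_pair lam f \<longrightarrow>
            (\<forall>l\<in>primes.
               lam l \<in> square_roots (Qlbar l)
                 ([(24::nat)] \<cdot>\<^bsub>Qlbar l\<^esub> Ql_embed l (c2 l (f l)) \<oplus>\<^bsub>Qlbar l\<^esub> \<one>\<^bsub>Qlbar l\<^esub>)))"
proof -
  interpret pentagon f using assms by unfold_locales
  show ?thesis using gt_pair_exists gt_pair_iff by blast
qed

end
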